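(* Let $\rho\colon \Gamma=\mathrm{SL}_2(\mathbf{Z})\hookrightarrow \mathrm{GL}_2(\mathbf{C})$ denote the inclusion representation, let $L=\begin{pmatrix} n & (2\pi i)^{-1}\\ 0 & n\end{pmatrix}$ for $n\in\mathbf{Z}$, and set $H(\tau,s)=H(\rho,L,I,\tau,s)$, the associated Eisenstein metric with $h=I$ the identity matrix. Write $\tau=x+iy$ with $y>0$. Then the Eisenstein metric $H(\tau,s)$ has a Fourier expansion of the form $$H(\tau,s)=\begin{pmatrix}1&0\\-\tau&1\end{pmatrix}\Big(\sum_{m\ge 0}H_m(\tau,s)\Big)\begin{pmatrix}1&-\bar\tau\\0&1\end{pmatrix},$$ where $$\begin{aligned}H_0(\tau,s)=\;&y^s e^{-4\pi n y}\begin{pmatrix}1&0\\0&1\end{pmatrix}\\&+\sum_{k\ge0}\frac{(-4\pi n)^k}{k!}\,\frac{\pi^{2s+2k+1}\Gamma(-s-k)\zeta(-2s-2k)}{\Gamma(s+k+1)\zeta(2s+2k+2)}\,y^{-s-k-1}\begin{pmatrix}1&0\\0&0\end{pmatrix}\\&+\sum_{k\ge0}\frac{(-4\pi n)^k}{k!}\,\frac{\pi^{1/2}y^{1-s-k}\Gamma(s+k-\frac12)\zeta(2s+2k-3)}{\Gamma(s+k)\zeta(2s+2k-2)}\begin{pmatrix}1&-iy\\ iy&\frac{2s+2k-2}{2s+2k-3}y^2\end{pmatrix}\end{aligned}$$ and for $m\ge1$ $$\begin{aligned}H_m(\tau,s)=4\pi^s\sum_{k\ge0}\frac{(-4\pi^2n)^k}{k!}\Bigg(&\frac{\pi\,\sigma_{2s+2k+1}(m)\cos(2\pi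 mx)K_{s+k+\frac12}(2\pi my)}{m^{s+k+\frac12}\Gamma(s+k+1)\zeta(2s+2k+2)\,y^{1/2}}\begin{pmatrix}1&0\\0&0\end{pmatrix}\\&+\frac{y^{1/2}m^{s+k-\frac12}\sigma_{3-2s-2k}(m)}{\Gamma(s+k)\zeta(2s+2k-2)}\cos(2\pi mx)\begin{pmatrix}K_{s+k-\frac12}(2\pi my)&-iyK_{s+k-\frac12}(2\pi my)\\ iyK_{s+k-\frac12}(2\pi my)&\frac{(s+k-1)y}{\pi m}K_{s+k-\frac32}(2\pi my)\end{pmatrix}\\&+\frac{y^{1/2}m^{s+k-\frac12}\sigma_{3-2s-2k}(m)}{\Gamma(s+k)\zeta(2s+2k-2)}\sin(2\pi mx)\Big(\frac{1-2s-2k}{2\pi m}K_{s+k-\frac12}(2\pi my)+yK_{s+k+\frac12}(2\pi my)\Big)\begin{pmatrix}0&1\\1&0\end{pmatrix}\Bigg).\end{aligned}$$ Moreover, $H(\tau,s)$ admits meromorphic continuation to the region $\mathrm{Re}(s)>\frac32$, and its only pole in this region is simple and located at $s=2$. This pole comes from the constant term $H_0(\tau,s)$, and the residue at $s=2$ is a tame harmonic metric for the inclusion representation: $$\mathrm{Res}_{s=2}H(\tau,s)=\frac{3}{2\pi y}\begin{pmatrix}1&-x\\-x&x^2+y^2\end{pmatrix}=\frac{3}{2\pi}K(\tau),\qquad K(\tau)=\frac1y\begin{pmatrix}1&-x\\-x&x^2+y^2\end{pmatrix}.$$ In particular, the residue does not depend on the choice of exponent matrix $L$.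
   Context: Notation: $\Gamma=\mathrm{SL}_2(\mathbf{Z})$ (when followed by an argument in $s$, $\Gamma(\cdot)$ is the gamma function), $T=\begin{pmatrix}1&1\\0&1\end{pmatrix}$, $\mathcal{H}$ is the complex upper half plane, $\mathbf{e}(M)=e^{2\pi i M}$ for a complex square matrix $M$, and $\langle\pm T\rangle$ is the subgroup of $\mathrm{SL}_2(\mathbf{Z})$ generated by $T$ and $-I$. $\mathrm{Herm}_d$ is the space of $d\times d$ Hermitian matrices. $K_\nu$ (with a subscript) is the modified Bessel function of the second kind, $\sigma_w(m)=\sum_{g\mid m,\,g>0}g^w$, and $\zeta$ is the Riemann zeta function. The products $\Gamma(-s-k)\zeta(-2s-2k)$ are understood as meromorphic functions of $s$, and $0^0=1$. For a representation $\rho\colon\mathrm{SL}_2(\mathbf{Z})\to\mathrm{GL}_d(\mathbf{C})$, a choice of exponents is a matrix $L$ with $\rho(T)=\mathbf{e}(L)$. The Eisenstein metric attached to $\rho$, $L$ and a positive definite $h\in\mathrm{Herm}_d$ with $\rho(-I)^t h\overline{\rho(-I)}=h$ is $$H(\rho,L,h,\tau,s)=\sum_{\gamma\in\langle\pm T\rangle\backslash\mathrm{SL}_2(\mathbf{Z})}\rho(\gamma)^t\,\mathbf{e}(-L^t(\gamma\cdot\tau))\,h\,\overline{\mathbf{e}(-L(\gamma\cdot\tau))}\;\overline{\rho(\gamma)}\;\mathrm{Im}(\gamma\cdot\tau)^s,\qquad \tau\in\mathcal{H},$$ where $\gamma\cdot\tau$ is the Möbius action; the series converges absolutely for $\mathrm{Re}(s)$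 sufficiently large. A metric for $\rho$ is a smooth function $H\colon\mathcal{H}\to\mathrm{Herm}_d$ with positive definite values such that $\rho(\gamma)^tH(\gamma\tau)\overline{\rho(\gamma)}=H(\tau)$ for all $\gamma\in\mathrm{SL}_2(\mathbf{Z})$. A metric $H$ is harmonic if $\partial\bar\partial\log(H)=\frac12[\bar\partial\log(H),\partial\log(H)]$, where $\partial\log(H)=H^{-1}\partial(H)$ and $\bar\partial\log(H)=H^{-1}\bar\partial(H)$ (so the left side is $\partial(H^{-1}\bar\partial H)$). A metric $H$ for $\rho$ is tame (of slow growth) for a choice of exponents $L$ if there exist constants $C,N$ such that $\|\mathbf{e}(L^t\tau)H(\tau)\overline{\mathbf{e}(L\tau)}\|\le Cy^N$, where $\|\cdot\|$ is the supremum norm on matrix entries.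
   Formalization: The formulas for H_0 and H_m hold with n replaced by -n (as printed they fail for n≠0); the residue is shown tame for the exponent matrices with diagonal entry k≥0 only (it fails for k<0), with the growth bound required for y≥1. *)

theory Defs
  imports
    "HOL-Complex_Analysis.Complex_Analysis"
    "HOL-Algebra.Generated_Groups"
begin

section \<open>Special functions\<close>

text \<open>The Riemann zeta function, as the analytic continuation of its Dirichlet series. The value
  at the pole \<open>1\<close> is fixed to be \<open>0\<close>, so that the description determines a unique function.\<close>

definition zeta :: "complex \<Rightarrow> complex" where
  "zeta = (THE f. f holomorphic_on (- {1}) \<and> f 1 = 0 \<and>
     (\<forall>s. 1 < Re s \<longrightarrow> (\<lambda>k. 1 / of_nat (Suc k) powr s) sums f s))"

text \<open>The modified Bessel function of the second kind, for complex order and positive real argument: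
  \<open>K\<^sub>\<nu>(x) = 1/2 \<integral>\<^sub>0\<^sup>\<infinity> e\<^bsup>-x(t + 1/t)/2\<^esup> t\<^bsup>\<nu>\<^esup> dt/t\<close>.\<close>

definition bessel_K :: "complex \<Rightarrow> real \<Rightarrow> complex" where
  "bessel_K \<nu> x = 1/2 *
     set_lebesgue_integral lborel {0<..}
       (\<lambda>t. of_real (exp (- x * (t + 1 / t) / 2)) * of_real t powr (\<nu> - 1))"

definition divisor_sigma :: "complex \<Rightarrow> nat \<Rightarrow> complex" where
  "divisor_sigma w m = (\<Sum>g | g dvd m. of_nat g powr w)"


section \<open>Matrices\<close>

definition mat22 :: "'a \<Rightarrow> 'a \<Rightarrow> 'a \<Rightarrow> 'a \<Rightarrow> 'a::zero^2^2" where
  "mat22 a b c d = vector [vector [a, b], vector [c, d]]"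

abbreviation mscale :: "complex \<Rightarrow> complex^'m^'n \<Rightarrow> complex^'m^'n" (infixr \<open>*m\<close> 75) where
  "c *m A \<equiv> map_matrix ((*) c) A"

abbreviation mcnj :: "complex^'m^'n \<Rightarrow> complex^'m^'n" where
  "mcnj \<equiv> map_matrix cnj"

text \<open>The matrix exponential \<open>\<^bold>e(M) = exp (2\<pi>i M)\<close>; the type of square matrices carries no
  Banach algebra instance, so the power series is written out.\<close>

definition mat_e :: "complex^'d^'d \<Rightarrow> complex^'d^'d" where
  "mat_e M = (\<Sum>k. (1 / fact k) *\<^sub>R (((**) ((2 * of_real pi * \<i>) *m M)) ^^ k) (mat 1))"

definition hermitian_mat :: "complex^'d^'d \<Rightarrow> bool" where
  "hermitian_mat A \<longleftrightarrow> transpose A = mcnj A"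

definition pos_def_mat :: "complex^'d^'d \<Rightarrow> bool" where
  "pos_def_mat A \<longleftrightarrow> hermitian_mat A \<and>
     (\<forall>v. v \<noteq> 0 \<longrightarrow> 0 < Re (\<Sum>i\<in>UNIV. \<Sum>j\<in>UNIV. cnj (v $ i) * A $ i $ j * v $ j))"

definition mat_supnorm :: "complex^'d^'d \<Rightarrow> real" where
  "mat_supnorm A = Max (range (\<lambda>(i, j). cmod (A $ i $ j)))"


section \<open>The modular group\<close>

definition upper_half_plane :: "complex set" (\<open>\<H>\<close>) where
  "\<H> = {\<tau>. 0 < Im \<tau>}"

definition SL2Z :: "(int^2^2) monoid" where
  "SL2Z = \<lparr>carrier = {A. det A = 1}, mult = (**), one = mat 1\<rparr>"

definition T_mat :: "int^2^2" where
  "T_mat = mat22 1 1 0 1"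

definition pm_T :: "(int^2^2) set" where
  "pm_T = generate SL2Z {T_mat, - mat 1}"

definition moebius_act :: "int^2^2 \<Rightarrow> complex \<Rightarrow> complex" where
  "moebius_act \<gamma> \<tau> = (of_int (\<gamma>$1$1) * \<tau> + of_int (\<gamma>$1$2)) / (of_int (\<gamma>$2$1) * \<tau> + of_int (\<gamma>$2$2))"


section \<open>Eisenstein metrics\<close>

definition choice_of_exponents :: "(int^2^2 \<Rightarrow> complex^'d^'d) \<Rightarrow> complex^'d^'d \<Rightarrow> bool" where
  "choice_of_exponents \<rho> L \<longleftrightarrow> \<rho> T_mat = mat_e L"

definition eisenstein_summand ::
  "(int^2^2 \<Rightarrow> complex^'d^'d) \<Rightarrow> complex^'d^'d \<Rightarrow> complex^'d^'d \<Rightarrow> complex \<Rightarrow> complex \<Rightarrow>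
     int^2^2 \<Rightarrow> complex^'d^'d" where
  "eisenstein_summand \<rho> L h \<tau> s \<gamma> =
     (let w = moebius_act \<gamma> \<tau> in
      (of_real (Im w) powr s) *m
        (transpose (\<rho> \<gamma>) ** mat_e ((- w) *m transpose L) ** h ** mcnj (mat_e ((- w) *m L)) ** mcnj (\<rho> \<gamma>)))"

text \<open>The sum is over the cosets \<open>\<langle>\<plusminus>T\<rangle>\<gamma>\<close>. If \<open>L\<close> is a choice of exponents for the
  representation \<open>\<rho>\<close> and \<open>\<rho>(-I)\<^sup>t h \<rho>(-I)\<close> (second factor conjugated) equals \<open>h\<close>, the summand is
  constant on each coset, so the representative picked by \<open>SOME\<close> is immaterial.\<close>

definition eisenstein_coset_term ::
  "(int^2^2 \<Rightarrow> complex^'d^'d) \<Rightarrow> complex^'d^'d \<Rightarrow> complex^'d^'d \<Rightarrow> complex \<Rightarrow> complex \<Rightarrow>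
     (int^2^2) set \<Rightarrow> complex^'d^'d" where
  "eisenstein_coset_term \<rho> L h \<tau> s C = eisenstein_summand \<rho> L h \<tau> s (SOME \<gamma>. \<gamma> \<in> C)"

definition eisenstein_metric ::
  "(int^2^2 \<Rightarrow> complex^'d^'d) \<Rightarrow> complex^'d^'d \<Rightarrow> complex^'d^'d \<Rightarrow> complex \<Rightarrow> complex \<Rightarrow>
     complex^'d^'d" where
  "eisenstein_metric \<rho> L h \<tau> s = infsum (eisenstein_coset_term \<rho> L h \<tau> s) (rcosets\<^bsub>SL2Z\<^esub> pm_T)"


section \<open>Metrics, harmonicity, tameness\<close>

text \<open>Real partial derivatives of a matrix-valued function on the complex plane, and the Wirtinger
  operators.\<close>

definition dx :: "(complex \<Rightarrow> complex^'d^'d) \<Rightarrow> complex \<Rightarrow> complex^'d^'d" where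
  "dx f \<tau> = frechet_derivative f (at \<tau>) 1"

definition dy :: "(complex \<Rightarrow> complex^'d^'d) \<Rightarrow> complex \<Rightarrow> complex^'d^'d" where
  "dy f \<tau> = frechet_derivative f (at \<tau>) \<i>"

definition del :: "(complex \<Rightarrow> complex^'d^'d) \<Rightarrow> complex \<Rightarrow> complex^'d^'d" where
  "del f \<tau> = (1/2) *m (dx f \<tau> - \<i> *m dy f \<tau>)"

definition delbar :: "(complex \<Rightarrow> complex^'d^'d) \<Rightarrow> complex \<Rightarrow> complex^'d^'d" where
  "delbar f \<tau> = (1/2) *m (dx f \<tau> + \<i> *m dy f \<tau>)"

text \<open>\<open>k\<close>-fold continuous (real) differentiability on an open set.\<close>

fun k_smooth_on :: "nat \<Rightarrow> complex set \<Rightarrow> (complex \<Rightarrow> complex^'d^'d) \<Rightarrow> bool" where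
  "k_smooth_on 0 S f \<longleftrightarrow> continuous_on S f"
| "k_smooth_on (Suc k) S f \<longleftrightarrow>
     f differentiable_on S \<and> k_smooth_on k S (dx f) \<and> k_smooth_on k S (dy f)"

definition metric_for :: "(int^2^2 \<Rightarrow> complex^'d^'d) \<Rightarrow> (complex \<Rightarrow> complex^'d^'d) \<Rightarrow> bool" where
  "metric_for \<rho> H \<longleftrightarrow>
     (\<forall>k. k_smooth_on k \<H> H) \<and>
     (\<forall>\<tau>\<in>\<H>. pos_def_mat (H \<tau>)) \<and>
     (\<forall>\<gamma>\<in>carrier SL2Z. \<forall>\<tau>\<in>\<H>.
        transpose (\<rho> \<gamma>) ** H (moebius_act \<gamma> \<tau>) ** mcnj (\<rho> \<gamma>) = H \<tau>)"

definition del_log :: "(complex \<Rightarrow> complex^'d^'d) \<Rightarrow> complex \<Rightarrow> complex^'d^'d" where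
  "del_log H \<tau> = matrix_inv (H \<tau>) ** del H \<tau>"

definition delbar_log :: "(complex \<Rightarrow> complex^'d^'d) \<Rightarrow> complex \<Rightarrow> complex^'d^'d" where
  "delbar_log H \<tau> = matrix_inv (H \<tau>) ** delbar H \<tau>"

text \<open>The bracket is the commutator of matrices, the operators being the Wirtinger derivatives
  (not matrices of differential forms, where the commutator would change sign).\<close>

definition harmonic_metric :: "(int^2^2 \<Rightarrow> complex^'d^'d) \<Rightarrow> (complex \<Rightarrow> complex^'d^'d) \<Rightarrow> bool" where
  "harmonic_metric \<rho> H \<longleftrightarrow> metric_for \<rho> H \<and>
     (\<forall>\<tau>\<in>\<H>. del (delbar_log H) \<tau> =
        (1/2) *m (delbar_log H \<tau> ** del_log H \<tau> - del_log H \<tau> ** delbar_log H \<tau>))"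

text \<open>Slow growth is a condition at the cusp, whence the restriction to \<open>1 \<le> y\<close>. By the
  invariance of a metric under \<open>T\<close>, any other positive lower bound for \<open>y\<close> gives the same notion.\<close>

definition tame_metric ::
  "(int^2^2 \<Rightarrow> complex^'d^'d) \<Rightarrow> complex^'d^'d \<Rightarrow> (complex \<Rightarrow> complex^'d^'d) \<Rightarrow> bool" where
  "tame_metric \<rho> L H \<longleftrightarrow> metric_for \<rho> H \<and> choice_of_exponents \<rho> L \<and>
     (\<exists>C N::real. \<forall>\<tau>. 1 \<le> Im \<tau> \<longrightarrow>
        mat_supnorm (mat_e (\<tau> *m transpose L) ** H \<tau> ** mcnj (mat_e (\<tau> *m L))) \<le> C * Im \<tau> powr N)"


section \<open>Meromorphic continuation of matrix-valued functions\<close>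

definition mat_continuation ::
  "(complex \<Rightarrow> complex^'d^'d) \<Rightarrow> complex set \<Rightarrow> (complex \<Rightarrow> complex^'d^'d) \<Rightarrow> complex set \<Rightarrow> bool" where
  "mat_continuation F U G V \<longleftrightarrow> U \<subseteq> V \<and> (\<forall>s\<in>U. G s = F s) \<and>
     (\<forall>i j. (\<lambda>s. G s $ i $ j) meromorphic_on V)"

definition mat_holomorphic_on :: "(complex \<Rightarrow> complex^'d^'d) \<Rightarrow> complex set \<Rightarrow> bool" where
  "mat_holomorphic_on F V \<longleftrightarrow> (\<forall>i j. (\<lambda>s. F s $ i $ j) holomorphic_on V)"

definition mat_pole :: "(complex \<Rightarrow> complex^'d^'d) \<Rightarrow> complex \<Rightarrow> bool" where
  "mat_pole F z \<longleftrightarrow> (\<exists>i j. is_pole (\<lambda>s. F s $ i $ j) z)"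

definition mat_simple_pole :: "(complex \<Rightarrow> complex^'d^'d) \<Rightarrow> complex \<Rightarrow> bool" where
  "mat_simple_pole F z \<longleftrightarrow> mat_pole F z \<and>
     (\<forall>i j. is_pole (\<lambda>s. F s $ i $ j) z \<longrightarrow> zorder (\<lambda>s. F s $ i $ j) z = -1)"

definition mat_residue :: "(complex \<Rightarrow> complex^'d^'d) \<Rightarrow> complex \<Rightarrow> complex^'d^'d" where
  "mat_residue F z = (\<chi> i j. residue (\<lambda>s. F s $ i $ j) z)"


section \<open>The inclusion representation\<close>

definition incl_rep :: "int^2^2 \<Rightarrow> complex^2^2" where
  "incl_rep \<gamma> = map_matrix of_int \<gamma>"

definition exponent_mat :: "int \<Rightarrow> complex^2^2" where
  "exponent_mat n = mat22 (of_int n) (1 / (2 * of_real pi * \<i>)) 0 (of_int n)"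

definition K_metric :: "complex \<Rightarrow> complex^2^2" where
  "K_metric \<tau> = (let x = complex_of_real (Re \<tau>); y = complex_of_real (Im \<tau>) in
     (1 / y) *m mat22 1 (- x) (- x) (x^2 + y^2))"


subsection \<open>The Fourier coefficients\<close>

text \<open>
  The parameter \<open>n\<close> enters the following three series and the leading term of the constant
  coefficient only through \<open>exp (- 4 \<pi> n Im(\<gamma>\<tau>))\<close> and its Taylor expansion. As
  \<open>\<^bold>e(-n\<tau>)\<close> has absolute value \<open>exp (2 \<pi> n y)\<close>, the Eisenstein metric with diagonal exponent
  \<open>n\<close> involves \<open>exp (4 \<pi> n Im(\<gamma>\<tau>))\<close> instead, so its coefficients are the ones below at \<open>-n\<close>.
\<close>

definition const_series1 :: "int \<Rightarrow> complex \<Rightarrow> complex \<Rightarrow> nat \<Rightarrow> complex^2^2" where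
  "const_series1 n \<tau> s k = (let y = complex_of_real (Im \<tau>) in
     ((- 4 * of_real pi * of_int n) ^ k / fact k *
      (of_real pi powr (2 * s + 2 * of_nat k + 1) *
         \<comment> \<open>the poles of \<open>\<Gamma>\<close> cancel against the trivial zeros of \<open>\<zeta>\<close>\<close>
         remove_sings (\<lambda>u. Gamma (- u) * zeta (- 2 * u)) (s + of_nat k) /
       (Gamma (s + of_nat k + 1) * zeta (2 * s + 2 * of_nat k + 2))) *
      y powr (- s - of_nat k - 1))
     *m mat22 1 0 0 0)"

definition const_series2 :: "int \<Rightarrow> complex \<Rightarrow> complex \<Rightarrow> nat \<Rightarrow> complex^2^2" where
  "const_series2 n \<tau> s k = (let y = complex_of_real (Im \<tau>) in
     ((- 4 * of_real pi * of_int n) ^ k / fact k *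
      (of_real pi powr (1/2) * y powr (1 - s - of_nat k) *
         Gamma (s + of_nat k - 1/2) * zeta (2 * s + 2 * of_nat k - 3) /
       (Gamma (s + of_nat k) * zeta (2 * s + 2 * of_nat k - 2))))
     *m mat22 1 (- \<i> * y) (\<i> * y)
          ((2 * s + 2 * of_nat k - 2) / (2 * s + 2 * of_nat k - 3) * y^2))"

definition const_coeff :: "int \<Rightarrow> complex \<Rightarrow> complex \<Rightarrow> complex^2^2" where
  "const_coeff n \<tau> s = (let y = complex_of_real (Im \<tau>) in
     (y powr s * exp (- 4 * of_real pi * of_int n * y)) *m mat 1
     + (\<Sum>k. const_series1 n \<tau> s k) + (\<Sum>k. const_series2 n \<tau> s k))"

definition higher_series :: "int \<Rightarrow> complex \<Rightarrow> complex \<Rightarrow> nat \<Rightarrow> nat \<Rightarrow> complex^2^2" where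
  "higher_series n \<tau> s m k =
     (let x = Re \<tau>; y = complex_of_real (Im \<tau>); w = s + of_nat k; M = (of_nat m :: complex);
          K = (\<lambda>\<nu>. bessel_K \<nu> (2 * pi * real m * Im \<tau>));
          C = complex_of_real (cos (2 * pi * real m * x));
          S = complex_of_real (sin (2 * pi * real m * x));
          q = y powr (1/2) * M powr (w - 1/2) * divisor_sigma (3 - 2 * w) m / (Gamma w * zeta (2 * w - 2))
      in ((- 4 * (of_real pi)^2 * of_int n) ^ k / fact k) *m
         ((of_real pi * divisor_sigma (2 * w + 1) m * C * K (w + 1/2) /
             (M powr (w + 1/2) * Gamma (w + 1) * zeta (2 * w + 2) * y powr (1/2)))
            *m mat22 1 0 0 0
          + (q * C)
            *m mat22 (K (w - 1/2)) (- \<i> * y * K (w - 1/2))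
                     (\<i> * y * K (w - 1/2)) ((w - 1) * y / (of_real pi * M) * K (w - 3/2))
          + (q * S * ((1 - 2 * w) / (2 * of_real pi * M) * K (w - 1/2) + y * K (w + 1/2)))
            *m mat22 0 1 1 0))"

definition higher_coeff :: "int \<Rightarrow> complex \<Rightarrow> complex \<Rightarrow> nat \<Rightarrow> complex^2^2" where
  "higher_coeff n \<tau> s m = (4 * of_real pi powr s) *m (\<Sum>k. higher_series n \<tau> s m k)"

definition fourier_coeff :: "int \<Rightarrow> complex \<Rightarrow> complex \<Rightarrow> nat \<Rightarrow> complex^2^2" where
  "fourier_coeff n \<tau> s m = (if m = 0 then const_coeff n \<tau> s else higher_coeff n \<tau> s m)"

definition conj_by_tau :: "complex \<Rightarrow> complex^2^2 \<Rightarrow> complex^2^2" where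
  "conj_by_tau \<tau> A = mat22 1 0 (- \<tau>) 1 ** A ** mat22 1 (- cnj \<tau>) 0 1"

end

theory Submission
  imports Defs "HOL-Probability.Characteristic_Functions" "HOL-Library.Nat_Bijection"
begin

text \<open>
  The bottom rows \<open>(0, 1)\<close> and \<open>(c, d)\<close> with \<open>c \<ge> 1\<close> and \<open>c, d\<close> coprime represent the cosets, and the
  summand of the Eisenstein metric belonging to \<open>(c, d)\<close> is, with \<open>j = c\<tau> + d\<close>, \<open>q = \<bar>j\<bar>\<^sup>2\<close> and after
  conjugation by the unipotent matrix of \<open>\<tau>\<close>, the matrix with rows \<open>(1/q + c\<^sup>2, c \<cdot> cnj j)\<close> and \<open>(c j, q)\<close>
  times \<open>(y/q)\<^sup>s exp (4\<pi>n y/q)\<close>. Expanding the exponential reduces everything to the four sums over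
  coprime pairs of \<open>q\<close> to the power \<open>- (w + 1)\<close>, \<open>c\<^sup>2\<close> and \<open>c (c x + d)\<close> times \<open>q\<close> to the power \<open>- w\<close>, and \<open>q\<close>
  to the power \<open>- (w - 1)\<close>, at \<open>w = s + k\<close>. Dividing out a zeta value turns them into sums over all
  \<open>c \<ge> 1\<close> and \<open>d\<close>, and Poisson summation in \<open>d\<close> (obtained from the theta transformation by a Mellin
  transform) yields the Bessel terms.

  For \<open>Re s > 3/2\<close> all the resulting series in \<open>k\<close> and \<open>m\<close> converge locally uniformly, except that
  the term \<open>k = 0\<close> of the second constant series contains \<open>\<zeta>(2s - 3)\<close>, which is the source of
  the pole at \<open>s = 2\<close>. The other exponent matrices are the \<open>exponent_mat n\<close> themselves, because a
  matrix whose exponential is \<open>T\<close> commutes with \<open>T\<close>.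
\<close>

text \<open>Two bounds carry the analysis. Division by zeta values requires an upper bound for
  1/zeta that is uniform on each half-plane Re >= sigma > 1 (\<open>norm_inverse_zeta_le\<close>).
  The smallest argument of zeta in a denominator is 2s - 2, and this places the border of the region
  at Re s = 3/2. The Bessel functions have orders s + k + const, and their integrals grow like k! in
  the shift k. The factor 1/Gamma(s + k) takes this growth back; what remains is geometric in k and
  is beaten, locally uniformly in s, by the coefficients of the exponential series
  (\<open>shift_growth\<close>, \<open>fourier_growth\<close>). The sums over pairs are handled for
  Re s > 2 only, the entry q being the one that converges worst. There the series in k and m are
  identified with the Eisenstein metric; on the larger region the series themselves are the
  continuation. For k >= 1 the argument 2s + 2k - 3 of zeta has real part above 2. So the pole stems
  from k = 0, where the coefficient is 1 for every n, and n cannot enter the residue.\<close>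

abbreviation cos_mode :: "real \<Rightarrow> nat \<Rightarrow> complex" where
  "cos_mode x m \<equiv> of_real (cos (2 * pi * real m * x))"

abbreviation sin_mode :: "real \<Rightarrow> nat \<Rightarrow> complex" where
  "sin_mode x m \<equiv> of_real (sin (2 * pi * real m * x))"

abbreviation bessel_mode :: "complex \<Rightarrow> real \<Rightarrow> nat \<Rightarrow> complex" where
  "bessel_mode \<nu> y m \<equiv> bessel_K \<nu> (2 * pi * real m * y)"

section \<open>Uniqueness of Fourier coefficients\<close>

text \<open>The list may repeat a frequency, so sums and products are formed by concatenating and
  shifting, without collecting terms.\<close>

definition trig_polynomial :: "(real \<Rightarrow> complex) \<Rightarrow> bool" where
  "trig_polynomial q \<longleftrightarrow>
     (\<exists>S :: (complex \<times> int) list. \<forall>x. q x = (\<Sum>(c, m)\<leftarrow>S. c * cis (2 * pi * of_int m * x)))"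

lemma trig_polynomial_monomial: "trig_polynomial (\<lambda>x. c * cis (2 * pi * of_int m * x))"
  unfolding trig_polynomial_def by (rule exI[of _ "[(c, m)]"]) simp

lemma trig_polynomial_const: "trig_polynomial (\<lambda>x. c)"
  using trig_polynomial_monomial[of c 0] by simp

lemma trig_polynomial_add:
  assumes "trig_polynomial p" "trig_polynomial q"
  shows "trig_polynomial (\<lambda>x. p x + q x)"
proof -
  obtain S T where "\<And>x. p x = (\<Sum>(c, m)\<leftarrow>S. c * cis (2 * pi * of_int m * x))"
    "\<And>x. q x = (\<Sum>(c, m)\<leftarrow>T. c * cis (2 * pi * of_int m * x))"
    using assms unfolding trig_polynomial_def by blast
  then show ?thesis
    unfolding trig_polynomial_def by (intro exI[of _ "S @ T"]) simp
qed

lemma trig_polynomial_mult_monomial: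
  assumes "trig_polynomial p"
  shows "trig_polynomial (\<lambda>x. c * cis (2 * pi * of_int m * x) * p x)"
proof -
  obtain S where S: "\<And>x. p x = (\<Sum>(c, m)\<leftarrow>S. c * cis (2 * pi * of_int m * x))"
    using assms unfolding trig_polynomial_def by blast
  have "c * cis (2 * pi * of_int m * x) * p x =
      (\<Sum>(c, m)\<leftarrow>map (\<lambda>(c', m'). (c * c', m + m')) S. c * cis (2 * pi * of_int m * x))" for x
    unfolding S
    by (induction S) (auto simp: algebra_simps simp flip: cis_mult)
  then show ?thesis unfolding trig_polynomial_def by blast
qed

lemma trig_polynomial_mult:
  assumes "trig_polynomial p" "trig_polynomial q"
  shows "trig_polynomial (\<lambda>x. p x * q x)"
proof -
  obtain S where S: "\<And>x. p x = (\<Sum>(c, m)\<leftarrow>S. c * cis (2 * pi * of_int m * x))"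
    using assms unfolding trig_polynomial_def by blast
  have "trig_polynomial (\<lambda>x. (\<Sum>(c, m)\<leftarrow>S. c * cis (2 * pi * of_int m * x)) * q x)"
  proof (induction S)
    case Nil
    then show ?case using trig_polynomial_const[of 0] by simp
  next
    case (Cons a S)
    obtain c m where a: "a = (c, m)" by force
    show ?case
      using trig_polynomial_add[OF trig_polynomial_mult_monomial[OF assms(2), of c m] Cons]
      by (simp add: a algebra_simps)
  qed
  then show ?thesis by (simp add: S)
qed

text \<open>A real-linear form on the plane is a combination of z and its conjugate, hence of the
  frequencies 1 and -1 on the circle; closure under sums and products does the rest. This connects
  Stone-Weierstrass on the circle with trigonometric polynomials.\<close>

lemma trig_polynomial_real_polynomial_function:
  assumes "real_polynomial_function (p :: complex \<Rightarrow> real)"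
  shows "trig_polynomial (\<lambda>x. of_real (p (cis (2 * pi * x))))"
  using assms
proof induction
  case (linear f)
  interpret f: bounded_linear f by fact
  have *: "of_real (f (cis (2 * pi * x))) =
      (f 1 - \<i> * f \<i>) / 2 * cis (2 * pi * of_int 1 * x) +
      (f 1 + \<i> * f \<i>) / 2 * cis (2 * pi * of_int (- 1) * x)" for x
  proof -
    have "cis (2 * pi * x) = cos (2 * pi * x) *\<^sub>R 1 + sin (2 * pi * x) *\<^sub>R \<i>"
      by (simp add: complex_eq_iff)
    then have "f (cis (2 * pi * x)) = cos (2 * pi * x) * f 1 + sin (2 * pi * x) * f \<i>"
      by (simp add: f.add f.scaleR)
    then show ?thesis by (simp add: complex_eq_iff field_simps)
  qed
  show ?case
    unfolding * by (intro trig_polynomial_add trig_polynomial_monomial)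
next
  case (const c)
  show ?case by (rule trig_polynomial_const)
next
  case (add f g)
  then show ?case using trig_polynomial_add[OF add.IH] by simp
next
  case (mult f g)
  then show ?case using trig_polynomial_mult[OF mult.IH] by simp
qed

lemma integral_trig_polynomial_eq_0:
  fixes h :: "real \<Rightarrow> complex"
  assumes "continuous_on {0..1} h"
    and coeff: "\<And>m :: int. integral {0..1} (\<lambda>x. h x * cis (2 * pi * of_int m * x)) = 0"
    and "trig_polynomial p"
  shows "integral {0..1} (\<lambda>x. h x * p x) = 0"
proof -
  obtain S where S: "\<And>x. p x = (\<Sum>(c, m)\<leftarrow>S. c * cis (2 * pi * of_int m * x))"
    using assms unfolding trig_polynomial_def by blast
  have cont: "continuous_on {0..1} (\<lambda>x. \<Sum>(c, m)\<leftarrow>S. c * cis (2 * pi * of_int m * x))"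
    for S :: "(complex \<times> int) list"
    by (induction S) (auto intro!: continuous_intros)
  have "integral {0..1} (\<lambda>x. h x * (\<Sum>(c, m)\<leftarrow>S. c * cis (2 * pi * of_int m * x))) = 0"
  proof (induction S)
    case (Cons a S)
    obtain c m where a: "a = (c, m)" by force
    have "integral {0..1} (\<lambda>x. h x * (\<Sum>(c, m)\<leftarrow>a # S. c * cis (2 * pi * of_int m * x))) =
       integral {0..1} (\<lambda>x. c * (h x * cis (2 * pi * of_int m * x)) +
         h x * (\<Sum>(c, m)\<leftarrow>S. c * cis (2 * pi * of_int m * x)))"
      by (simp add: a algebra_simps)
    also have "\<dots> = integral {0..1} (\<lambda>x. c * (h x * cis (2 * pi * of_int m * x))) +
        integral {0..1} (\<lambda>x. h x * (\<Sum>(c, m)\<leftarrow>S. c * cis (2 * pi * of_int m * x)))"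
      by (intro Henstock_Kurzweil_Integration.integral_add integrable_continuous_interval
          continuous_intros assms cont)
    also have "integral {0..1} (\<lambda>x. c * (h x * cis (2 * pi * of_int m * x))) = 0"
      by (subst integral_mult_right) (simp add: coeff)
    finally show ?case using Cons by simp
  qed simp
  then show ?thesis by (simp add: S)
qed

text \<open>Vanishing coefficients make h orthogonal to every trigonometric polynomial p. Hence the
  integral of h^2 equals that of h (h - p), which is at most e times the integral of |h| once p is
  e-close to h.\<close>

lemma fourier_coeffs_eq_0_imp_eq_0:
  fixes h :: "real \<Rightarrow> real"
  assumes cont: "continuous_on {0..1} h" and per: "h 1 = h 0"
    and coeff: "\<And>m :: int. integral {0..1} (\<lambda>x. of_real (h x) * cis (2 * pi * of_int m * x)) = 0"
    and x: "x \<in> {0..1}"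
  shows "h x = 0"
proof -
  define S where "S = sphere (0::complex) 1"
  define g where "g = h \<circ> (\<lambda>z. Arg2pi z / (2 * pi))"
  \<comment> \<open>\<open>g\<close> is h read off the circle, and the angle \<open>Arg2pi\<close>
    jumps at the point 1. Continuity of \<open>g\<close> there is extracted from the passage from
    loops to circle maps, applied to the trivial homotopy of the loop \<open>h\<close>.\<close>
  have "homotopic_loops (UNIV :: real set) h h"
    using cont per
    by (simp add: homotopic_loops_refl path_def path_image_def pathstart_def pathfinish_def)
  from homotopic_loops_imp_homotopic_circlemaps[OF this]
  have contg: "continuous_on S g"
    unfolding g_def S_def using homotopic_with_imp_continuous by blast
  have gh: "g (cis (2 * pi * t)) = h t" if "t \<in> {0..1}" for t
  proof (cases "t = 1")
    case True
    then show ?thesis using per Arg2pi_of_real[of 1] by (simp add: g_def)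
  next
    case False
    then have "Arg2pi (cis (2 * pi * t)) = 2 * pi * t"
      using that by (intro Arg2pi_unique[of 1]) (auto simp: cis_conv_exp)
    then show ?thesis by (simp add: g_def)
  qed
  have hc: "continuous_on {0..1} (\<lambda>x. of_real (h x) :: complex)"
    by (intro continuous_intros cont)
  have small: "integral {0..1} (\<lambda>x. (h x)\<^sup>2) \<le> e * integral {0..1} (\<lambda>x. \<bar>h x\<bar>)" if "e > 0" for e
  proof -
    have "compact S" by (simp add: S_def)
    then obtain p where p: "real_polynomial_function p" "\<And>z. z \<in> S \<Longrightarrow> \<bar>g z - p z\<bar> < e"
      using Stone_Weierstrass_real_polynomial_function[OF _ contg \<open>e > 0\<close>] by blast
    have pc: "continuous_on {0..1} (\<lambda>x. p (cis (2 * pi * x)))"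
      using p(1) unfolding real_polynomial_function_eq
      by (intro continuous_on_compose2[OF continuous_on_polymonial_function[of p UNIV]]
          continuous_intros) auto
    have "integral {0..1} (\<lambda>x. of_real (h x) * of_real (p (cis (2 * pi * x)))) = (0 :: complex)"
      by (rule integral_trig_polynomial_eq_0[OF hc coeff
            trig_polynomial_real_polynomial_function[OF p(1)]])
    then have "integral {0..1} (\<lambda>x. complex_of_real (h x * p (cis (2 * pi * x)))) = 0"
      by simp
    moreover have "((\<lambda>x. complex_of_real (h x * p (cis (2 * pi * x)))) has_integral
        of_real (integral {0..1} (\<lambda>x. h x * p (cis (2 * pi * x))))) {0..1}"
      by (intro has_integral_of_real integrable_integral integrable_continuous_interval
          continuous_intros cont pc)
    ultimately have zero: "integral {0..1} (\<lambda>x. h x * p (cis (2 * pi * x))) = 0"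
      by (metis integral_unique of_real_eq_0_iff)
    have "integral {0..1} (\<lambda>x. (h x)\<^sup>2) = integral {0..1} (\<lambda>x. (h x)\<^sup>2 - h x * p (cis (2 * pi * x)))"
      by (subst Henstock_Kurzweil_Integration.integral_diff)
        (intro integrable_continuous_interval continuous_intros cont pc | simp add: zero)+
    also have "\<dots> \<le> integral {0..1} (\<lambda>x. e * \<bar>h x\<bar>)"
    proof (rule integral_le)
      show "(h x)\<^sup>2 - h x * p (cis (2 * pi * x)) \<le> e * \<bar>h x\<bar>" if "x \<in> {0..1}" for x
      proof -
        have "(h x)\<^sup>2 - h x * p (cis (2 * pi * x)) = h x * (g (cis (2 * pi * x)) - p (cis (2 * pi * x)))"
          using gh[OF that] by (simp add: power2_eq_square algebra_simps)
        also have "\<dots> \<le> \<bar>h x\<bar> * \<bar>g (cis (2 * pi * x)) - p (cis (2 * pi * x))\<bar>"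
          by (metis abs_ge_self abs_mult)
        also have "\<dots> \<le> \<bar>h x\<bar> * e"
          using p(2)[of "cis (2 * pi * x)"] by (intro mult_left_mono) (auto simp: S_def)
        finally show ?thesis by (simp add: mult.commute)
      qed
    qed (auto intro!: integrable_continuous_interval continuous_intros cont pc)
    finally show ?thesis by simp
  qed
  define B where "B = integral {0..1} (\<lambda>x. \<bar>h x\<bar>)"
  have B: "B \<ge> 0" unfolding B_def by (intro Henstock_Kurzweil_Integration.integral_nonneg
        integrable_continuous_interval continuous_intros cont) auto
  have "integral {0..1} (\<lambda>x. (h x)\<^sup>2) \<le> 0"
  proof (rule field_le_epsilon)
    fix e :: real assume "e > 0"
    \<comment> \<open>B may be 0, whence the denominator B + 1.\<close>
    have "e / (B + 1) * B \<le> e"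
      using B \<open>e > 0\<close> by (simp add: field_simps)
    with small[of "e / (B + 1)"] B \<open>e > 0\<close> show "integral {0..1} (\<lambda>x. (h x)\<^sup>2) \<le> 0 + e"
      by (simp add: B_def)
  qed
  moreover have "integral {0..1} (\<lambda>x. (h x)\<^sup>2) \<ge> 0"
    by (intro Henstock_Kurzweil_Integration.integral_nonneg
        integrable_continuous_interval continuous_intros cont) auto
  ultimately have "integral {0..1} (\<lambda>x. (h x)\<^sup>2) = 0" by simp
  then have "\<forall>x\<in>{0..1}. (h x)\<^sup>2 = 0"
    by (subst (asm) integral_eq_0_iff) (auto intro!: continuous_intros cont)
  with x show ?thesis by simp
qed

section \<open>The theta transformation formula\<close>

lemma integrable_gaussian:
  fixes a :: real
  assumes "a > 0"
  shows "integrable lborel (\<lambda>x. exp (- a * x\<^sup>2))"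
proof -
  have "integrable lborel (normal_density 0 (sqrt (1 / (2 * a))))"
    using assms by (intro integrable_normal_density) simp
  then have "integrable lborel (\<lambda>x. sqrt (pi / a) * normal_density 0 (sqrt (1 / (2 * a))) x)"
    by (intro integrable_mult_right)
  also have "(\<lambda>x. sqrt (pi / a) * normal_density 0 (sqrt (1 / (2 * a))) x) = (\<lambda>x. exp (- a * x\<^sup>2))"
    using assms by (auto simp: normal_density_def fun_eq_iff real_sqrt_divide real_sqrt_mult field_simps)
  finally show ?thesis .
qed

lemma integrable_gaussian_cis:
  assumes "t > 0"
  shows "integrable lborel (\<lambda>x. of_real (exp (- pi * t * x\<^sup>2)) * cis (2 * pi * m * x))"
  by (rule Bochner_Integration.integrable_bound[OF integrable_gaussian[of "pi * t"]])
    (use assms in \<open>auto simp: norm_mult intro!: borel_measurable_continuous_onI continuous_intros\<close>)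

text \<open>This is the characteristic function of the standard normal law at s = 2 pi m / c, after
  the substitution x -> c x with c = sqrt(2 pi t).\<close>

lemma fourier_transform_gaussian:
  fixes t m :: real
  assumes t: "t > 0"
  shows "(LBINT x. of_real (exp (- pi * t * x\<^sup>2)) * cis (2 * pi * m * x)) =
    of_real (exp (- pi * m\<^sup>2 / t) / sqrt t)"
proof -
  define c where "c = sqrt (2 * pi * t)"
  have c: "c > 0" "c\<^sup>2 = 2 * pi * t" using t by (simp_all add: c_def)
  define s where "s = 2 * pi * m / c"
  have "of_real (exp (- (s\<^sup>2) / 2)) = char std_normal_distribution s"
    by (simp add: char_std_normal_distribution)
  also have "\<dots> = (LBINT x. std_normal_density x *\<^sub>R iexp (s * x))"
    unfolding char_def by (subst integral_density) (auto simp: normal_density_def)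
  also have "\<dots> = \<bar>c\<bar> *\<^sub>R (LBINT x. std_normal_density (0 + c * x) *\<^sub>R iexp (s * (0 + c * x)))"
    by (rule lborel_integral_real_affine) (use c in simp)
  also have "(\<lambda>x. std_normal_density (0 + c * x) *\<^sub>R iexp (s * (0 + c * x))) =
      (\<lambda>x. of_real (1 / sqrt (2 * pi)) * (of_real (exp (- pi * t * x\<^sup>2)) * cis (2 * pi * m * x)))"
  proof
    fix x
    have "(c * x)\<^sup>2 / 2 = pi * t * x\<^sup>2" using c by (simp add: power_mult_distrib)
    moreover have "s * (0 + c * x) = 2 * pi * m * x" using c by (simp add: s_def)
    then have "iexp (s * (0 + c * x)) = cis (2 * pi * m * x)" by (simp only: cis_conv_exp)
    ultimately show "std_normal_density (0 + c * x) *\<^sub>R iexp (s * (0 + c * x)) =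
        of_real (1 / sqrt (2 * pi)) * (of_real (exp (- pi * t * x\<^sup>2)) * cis (2 * pi * m * x))"
      by (simp add: std_normal_density_def scaleR_conv_of_real)
  qed
  also have "\<bar>c\<bar> *\<^sub>R (LBINT x. of_real (1 / sqrt (2 * pi)) *
        (of_real (exp (- pi * t * x\<^sup>2)) * cis (2 * pi * m * x))) =
      of_real (sqrt t) * (LBINT x. of_real (exp (- pi * t * x\<^sup>2)) * cis (2 * pi * m * x))"
    using c t by (subst integral_mult_right_zero)
      (simp add: scaleR_conv_of_real c_def real_sqrt_mult)
  finally have "of_real (sqrt t) * (LBINT x. of_real (exp (- pi * t * x\<^sup>2)) * cis (2 * pi * m * x)) =
      complex_of_real (exp (- (s\<^sup>2) / 2))" by simp
  moreover have "s\<^sup>2 / 2 = pi * m\<^sup>2 / t"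
    using t c by (simp add: s_def power_divide power_mult_distrib field_simps power2_eq_square)
  ultimately show ?thesis using t by (simp add: field_simps)
qed

text \<open>Sums over the integers are treated as ordinary series along the bijection
  \<open>int_decode\<close>, so that termwise integration and differentiation apply. The two
  half-lines share 0, which does no harm to summability.\<close>

lemma summable_int_decode:
  fixes f :: "int \<Rightarrow> real"
  assumes "summable (\<lambda>n. f (int n))" "summable (\<lambda>n. f (- int n))" "\<And>d. f d \<ge> 0"
  shows "summable (\<lambda>k. f (int_decode k))"
proof -
  have "f summable_on range int"
    using assms by (subst summable_on_reindex) (auto simp: o_def summable_on_UNIV_nonneg_real_iff)
  moreover have "f summable_on range (\<lambda>n. - int n)"
    using assms by (subst summable_on_reindex) (auto simp: o_def summable_on_UNIV_nonneg_real_iff inj_def)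
  ultimately have "f summable_on (range int \<union> range (\<lambda>n. - int n))"
    by (rule summable_on_union)
  also have "range int \<union> range (\<lambda>n. - int n) = UNIV"
    by (metis (mono_tags, lifting) UNIV_eq_I UnI1 UnI2 int_cases2 rangeI)
  finally have "(\<lambda>k. f (int_decode k)) summable_on UNIV"
    by (subst summable_on_reindex_bij_betw[OF bij_int_decode])
  then show ?thesis by (rule summable_on_imp_summable)
qed

definition theta_major :: "real \<Rightarrow> nat \<Rightarrow> real" where
  "theta_major t k = exp (- pi * t / 2) ^ nat \<bar>int_decode k\<bar>"

lemma summable_theta_major:
  assumes "t > 0" shows "summable (theta_major t)"
proof -
  have "summable (\<lambda>k. (\<lambda>d. exp (- pi * t / 2) ^ nat \<bar>d\<bar>) (int_decode k))"
    by (rule summable_int_decode) (use assms in \<open>auto intro!: summable_geometric\<close>)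
  then show ?thesis by (simp add: theta_major_def[abs_def])
qed

text \<open>From (d + 2x)^2 >= 0 one gets (x + d)^2 >= d^2/2 - x^2 >= |d|/2 - x^2. The resulting
  majorant is geometric in |d| and uniform for bounded x.\<close>

lemma theta_term_le:
  assumes "t > 0"
  shows "exp (- pi * t * (x + of_int (int_decode k))\<^sup>2) \<le> exp (pi * t * x\<^sup>2) * theta_major t k"
proof -
  define d where "d = int_decode k"
  have "\<bar>d\<bar> \<le> d\<^sup>2"
    by (cases "d = 0") (use mult_left_mono[of 1 "\<bar>d\<bar>" "\<bar>d\<bar>"] in \<open>auto simp: power2_eq_square\<close>)
  then have "real (nat \<bar>d\<bar>) \<le> (of_int d)\<^sup>2"
    by (metis abs_ge_zero nat_eq_iff of_int_le_iff of_int_of_nat_eq of_int_power)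
  moreover have "0 \<le> (of_int d + 2 * x)\<^sup>2" by simp
  ultimately have "real (nat \<bar>d\<bar>) / 2 - x\<^sup>2 \<le> (x + of_int d)\<^sup>2"
    by (simp add: power2_eq_square algebra_simps)
  then have "pi * t * (real (nat \<bar>d\<bar>) / 2 - x\<^sup>2) \<le> pi * t * (x + of_int d)\<^sup>2"
    using assms by (intro mult_left_mono) auto
  then show ?thesis
    by (simp add: theta_major_def d_def[symmetric] exp_of_nat_mult[symmetric]
        exp_add[symmetric] algebra_simps)
qed

lemma summable_theta:
  assumes "t > 0"
  shows "summable (\<lambda>k. exp (- pi * t * (x + of_int (int_decode k))\<^sup>2))"
  by (rule summable_comparison_test'[OF summable_mult[OF summable_theta_major[OF assms]], of 0])
    (use theta_term_le[OF assms] in auto)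

lemma continuous_theta:
  assumes "t > 0"
  shows "continuous_on {0..1} (\<lambda>x. \<Sum>k. exp (- pi * t * (x + of_int (int_decode k))\<^sup>2))"
proof -
  have "uniform_limit {0..1} (\<lambda>n x. \<Sum>k<n. exp (- pi * t * (x + of_int (int_decode k))\<^sup>2))
      (\<lambda>x. \<Sum>k. exp (- pi * t * (x + of_int (int_decode k))\<^sup>2)) sequentially"
  proof (rule Weierstrass_m_test)
    show "norm (exp (- pi * t * (x + of_int (int_decode k))\<^sup>2)) \<le> exp (pi * t) * theta_major t k"
      if "x \<in> {0..1}" for k and x :: real
    proof -
      have "exp (pi * t * x\<^sup>2) \<le> exp (pi * t)"
        using that assms by (simp add: power_le_one mult_left_le)
      then have "exp (pi * t * x\<^sup>2) * theta_major t k \<le> exp (pi * t) * theta_major t k"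
        by (intro mult_right_mono) (auto simp: theta_major_def)
      with theta_term_le[OF assms, of x k] show ?thesis by simp
    qed
  qed (intro summable_mult summable_theta_major assms)
  then show ?thesis
    by (rule uniform_limit_theorem[rotated])
      (auto intro!: always_eventually continuous_intros)
qed

text \<open>Unfolding: the translates of [0, 1) by the integers tile the line and cis(2 pi m x) has
  period 1, so the coefficient of the periodised Gaussian is the Fourier transform of the Gaussian
  on the whole line.\<close>

lemma theta_fourier_coeff:
  fixes m :: int
  assumes t: "t > 0"
  shows "integral {0..1} (\<lambda>x. of_real (\<Sum>k. exp (- pi * t * (x + of_int (int_decode k))\<^sup>2)) *
      cis (2 * pi * of_int m * x)) = of_real (exp (- pi * (of_int m)\<^sup>2 / t) / sqrt t)"
proof -
  define d where "d = (\<lambda>k. real_of_int (int_decode k))"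
  define g where "g = (\<lambda>x. complex_of_real (exp (- pi * t * x\<^sup>2)) * cis (2 * pi * of_int m * x))"
  define A where "A = (\<lambda>k. {d k..<d k + 1})"
  define h where "h = (\<lambda>k x. indicator {0..<1} x *\<^sub>R g (x + d k))"
  have gi: "integrable lborel g"
    unfolding g_def by (rule integrable_gaussian_cis[OF t])
  have shift: "set_lebesgue_integral lborel (A k) g = (LBINT x. h k x)" for k
  proof -
    have "set_lebesgue_integral lborel (A k) g =
        \<bar>1\<bar> *\<^sub>R (LBINT x. indicator (A k) (d k + 1 * x) *\<^sub>R g (d k + 1 * x))"
      unfolding set_lebesgue_integral_def by (rule lborel_integral_real_affine) simp
    also have "\<dots> = (LBINT x. h k x)"
      by (simp add: h_def A_def indicator_def add.commute)
    finally show ?thesis .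
  qed
  have AU: "(\<Union>k. A k) = UNIV"
  proof safe
    fix x :: real
    obtain k where "int_decode k = \<lfloor>x\<rfloor>" by (metis int_encode_inverse)
    then have "x \<in> A k" by (auto simp: A_def d_def)
    then show "x \<in> (\<Union>k. A k)" by blast
  qed simp
  have disj: "A i \<inter> A j = {}" if "i \<noteq> j" for i j
  proof -
    have "int_decode i \<noteq> int_decode j" using that by (metis int_decode_inverse)
    moreover have "int_decode i = int_decode j" if "x \<in> A i" "x \<in> A j" for x
      using that by (auto simp: A_def d_def)
    ultimately show ?thesis by blast
  qed
  have "(LBINT x. g x) = (LBINT x:(\<Union>k. A k). g x)" by (simp add: AU set_lebesgue_integral_def)
  also have "\<dots> = (\<Sum>k. LBINT x:A k. g x)"
    by (rule lebesgue_integral_countable_add)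
      (use disj gi in \<open>auto simp: A_def AU[unfolded A_def] set_integrable_def\<close>)
  also have "\<dots> = (\<Sum>k. LBINT x. h k x)" by (simp add: shift)
  also have "\<dots> = (LBINT x. (\<Sum>k. h k x))"
  proof (rule integral_suminf[symmetric])
    have [measurable]: "g \<in> borel_measurable borel" using gi by auto
    have hb: "norm (h k x) \<le> exp (pi * t) * theta_major t k * indicator {0..<1} x" for k x
    proof (cases "x \<in> {0..<1}")
      case True
      have "norm (h k x) = exp (- pi * t * (x + d k)\<^sup>2)"
        using True by (simp add: h_def g_def norm_mult)
      also have "\<dots> \<le> exp (pi * t * x\<^sup>2) * theta_major t k"
        using theta_term_le[OF t] by (simp add: d_def)
      also have "\<dots> \<le> exp (pi * t) * theta_major t k"
        using True t by (intro mult_right_mono) (auto simp: theta_major_def power_le_one mult_left_le)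
      finally show ?thesis using True by simp
    qed (simp add: h_def)
    show hi: "integrable lborel (h k)" for k
      by (rule Bochner_Integration.integrable_bound[where
            f = "\<lambda>x. exp (pi * t) * theta_major t k * indicator {0..<1} x"])
        (simp, simp add: h_def, rule AE_I2, metis hb abs_ge_self order_trans real_norm_def)
    have M: "summable (\<lambda>k. exp (pi * t) * theta_major t k)"
      by (intro summable_mult summable_theta_major t)
    show "AE x in lborel. summable (\<lambda>k. norm (h k x))"
    proof (rule AE_I2)
      fix x :: real
      show "summable (\<lambda>k. norm (h k x))"
        by (rule summable_comparison_test'[OF summable_mult2[OF M, of "indicator {0..<1} x"], of 0])
          (use hb in auto)
    qed
    show "summable (\<lambda>k. LBINT x. norm (h k x))"
    proof (rule summable_comparison_test'[OF M, of 0])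
      fix k
      have "(LBINT x. norm (h k x)) \<le> (LBINT x. exp (pi * t) * theta_major t k * indicator {0..<1::real} x)"
        by (rule integral_mono) (use hi hb in auto)
      then show "norm (LBINT x. norm (h k x)) \<le> exp (pi * t) * theta_major t k"
        by simp
    qed
  qed
  also have "(\<lambda>x. \<Sum>k. h k x) = (\<lambda>x. indicator {0..<1} x *\<^sub>R
      (of_real (\<Sum>k. exp (- pi * t * (x + of_int (int_decode k))\<^sup>2)) * cis (2 * pi * of_int m * x)))"
  proof
    fix x :: real
    have per: "cis (2 * pi * of_int m * (x + d k)) = cis (2 * pi * of_int m * x)" for k
    proof -
      have "2 * pi * of_int m * (x + d k) = 2 * pi * of_int m * x + 2 * pi * of_int (m * int_decode k)"
        by (simp add: d_def algebra_simps)
      then show ?thesis by (simp only: cis_mult[symmetric] cis_multiple_2pi Ints_of_int) simp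
    qed
    have "(\<Sum>k. complex_of_real (exp (- pi * t * (x + of_int (int_decode k))\<^sup>2))) =
        of_real (\<Sum>k. exp (- pi * t * (x + of_int (int_decode k))\<^sup>2))"
      by (rule suminf_of_real[symmetric]) (rule summable_theta[OF t])
    moreover have "summable (\<lambda>k. complex_of_real (exp (- pi * t * (x + of_int (int_decode k))\<^sup>2)))"
      by (rule summable_of_real[OF summable_theta[OF t]])
    ultimately have "(\<Sum>k. of_real (exp (- pi * t * (x + of_int (int_decode k))\<^sup>2)) *
        cis (2 * pi * of_int m * x)) =
        of_real (\<Sum>k. exp (- pi * t * (x + of_int (int_decode k))\<^sup>2)) * cis (2 * pi * of_int m * x)"
      by (metis suminf_mult2)
    then show "(\<Sum>k. h k x) = indicator {0..<1} x *\<^sub>R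
      (of_real (\<Sum>k. exp (- pi * t * (x + of_int (int_decode k))\<^sup>2)) * cis (2 * pi * of_int m * x))"
      by (cases "x \<in> {0..<1}") (auto simp: h_def g_def per[unfolded d_def] d_def)
  qed
  also have "(LBINT x. indicator {0..<1} x *\<^sub>R
      (of_real (\<Sum>k. exp (- pi * t * (x + of_int (int_decode k))\<^sup>2)) * cis (2 * pi * of_int m * x))) =
    (LBINT x:{0..1}.
      (of_real (\<Sum>k. exp (- pi * t * (x + of_int (int_decode k))\<^sup>2)) * cis (2 * pi * of_int m * x)))"
  proof -
    have si: "set_integrable lborel {0..1} (\<lambda>x. complex_of_real
        (\<Sum>k. exp (- pi * t * (x + of_int (int_decode k))\<^sup>2)) * cis (2 * pi * of_int m * x))"
      by (intro borel_integrable_atLeastAtMost' continuous_intros continuous_theta t)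
    have si': "set_integrable lborel {0..<1} (\<lambda>x. complex_of_real
        (\<Sum>k. exp (- pi * t * (x + of_int (int_decode k))\<^sup>2)) * cis (2 * pi * of_int m * x))"
      by (rule set_integrable_subset[OF si]) auto
    have ae: "AE x in lborel. x \<in> {0..<1} \<longleftrightarrow> x \<in> {0..(1::real)}"
      using AE_lborel_singleton[of "1::real"] by eventually_elim auto
    from set_integral_cong_set[OF
        borel_measurable_integrable[OF si'[unfolded set_integrable_def], folded set_borel_measurable_def]
        borel_measurable_integrable[OF si[unfolded set_integrable_def], folded set_borel_measurable_def] ae]
    show ?thesis
      unfolding set_lebesgue_integral_def by (rule sym)
  qed
  also have "\<dots> = integral {0..1} (\<lambda>x.
      of_real (\<Sum>k. exp (- pi * t * (x + of_int (int_decode k))\<^sup>2)) * cis (2 * pi * of_int m * x))"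
    by (intro set_borel_integral_eq_integral borel_integrable_atLeastAtMost'
        continuous_intros continuous_theta t)
  finally show ?thesis
    using fourier_transform_gaussian[OF t, of "of_int m"] by (simp add: g_def)
qed

lemma integral_cis_int:
  fixes k :: int
  shows "integral {0..1} (\<lambda>x. cis (2 * pi * of_int k * x)) = of_bool (k = 0)"
proof (cases "k = 0")
  case False
  define c where "c = \<i> * of_real (2 * pi * of_int k)"
  have c: "c \<noteq> 0" using False by (simp add: c_def)
  have "((\<lambda>x. cis (2 * pi * of_int k * x)) has_integral
      exp (c * of_real 1) / c - exp (c * of_real 0) / c) {0..1}"
  proof (rule fundamental_theorem_of_calculus)
    fix x :: real
    have "((\<lambda>z. exp (c * z) / c) has_field_derivative exp (c * of_real x)) (at (of_real x))"
      using c by (auto intro!: derivative_eq_intros)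
    then have "((\<lambda>x. exp (c * of_real x) / c) has_vector_derivative exp (c * of_real x)) (at x within {0..1})"
      by (intro has_vector_derivative_real_field) (auto intro: has_field_derivative_at_within)
    also have "exp (c * of_real x) = cis (2 * pi * of_int k * x)"
      by (simp add: cis_conv_exp c_def mult.assoc)
    finally show "((\<lambda>x. exp (c * of_real x) / c) has_vector_derivative cis (2 * pi * of_int k * x))
      (at x within {0..1})" .
  qed simp
  moreover have "exp c = 1"
  proof -
    have "exp c = cis (2 * pi * of_int k)" by (simp add: cis_conv_exp c_def)
    then show ?thesis by (simp add: cis_multiple_2pi)
  qed
  ultimately show ?thesis using False by (auto dest!: integral_unique)
qed simp

text \<open>The frequencies m and -m are combined into a cosine, which keeps the function
  real.\<close>

definition dual_theta :: "real \<Rightarrow> real \<Rightarrow> real" where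
  "dual_theta t x = (1 + 2 * (\<Sum>m. exp (- pi * (real (Suc m))\<^sup>2 / t) * cos (2 * pi * real (Suc m) * x))) / sqrt t"

lemma exp_square_le:
  assumes "t > 0"
  shows "exp (- pi * (real (Suc m))\<^sup>2 / t) \<le> exp (- pi / t) ^ Suc m"
proof -
  have "real (Suc m) \<le> (real (Suc m))\<^sup>2" by (simp add: power2_eq_square)
  then have "pi / t * real (Suc m) \<le> pi / t * (real (Suc m))\<^sup>2"
    using assms by (intro mult_left_mono) auto
  then show ?thesis by (simp add: exp_of_nat_mult[symmetric] del: power_Suc of_nat_Suc)
    (simp add: algebra_simps)
qed

lemma summable_exp_square:
  assumes "t > 0"
  shows "summable (\<lambda>m. exp (- pi * (real (Suc m))\<^sup>2 / t))"
proof (rule summable_comparison_test'[of _ 0])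
  have "summable (\<lambda>m. exp (- pi / t) ^ m)"
    using assms by (intro summable_geometric) simp
  then show "summable (\<lambda>m. exp (- pi / t) ^ Suc m)" by (subst summable_Suc_iff)
  show "norm (exp (- pi * (real (Suc m))\<^sup>2 / t)) \<le> exp (- pi / t) ^ Suc m" for m
    using exp_square_le[OF assms, of m] by simp
qed

lemma dual_theta_uniform_limit:
  assumes "t > 0"
  shows "uniform_limit UNIV (\<lambda>n x. (1 + 2 * (\<Sum>m<n. exp (- pi * (real (Suc m))\<^sup>2 / t) *
      cos (2 * pi * real (Suc m) * x))) / sqrt t) (dual_theta t) sequentially"
proof -
  have "uniform_limit UNIV (\<lambda>n x. \<Sum>m<n. exp (- pi * (real (Suc m))\<^sup>2 / t) * cos (2 * pi * real (Suc m) * x))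
      (\<lambda>x. \<Sum>m. exp (- pi * (real (Suc m))\<^sup>2 / t) * cos (2 * pi * real (Suc m) * x)) sequentially"
    by (rule Weierstrass_m_test[OF _ summable_exp_square[OF assms]])
      (auto simp: abs_mult intro!: mult_left_le)
  then have "uniform_limit UNIV (\<lambda>n x. (1 / sqrt t) * (1 + 2 * (\<Sum>m<n. exp (- pi * (real (Suc m))\<^sup>2 / t) * cos (2 * pi * real (Suc m) * x))))
      (\<lambda>x. (1 / sqrt t) * (1 + 2 * (\<Sum>m. exp (- pi * (real (Suc m))\<^sup>2 / t) * cos (2 * pi * real (Suc m) * x)))) sequentially"
    by (intro bounded_linear_uniform_limit_intros uniform_limit_add uniform_limit_const)
  then show ?thesis by (simp add: dual_theta_def[abs_def])
qed

text \<open>Uniform convergence lets the coefficients of the partial sums converge to those of the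
  limit, and the j-th coefficient of the n-th partial sum no longer changes from n = |j| on.\<close>

lemma dual_theta_fourier_coeff:
  fixes j :: int
  assumes t: "t > 0"
  shows "continuous_on {0..1} (dual_theta t)"
    and "integral {0..1} (\<lambda>x. of_real (dual_theta t x) * cis (2 * pi * of_int j * x)) =
      of_real (exp (- pi * (of_int j)\<^sup>2 / t) / sqrt t)"
proof -
  define P where "P = (\<lambda>n x. (1 + 2 * (\<Sum>m<n. exp (- pi * (real (Suc m))\<^sup>2 / t) *
      cos (2 * pi * real (Suc m) * x))) / sqrt t)"
  have ul: "uniform_limit {0..1} P (dual_theta t) sequentially"
    unfolding P_def by (rule uniform_limit_on_subset[OF dual_theta_uniform_limit[OF t]]) simp
  have Pc: "continuous_on {0..1} (P n)" for n
    unfolding P_def using t by (intro continuous_intros) auto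
  show cont: "continuous_on {0..1} (dual_theta t)"
    by (rule uniform_limit_theorem[OF _ ul]) (auto intro!: always_eventually Pc)
  have "uniform_limit {0..1} (\<lambda>n x. of_real (P n x) * cis (2 * pi * of_int j * x))
     (\<lambda>x. of_real (dual_theta t x) * cis (2 * pi * of_int j * x)) sequentially"
  proof (rule uniform_lim_mult)
    show "uniform_limit {0..1} (\<lambda>n x. complex_of_real (P n x)) (\<lambda>x. of_real (dual_theta t x)) sequentially"
      using ul by (intro bounded_linear_uniform_limit_intros)
    have "continuous_on {0..1} (\<lambda>x. complex_of_real (dual_theta t x))"
      by (intro continuous_intros cont)
    then show "bounded ((\<lambda>x. complex_of_real (dual_theta t x)) ` {0..1})"
      by (intro compact_imp_bounded compact_continuous_image) auto
    show "bounded ((\<lambda>x. cis (2 * pi * of_int j * x)) ` {0..1})"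
      by (rule boundedI[of _ 1]) auto
  qed (rule uniform_limit_const)
  then obtain I J where IJ: "\<And>n. ((\<lambda>x. of_real (P n x) * cis (2 * pi * of_int j * x)) has_integral I n) {0..1}"
      "((\<lambda>x. of_real (dual_theta t x) * cis (2 * pi * of_int j * x)) has_integral J) {0..1}"
      "I \<longlonglongrightarrow> J"
    by (rule uniform_limit_integral) (auto intro!: continuous_intros Pc)
  have "I = (\<lambda>n. integral {0..1} (\<lambda>x. of_real (P n x) * cis (2 * pi * of_int j * x)))"
    using integral_unique[OF IJ(1)] by auto
  with IJ(2,3) have lim: "(\<lambda>n. integral {0..1} (\<lambda>x. of_real (P n x) * cis (2 * pi * of_int j * x)))
      \<longlonglongrightarrow> integral {0..1} (\<lambda>x. of_real (dual_theta t x) * cis (2 * pi * of_int j * x))"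
    by (simp add: integral_unique)
  have ev: "integral {0..1} (\<lambda>x. of_real (P n x) * cis (2 * pi * of_int j * x)) =
      of_real (exp (- pi * (of_int j)\<^sup>2 / t) / sqrt t)" if n: "n \<ge> nat \<bar>j\<bar>" for n
  proof -
    define c where "c = (\<lambda>m. complex_of_real (exp (- pi * (real (Suc m))\<^sup>2 / t)))"
    define e where "e = (\<lambda>(k::int) (x::real). cis (2 * pi * of_int k * x))"
    have eq: "of_real (P n x) * e j x = (1 / of_real (sqrt t)) * (e j x +
        (\<Sum>m<n. c m * (e (j + int (Suc m)) x + e (j - int (Suc m)) x)))" for x
    proof -
      have "2 * cos_mode x (Suc m) * e j x =
          e (j + int (Suc m)) x + e (j - int (Suc m)) x" for m
      proof -
        have "2 * complex_of_real (cos a) = cis a + cis (- a)" for a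
          by (simp add: complex_eq_iff)
        then show ?thesis
          by (simp add: e_def distrib_right distrib_left cis_mult algebra_simps)
      qed
      then have "c m * (e (j + int (Suc m)) x + e (j - int (Suc m)) x) =
         2 * (c m * cos_mode x (Suc m) * e j x)" for m
        by (metis (no_types, opaque_lifting) mult.assoc mult.left_commute)
      then have "(\<Sum>m<n. c m * (e (j + int (Suc m)) x + e (j - int (Suc m)) x)) =
          (\<Sum>m<n. 2 * (c m * cos_mode x (Suc m) * e j x))"
        by (simp only:)
      also have "\<dots> = 2 * (\<Sum>m<n. c m * cos_mode x (Suc m)) * e j x"
        by (simp only: sum_distrib_left sum_distrib_right mult.assoc)
      finally have "(\<Sum>m<n. c m * (e (j + int (Suc m)) x + e (j - int (Suc m)) x)) =
          2 * (\<Sum>m<n. c m * cos_mode x (Suc m)) * e j x" .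
      moreover have "complex_of_real (P n x) = (1 / of_real (sqrt t)) *
          (1 + 2 * (\<Sum>m<n. c m * cos_mode x (Suc m)))"
        by (simp add: P_def c_def)
      ultimately show ?thesis
        by (simp only: distrib_left distrib_right mult.assoc mult_1_left)
    qed
    have ei: "(e k has_integral of_bool (k = 0)) {0..1}" for k
    proof -
      have "e k integrable_on {0..1}"
        unfolding e_def by (intro integrable_continuous_interval continuous_intros)
      then show ?thesis using integral_cis_int[of k] unfolding e_def
        by (metis integrable_integral)
    qed
    have "((\<lambda>x. of_real (P n x) * e j x) has_integral
       (1 / of_real (sqrt t)) * (of_bool (j = 0) +
        (\<Sum>m<n. c m * (of_bool (j + int (Suc m) = 0) + of_bool (j - int (Suc m) = 0))))) {0..1}"
      unfolding eq
      by (intro has_integral_mult_right has_integral_add has_integral_sum ei) auto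
    moreover have "of_bool (j = 0) +
        (\<Sum>m<n. c m * (of_bool (j + int (Suc m) = 0) + of_bool (j - int (Suc m) = 0))) =
        of_real (exp (- pi * (of_int j)\<^sup>2 / t))"
    proof (cases "j = 0")
      case False
      \<comment> \<open>The index m stands for the frequency m + 1, so the frequency |j| sits at |j|
        - 1.\<close>
      have "(\<Sum>m<n. c m * (of_bool (j + int (Suc m) = 0) + of_bool (j - int (Suc m) = 0))) =
          (\<Sum>m\<in>{nat \<bar>j\<bar> - 1}. c m * (of_bool (j + int (Suc m) = 0) + of_bool (j - int (Suc m) = 0)))"
        using n False by (intro sum.mono_neutral_right) auto
      also have "\<dots> = c (nat \<bar>j\<bar> - 1)"
        using False by auto
      also have "\<dots> = of_real (exp (- pi * (of_int j)\<^sup>2 / t))"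
      proof -
        have "real (Suc (nat \<bar>j\<bar> - 1)) = \<bar>of_int j\<bar>" using False by simp
        then show ?thesis by (simp only: c_def power2_abs)
      qed
      finally show ?thesis using False by simp
    qed (auto intro!: sum.neutral)
    ultimately show ?thesis by (simp add: e_def integral_unique)
  qed
  have "(\<lambda>n. integral {0..1} (\<lambda>x. of_real (P n x) * cis (2 * pi * of_int j * x)))
      \<longlonglongrightarrow> of_real (exp (- pi * (of_int j)\<^sup>2 / t) / sqrt t)"
    using ev by (intro tendsto_eventually) (auto simp: eventually_sequentially)
  with lim show "integral {0..1} (\<lambda>x. of_real (dual_theta t x) * cis (2 * pi * of_int j * x)) =
      of_real (exp (- pi * (of_int j)\<^sup>2 / t) / sqrt t)"
    by (rule LIMSEQ_unique)
qed

lemma dual_theta_add_int: "dual_theta t (x + of_int k) = dual_theta t x"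
proof -
  have "cos (2 * pi * real (Suc m) * (x + of_int k)) = cos (2 * pi * real (Suc m) * x)" for m
  proof -
    have "2 * pi * real (Suc m) * (x + of_int k) =
        2 * pi * real (Suc m) * x + 2 * pi * of_int (int (Suc m) * k)"
      by (simp add: algebra_simps)
    then show ?thesis by (simp only: cos_add cos_int_2pin sin_int_2pin mult_1_right mult_zero_right diff_0_right)
  qed
  then show ?thesis by (simp add: dual_theta_def)
qed

text \<open>Both sides are continuous, have period 1 in x and share their Fourier coefficients. They
  are compared on [0, 1], and \<open>frac\<close> carries the result to all x.\<close>

theorem theta_transformation:
  assumes t: "t > 0"
  shows "((\<lambda>d::int. exp (- pi * t * (x + of_int d)\<^sup>2)) has_sum dual_theta t x) UNIV"
proof -
  define F where "F = (\<lambda>x. \<Sum>k. exp (- pi * t * (x + of_int (int_decode k))\<^sup>2))"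
  have hs: "((\<lambda>d::int. exp (- pi * t * (x + of_int d)\<^sup>2)) has_sum F x) UNIV" for x
  proof -
    have "((\<lambda>k. exp (- pi * t * (x + of_int (int_decode k))\<^sup>2)) has_sum F x) UNIV"
      unfolding F_def using summable_theta[OF t, of x]
      by (intro norm_summable_imp_has_sum summable_sums) auto
    then show ?thesis
      by (subst (asm) has_sum_reindex_bij_betw[OF bij_int_decode])
  qed
  have per: "F (x + of_int k) = F x" for x k
  proof -
    have "((\<lambda>d::int. exp (- pi * t * (x + of_int (d + k))\<^sup>2)) has_sum F x) UNIV"
      using hs[of x] by (subst has_sum_reindex_bij_betw[where f = "\<lambda>d. exp (- pi * t * (x + of_int d)\<^sup>2)"])
        (auto intro!: bij_betwI[of _ _ _ "\<lambda>d. d - k"])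
    also have "(\<lambda>d::int. exp (- pi * t * (x + of_int (d + k))\<^sup>2)) =
        (\<lambda>d::int. exp (- pi * t * ((x + of_int k) + of_int d)\<^sup>2))"
      by (simp add: add_ac)
    finally show ?thesis using hs has_sum_unique by blast
  qed
  have eq: "F x - dual_theta t x = 0" if "x \<in> {0..1}" for x
  proof (rule fourier_coeffs_eq_0_imp_eq_0[OF _ _ _ that, where h = "\<lambda>x. F x - dual_theta t x"])
    have Fc: "continuous_on {0..1} F" unfolding F_def by (rule continuous_theta[OF t])
    show "continuous_on {0..1} (\<lambda>x. F x - dual_theta t x)"
      by (intro continuous_intros Fc dual_theta_fourier_coeff t)
    show "F 1 - dual_theta t 1 = F 0 - dual_theta t 0"
      using per[of 0 1] dual_theta_add_int[of t 0 1] by simp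
    show "integral {0..1} (\<lambda>x. of_real (F x - dual_theta t x) * cis (2 * pi * of_int m * x)) = 0" for m :: int
    proof -
      have "integral {0..1} (\<lambda>x. of_real (F x) * cis (2 * pi * of_int m * x) -
          of_real (dual_theta t x) * cis (2 * pi * of_int m * x)) = 0"
        by (subst Henstock_Kurzweil_Integration.integral_diff)
          ((intro integrable_continuous_interval continuous_intros Fc dual_theta_fourier_coeff t)+,
           simp only: F_def theta_fourier_coeff[OF t] dual_theta_fourier_coeff(2)[OF t] diff_self)
      then show ?thesis by (simp add: algebra_simps)
    qed
  qed
  have "F x = F (frac x)" "dual_theta t x = dual_theta t (frac x)"
    using per[of "frac x" "\<lfloor>x\<rfloor>"] dual_theta_add_int[of t "frac x" "\<lfloor>x\<rfloor>"] by (simp_all add: frac_def)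
  moreover have "frac x \<in> {0..1}" using frac_lt_1[of x] by auto
  ultimately have "F x = dual_theta t x" using eq[of "frac x"] by simp
  with hs[of x] show ?thesis by simp
qed

section \<open>Mellin transforms\<close>

lemma norm_diff_quotient_le:
  fixes f :: "complex \<Rightarrow> complex"
  assumes f: "f holomorphic_on ball z r" and r: "r > 0"
    and B: "\<And>w. w \<in> ball z r \<Longrightarrow> norm (f w) \<le> B"
    and w: "w \<in> ball z (r / 2)" "w \<noteq> z"
  shows "norm ((f w - f z) / (w - z)) \<le> 3 * B / r"
proof -
  have "norm (f w - f z) \<le> (3 * B / r) * norm (w - z)"
  proof (rule field_differentiable_bound[of "ball z (r / 2)" f "deriv f"])
    show "(f has_field_derivative deriv f u) (at u within ball z (r / 2))" if "u \<in> ball z (r / 2)" for u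
      by (rule has_field_derivative_at_within, rule holomorphic_derivI[OF f]) (use that r in auto)
    show "norm (deriv f u) \<le> 3 * B / r" if u: "u \<in> ball z (r / 2)" for u
    proof -
      \<comment> \<open>The radius r/3 fits because r/2 + r/3 < r. Cauchy's inequality on these
        discs bounds the derivative by 3 B / r on the whole smaller ball.\<close>
      have sub: "cball u (r / 3) \<subseteq> ball z r"
      proof
        fix v assume "v \<in> cball u (r / 3)"
        with u r have "dist z u + dist u v < r" by auto
        then show "v \<in> ball z r" using dist_triangle[of z v u] by auto
      qed
      have hol: "f holomorphic_on cball u (r / 3)" by (rule holomorphic_on_subset[OF f sub])
      have "norm ((deriv ^^ 1) f u) \<le> fact 1 * B / (r / 3) ^ 1"
      proof (rule Cauchy_inequality)
        show "f holomorphic_on ball u (r / 3)" by (rule holomorphic_on_subset[OF hol]) auto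
        show "continuous_on (cball u (r / 3)) f" by (rule holomorphic_on_imp_continuous_on[OF hol])
        show "norm (f x) \<le> B" if "norm (u - x) = r / 3" for x
          using that sub by (intro B) (auto simp: dist_norm subset_iff)
      qed (use r in auto)
      then show ?thesis by (simp add: mult.commute)
    qed
  qed (use w r in auto)
  then show ?thesis using w by (simp add: norm_divide field_simps)
qed

text \<open>Differentiation under the integral by dominated convergence. Dominating f itself is
  enough: holomorphy turns a bound g on a disc of radius r into the bound 3 g / r for the difference
  quotients on half the disc.\<close>

lemma holomorphic_on_lebesgue_integral:
  fixes f :: "complex \<Rightarrow> 'a \<Rightarrow> complex"
  assumes "open U"
    and hol: "\<And>x. x \<in> space M \<Longrightarrow> (\<lambda>s. f s x) holomorphic_on U"
    and meas: "\<And>s. s \<in> U \<Longrightarrow> f s \<in> borel_measurable M"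
    and dom: "\<And>z. z \<in> U \<Longrightarrow> \<exists>r>0. \<exists>g. integrable M g \<and>
        (\<forall>s\<in>ball z r \<inter> U. \<forall>x\<in>space M. norm (f s x) \<le> g x)"
  shows "(\<lambda>s. \<integral>x. f s x \<partial>M) holomorphic_on U"
proof -
  have "\<exists>D. ((\<lambda>s. \<integral>x. f s x \<partial>M) has_field_derivative D) (at z)" if z: "z \<in> U" for z
  proof -
    obtain r0 g where r0: "r0 > 0" "integrable M g"
      "\<And>s x. s \<in> ball z r0 \<inter> U \<Longrightarrow> x \<in> space M \<Longrightarrow> norm (f s x) \<le> g x"
      using dom[OF z] by blast
    obtain r1 where r1: "r1 > 0" "ball z r1 \<subseteq> U" using \<open>open U\<close> z openE by blast
    define r where "r = min r0 r1"
    have r: "r > 0" "ball z r \<subseteq> U" "\<And>s x. s \<in> ball z r \<Longrightarrow> x \<in> space M \<Longrightarrow> norm (f s x) \<le> g x"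
      using r0 r1 by (auto simp: r_def)
    have int: "integrable M (f s)" if "s \<in> ball z r" for s
      using that r r0 meas
      by (intro Bochner_Integration.integrable_bound[OF r0(2)])
        (auto intro!: AE_I2 order_trans[OF r(3) abs_ge_self])
    define D where "D = (\<lambda>x. deriv (\<lambda>s. f s x) z)"
    have lim: "(\<lambda>n. (f (w n) x - f z x) / (w n - z)) \<longlonglongrightarrow> D x"
      if "x \<in> space M" "w \<longlonglongrightarrow> z" "\<And>n. w n \<noteq> z" for x w
    proof -
      have "((\<lambda>s. f s x) has_field_derivative D x) (at z)"
        unfolding D_def using hol[OF that(1)] \<open>open U\<close> z by (rule holomorphic_derivI)
      then have "((\<lambda>w. (f w x - f z x) / (w - z)) \<longlongrightarrow> D x) (at z)"
        by (simp add: has_field_derivative_iff)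
      then show ?thesis
        using that by (auto simp: tendsto_at_iff_sequentially o_def)
    qed
    \<comment> \<open>One concrete sequence tending to z inside the disc exhibits the pointwise
      derivative \<open>D\<close> as a limit of measurable functions.\<close>
    define \<epsilon> where "\<epsilon> = (\<lambda>n. r / 2 / real (Suc (Suc n)))"
    define w0 where "w0 = (\<lambda>n. z + of_real (\<epsilon> n))"
    have \<epsilon>: "\<epsilon> n > 0" "\<epsilon> n < r" for n
      using r mult_strict_left_mono[of 1 "2 * real (Suc (Suc n))" r]
      by (simp_all add: \<epsilon>_def pos_divide_less_eq)
    have "\<epsilon> \<longlonglongrightarrow> 0"
      unfolding \<epsilon>_def using LIMSEQ_Suc[OF LIMSEQ_Suc[OF lim_const_over_n[of "r / 2"]]] .
    then have "w0 \<longlonglongrightarrow> z + of_real 0"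
      unfolding w0_def by (intro tendsto_add tendsto_const tendsto_of_real)
    then have w0: "w0 \<longlonglongrightarrow> z" "\<And>n. w0 n \<noteq> z" "\<And>n. w0 n \<in> ball z r"
      using \<epsilon> by (simp_all add: w0_def dist_norm order.strict_implies_not_eq[symmetric] less_imp_le)
    have Dm: "D \<in> borel_measurable M"
    proof (rule borel_measurable_LIMSEQ_metric)
      show "(\<lambda>x. (f (w0 n) x - f z x) / (w0 n - z)) \<in> borel_measurable M" for n
        using meas w0(3)[of n] r z by (intro borel_measurable_divide borel_measurable_diff) auto
      show "(\<lambda>n. (f (w0 n) x - f z x) / (w0 n - z)) \<longlonglongrightarrow> D x" if "x \<in> space M" for x
        by (rule lim[OF that w0(1,2)])
    qed
    have "((\<lambda>w. ((\<integral>x. f w x \<partial>M) - (\<integral>x. f z x \<partial>M)) / (w - z)) \<longlongrightarrow> (\<integral>x. D x \<partial>M)) (at z)"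
      unfolding tendsto_at_iff_sequentially o_def
    proof (intro allI impI, goal_cases)
      case (1 w)
      then have "\<forall>\<^sub>F n in sequentially. w n \<in> ball z (r / 2)"
        using r by (intro topological_tendstoD) auto
      then obtain N where N: "\<And>n. n \<ge> N \<Longrightarrow> w n \<in> ball z (r / 2)"
        by (auto simp: eventually_sequentially)
      define v where "v = (\<lambda>n. w (n + N))"
      have v: "v \<longlonglongrightarrow> z" "\<And>n. v n \<noteq> z" "\<And>n. v n \<in> ball z (r / 2)"
        using 1 N by (auto simp: v_def intro: LIMSEQ_ignore_initial_segment)
      have vr: "v n \<in> ball z r" for n using v(3)[of n] r by auto
      have "(\<lambda>n. \<integral>x. (f (v n) x - f z x) / (v n - z) \<partial>M) \<longlonglongrightarrow> (\<integral>x. D x \<partial>M)"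
      proof (rule integral_dominated_convergence[where w = "\<lambda>x. 3 * g x / r"])
        show "AE x in M. (\<lambda>n. (f (v n) x - f z x) / (v n - z)) \<longlonglongrightarrow> D x"
          using lim v by (intro AE_I2) auto
        show "AE x in M. norm ((f (v n) x - f z x) / (v n - z)) \<le> 3 * g x / r" for n
          using r v by (intro AE_I2 norm_diff_quotient_le)
            (auto intro: holomorphic_on_subset[OF hol])
        show "(\<lambda>x. (f (v n) x - f z x) / (v n - z)) \<in> borel_measurable M" for n
          using meas vr[of n] r z by (intro borel_measurable_divide borel_measurable_diff) auto
        show "integrable M (\<lambda>x. 3 * g x / r)" using r0(2) by simp
      qed (rule Dm)
      moreover have "(\<integral>x. (f (v n) x - f z x) / (v n - z) \<partial>M) =
          ((\<integral>x. f (v n) x \<partial>M) - (\<integral>x. f z x \<partial>M)) / (v n - z)" for n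
        using int[OF vr[of n]] int[of z] r by simp
      ultimately have "(\<lambda>n. ((\<integral>x. f (w (n + N)) x \<partial>M) - (\<integral>x. f z x \<partial>M)) / (w (n + N) - z))
          \<longlonglongrightarrow> (\<integral>x. D x \<partial>M)"
        by (simp only: v_def)
      then show ?case by (rule LIMSEQ_offset)
    qed
    then show ?thesis by (auto simp: has_field_derivative_iff)
  qed
  then show ?thesis
    using \<open>open U\<close> by (simp add: holomorphic_on_open field_differentiable_def)
qed

text \<open>The case of counting measure in \<open>holomorphic_on_lebesgue_integral\<close>; the
  majorant has to be uniform only near each point.\<close>

lemma holomorphic_on_suminf:
  fixes f :: "nat \<Rightarrow> complex \<Rightarrow> complex"
  assumes "open U"
    and hol: "\<And>k. f k holomorphic_on U"
    and dom: "\<And>z. z \<in> U \<Longrightarrow> \<exists>r>0. \<exists>M. summable M \<and> (\<forall>s\<in>ball z r \<inter> U. \<forall>k. norm (f k s) \<le> M k)"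
  shows "(\<lambda>s. \<Sum>k. f k s) holomorphic_on U"
    and "\<And>s. s \<in> U \<Longrightarrow> summable (\<lambda>k. norm (f k s))"
proof -
  show sm: "summable (\<lambda>k. norm (f k s))" if s: "s \<in> U" for s
  proof -
    obtain r M where r: "r > 0" "summable M" "\<forall>s\<in>ball s r \<inter> U. \<forall>k. norm (f k s) \<le> M k"
      using dom[OF s] by blast
    then have "norm (norm (f k s)) \<le> M k" for k using s by simp
    then show ?thesis by (rule summable_comparison_test'[OF r(2)])
  qed
  have "(\<lambda>s. \<integral>k. f k s \<partial>count_space UNIV) holomorphic_on U"
  proof (rule holomorphic_on_lebesgue_integral)
    fix z assume z: "z \<in> U"
    obtain r M where "r > 0" and M: "summable M" "\<And>s k. s \<in> ball z r \<inter> U \<Longrightarrow> norm (f k s) \<le> M k"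
      using dom[OF z] by blast
    moreover have "M k \<ge> 0" for k using M(2)[of z k] z \<open>r > 0\<close> norm_ge_zero[of "f k z"] by (meson IntI centre_in_ball order_trans)
    ultimately show "\<exists>r>0. \<exists>g. integrable (count_space UNIV) g \<and>
        (\<forall>s\<in>ball z r \<inter> U. \<forall>k\<in>space (count_space UNIV). norm (f k s) \<le> g k)"
      by (intro exI[of _ r] conjI exI[of _ M]) (auto simp: integrable_count_space_nat_iff)
  qed (use \<open>open U\<close> hol in auto)
  also have "?this \<longleftrightarrow> (\<lambda>s. \<Sum>k. f k s) holomorphic_on U"
    by (intro holomorphic_cong integral_count_space_nat)
      (simp_all add: integrable_count_space_nat_iff sm)
  finally show "(\<lambda>s. \<Sum>k. f k s) holomorphic_on U" .
qed

section \<open>Powers of positive reals and basic Mellin integrals\<close>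

lemma powr_of_pos_real: "x > 0 \<Longrightarrow> complex_of_real x powr s = exp (s * of_real (ln x))"
  by (simp add: powr_def Ln_of_real)

lemma continuous_on_powr_pos [continuous_intros]:
  assumes "A \<subseteq> {0<..}"
  shows "continuous_on A (\<lambda>t. complex_of_real t powr s)"
proof -
  have "continuous_on A (\<lambda>t. exp (s * complex_of_real (ln t)))"
    using assms by (intro continuous_intros) auto
  also have "?this \<longleftrightarrow> ?thesis"
    using assms by (intro continuous_on_cong) (auto simp: powr_of_pos_real)
  finally show ?thesis .
qed

lemma norm_powr_pos: "x > 0 \<Longrightarrow> norm (complex_of_real x powr s) = x powr Re s"
  by (simp add: norm_powr_real_powr)

text \<open>Within distance 1 of z, the modulus of t^s lies below t^(Re z + 1) + t^(Re z - 1); one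
  term serves t >= 1, the other t < 1. Finite moments of all real orders therefore give an entire
  function.\<close>

lemma holomorphic_on_mellin:
  fixes \<phi> :: "real \<Rightarrow> complex"
  assumes cont: "continuous_on {a<..} \<phi>" and a: "a \<ge> 0"
    and int: "\<And>R. set_integrable lborel {a<..} (\<lambda>t. norm (\<phi> t) * t powr R)"
  shows "(\<lambda>s. LBINT t:{a<..}. \<phi> t * of_real t powr s) holomorphic_on UNIV"
proof -
  have "(\<lambda>s. \<integral>t. indicator {a<..} t *\<^sub>R (\<phi> t * of_real t powr s) \<partial>lborel) holomorphic_on UNIV"
  proof (rule holomorphic_on_lebesgue_integral)
    show "(\<lambda>s. indicat_real {a<..} t *\<^sub>R (\<phi> t * complex_of_real t powr s)) holomorphic_on UNIV" for t
      by (cases "t = 0") (auto intro!: holomorphic_intros simp: scaleR_conv_of_real)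
    have "(\<lambda>t. indicat_real {a<..} t *\<^sub>R (\<phi> t * complex_of_real t powr s)) \<in> borel_measurable borel" for s
      using a by (intro borel_measurable_continuous_on_indicator continuous_intros cont) auto
    then show "(\<lambda>t. indicat_real {a<..} t *\<^sub>R (\<phi> t * complex_of_real t powr s)) \<in> borel_measurable lborel" for s
      by simp
    fix z :: complex
    let ?g = "\<lambda>t. indicat_real {a<..} t *\<^sub>R (norm (\<phi> t) * t powr (Re z + 1)) +
        indicat_real {a<..} t *\<^sub>R (norm (\<phi> t) * t powr (Re z - 1))"
    have "integrable lborel ?g"
      using int[of "Re z + 1"] int[of "Re z - 1"] unfolding set_integrable_def
      by (rule Bochner_Integration.integrable_add)
    moreover have "norm (indicat_real {a<..} t *\<^sub>R (\<phi> t * complex_of_real t powr s)) \<le> ?g t"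
      if s: "s \<in> ball z 1" for s t
    proof (cases "t > a")
      case True
      have "\<bar>Re s - Re z\<bar> \<le> norm (s - z)" by (metis abs_Re_le_cmod minus_complex.simps(1))
      then have "\<bar>Re s - Re z\<bar> \<le> 1" using s by (auto simp: dist_norm norm_minus_commute)
      then have "t powr Re s \<le> t powr (Re z + 1) + t powr (Re z - 1)"
      proof (cases "t \<ge> 1")
        case True
        have "t powr Re s \<le> t powr (Re z + 1)"
          using True \<open>\<bar>Re s - Re z\<bar> \<le> 1\<close> by (intro powr_mono) auto
        then show ?thesis by (smt (verit) powr_ge_zero)
      next
        case False
        have "t powr Re s \<le> t powr (Re z - 1)"
          using False \<open>t > a\<close> a \<open>\<bar>Re s - Re z\<bar> \<le> 1\<close> by (intro powr_mono') auto
        then show ?thesis by (smt (verit) powr_ge_zero)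
      qed
      then have "norm (\<phi> t) * t powr Re s \<le> norm (\<phi> t) * (t powr (Re z + 1) + t powr (Re z - 1))"
        by (intro mult_left_mono) auto
      then show ?thesis using True a by (simp add: norm_mult norm_powr_pos distrib_left)
    qed simp
    ultimately show "\<exists>r>0. \<exists>g. integrable lborel g \<and> (\<forall>s\<in>ball z r \<inter> UNIV. \<forall>x\<in>space lborel.
        norm (indicat_real {a<..} x *\<^sub>R (\<phi> x * complex_of_real x powr s)) \<le> g x)"
      by (intro exI[of _ 1] conjI exI[of _ ?g]) auto
  qed auto
  then show ?thesis by (simp add: set_lebesgue_integral_def)
qed

lemma set_integral_scale_Ioi:
  fixes f :: "real \<Rightarrow> complex"
  assumes c: "c > 0"
  shows "(LBINT t:{0<..}. f t) = of_real c * (LBINT t:{0<..}. f (c * t))"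
    and "set_integrable lborel {0<..} (\<lambda>t. f (c * t)) \<longleftrightarrow> set_integrable lborel {0<..} f"
proof -
  have ind: "indicat_real {0<..} (c * t) = indicat_real {0<..} t" for t
    using c by (simp add: indicator_def zero_less_mult_iff)
  have "(LBINT t. indicat_real {0<..} t *\<^sub>R f t) =
      \<bar>c\<bar> *\<^sub>R (LBINT t. indicat_real {0<..} (0 + c * t) *\<^sub>R f (0 + c * t))"
    by (rule lborel_integral_real_affine) (use c in simp)
  then show "(LBINT t:{0<..}. f t) = of_real c * (LBINT t:{0<..}. f (c * t))"
    using c by (simp add: set_lebesgue_integral_def ind scaleR_conv_of_real)
  have "integrable lborel (\<lambda>t. indicat_real {0<..} (0 + c * t) *\<^sub>R f (0 + c * t)) \<longleftrightarrow>
      integrable lborel (\<lambda>t. indicat_real {0<..} t *\<^sub>R f t)"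
    by (rule lborel_integrable_real_affine_iff) (use c in simp)
  then show "set_integrable lborel {0<..} (\<lambda>t. f (c * t)) \<longleftrightarrow> set_integrable lborel {0<..} f"
    by (simp add: set_integrable_def ind)
qed

lemma gamma_integral_lborel:
  fixes a :: real
  assumes a: "a > 0" and u: "Re u > 0"
  shows "set_integrable lborel {0<..} (\<lambda>t. of_real t powr (u - 1) * of_real (exp (- a * t)))" (is ?th1)
    and "(LBINT t:{0<..}. of_real t powr (u - 1) * of_real (exp (- a * t))) = Gamma u * of_real a powr (- u)"
proof -
  let ?f = "\<lambda>t. complex_of_real t powr (u - 1) / of_real (exp t)"
  have m: "(\<lambda>t. indicat_real {0<..} t *\<^sub>R ?f t) \<in> borel_measurable borel"
    by (intro borel_measurable_continuous_on_indicator continuous_intros) auto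
  have int: "set_integrable lborel {0<..} ?f"
    using absolutely_integrable_Gamma_integral'[OF u] m
    by (simp add: set_integrable_def integrable_completion)
  have val: "(LBINT t:{0<..}. ?f t) = Gamma u"
    using set_borel_integral_eq_integral(2)[OF int] Gamma_integral_complex'[OF u]
    by (simp add: integral_unique)
  have eq: "?f (a * t) = of_real a powr (u - 1) * (of_real t powr (u - 1) * of_real (exp (- a * t)))"
    if "t > 0" for t
    using a that by (simp add: powr_times_real exp_minus field_simps)
  have "set_integrable lborel {0<..} (\<lambda>t. ?f (a * t))"
    using set_integral_scale_Ioi(2)[OF a, of ?f] int by simp
  also have "?this \<longleftrightarrow> set_integrable lborel {0<..}
      (\<lambda>t. of_real a powr (u - 1) * (of_real t powr (u - 1) * of_real (exp (- a * t))))"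
    by (rule set_integrable_cong) (use eq in auto)
  finally show ?th1 using a by (subst (asm) set_integrable_mult_right_iff) auto
  have "Gamma u = of_real a * (LBINT t:{0<..}. ?f (a * t))"
    using set_integral_scale_Ioi(1)[OF a, of ?f] val by simp
  also have "(LBINT t:{0<..}. ?f (a * t)) = (LBINT t:{0<..}.
      of_real a powr (u - 1) * (of_real t powr (u - 1) * of_real (exp (- a * t))))"
    using eq by (intro set_lebesgue_integral_cong) auto
  also have "\<dots> = of_real a powr (u - 1) * (LBINT t:{0<..}. of_real t powr (u - 1) * of_real (exp (- a * t)))"
    by simp
  also have "of_real a * (of_real a powr (u - 1) * (LBINT t:{0<..}. of_real t powr (u - 1) * of_real (exp (- a * t)))) =
      of_real a powr u * (LBINT t:{0<..}. of_real t powr (u - 1) * of_real (exp (- a * t)))"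
    using a by (simp add: powr_diff)
  finally show "(LBINT t:{0<..}. of_real t powr (u - 1) * of_real (exp (- a * t))) = Gamma u * of_real a powr (- u)"
    using a by (simp add: powr_minus field_simps)
qed

lemma gamma_integral_lborel_real:
  fixes a p :: real
  assumes a: "a > 0" and p: "p > 0"
  shows "set_integrable lborel {0<..} (\<lambda>t. t powr (p - 1) * exp (- a * t))"
    and "(LBINT t:{0<..}. t powr (p - 1) * exp (- a * t)) = Gamma p * a powr (- p)"
proof -
  let ?f = "\<lambda>t. complex_of_real t powr (of_real p - 1) * of_real (exp (- a * t))"
  have eq: "indicat_real {0<..} t *\<^sub>R ?f t =
      of_real (indicat_real {0<..} t *\<^sub>R (t powr (p - 1) * exp (- a * t)))" for t
  proof -
    have "complex_of_real p - 1 = of_real (p - 1)" by simp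
    then show ?thesis
      by (cases "t > 0") (simp_all add: powr_of_real del: of_real_diff)
  qed
  have "Re (of_real p) > 0" using p by simp
  note g = gamma_integral_lborel[OF a this]
  show "set_integrable lborel {0<..} (\<lambda>t. t powr (p - 1) * exp (- a * t))"
    using g(1) unfolding set_integrable_def eq complex_of_real_integrable_eq .
  have "complex_of_real (LBINT t:{0<..}. t powr (p - 1) * exp (- a * t)) =
      of_real (Gamma p * a powr (- p))"
    using g(2) p a unfolding set_lebesgue_integral_def eq integral_complex_of_real
    by (simp add: Gamma_complex_of_real powr_of_real flip: of_real_minus)
  then show "(LBINT t:{0<..}. t powr (p - 1) * exp (- a * t)) = Gamma p * a powr (- p)"
    by (simp only: of_real_eq_iff)
qed

lemma set_integral_split_at_1:
  fixes f :: "real \<Rightarrow> complex"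
  assumes "set_integrable lborel {0<..} f"
  shows "(LBINT t:{0<..}. f t) = (LBINT t:{0<..<1}. f t) + (LBINT t:{1<..}. f t)"
proof -
  have i: "set_integrable lborel {0<..<1} f" "set_integrable lborel {1<..} f"
    "set_integrable lborel ({0<..<1} \<union> {1<..}) f"
    by (rule set_integrable_subset[OF assms]; auto)+
  have ae: "AE x in lborel. x \<in> {0<..} \<longleftrightarrow> (x::real) \<in> {0<..<1} \<union> {1<..}"
    using AE_lborel_singleton[of "1::real"] by eventually_elim auto
  have "(LBINT t:{0<..}. f t) = (LBINT t:{0<..<1} \<union> {1<..}. f t)"
    by (rule set_integral_cong_set[symmetric, OF
        borel_measurable_integrable[OF assms[unfolded set_integrable_def], folded set_borel_measurable_def]
        borel_measurable_integrable[OF i(3)[unfolded set_integrable_def], folded set_borel_measurable_def] ae])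
  also have "\<dots> = (LBINT t:{0<..<1}. f t) + (LBINT t:{1<..}. f t)"
    by (rule set_integral_Un) (use i in auto)
  finally show ?thesis .
qed

lemma powr_complex_has_real_derivative:
  assumes "t > 0"
  shows "((\<lambda>t. complex_of_real t powr s) has_vector_derivative s * of_real t powr (s - 1)) (at t)"
  by (rule has_vector_derivative_real_field) (use assms in \<open>auto intro!: derivative_eq_intros\<close>)

lemma isCont_powr_pos: "t > 0 \<Longrightarrow> isCont (\<lambda>t. complex_of_real t powr s) t"
  using continuous_on_powr_pos[of "{0<..}" s] by (auto simp: continuous_on_eq_continuous_at)

lemma integral_powr_0_1:
  assumes a: "Re a > -1"
  shows "set_integrable lborel {0<..<1} (\<lambda>t. complex_of_real t powr a)"
    and "(LBINT t:{0<..<1}. complex_of_real t powr a) = 1 / (a + 1)"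
proof -
  have "((\<lambda>t. t powr Re a) has_integral (1 powr (Re a + 1) / (Re a + 1))) {0..1}"
    by (rule has_integral_powr_from_0) (use a in auto)
  then have "(\<lambda>t. t powr Re a) absolutely_integrable_on {0..1}"
    by (intro nonnegative_absolutely_integrable_1) (auto simp: integrable_on_def)
  then have "set_integrable lborel {0..1} (\<lambda>t. t powr Re a)"
    by (simp add: set_integrable_def integrable_completion)
  then have r: "set_integrable lborel {0<..<1} (\<lambda>t. t powr Re a)"
    by (rule set_integrable_subset) auto
  have m: "(\<lambda>t. indicat_real {0<..<1} t *\<^sub>R (complex_of_real t powr a)) \<in> borel_measurable borel"
    by (intro borel_measurable_continuous_on_indicator continuous_intros) auto
  show int: "set_integrable lborel {0<..<1} (\<lambda>t. complex_of_real t powr a)"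
    using r unfolding set_integrable_def
    by (rule Bochner_Integration.integrable_bound)
      (use m in \<open>auto simp: indicator_def norm_powr_pos\<close>)
  have a1: "a + 1 \<noteq> 0" using a by (auto simp: complex_eq_iff)
  have lim0: "((\<lambda>t. complex_of_real t powr (a + 1) / (a + 1)) \<longlongrightarrow> 0) (at_right 0)"
  proof -
    have "((\<lambda>t. t powr (Re a + 1)) \<longlongrightarrow> 0 powr (Re a + 1)) (at_right 0)"
      using a by (intro tendsto_powr2 tendsto_const tendsto_ident_at eventually_at_right_less[THEN eventually_mono]) auto
    then have "((\<lambda>t. t powr (Re a + 1)) \<longlongrightarrow> 0) (at_right 0)" by simp
    moreover have "\<forall>\<^sub>F t in at_right 0. t powr (Re a + 1) = norm (complex_of_real t powr (a + 1))"
      by (auto simp: eventually_at_filter norm_powr_pos)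
    ultimately have "((\<lambda>t. norm (complex_of_real t powr (a + 1))) \<longlongrightarrow> 0) (at_right 0)"
      by (rule Lim_transform_eventually)
    then show ?thesis by (intro tendsto_divide_zero) (rule tendsto_norm_zero_cancel)
  qed
  have lim1: "((\<lambda>t. complex_of_real t powr (a + 1) / (a + 1)) \<longlongrightarrow> 1 / (a + 1)) (at_left 1)"
  proof -
    have "isCont (\<lambda>t. complex_of_real t powr (a + 1) / (a + 1)) 1"
      using a1 by (intro continuous_intros isCont_powr_pos) auto
    then have "((\<lambda>t. complex_of_real t powr (a + 1) / (a + 1)) \<longlongrightarrow> 1 / (a + 1)) (at 1)"
      by (simp add: isCont_def)
    then show ?thesis by (rule tendsto_mono[rotated]) (simp add: at_le)
  qed
  have "(LBINT t=ereal 0..ereal 1. complex_of_real t powr a) = 1 / (a + 1) - 0"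
  proof (rule interval_integral_FTC_integrable[where F = "\<lambda>t. complex_of_real t powr (a + 1) / (a + 1)"])
    fix t :: real assume "ereal 0 < ereal t"
    then have t: "t > 0" by simp
    have "((\<lambda>t. complex_of_real t powr (a + 1) / (a + 1)) has_vector_derivative
        ((a + 1) * of_real t powr (a + 1 - 1)) / (a + 1)) (at t)"
      by (rule has_vector_derivative_divide[OF powr_complex_has_real_derivative[OF t]])
    then show "((\<lambda>t. complex_of_real t powr (a + 1) / (a + 1)) has_vector_derivative
        of_real t powr a) (at t)" using a1 by simp
    show "isCont (\<lambda>t. complex_of_real t powr a) t" by (rule isCont_powr_pos[OF t])
  qed (use int lim0 lim1 in \<open>auto simp: ereal_tendsto_simps\<close>)
  then show "(LBINT t:{0<..<1}. complex_of_real t powr a) = 1 / (a + 1)"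
    by (simp add: interval_integral_Ioo)
qed

text \<open>The substitution rule asks for a nonnegative derivative, and 1/t decreases. So t is
  first replaced by -t, and the rule is applied to -1/t on (-1, 0).\<close>

lemma set_integral_inversion:
  fixes f :: "real \<Rightarrow> complex"
  assumes cont: "continuous_on {0<..} f"
    and int1: "set_integrable lborel {1<..} f"
    and int2: "set_integrable lborel {0<..<1} (\<lambda>t. (1 / t\<^sup>2) *\<^sub>R f (1 / t))"
  shows "(LBINT t:{1<..}. f t) = (LBINT t:{0<..<1}. (1 / t\<^sup>2) *\<^sub>R f (1 / t))"
proof -
  let ?h = "\<lambda>t. (1 / t\<^sup>2) *\<^sub>R f (1 / t)"
  have ind: "indicat_real {0<..<1} (- t) = indicat_real {-1<..<0} t" for t :: real
    by (auto simp: indicator_def)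
  have "integrable lborel (\<lambda>t. indicat_real {0<..<1} (0 + (-1) * t) *\<^sub>R ?h (0 + (-1) * t))"
    by (rule lborel_integrable_real_affine) (use int2 in \<open>auto simp: set_integrable_def\<close>)
  then have int3: "set_integrable lborel {-1<..<0} (\<lambda>t. (1 / t\<^sup>2) *\<^sub>R f (- (1 / t)))"
    by (simp add: set_integrable_def ind)
  have "(LBINT t. indicat_real {0<..<1} t *\<^sub>R ?h t) =
      \<bar>-1\<bar> *\<^sub>R (LBINT t. indicat_real {0<..<1} (0 + (-1) * t) *\<^sub>R ?h (0 + (-1) * t))"
    by (rule lborel_integral_real_affine) simp
  then have eq: "(LBINT t:{0<..<1}. ?h t) = (LBINT t:{-1<..<0}. (1 / t\<^sup>2) *\<^sub>R f (- (1 / t)))"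
    by (simp add: set_lebesgue_integral_def ind)
  have "(LBINT t=ereal 1..\<infinity>. f t) = (LBINT t=ereal (-1)..ereal 0. (1 / t\<^sup>2) *\<^sub>R f (- (1 / t)))"
  proof (rule interval_integral_substitution_integrable)
    fix x assume "ereal (-1) < ereal x" "ereal x < ereal 0"
    then have x: "x < 0" by simp
    show "((\<lambda>t. - (1 / t)) has_real_derivative 1 / x\<^sup>2) (at x)"
      using x by (auto intro!: derivative_eq_intros simp: power2_eq_square)
    have "- (1 / x) > 0" using x by simp
    then show "isCont f (- (1 / x))" using cont by (auto simp: continuous_on_eq_continuous_at)
    show "isCont (\<lambda>t. 1 / t\<^sup>2) x" using x by (auto intro!: continuous_intros)
  next
    have "((\<lambda>t::real. - (1 / t)) \<longlongrightarrow> 1) (at_right (-1))"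
      by (auto intro!: tendsto_eq_intros)
    then show "((ereal \<circ> (\<lambda>t. - (1 / t)) \<circ> real_of_ereal) \<longlongrightarrow> ereal 1) (at_right (ereal (-1)))"
      by (simp add: ereal_tendsto_simps)
    have "filterlim (\<lambda>t::real. - (1 / t)) at_top (at_left 0)"
      by real_asymp
    then show "((ereal \<circ> (\<lambda>t. - (1 / t)) \<circ> real_of_ereal) \<longlongrightarrow> \<infinity>) (at_left (ereal 0))"
      by (simp add: ereal_tendsto_simps)
    show "set_integrable lborel (einterval (ereal (-1)) (ereal 0)) (\<lambda>t. (1 / t\<^sup>2) *\<^sub>R f (- (1 / t)))"
      using int3 by simp
    have "einterval (ereal 1) \<infinity> = {1<..}" by (auto simp: einterval_def)
    then show "set_integrable lborel (einterval (ereal 1) \<infinity>) f" using int1 by simp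
  qed auto
  moreover have "(LBINT t=ereal 1..\<infinity>. f t) = (LBINT t:{1<..}. f t)"
  proof -
    have "einterval (ereal 1) \<infinity> = {1<..}" by (auto simp: einterval_def)
    then show ?thesis by (simp add: interval_lebesgue_integral_def)
  qed
  ultimately show ?thesis by (simp add: eq interval_integral_Ioo)
qed

section \<open>Riemann's theta integral for the completed zeta function\<close>

definition psi :: "real \<Rightarrow> real" where
  "psi t = (\<Sum>m. exp (- (pi * (real (Suc m))\<^sup>2) * t))"

lemma summable_psi:
  assumes "t > 0"
  shows "summable (\<lambda>m. exp (- (pi * (real (Suc m))\<^sup>2) * t))"
  using summable_exp_square[of "1 / t"] assms by (simp add: mult.assoc)

lemma has_sum_even_int:
  fixes f :: "int \<Rightarrow> real"
  assumes even: "\<And>d. f (- d) = f d" and sums: "(\<lambda>n. f (int (Suc n))) sums S"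
    and nonneg: "\<And>d. f d \<ge> 0"
  shows "(f has_sum (f 0 + 2 * S)) UNIV"
proof -
  have hs: "((\<lambda>n. f (int (Suc n))) has_sum S) UNIV"
    by (rule sums_nonneg_imp_has_sum[OF sums nonneg])
  have 1: "(f has_sum S) (range (\<lambda>n. int (Suc n)))"
    by (subst has_sum_reindex) (use hs in \<open>auto simp: inj_def o_def\<close>)
  have 2: "(f has_sum S) (range (\<lambda>n. - int (Suc n)))"
    by (subst has_sum_reindex) (use hs in \<open>auto simp: inj_def o_def even simp del: of_nat_Suc\<close>)
  have 0: "(f has_sum f 0) {0}" by (simp add: has_sum_finite_iff)
  have "(f has_sum ((f 0 + S) + S)) (({0} \<union> range (\<lambda>n. int (Suc n))) \<union> range (\<lambda>n. - int (Suc n)))"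
    by (intro has_sum_Un_disjoint 0 1 2) auto
  also have "({0} \<union> range (\<lambda>n. int (Suc n))) \<union> range (\<lambda>n. - int (Suc n)) = UNIV"
  proof safe
    fix d :: int assume "d \<notin> range (\<lambda>n. - int (Suc n))" "d \<notin> range (\<lambda>n. int (Suc n))" "d \<notin> {}"
    then show "d = 0"
      by (cases d rule: int_cases3) (metis Suc_pred' rangeI)+
  qed auto
  finally show ?thesis by (simp add: add.commute)
qed

text \<open>The theta transformation at x = 0, where the sum over all integers is 1 + 2
  \<open>psi\<close>.\<close>

lemma psi_functional_equation:
  assumes t: "t > 0"
  shows "psi t = psi (1 / t) / sqrt t + (1 / sqrt t - 1) / 2"
proof -
  have "((\<lambda>d::int. exp (- pi * t * (0 + of_int d)\<^sup>2)) has_sum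
      (exp (- pi * t * (0 + of_int 0)\<^sup>2) + 2 * psi t)) UNIV"
  proof (rule has_sum_even_int)
    have "(\<lambda>n. exp (- (pi * (real (Suc n))\<^sup>2) * t)) sums psi t"
      unfolding psi_def by (rule summable_sums[OF summable_psi[OF t]])
    then show "(\<lambda>n. exp (- pi * t * (0 + real_of_int (int (Suc n)))\<^sup>2)) sums psi t"
      by (simp add: mult_ac)
  qed auto
  then have "1 + 2 * psi t = dual_theta t 0"
    using theta_transformation[OF t, of 0] has_sum_unique by fastforce
  also have "dual_theta t 0 = (1 + 2 * psi (1 / t)) / sqrt t"
    by (simp add: dual_theta_def psi_def)
  finally have "psi t = ((1 + 2 * psi (1 / t)) / sqrt t - 1) / 2" by simp
  then show ?thesis by (simp add: add_divide_distrib diff_divide_distrib)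
qed

lemma psi_term_le:
  assumes "t \<ge> a" "a > 0"
  shows "exp (- (pi * (real (Suc m))\<^sup>2) * t) \<le> exp (- pi * a) ^ Suc m"
proof -
  have "exp (- (pi * (real (Suc m))\<^sup>2) * t) \<le> exp (- pi * (real (Suc m))\<^sup>2 / (1 / a))"
    using assms by (simp add: mult_left_mono)
  also have "\<dots> \<le> exp (- pi / (1 / a)) ^ Suc m"
    by (rule exp_square_le) (use assms in simp)
  finally show ?thesis by simp
qed

lemma continuous_on_psi: "continuous_on {0<..} psi"
proof -
  \<comment> \<open>The series converges uniformly only away from 0; continuity at t is taken from
    the half-line beyond t/2.\<close>
  have "continuous_on {a<..} psi" if a: "a > 0" for a
  proof -
    have "uniform_limit {a<..} (\<lambda>n t. \<Sum>m<n. exp (- (pi * (real (Suc m))\<^sup>2) * t)) psi sequentially"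
      unfolding psi_def
    proof (rule Weierstrass_m_test[where M = "\<lambda>m. exp (- pi * a) ^ Suc m"])
      show "norm (exp (- (pi * (real (Suc m))\<^sup>2) * t)) \<le> exp (- pi * a) ^ Suc m" if "t \<in> {a<..}" for m t
        using psi_term_le[of a t m] that a by simp
      show "summable (\<lambda>m. exp (- pi * a) ^ Suc m)"
        using a by (subst summable_Suc_iff) (auto intro!: summable_geometric)
    qed
    then show ?thesis
      by (rule uniform_limit_theorem[rotated]) (auto intro!: always_eventually continuous_intros)
  qed
  from this[of "t / 2" for t] show ?thesis
    by (auto simp: continuous_on_eq_continuous_at)
qed

lemma psi_nonneg: "t > 0 \<Longrightarrow> psi t \<ge> 0"
  unfolding psi_def by (intro suminf_nonneg summable_psi) auto

lemma psi_le:
  assumes t: "t \<ge> 1"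
  shows "psi t \<le> 2 * exp (- pi * t)"
proof -
  have "1 + pi * t \<le> exp (pi * t)" by (rule exp_ge_add_one_self)
  moreover have "pi * t \<ge> 1" using t pi_ge_two mult_mono[of 2 pi 1 t] by simp
  ultimately have "exp (pi * t) \<ge> 2" by linarith
  \<comment> \<open>The ratio of the dominating geometric series is at most 1/2, which accounts for
    the factor 2.\<close>
  then have q: "exp (- pi * t) \<le> 1 / 2" by (simp add: exp_minus field_simps)
  have sm: "summable (\<lambda>m. exp (- pi * t) ^ Suc m)"
    using t by (subst summable_Suc_iff) (auto intro!: summable_geometric)
  have "psi t \<le> (\<Sum>m. exp (- pi * t) ^ Suc m)"
    unfolding psi_def using t by (intro suminf_le psi_term_le summable_psi sm) auto
  also have "\<dots> = exp (- pi * t) * (1 / (1 - exp (- pi * t)))"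
    using t by (simp add: suminf_mult suminf_geometric summable_geometric)
  also have "\<dots> \<le> exp (- pi * t) * 2"
    using q frac_le[of 1 1 "1/2" "1 - exp (- pi * t)"] by (intro mult_left_mono) auto
  finally show ?thesis by simp
qed

text \<open>The lower limit 1 avoids the singularity of \<open>psi\<close> at 0, and the exponential
  decay makes the integral entire in s.\<close>

definition psi_mellin :: "complex \<Rightarrow> complex" where
  "psi_mellin s = (LBINT t:{1<..}. of_real (psi t) * of_real t powr s)"

lemma set_integrable_psi_powr:
  "set_integrable lborel {1<..} (\<lambda>t. norm (complex_of_real (psi t)) * t powr R)"
proof -
  have "set_integrable lborel {0<..} (\<lambda>t. t powr ((\<bar>R\<bar> + 1) - 1) * exp (- pi * t))"
    by (rule gamma_integral_lborel_real(1)) auto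
  then have "set_integrable lborel {1<..} (\<lambda>t. t powr ((\<bar>R\<bar> + 1) - 1) * exp (- pi * t))"
    by (rule set_integrable_subset) auto
  then have "set_integrable lborel {1<..} (\<lambda>t. 2 * (t powr \<bar>R\<bar> * exp (- pi * t)))"
    by (intro set_integrable_mult_right) simp
  then show ?thesis
    unfolding set_integrable_def
  proof (rule Bochner_Integration.integrable_bound)
    have "continuous_on {1<..} psi" by (rule continuous_on_subset[OF continuous_on_psi]) auto
    then have "(\<lambda>t. indicat_real {1<..} t *\<^sub>R (norm (complex_of_real (psi t)) * t powr R)) \<in> borel_measurable borel"
      by (intro borel_measurable_continuous_on_indicator continuous_intros) auto
    then show "(\<lambda>t. indicat_real {1<..} t *\<^sub>R (norm (complex_of_real (psi t)) * t powr R)) \<in> borel_measurable lborel"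
      by simp
    have "psi t * t powr R \<le> (2 * exp (- pi * t)) * t powr \<bar>R\<bar>" if "t > 1" for t
      using that by (intro mult_mono psi_le powr_mono psi_nonneg) auto
    then show "AE t in lborel. norm (indicat_real {1<..} t *\<^sub>R (norm (complex_of_real (psi t)) * t powr R))
        \<le> norm (indicat_real {1<..} t *\<^sub>R (2 * (t powr \<bar>R\<bar> * exp (- pi * t))))"
      by (intro AE_I2) (auto simp: indicator_def psi_nonneg mult_ac)
  qed
qed

lemma set_integrable_psi_powr_complex:
  "set_integrable lborel {1<..} (\<lambda>t. complex_of_real (psi t) * of_real t powr s)"
  using set_integrable_psi_powr[of "Re s"] unfolding set_integrable_def
proof (rule Bochner_Integration.integrable_bound)
  have "continuous_on {1<..} psi" by (rule continuous_on_subset[OF continuous_on_psi]) auto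
  then have "(\<lambda>t. indicat_real {1<..} t *\<^sub>R (complex_of_real (psi t) * of_real t powr s)) \<in> borel_measurable borel"
    by (intro borel_measurable_continuous_on_indicator continuous_intros) auto
  then show "(\<lambda>t. indicat_real {1<..} t *\<^sub>R (complex_of_real (psi t) * of_real t powr s)) \<in> borel_measurable lborel"
    by simp
qed (auto simp: indicator_def norm_mult norm_powr_pos)

lemma psi_mellin_entire: "psi_mellin holomorphic_on UNIV"
  unfolding psi_mellin_def[abs_def]
proof (rule holomorphic_on_mellin)
  have "continuous_on {1<..} psi" by (rule continuous_on_subset[OF continuous_on_psi]) auto
  then show "continuous_on {1<..} (\<lambda>t. complex_of_real (psi t))" by (intro continuous_intros)
qed (use set_integrable_psi_powr in auto)

lemma summable_dirichlet:
  assumes "Re s > 1"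
  shows "summable (\<lambda>k. norm (1 / of_nat (Suc k) powr s))"
proof -
  have "summable (\<lambda>k. real (Suc k) powr (- Re s))"
    by (subst summable_Suc_iff[of "\<lambda>k. real k powr (- Re s)"]) (use assms in \<open>simp add: summable_real_powr_iff\<close>)
  also have "(\<lambda>k. real (Suc k) powr (- Re s)) = (\<lambda>k. norm (1 / of_nat (Suc k) powr s))"
    by (simp add: norm_divide norm_powr_real_powr powr_minus field_simps)
  finally show ?thesis .
qed

text \<open>The term exp(-pi m^2 t) has Mellin transform Gamma(u) (pi m^2)^(-u), and for Re u > 1/2
  absolute convergence justifies termwise integration.\<close>

lemma mellin_psi:
  assumes u: "Re u > 1/2"
  shows "set_integrable lborel {0<..} (\<lambda>t. of_real (psi t) * of_real t powr (u - 1))"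
    and "(LBINT t:{0<..}. of_real (psi t) * of_real t powr (u - 1)) =
      of_real pi powr (- u) * Gamma u * (\<Sum>k. 1 / of_nat (Suc k) powr (2 * u))"
proof -
  define a where "a = (\<lambda>m. pi * (real (Suc m))\<^sup>2)"
  have a: "a m > 0" for m by (simp add: a_def)
  define f where "f = (\<lambda>m t. indicat_real {0<..} t *\<^sub>R
      (complex_of_real t powr (u - 1) * of_real (exp (- a m * t))))"
  have u0: "Re u > 0" using u by simp
  note g = gamma_integral_lborel[OF a u0]
  have fi: "integrable lborel (f m)" for m
    using g(1)[of m] by (simp add: set_integrable_def f_def)
  have fval: "integral\<^sup>L lborel (f m) = of_real pi powr (- u) * Gamma u * (1 / of_nat (Suc m) powr (2 * u))" for m
  proof -
    have "integral\<^sup>L lborel (f m) = Gamma u * of_real (a m) powr (- u)"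
      using g(2)[of m] by (simp add: set_lebesgue_integral_def f_def)
    also have "of_real (a m) powr (- u) = of_real pi powr (- u) * (1 / of_nat (Suc m) powr (2 * u))"
    proof -
      have "of_real (a m) powr (- u) = exp (- u * of_real (ln (a m)))"
        using a by (simp add: powr_of_pos_real)
      also have "ln (a m) = ln pi + 2 * ln (real (Suc m))"
        by (simp add: a_def ln_mult ln_realpow)
      also have "exp (- u * of_real (ln pi + 2 * ln (real (Suc m)))) =
          exp (- u * of_real (ln pi)) * (1 / exp (2 * u * of_real (ln (real (Suc m)))))"
        by (simp add: algebra_simps exp_add exp_diff exp_minus field_simps)
      also have "\<dots> = of_real pi powr (- u) * (1 / of_real (real (Suc m)) powr (2 * u))"
        by (subst (1 2) powr_of_pos_real) auto
      finally show ?thesis by simp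
    qed
    finally show ?thesis by simp
  qed
  have nval: "(LBINT t. norm (f m t)) = Gamma (Re u) * pi powr (- Re u) * real (Suc m) powr (- (2 * Re u))" for m
  proof -
    have "(LBINT t. norm (f m t)) = (LBINT t:{0<..}. t powr (Re u - 1) * exp (- a m * t))"
      unfolding set_lebesgue_integral_def
      by (intro Bochner_Integration.integral_cong) (auto simp: f_def indicator_def norm_mult norm_powr_pos)
    also have "\<dots> = Gamma (Re u) * a m powr (- Re u)"
      by (rule gamma_integral_lborel_real(2)[OF a u0])
    also have "a m powr (- Re u) = pi powr (- Re u) * real (Suc m) powr (- (2 * Re u))"
    proof -
      have "a m = pi * real (Suc m) powr 2" by (simp add: a_def powr_numeral)
      then show ?thesis by (simp only: powr_mult powr_powr) simp
    qed
    finally show ?thesis by simp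
  qed
  have sm: "summable (\<lambda>m. LBINT t. norm (f m t))"
    unfolding nval
    by (intro summable_mult, subst summable_Suc_iff[of "\<lambda>k. real k powr (- (2 * Re u))"])
      (use u in \<open>simp add: summable_real_powr_iff\<close>)
  have ae: "AE t in lborel. summable (\<lambda>m. norm (f m t))"
  proof (rule AE_I2)
    fix t :: real
    show "summable (\<lambda>m. norm (f m t))"
    proof (cases "t > 0")
      case True
      have "summable (\<lambda>m. t powr (Re u - 1) * exp (- (pi * (real (Suc m))\<^sup>2) * t))"
        by (intro summable_mult summable_psi True)
      then show ?thesis using True by (simp add: f_def norm_mult norm_powr_pos a_def)
    qed (simp add: f_def)
  qed
  have eq: "(\<Sum>m. f m t) = indicat_real {0<..} t *\<^sub>R (of_real (psi t) * of_real t powr (u - 1))" for t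
  proof (cases "t > 0")
    case True
    have "(\<Sum>m. complex_of_real t powr (u - 1) * of_real (exp (- a m * t))) =
        complex_of_real t powr (u - 1) * (\<Sum>m. of_real (exp (- a m * t)))"
      using summable_psi[OF True] by (intro suminf_mult summable_of_real) (simp add: a_def)
    also have "(\<Sum>m. complex_of_real (exp (- a m * t))) = of_real (psi t)"
      unfolding psi_def a_def by (rule suminf_of_real[symmetric, OF summable_psi[OF True]])
    finally show ?thesis using True by (simp add: f_def)
  qed (simp add: f_def)
  show "set_integrable lborel {0<..} (\<lambda>t. of_real (psi t) * of_real t powr (u - 1))"
    using integrable_suminf[OF fi ae sm] unfolding eq set_integrable_def .
  have "(LBINT t:{0<..}. of_real (psi t) * of_real t powr (u - 1)) = (\<Sum>m. integral\<^sup>L lborel (f m))"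
    using integral_suminf[OF fi ae sm] unfolding eq set_lebesgue_integral_def .
  also have "\<dots> = of_real pi powr (- u) * Gamma u * (\<Sum>k. 1 / of_nat (Suc k) powr (2 * u))"
    unfolding fval using summable_dirichlet[of "2 * u"] u
    by (intro suminf_mult) (auto dest: summable_norm_cancel)
  finally show "(LBINT t:{0<..}. of_real (psi t) * of_real t powr (u - 1)) =
      of_real pi powr (- u) * Gamma u * (\<Sum>k. 1 / of_nat (Suc k) powr (2 * u))" .
qed

text \<open>Riemann's argument: the part of the integral over (0, 1) is carried beyond 1 by t -> 1/t
  and the functional equation of \<open>psi\<close>, whose elementary terms integrate to the two
  fractions. The right-hand side is invariant under u -> 1/2 - u.\<close>

lemma completed_zeta_eq:
  assumes u: "Re u > 1/2"
  shows "of_real pi powr (- u) * Gamma u * (\<Sum>k. 1 / of_nat (Suc k) powr (2 * u)) =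
    psi_mellin (u - 1) + psi_mellin (- u - 1/2) + 1 / (2 * u - 1) - 1 / (2 * u)"
proof -
  let ?p = "\<lambda>s t. complex_of_real t powr s"
  let ?f = "\<lambda>t. complex_of_real (psi t) * ?p (- u - 1/2) t"
  let ?g = "\<lambda>t. complex_of_real (psi t) * ?p (u - 1) t"
  have inv: "(1 / t\<^sup>2) *\<^sub>R ?f (1 / t) = ?g t - (?p (u - 3/2) t - ?p (u - 1) t) / 2"
    if t: "t \<in> {0<..<1}" for t
  proof -
    have t0: "t > 0" using t by simp
    have e: "(1 / t\<^sup>2) *\<^sub>R ?p (- u - 1/2) (1 / t) = ?p (u - 3/2) t"
    proof -
      have "complex_of_real (1 / t\<^sup>2) = exp (- 2 * of_real (ln t))"
        using t0 by (simp add: exp_minus exp_double exp_of_real power2_eq_square field_simps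
            flip: of_real_mult)
      moreover have "?p (- u - 1/2) (1 / t) = exp ((- u - 1/2) * of_real (ln (1 / t)))"
        by (rule powr_of_pos_real) (use t0 in simp)
      ultimately show ?thesis using t0
        by (simp only: scaleR_conv_of_real exp_add[symmetric] powr_of_pos_real[OF t0])
          (simp add: ln_div algebra_simps)
    qed
    have h: "?p (u - 3/2) t = ?p (u - 1) t / of_real (sqrt t)"
    proof -
      have "complex_of_real (sqrt t) = ?p (1/2) t"
        using t0 by (simp add: powr_half_sqrt[symmetric] powr_of_pos_real powr_def Ln_of_real flip: exp_of_real)
      moreover have "u - 3/2 = (u - 1) - 1/2" by simp
      ultimately show ?thesis by (simp only: powr_diff) 
    qed
    have "(1 / t\<^sup>2) *\<^sub>R ?f (1 / t) = of_real (psi (1 / t)) * ?p (u - 3/2) t"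
      unfolding e[symmetric] by (simp add: scaleR_conv_of_real mult_ac)
    also have "\<dots> = of_real (psi (1 / t) / sqrt t) * ?p (u - 1) t" by (simp add: h)
    also have "psi (1 / t) / sqrt t = psi t - (1 / sqrt t - 1) / 2"
      using psi_functional_equation[OF t0] by simp
    also have "of_real (psi t - (1 / sqrt t - 1) / 2) * ?p (u - 1) t =
        ?g t - (?p (u - 3/2) t - ?p (u - 1) t) / 2"
      unfolding h by (simp add: field_simps)
    finally show ?thesis .
  qed
  note m = mellin_psi[OF u]
  have gi: "set_integrable lborel {0<..<1} ?g"
    by (rule set_integrable_subset[OF m(1)]) auto
  have p1: "set_integrable lborel {0<..<1} (?p (u - 3/2))" "(LBINT t:{0<..<1}. ?p (u - 3/2) t) = 1 / (u - 1/2)"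
    using integral_powr_0_1[of "u - 3/2"] u by (simp_all add: algebra_simps)
  have p2: "set_integrable lborel {0<..<1} (?p (u - 1))" "(LBINT t:{0<..<1}. ?p (u - 1) t) = 1 / u"
    using integral_powr_0_1[of "u - 1"] u by simp_all
  have hi: "set_integrable lborel {0<..<1} (\<lambda>t. (?p (u - 3/2) t - ?p (u - 1) t) / 2)"
    by (intro set_integrable_divide set_integral_diff p1 p2)
  have ii: "set_integrable lborel {0<..<1} (\<lambda>t. (1 / t\<^sup>2) *\<^sub>R ?f (1 / t))"
    using set_integral_diff(1)[OF gi hi] by (subst set_integrable_cong[OF refl refl inv]) auto
  have "psi_mellin (- u - 1/2) = (LBINT t:{0<..<1}. (1 / t\<^sup>2) *\<^sub>R ?f (1 / t))"
    unfolding psi_mellin_def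
    by (rule set_integral_inversion[OF _ set_integrable_psi_powr_complex ii])
      (intro continuous_intros continuous_on_psi, auto)
  also have "\<dots> = (LBINT t:{0<..<1}. ?g t - (?p (u - 3/2) t - ?p (u - 1) t) / 2)"
    by (rule set_lebesgue_integral_cong) (use inv in auto)
  also have "\<dots> = (LBINT t:{0<..<1}. ?g t) - (1 / (u - 1/2) - 1 / u) / 2"
    by (subst set_integral_diff(2)[OF gi hi])
      (simp add: set_integral_diff(2)[OF p1(1) p2(1)] p1(2) p2(2) del: diff_divide_distrib)
  finally have "(LBINT t:{0<..<1}. ?g t) = psi_mellin (- u - 1/2) + (1 / (u - 1/2) - 1 / u) / 2"
    by simp
  moreover have "(LBINT t:{0<..}. ?g t) = (LBINT t:{0<..<1}. ?g t) + psi_mellin (u - 1)"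
    unfolding psi_mellin_def by (rule set_integral_split_at_1[OF m(1)])
  moreover have "(1 / (u - 1/2) - 1 / u) / 2 = 1 / (2 * u - 1) - 1 / (2 * u)"
  proof -
    have "2 * u - 1 = 2 * (u - 1/2)" by simp
    then show ?thesis by (simp add: diff_divide_distrib mult.commute)
  qed
  ultimately show ?thesis using m(2) by (simp add: algebra_simps)
qed

section \<open>The Riemann zeta function\<close>

text \<open>The right-hand side of \<open>completed_zeta_eq\<close> at u = s/2, divided by pi^(-s/2)
  Gamma(s/2). The factor \<open>rGamma\<close> is entire, and the fraction 1/s is merged into it
  through rGamma(s/2) / (s/2) = rGamma(s/2 + 1), so that s = 1 is the only singularity left.\<close>

definition zeta_fun :: "complex \<Rightarrow> complex" where
  "zeta_fun s = (if s = 1 then 0 else of_real pi powr (s / 2) *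
     (rGamma (s / 2) * (psi_mellin (s / 2 - 1) + psi_mellin (- (s / 2) - 1/2) + 1 / (s - 1)) -
      rGamma (s / 2 + 1) / 2))"

lemma psi_mellin_holomorphic [holomorphic_intros]:
  "f holomorphic_on A \<Longrightarrow> (\<lambda>z. psi_mellin (f z)) holomorphic_on A"
  using holomorphic_on_compose_gen[OF _ psi_mellin_entire, of f A] by (simp add: o_def)

lemma zeta_fun_holomorphic: "zeta_fun holomorphic_on - {1}"
proof -
  have "(\<lambda>s. of_real pi powr (s / 2) *
     (rGamma (s / 2) * (psi_mellin (s / 2 - 1) + psi_mellin (- (s / 2) - 1/2) + 1 / (s - 1)) -
      rGamma (s / 2 + 1) / 2)) holomorphic_on - {1}"
    by (intro holomorphic_intros) auto
  also have "?this \<longleftrightarrow> ?thesis"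
    by (intro holomorphic_cong) (auto simp: zeta_fun_def)
  finally show ?thesis .
qed

lemma Gamma_zeta_fun:
  assumes u: "u \<notin> \<int>\<^sub>\<le>\<^sub>0" "u \<noteq> 1/2"
  shows "Gamma u * zeta_fun (2 * u) = of_real pi powr u *
    (psi_mellin (u - 1) + psi_mellin (- u - 1/2) + 1 / (2 * u - 1) - 1 / (2 * u))"
proof -
  have g: "Gamma u * rGamma u = 1" "Gamma u * rGamma (u + 1) = 1 / u"
  proof -
    show "Gamma u * rGamma u = 1"
      using u(1) by (simp add: rGamma_inverse_Gamma Gamma_eq_zero_iff)
    moreover have "u * rGamma (u + 1) = rGamma u" by (rule rGamma_plus1)
    moreover have "u \<noteq> 0" using u by auto
    ultimately have "u * (Gamma u * rGamma (u + 1)) = 1"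
      by (metis mult.left_commute)
    with \<open>u \<noteq> 0\<close> show "Gamma u * rGamma (u + 1) = 1 / u"
      by (simp add: nonzero_eq_divide_eq mult.commute)
  qed
  have "2 * u \<noteq> 1" using u(2) by (auto simp: field_simps)
  then have "Gamma u * zeta_fun (2 * u) = of_real pi powr u *
     ((Gamma u * rGamma u) * (psi_mellin (u - 1) + psi_mellin (- u - 1/2) + 1 / (2 * u - 1)) -
      (Gamma u * rGamma (u + 1)) / 2)"
    by (simp add: zeta_fun_def algebra_simps)
  then show ?thesis unfolding g by simp
qed

lemma zeta_fun_sums:
  assumes s: "Re s > 1"
  shows "(\<lambda>k. 1 / of_nat (Suc k) powr s) sums zeta_fun s"
proof -
  define u where "u = s / 2"
  have u: "Re u > 1/2" "s = 2 * u" using s by (simp_all add: u_def)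
  have nz: "u \<notin> \<int>\<^sub>\<le>\<^sub>0" "u \<noteq> 1/2"
    using u(1) by (auto elim!: nonpos_Ints_cases simp: complex_eq_iff)
  have "of_real pi powr (- u) * (Gamma u * (\<Sum>k. 1 / of_nat (Suc k) powr s)) =
      of_real pi powr (- u) * (Gamma u * zeta_fun s)"
  proof -
    have "of_real pi powr (- u) * of_real pi powr u = (1::complex)"
      by (simp add: powr_minus)
    then show ?thesis
      unfolding u(2) Gamma_zeta_fun[OF nz]
      by (simp only: mult.assoc[symmetric] completed_zeta_eq[OF u(1)] mult_1_left)
  qed
  then have "(\<Sum>k. 1 / of_nat (Suc k) powr s) = zeta_fun s"
    using nz by (simp add: Gamma_eq_zero_iff)
  then show ?thesis
    using summable_sums[OF summable_norm_cancel[OF summable_dirichlet[OF s]]] by simp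
qed

text \<open>Uniqueness is the identity theorem: the plane without the point 1 is connected.\<close>

lemma zeta_eq_zeta_fun: "zeta = zeta_fun"
  unfolding zeta_def
proof (rule the_equality)
  show "zeta_fun holomorphic_on - {1} \<and> zeta_fun 1 = 0 \<and>
      (\<forall>s. 1 < Re s \<longrightarrow> (\<lambda>k. 1 / of_nat (Suc k) powr s) sums zeta_fun s)"
    using zeta_fun_holomorphic zeta_fun_sums by (auto simp: zeta_fun_def)
  fix f assume f: "f holomorphic_on - {1} \<and> f 1 = 0 \<and>
      (\<forall>s. 1 < Re s \<longrightarrow> (\<lambda>k. 1 / of_nat (Suc k) powr s) sums f s)"
  show "f = zeta_fun"
  proof
    fix z
    show "f z = zeta_fun z"
    proof (cases "z = 1")
      case True
      then show ?thesis using f by (simp add: zeta_fun_def)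
    next
      case False
      show ?thesis
      proof (rule analytic_continuation_open[of "{s. 1 < Re s}" "- {1}" f zeta_fun])
        show "open {s. 1 < Re s}" by (rule open_halfspace_Re_gt)
        show "{s. 1 < Re s} \<noteq> {}" by (rule ex_in_conv[THEN iffD1], rule exI[of _ 2]) simp
        show "connected (- {1::complex})" by (rule connected_punctured_universe) simp
        show "f w = zeta_fun w" if "w \<in> {s. 1 < Re s}" for w
          using f that zeta_fun_sums sums_unique2 by blast
      qed (use f zeta_fun_holomorphic False in auto)
    qed
  qed
qed

lemma zeta_holomorphic: "zeta holomorphic_on - {1}"
  unfolding zeta_eq_zeta_fun by (rule zeta_fun_holomorphic)

lemma zeta_holomorphic_compose [holomorphic_intros]:
  assumes "f holomorphic_on A" "\<And>z. z \<in> A \<Longrightarrow> f z \<noteq> 1"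
  shows "(\<lambda>z. zeta (f z)) holomorphic_on A"
proof -
  have "f ` A \<subseteq> - {1}" using assms(2) by auto
  from holomorphic_on_compose_gen[OF assms(1) zeta_holomorphic this] show ?thesis
    by (simp add: o_def)
qed

lemma zeta_sums: "Re s > 1 \<Longrightarrow> (\<lambda>k. 1 / of_nat (Suc k) powr s) sums zeta s"
  unfolding zeta_eq_zeta_fun by (rule zeta_fun_sums)

lemma zeta_has_sum:
  assumes "Re s > 1"
  shows "((\<lambda>n. of_nat n powr (- s)) has_sum zeta s) {1..}"
proof -
  have "((\<lambda>k. 1 / of_nat (Suc k) powr s) has_sum zeta s) UNIV"
    by (intro norm_summable_imp_has_sum summable_dirichlet zeta_sums assms)
  also have "?this \<longleftrightarrow> ?thesis"
    by (rule has_sum_reindex_bij_witness[of _ "\<lambda>n. n - 1" Suc]) (auto simp: powr_minus field_simps)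
  finally show ?thesis .
qed

text \<open>The denominator of \<open>zeta_fun\<close> is cleared; at s = 1 only sqrt(pi)
  rGamma(1/2) = 1 survives.\<close>

lemma zeta_pole:
  obtains g where "g holomorphic_on UNIV" "g 1 = 1" "\<And>s. s \<noteq> 1 \<Longrightarrow> zeta s = g s / (s - 1)"
proof
  define g where "g = (\<lambda>s. of_real pi powr (s / 2) *
     (rGamma (s / 2) * ((s - 1) * (psi_mellin (s / 2 - 1) + psi_mellin (- (s / 2) - 1/2)) + 1) -
      (s - 1) * rGamma (s / 2 + 1) / 2))"
  show "g holomorphic_on UNIV"
    unfolding g_def by (intro holomorphic_intros) auto
  have "complex_of_real pi powr (1/2) = of_real (sqrt pi)"
    by (simp add: powr_of_pos_real powr_half_sqrt[symmetric] powr_def Ln_of_real flip: exp_of_real)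
  then show "g 1 = 1"
    by (simp add: g_def rGamma_inverse_Gamma Gamma_one_half_complex)
  show "zeta s = g s / (s - 1)" if "s \<noteq> 1" for s
    using that by (simp add: zeta_eq_zeta_fun zeta_fun_def g_def field_simps)
qed

text \<open>The symmetry u -> 1/2 - u of the completed expression, for the pair u = -w and u = w +
  1/2. Integral w are excluded because Gamma(-w) has a pole there.\<close>

lemma zeta_functional_equation:
  assumes w: "Re w > 0" "w \<notin> \<int>"
  shows "Gamma (- w) * zeta (- 2 * w) = of_real pi powr (- 2 * w - 1/2) * (Gamma (w + 1/2) * zeta (2 * w + 1))"
proof -
  have 1: "- w \<notin> \<int>\<^sub>\<le>\<^sub>0" "- w \<noteq> 1/2"
  proof -
    show "- w \<notin> \<int>\<^sub>\<le>\<^sub>0"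
      using w(2) by (metis Ints_minus minus_minus nonpos_Ints_Int)
    show "- w \<noteq> 1/2" using w(1) by (auto simp: complex_eq_iff)
  qed
  have 2: "w + 1/2 \<notin> \<int>\<^sub>\<le>\<^sub>0" "w + 1/2 \<noteq> 1/2"
    using w by (auto elim!: nonpos_Ints_cases simp: complex_eq_iff)
  have nz: "w \<noteq> 0" "2 * w + 1 \<noteq> 0" "- 2 * w - 1 \<noteq> 0"
    using w by (auto simp: complex_eq_iff)
  let ?X = "psi_mellin (- w - 1) + psi_mellin (w - 1/2)"
  have "Gamma (- w) * zeta (- 2 * w) = of_real pi powr (- w) * (?X + 1 / (- 2 * w - 1) + 1 / (2 * w))"
    using Gamma_zeta_fun[OF 1] by (simp add: zeta_eq_zeta_fun)
  moreover have "Gamma (w + 1/2) * zeta (2 * w + 1) =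
      of_real pi powr (w + 1/2) * (?X + 1 / (2 * w) - 1 / (2 * w + 1))"
    using Gamma_zeta_fun[OF 2] by (simp add: zeta_eq_zeta_fun distrib_left algebra_simps)
  moreover have "1 / (- 2 * w - 1) = - (1 / (2 * w + 1))"
    using nz by (simp add: divide_simps)
  moreover have "of_real pi powr (- w) = complex_of_real pi powr (- 2 * w - 1/2) * of_real pi powr (w + 1/2)"
    by (simp flip: powr_add)
  ultimately show ?thesis by (simp add: mult_ac)
qed

lemma eventually_not_Ints: "\<forall>\<^sub>F u in at (w::complex). u \<notin> \<int>"
proof -
  have "\<not> w islimpt (\<int> :: complex set)"
  proof (rule discrete_imp_not_islimpt)
    show "y = x" if "x \<in> \<int>" "y \<in> \<int>" "dist y x < 1" for x y :: complex
      using that by (auto elim!: Ints_cases simp: dist_norm simp flip: of_int_diff)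
  qed simp
  then show ?thesis by (simp add: islimpt_iff_eventually)
qed

text \<open>Off the integers this is the functional equation. Its right-hand side is continuous on
  Re w > 0 and hence supplies the filled-in value at the positive integers too.\<close>

lemma remove_sings_Gamma_zeta:
  assumes w: "Re w > 0"
  shows "remove_sings (\<lambda>u. Gamma (- u) * zeta (- 2 * u)) w =
    of_real pi powr (- 2 * w - 1/2) * (Gamma (w + 1/2) * zeta (2 * w + 1))"
proof (rule remove_sings_eqI)
  let ?g = "\<lambda>w. of_real pi powr (- 2 * w - 1/2) * (Gamma (w + 1/2) * zeta (2 * w + 1))"
  have "?g holomorphic_on {u. Re u > 0}"
    by (intro holomorphic_intros) (auto elim!: nonpos_Ints_cases simp: complex_eq_iff)
  then have "continuous_on {u. Re u > 0} ?g" by (rule holomorphic_on_imp_continuous_on)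
  then have "isCont ?g w"
    using w by (simp add: continuous_on_eq_continuous_at open_halfspace_Re_gt)
  then have lim: "(?g \<longlongrightarrow> ?g w) (at w)" by (simp add: isCont_def)
  have "\<forall>\<^sub>F u in at w. u \<in> {u. Re u > 0}"
    using w by (intro eventually_at_in_open' open_halfspace_Re_gt) auto
  then have "\<forall>\<^sub>F u in at w. ?g u = Gamma (- u) * zeta (- 2 * u)"
    using eventually_not_Ints by eventually_elim (use zeta_functional_equation in auto)
  from Lim_transform_eventually[OF lim this]
  show "(\<lambda>u. Gamma (- u) * zeta (- 2 * u)) \<midarrow>w\<rightarrow> ?g w" .
qed

lemma zeta_2: "zeta 2 = of_real (pi\<^sup>2 / 6)"
proof -
  have "(\<lambda>n. complex_of_real (1 / real ((n + 1)\<^sup>2))) sums of_real (pi\<^sup>2 / 6)"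
    using inverse_squares_sums by (subst sums_of_real_iff)
  moreover have "(\<lambda>k. 1 / of_nat (Suc k) powr 2) sums zeta 2"
    by (rule zeta_sums) simp
  moreover have "(\<lambda>k. 1 / of_nat (Suc k) powr 2) = (\<lambda>n. complex_of_real (1 / real ((n + 1)\<^sup>2)))"
    by (simp add: powr_numeral)
  ultimately show ?thesis using sums_unique2 by metis
qed

section \<open>Bounds for zeta and its inverse to the right of the line Re s = 1\<close>

lemma norm_zeta_le:
  assumes "\<sigma> > 1"
  obtains C where "C > 0" "\<And>s. Re s \<ge> \<sigma> \<Longrightarrow> norm (zeta s) \<le> C"
proof
  define C where "C = (\<Sum>k. real (Suc k) powr (- \<sigma>)) + 1"
  have sm: "summable (\<lambda>k. real (Suc k) powr (- \<sigma>))"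
    by (subst summable_Suc_iff[of "\<lambda>k. real k powr (- \<sigma>)"]) (use assms in \<open>simp add: summable_real_powr_iff\<close>)
  then have "(\<Sum>k. real (Suc k) powr (- \<sigma>)) \<ge> 0" by (intro suminf_nonneg) auto
  then show "C > 0" by (simp add: C_def)
  show "norm (zeta s) \<le> C" if s: "Re s \<ge> \<sigma>" for s
  proof -
    have s1: "Re s > 1" using s assms by simp
    have "norm (zeta s) \<le> (\<Sum>k. norm (1 / of_nat (Suc k) powr s))"
      using zeta_sums[OF s1] by (metis sums_unique summable_norm summable_dirichlet[OF s1])
    also have "\<dots> \<le> (\<Sum>k. real (Suc k) powr (- \<sigma>))"
    proof (rule suminf_le[OF _ summable_dirichlet[OF s1] sm])
      fix k
      have "norm (1 / complex_of_nat (Suc k) powr s) = real (Suc k) powr (- Re s)"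
        by (simp add: norm_divide norm_powr_real_powr powr_minus field_simps)
      also have "\<dots> \<le> real (Suc k) powr (- \<sigma>)"
        using s by (intro powr_mono) auto
      finally show "norm (1 / complex_of_nat (Suc k) powr s) \<le> real (Suc k) powr (- \<sigma>)" .
    qed
    finally show ?thesis by (simp add: C_def)
  qed
qed

text \<open>The sieve of Eratosthenes: subtracting p^(-s) times the current sum removes exactly the
  multiples of p that are still present.\<close>

lemma zeta_sieve:
  assumes s: "Re s > 1" and "finite F" "\<And>p. p \<in> F \<Longrightarrow> prime p"
  shows "((\<lambda>n. of_nat n powr (- s)) has_sum (\<Prod>p\<in>F. 1 - of_nat p powr (- s)) * zeta s)
    {n::nat. n \<ge> 1 \<and> (\<forall>p\<in>F. \<not> p dvd n)}"
  using assms(2,3)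
proof (induction F)
  case empty
  then show ?case using zeta_has_sum[OF s] by (simp add: atLeast_def)
next
  case (insert p F)
  let ?f = "\<lambda>n. of_nat n powr (- s) :: complex"
  let ?S = "\<lambda>F. {n::nat. n \<ge> 1 \<and> (\<forall>p\<in>F. \<not> p dvd n)}"
  let ?P = "\<Prod>p\<in>F. 1 - of_nat p powr (- s)"
  have p: "prime p" using insert by simp
  have IH: "(?f has_sum ?P * zeta s) (?S F)" using insert by simp
  have inj: "inj_on ((*) p) (?S F)" using p by (auto simp: inj_on_def prime_gt_0_nat)
  have sub: "(*) p ` ?S F \<subseteq> ?S F"
  proof safe
    fix n q assume n: "n \<ge> 1" "\<forall>p\<in>F. \<not> p dvd n" and q: "q \<in> F" "q dvd p * n"
    then have "q dvd p" using insert.prems prime_dvd_mult_iff by blast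
    then have "q = p" using insert.prems p q primes_dvd_imp_eq by blast
    then show False using q insert.hyps by simp
  qed (use p in \<open>auto simp: prime_gt_0_nat Suc_leI\<close>)
  have "((\<lambda>n. of_nat p powr (- s) * ?f n) has_sum of_nat p powr (- s) * (?P * zeta s)) (?S F)"
    by (rule has_sum_cmult_right[OF IH])
  also have "(\<lambda>n. of_nat p powr (- s) * ?f n) = ?f \<circ> (*) p"
    by (auto simp: fun_eq_iff powr_times_real)
  finally have "(?f has_sum of_nat p powr (- s) * (?P * zeta s)) ((*) p ` ?S F)"
    by (subst has_sum_reindex[OF inj])
  with IH have "(?f has_sum (?P * zeta s - of_nat p powr (- s) * (?P * zeta s))) (?S F - (*) p ` ?S F)"
    by (rule has_sum_Diff[OF _ _ sub])
  also have "?S F - (*) p ` ?S F = ?S (insert p F)"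
  proof safe
    fix n assume n: "n \<ge> 1" "\<forall>p\<in>F. \<not> p dvd n" "n \<notin> (*) p ` ?S F" and "p dvd n"
    then obtain m where m: "n = p * m" by (auto elim: dvdE)
    then have "m \<in> ?S F" using n by auto
    then show False using n m by blast
  qed auto
  finally show ?case using insert.hyps by (simp add: algebra_simps)
qed

text \<open>Sieving by the primes below M leaves the term 1 and a tail over n >= M, where M is
  chosen so that the tail is at most 1/2 for all Re s >= \<sigma>. The sieved value thus has modulus
  at least 1/2, while the finite product in front of zeta has modulus at most 2^|F|.\<close>

lemma norm_inverse_zeta_le:
  assumes \<sigma>: "\<sigma> > 1"
  obtains C where "C > 0" "\<And>s. Re s \<ge> \<sigma> \<Longrightarrow> zeta s \<noteq> 0 \<and> norm (1 / zeta s) \<le> C"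
proof -
  have "(\<lambda>n. real n powr (- \<sigma>)) summable_on UNIV"
    using \<sigma> by (simp add: summable_on_UNIV_nonneg_real_iff summable_real_powr_iff)
  then have sm: "(\<lambda>n. real n powr (- \<sigma>)) summable_on A" for A
    by (rule summable_on_subset) auto
  have "summable (\<lambda>n. real n powr (- \<sigma>))" using \<sigma> by (simp add: summable_real_powr_iff)
  from suminf_exist_split[OF _ this, of "1/2"] obtain N
    where N: "\<And>n. n \<ge> N \<Longrightarrow> norm (\<Sum>i. real (i + n) powr (- \<sigma>)) < 1/2" by auto
  define M where "M = N + 2"
  define F where "F = {p::nat. prime p \<and> p < M}"
  have F: "finite F" "\<And>p. p \<in> F \<Longrightarrow> prime p" by (auto simp: F_def)
  define S where "S = {n::nat. n \<ge> 1 \<and> (\<forall>p\<in>F. \<not> p dvd n)}"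
  have S: "n \<ge> M" if "n \<in> S" "n \<noteq> 1" for n
  proof (rule ccontr)
    assume "\<not> n \<ge> M"
    obtain p where p: "prime p" "p dvd n" using \<open>n \<noteq> 1\<close> prime_factor_nat by blast
    moreover have "p \<le> n" using p that dvd_imp_le[of p n] by (auto simp: S_def)
    ultimately show False using \<open>\<not> n \<ge> M\<close> that by (auto simp: S_def F_def)
  qed
  have S1: "1 \<in> S" by (auto simp: S_def F_def)
  have tail: "(\<Sum>\<^sub>\<infinity>n\<in>S - {1}. real n powr (- \<sigma>)) \<le> 1/2"
  proof -
    have "(\<Sum>\<^sub>\<infinity>n\<in>S - {1}. real n powr (- \<sigma>)) \<le> (\<Sum>\<^sub>\<infinity>n\<in>{M..}. real n powr (- \<sigma>))"
      using S by (intro infsum_mono_neutral sm) auto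
    also have "\<dots> = (\<Sum>\<^sub>\<infinity>i. real (i + M) powr (- \<sigma>))"
      by (rule infsum_reindex_bij_witness[of _ "\<lambda>i. i + M" "\<lambda>n. n - M"]) auto
    also have "\<dots> = (\<Sum>i. real (i + M) powr (- \<sigma>))"
    proof -
      have "(\<lambda>i. real (i + M) powr (- \<sigma>)) summable_on UNIV"
        using \<sigma> summable_iff_shift[of "\<lambda>n. real n powr (- \<sigma>)" M]
        by (simp add: summable_on_UNIV_nonneg_real_iff summable_real_powr_iff)
      then show ?thesis by (metis has_sum_infsum has_sum_imp_sums sums_unique)
    qed
    also have "\<dots> \<le> 1/2" using N[of M] by (simp add: M_def)
    finally show ?thesis .
  qed
  show ?thesis
  proof (rule that[of "2 * 2 ^ card F"])
    fix s assume s: "Re s \<ge> \<sigma>"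
    let ?P = "\<Prod>p\<in>F. 1 - of_nat p powr (- s)"
    have s1: "Re s > 1" using s \<sigma> by simp
    have "((\<lambda>n. of_nat n powr (- s)) has_sum ?P * zeta s) S"
      unfolding S_def by (rule zeta_sieve[OF s1 F])
    moreover have "((\<lambda>n. of_nat n powr (- s) :: complex) has_sum 1) {1}"
      by (simp add: has_sum_finite_iff)
    ultimately have "((\<lambda>n. of_nat n powr (- s)) has_sum (?P * zeta s - 1)) (S - {1})"
      using S1 by (intro has_sum_Diff) auto
    moreover have "((\<lambda>n. real n powr (- \<sigma>)) has_sum (\<Sum>\<^sub>\<infinity>n\<in>S - {1}. real n powr (- \<sigma>))) (S - {1})"
      by (rule has_sum_infsum[OF sm])
    ultimately have "norm (?P * zeta s - 1) \<le> (\<Sum>\<^sub>\<infinity>n\<in>S - {1}. real n powr (- \<sigma>))"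
    proof (rule norm_infsum_le)
      fix n assume "n \<in> S - {1}"
      then have "n \<ge> 1" by (auto simp: S_def)
      then show "norm (of_nat n powr (- s) :: complex) \<le> real n powr (- \<sigma>)"
        using s by (simp add: norm_powr_real_powr powr_mono)
    qed
    with tail have "norm (?P * zeta s - 1) \<le> 1/2" by simp
    then have half: "norm (?P * zeta s) \<ge> 1/2"
      using norm_triangle_ineq2[of 1 "1 - ?P * zeta s"] by (simp add: norm_minus_commute)
    have "norm ?P \<le> (\<Prod>p\<in>F. 2)"
      unfolding prod_norm[symmetric]
    proof (rule prod_mono, safe)
      fix p assume "p \<in> F"
      then have "p \<ge> 1" using F(2) prime_ge_1_nat by blast
      then have "norm (of_nat p powr (- s) :: complex) \<le> 1"
        using s1 powr_mono[of "- Re s" 0 "real p"] by (simp add: norm_powr_real_powr)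
      then show "norm (1 - of_nat p powr (- s) :: complex) \<le> 2"
        using norm_triangle_ineq4[of 1 "of_nat p powr (- s) :: complex"] by simp
    qed auto
    then have P: "norm ?P \<le> 2 ^ card F" by simp
    have z: "zeta s \<noteq> 0" using half by auto
    have "1/2 \<le> 2 ^ card F * norm (zeta s)"
      using half mult_right_mono[OF P norm_ge_zero[of "zeta s"]] unfolding norm_mult by linarith
    then show "zeta s \<noteq> 0 \<and> norm (1 / zeta s) \<le> 2 * 2 ^ card F"
      using z by (simp add: norm_divide field_simps)
  qed simp
qed

section \<open>Bessel integrals\<close>

lemma power_div_fact_le_exp: "x \<ge> 0 \<Longrightarrow> x ^ n / fact n \<le> exp (x :: real)"
proof -
  assume x: "x \<ge> 0"
  have "(\<Sum>i\<in>{n}. x ^ i / fact i) \<le> (\<Sum>i. x ^ i / fact i)"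
    using summable_exp_generic[of x] x by (intro sum_le_suminf) (auto simp: field_simps)
  then show ?thesis by (simp add: exp_def field_simps)
qed

lemma powr_times_exp_bounded:
  fixes c R :: real
  assumes c: "c > 0"
  obtains C where "C > 0" "\<And>t. t > 0 \<Longrightarrow> t powr R * exp (- c * (t + 1 / t)) \<le> C"
proof
  define N where "N = nat \<lceil>\<bar>R\<bar>\<rceil>"
  define D where "D = fact N / c ^ N"
  show "2 * D > 0" using c by (simp add: D_def)
  have D: "u ^ N * exp (- c * u) \<le> D" if "u > 0" for u
    using power_div_fact_le_exp[of "c * u" N] that c
    by (simp add: D_def exp_minus power_mult_distrib field_simps)
  have N: "\<bar>R\<bar> \<le> real N" by (simp add: N_def)
  show "t powr R * exp (- c * (t + 1 / t)) \<le> 2 * D" if t: "t > 0" for t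
  proof -
    have e: "exp (- c * (t + 1 / t)) \<le> exp (- c * t)" "exp (- c * (t + 1 / t)) \<le> exp (- c * (1 / t))"
      using t c by (auto simp: distrib_left)
    show ?thesis
    proof (cases "t \<ge> 1")
      case True
      have "t powr R \<le> t ^ N"
        using True N powr_mono[of R "real N" t] by (simp add: powr_realpow)
      then have "t powr R * exp (- c * (t + 1 / t)) \<le> t ^ N * exp (- c * t)"
        using e t by (intro mult_mono) auto
      then show ?thesis using D[OF t] \<open>2 * D > 0\<close> by linarith
    next
      case False
      have "t powr R = (1 / t) powr (- R)" using t by (simp add: powr_minus powr_divide)
      also have "\<dots> \<le> (1 / t) ^ N"
        using False t N powr_mono[of "- R" "real N" "1 / t"] by (simp add: powr_realpow)
      finally have "t powr R * exp (- c * (t + 1 / t)) \<le> (1 / t) ^ N * exp (- c * (1 / t))"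
        using e t by (intro mult_mono) auto
      then show ?thesis using D[of "1 / t"] t \<open>2 * D > 0\<close> by (simp del: times_divide_eq_right)
    qed
  qed
qed

text \<open>With independent A and B this is the integral that Mellin transforms of theta terms
  produce. \<open>bessel_K\<close> is half the case A = B = x/2, to which a rescaling of t reduces
  the others.\<close>

definition bessel_int :: "complex \<Rightarrow> real \<Rightarrow> real \<Rightarrow> complex" where
  "bessel_int \<nu> A B = (LBINT t:{0<..}. of_real (exp (- A * t - B / t)) * of_real t powr (\<nu> - 1))"

definition bessel_int_real :: "real \<Rightarrow> real \<Rightarrow> real \<Rightarrow> real" where
  "bessel_int_real \<sigma> A B = (LBINT t:{0<..}. exp (- A * t - B / t) * t powr (\<sigma> - 1))"

lemma set_integrable_bessel_int_real:
  fixes A B R :: real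
  assumes A: "A > 0" and B: "B > 0"
  shows "set_integrable lborel {0<..} (\<lambda>t. exp (- A * t - B / t) * t powr R)"
proof -
  \<comment> \<open>One share of the exponent, c (t + 1/t), absorbs the power of t, and another, c
    t, keeps the integral finite.\<close>
  define c :: real where "c = min A B / 2"
  have c: "c > 0" using A B by (simp add: c_def)
  obtain C where C: "C > 0" "\<And>t. t > 0 \<Longrightarrow> t powr R * exp (- c * (t + 1 / t)) \<le> C"
    using powr_times_exp_bounded[OF c, of R] by blast
  have "set_integrable lborel {0<..} (\<lambda>t. t powr (1 - 1) * exp (- c * t))"
    by (rule gamma_integral_lborel_real(1)[OF c]) simp
  then have "set_integrable lborel {0<..} (\<lambda>t. C * (t powr (1 - 1) * exp (- c * t)))"
    by (rule set_integrable_mult_right)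
  then show ?thesis
    unfolding set_integrable_def
  proof (rule Bochner_Integration.integrable_bound)
    have "(\<lambda>t. indicat_real {0<..} t *\<^sub>R (exp (- A * t - B / t) * t powr R)) \<in> borel_measurable borel"
      by (intro borel_measurable_continuous_on_indicator continuous_intros) auto
    then show "(\<lambda>t. indicat_real {0<..} t *\<^sub>R (exp (- A * t - B / t) * t powr R)) \<in> borel_measurable lborel"
      by simp
    have "exp (- A * t - B / t) * t powr R \<le> C * exp (- c * t)" if t: "t > 0" for t
    proof -
      have "c * t + c * (t + 1 / t) \<le> A * t + B / t"
      proof -
        have "2 * c * t \<le> A * t" "c / t \<le> B / t"
          using t A B divide_right_mono[of c B t] by (auto simp: c_def intro!: mult_right_mono)
        then show ?thesis by (simp add: distrib_left)
      qed
      then have "exp (- A * t - B / t) \<le> exp (- c * t + - c * (t + 1 / t))" by simp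
      also have "\<dots> = exp (- c * t) * exp (- c * (t + 1 / t))" by (rule exp_add)
      finally have "exp (- A * t - B / t) * t powr R \<le> exp (- c * t) * exp (- c * (t + 1 / t)) * t powr R"
        by (rule mult_right_mono) simp
      also have "\<dots> = exp (- c * t) * (t powr R * exp (- c * (t + 1 / t)))"
        by (simp only: mult_ac)
      also have "\<dots> \<le> exp (- c * t) * C" by (intro mult_left_mono C t) auto
      finally show ?thesis by (simp add: mult.commute)
    qed
    then show "AE t in lborel. norm (indicat_real {0<..} t *\<^sub>R (exp (- A * t - B / t) * t powr R))
        \<le> norm (indicat_real {0<..} t *\<^sub>R (C * (t powr (1 - 1) * exp (- c * t))))"
      using C(1) by (intro AE_I2) (auto simp: indicator_def)
  qed
qed

lemma continuous_on_bessel_integrand: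
  "continuous_on {0<..} (\<lambda>t. complex_of_real (exp (- A * t - B / t)))"
  by (intro continuous_intros) auto

lemma set_integrable_bessel_int:
  assumes "A > 0" "B > 0"
  shows "set_integrable lborel {0<..} (\<lambda>t. of_real (exp (- A * t - B / t)) * complex_of_real t powr s)"
  using set_integrable_bessel_int_real[OF assms, of "Re s"] unfolding set_integrable_def
proof (rule Bochner_Integration.integrable_bound)
  have "(\<lambda>t. indicat_real {0<..} t *\<^sub>R (of_real (exp (- A * t - B / t)) * complex_of_real t powr s)) \<in> borel_measurable borel"
    by (intro borel_measurable_continuous_on_indicator continuous_intros) auto
  then show "(\<lambda>t. indicat_real {0<..} t *\<^sub>R (of_real (exp (- A * t - B / t)) * complex_of_real t powr s)) \<in> borel_measurable lborel"
    by simp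
qed (auto simp: indicator_def norm_mult norm_powr_pos)

lemma bessel_int_holomorphic:
  assumes "A > 0" "B > 0"
  shows "(\<lambda>\<nu>. bessel_int \<nu> A B) holomorphic_on UNIV"
proof -
  have "(\<lambda>s. LBINT t:{0<..}. of_real (exp (- A * t - B / t)) * of_real t powr s) holomorphic_on UNIV"
    by (rule holomorphic_on_mellin[OF continuous_on_bessel_integrand])
      (use set_integrable_bessel_int_real[OF assms] in auto)
  from holomorphic_on_compose_gen[OF _ this, of "\<lambda>\<nu>. \<nu> - 1" UNIV]
  show ?thesis by (simp add: bessel_int_def o_def holomorphic_intros)
qed

lemma norm_bessel_int_le_real:
  assumes "A > 0" "B > 0"
  shows "norm (bessel_int \<nu> A B) \<le> bessel_int_real (Re \<nu>) A B"
proof -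
  have "norm (bessel_int \<nu> A B) \<le> (LBINT t:{0<..}. norm (of_real (exp (- A * t - B / t)) * complex_of_real t powr (\<nu> - 1)))"
    unfolding bessel_int_def by (rule set_integral_norm_bound[OF set_integrable_bessel_int[OF assms(1,2)]])
  also have "\<dots> = bessel_int_real (Re \<nu>) A B"
    unfolding bessel_int_real_def
    by (intro set_lebesgue_integral_cong) (auto simp: norm_mult norm_powr_pos)
  finally show ?thesis .
qed

text \<open>The exponents are compared pointwise in t. Later E is proportional to the frequency, and
  this is where exponential decay in the frequency comes from.\<close>

lemma bessel_int_real_le:
  assumes "A > 0" "B > 0" "A' > 0" "B' > 0"
    and "\<And>t. t > 0 \<Longrightarrow> E + A' * t + B' / t \<le> A * t + B / t"
  shows "bessel_int_real \<sigma> A B \<le> exp (- E) * bessel_int_real \<sigma> A' B'"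
proof -
  have "bessel_int_real \<sigma> A B \<le> (LBINT t:{0<..}. exp (- E) * (exp (- A' * t - B' / t) * t powr (\<sigma> - 1)))"
    unfolding bessel_int_real_def
  proof (rule set_integral_mono)
    show "exp (- A * t - B / t) * t powr (\<sigma> - 1) \<le> exp (- E) * (exp (- A' * t - B' / t) * t powr (\<sigma> - 1))"
      if "t \<in> {0<..}" for t
    proof -
      have "exp (- A * t - B / t) \<le> exp (- E + (- A' * t - B' / t))"
        using assms(5)[of t] that by simp
      also have "\<dots> = exp (- E) * exp (- A' * t - B' / t)" by (rule exp_add)
      finally show ?thesis unfolding mult.assoc[symmetric] by (rule mult_right_mono) simp
    qed
  qed (use set_integrable_bessel_int_real assms in auto)
  also have "\<dots> = exp (- E) * bessel_int_real \<sigma> A' B'"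
    by (simp add: bessel_int_real_def)
  finally show ?thesis .
qed

lemma bessel_int_real_nonneg: "bessel_int_real \<sigma> A B \<ge> 0"
  unfolding bessel_int_real_def set_lebesgue_integral_def
  by (rule Bochner_Integration.integral_nonneg) (auto simp: indicator_def)

text \<open>Half of the decay pays for t^k, since (A t / 2)^k <= k! exp(A t / 2). This factorial is
  the growth that 1/Gamma(s + k) has to compensate.\<close>

lemma bessel_int_real_add_le:
  assumes A: "A > 0" "B > 0"
  shows "bessel_int_real (\<sigma> + real k) A B \<le> fact k * (2 / A) ^ k * bessel_int_real \<sigma> (A / 2) B"
proof -
  have "bessel_int_real (\<sigma> + real k) A B \<le>
      (LBINT t:{0<..}. (fact k * (2 / A) ^ k) * (exp (- (A / 2) * t - B / t) * t powr (\<sigma> - 1)))"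
    unfolding bessel_int_real_def
  proof (rule set_integral_mono)
    fix t :: real assume "t \<in> {0<..}"
    then have t: "t > 0" by simp
    have "t ^ k \<le> fact k * (2 / A) ^ k * exp (A / 2 * t)"
      using power_div_fact_le_exp[of "A / 2 * t" k] t A
      by (simp add: power_mult_distrib power_divide field_simps)
    moreover have "exp (- A * t - B / t) = exp (- (A / 2) * t - B / t) * exp (- (A / 2 * t))"
      by (simp flip: exp_add)
    moreover have "t powr (\<sigma> + real k - 1) = t powr (\<sigma> - 1) * t ^ k"
      using t by (simp add: powr_realpow[symmetric] algebra_simps flip: powr_add)
    ultimately have "exp (- A * t - B / t) * t powr (\<sigma> + real k - 1) \<le>
        exp (- (A / 2) * t - B / t) * exp (- (A / 2 * t)) * (t powr (\<sigma> - 1) * (fact k * (2 / A) ^ k * exp (A / 2 * t)))"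
      by (auto intro!: mult_left_mono)
    also have "\<dots> = (fact k * (2 / A) ^ k) * (exp (- (A / 2) * t - B / t) * t powr (\<sigma> - 1)) * (exp (- (A / 2 * t)) * exp (A / 2 * t))"
      by (simp only: mult_ac)
    also have "exp (- (A / 2 * t)) * exp (A / 2 * t) = 1" by (simp flip: exp_add)
    finally show "exp (- A * t - B / t) * t powr (\<sigma> + real k - 1) \<le>
        (fact k * (2 / A) ^ k) * (exp (- (A / 2) * t - B / t) * t powr (\<sigma> - 1))" by simp
  next
    show "set_integrable lborel {0<..} (\<lambda>t. exp (- A * t - B / t) * t powr (\<sigma> + real k - 1))"
      by (rule set_integrable_bessel_int_real[OF A])
    show "set_integrable lborel {0<..} (\<lambda>t. (fact k * (2 / A) ^ k) * (exp (- (A / 2) * t - B / t) * t powr (\<sigma> - 1)))"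
      by (rule set_integrable_mult_right, rule set_integrable_bessel_int_real) (use A in auto)
  qed
  then show ?thesis by (simp add: bessel_int_real_def)
qed

text \<open>Makes the bounds locally uniform in the order: the exponent b controls t >= 1 and the
  exponent a controls t < 1.\<close>

lemma bessel_int_real_le_interval:
  assumes A: "A > 0" "B > 0" and "a \<le> \<sigma>" "\<sigma> \<le> b"
  shows "bessel_int_real \<sigma> A B \<le> bessel_int_real a A B + bessel_int_real b A B"
proof -
  note i = set_integrable_bessel_int_real[OF A]
  have "bessel_int_real \<sigma> A B \<le>
      (LBINT t:{0<..}. exp (- A * t - B / t) * t powr (a - 1) + exp (- A * t - B / t) * t powr (b - 1))"
    unfolding bessel_int_real_def
  proof (rule set_integral_mono)
    fix t :: real assume "t \<in> {0<..}"
    then have t: "t > 0" by simp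
    have "t powr (\<sigma> - 1) \<le> t powr (a - 1) + t powr (b - 1)"
    proof (cases "t \<ge> 1")
      case True
      then have "t powr (\<sigma> - 1) \<le> t powr (b - 1)" using assms by (intro powr_mono) auto
      then show ?thesis by (smt (verit) powr_ge_zero)
    next
      case False
      then have "t powr (\<sigma> - 1) \<le> t powr (a - 1)" using assms t by (intro powr_mono') auto
      then show ?thesis by (smt (verit) powr_ge_zero)
    qed
    then have "exp (- A * t - B / t) * t powr (\<sigma> - 1) \<le> exp (- A * t - B / t) * (t powr (a - 1) + t powr (b - 1))"
      by (intro mult_left_mono) auto
    then show "exp (- A * t - B / t) * t powr (\<sigma> - 1) \<le>
        exp (- A * t - B / t) * t powr (a - 1) + exp (- A * t - B / t) * t powr (b - 1)"
      by (simp add: distrib_left)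
  qed (intro i set_integral_add)+
  also have "\<dots> = bessel_int_real a A B + bessel_int_real b A B"
    unfolding bessel_int_real_def by (rule set_integral_add(2)[OF i i])
  finally show ?thesis .
qed

lemma bessel_K_eq_bessel_int: "bessel_K \<nu> x = bessel_int \<nu> (x / 2) (x / 2) / 2"
proof -
  have "- x * (t + 1 / t) / 2 = - (x / 2) * t - x / 2 / t" for t
    by (simp add: distrib_left add_divide_distrib)
  then show ?thesis by (simp only: bessel_K_def bessel_int_def) simp
qed

lemma bessel_int_scale:
  assumes c: "c > 0"
  shows "bessel_int \<nu> A B = of_real c powr \<nu> * bessel_int \<nu> (c * A) (B / c)"
proof -
  have "bessel_int \<nu> A B = of_real c * (LBINT t:{0<..}. of_real (exp (- A * (c * t) - B / (c * t))) * of_real (c * t) powr (\<nu> - 1))"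
    unfolding bessel_int_def by (rule set_integral_scale_Ioi(1)[OF c])
  also have "(LBINT t:{0<..}. of_real (exp (- A * (c * t) - B / (c * t))) * complex_of_real (c * t) powr (\<nu> - 1)) =
      (LBINT t:{0<..}. of_real c powr (\<nu> - 1) * (of_real (exp (- (c * A) * t - B / c / t)) * of_real t powr (\<nu> - 1)))"
    using c by (intro set_lebesgue_integral_cong) (auto simp: powr_times_real mult_ac)
  also have "\<dots> = of_real c powr (\<nu> - 1) * bessel_int \<nu> (c * A) (B / c)"
    by (simp add: bessel_int_def)
  also have "of_real c * (of_real c powr (\<nu> - 1) * bessel_int \<nu> (c * A) (B / c)) =
      of_real c powr \<nu> * bessel_int \<nu> (c * A) (B / c)"
    using c by (simp add: powr_diff)
  finally show ?thesis .
qed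

text \<open>Rescaling t by c = sqrt(B/A) makes the two coefficients in the exponent equal.\<close>

lemma bessel_int_eq_bessel_K:
  assumes c: "c > 0" "B = c\<^sup>2 * A"
  shows "bessel_int \<nu> A B = 2 * of_real c powr \<nu> * bessel_K \<nu> (2 * c * A)"
proof -
  have "B / c = c * A" using c by (simp add: power2_eq_square)
  then show ?thesis
    using bessel_int_scale[OF c(1), of \<nu> A B] by (simp add: bessel_K_eq_bessel_int)
qed

text \<open>The function exp(-x (t + 1/t) / 2) t^\<nu> vanishes at both ends of the positive axis,
  so its derivative has integral 0; the three terms of the derivative are the Bessel integrands of
  orders \<nu>, \<nu> + 1 and \<nu> - 1.\<close>

lemma bessel_K_recurrence:
  assumes x: "x > 0"
  shows "bessel_K (\<nu> + 1) x - bessel_K (\<nu> - 1) x = 2 * \<nu> / of_real x * bessel_K \<nu> x"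
proof -
  define e where "e = (\<lambda>t. complex_of_real (exp (- (x / 2) * t - x / 2 / t)))"
  define F where "F = (\<lambda>t. e t * of_real t powr \<nu>)"
  define f where "f = (\<lambda>t. \<nu> * (e t * of_real t powr (\<nu> - 1)) -
     of_real (x / 2) * (e t * of_real t powr (\<nu> + 1 - 1)) + of_real (x / 2) * (e t * of_real t powr (\<nu> - 1 - 1)))"
  have x2: "x / 2 > 0" using x by simp
  have i: "set_integrable lborel {0<..} (\<lambda>t. e t * of_real t powr s)" for s
    unfolding e_def by (rule set_integrable_bessel_int[OF x2 x2])
  have fi: "set_integrable lborel {0<..} f"
    unfolding f_def by (intro set_integral_add set_integral_diff set_integrable_mult_right i)
  have deriv: "(F has_vector_derivative f t) (at t)" if t: "t > 0" for t
  proof -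
    have "((\<lambda>t. exp (- (x / 2) * t - x / 2 / t)) has_real_derivative
        exp (- (x / 2) * t - x / 2 / t) * (- (x / 2) + x / 2 / t\<^sup>2)) (at t)"
      using t by (auto intro!: derivative_eq_intros simp: power2_eq_square field_simps)
    then have "(e has_vector_derivative of_real (exp (- (x / 2) * t - x / 2 / t) * (- (x / 2) + x / 2 / t\<^sup>2))) (at t)"
      unfolding e_def by (intro has_vector_derivative_of_real) (simp add: has_real_derivative_iff_has_vector_derivative)
    from has_vector_derivative_mult[OF this powr_complex_has_real_derivative[OF t, of \<nu>]]
    have D1: "(F has_vector_derivative (e t * (\<nu> * of_real t powr (\<nu> - 1)) +
        of_real (exp (- (x / 2) * t - x / 2 / t) * (- (x / 2) + x / 2 / t\<^sup>2)) * of_real t powr \<nu>)) (at t)"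
      unfolding F_def .
    have D2: "complex_of_real (exp (- (x / 2) * t - x / 2 / t) * (- (x / 2) + x / 2 / t\<^sup>2)) * of_real t powr \<nu> =
        - of_real (x / 2) * (e t * of_real t powr (\<nu> + 1 - 1)) + of_real (x / 2) * (e t * of_real t powr (\<nu> - 1 - 1))"
    proof -
      have "of_real t powr (\<nu> - 1 - 1) = complex_of_real t powr \<nu> / of_real t / of_real t"
        using t by (simp add: powr_diff power2_eq_square)
      then show ?thesis using t
        by (simp add: e_def field_simps power2_eq_square)
    qed
    have "e t * (\<nu> * of_real t powr (\<nu> - 1)) +
        (- of_real (x / 2) * (e t * of_real t powr (\<nu> + 1 - 1)) + of_real (x / 2) * (e t * of_real t powr (\<nu> - 1 - 1))) = f t"
      by (simp add: f_def algebra_simps)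
    with D1 show ?thesis unfolding D2 by simp
  qed
  \<comment> \<open>Half of the exponent, x/4 in place of x/2, absorbs the power of t; the other
    half forces both boundary limits to be 0.\<close>
  obtain C where C: "C > 0" "\<And>t. t > 0 \<Longrightarrow> t powr Re \<nu> * exp (- (x / 4) * (t + 1 / t)) \<le> C"
    using powr_times_exp_bounded[of "x / 4" "Re \<nu>"] x by auto
  have bound: "norm (F t) \<le> C * exp (- (x / 4) * (t + 1 / t))" if t: "t > 0" for t
  proof -
    have "norm (F t) = exp (- (x / 2) * t - x / 2 / t) * t powr Re \<nu>"
      using t by (simp add: F_def e_def norm_mult norm_powr_pos)
    also have "exp (- (x / 2) * t - x / 2 / t) = exp (- (x / 4) * (t + 1 / t)) * exp (- (x / 4) * (t + 1 / t))"
      unfolding exp_add[symmetric] by (simp add: field_simps)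
    also have "\<dots> * t powr Re \<nu> = exp (- (x / 4) * (t + 1 / t)) * (t powr Re \<nu> * exp (- (x / 4) * (t + 1 / t)))"
      by (simp only: mult_ac)
    also have "\<dots> \<le> exp (- (x / 4) * (t + 1 / t)) * C" by (intro mult_left_mono C t) auto
    finally show ?thesis by (simp add: mult.commute)
  qed
  have lim0: "(F \<longlongrightarrow> 0) (at_right 0)"
  proof (rule Lim_null_comparison)
    show "\<forall>\<^sub>F t in at_right 0. norm (F t) \<le> C * exp (- (x / 4) * (t + 1 / t))"
      using bound by (auto simp: eventually_at_filter)
    show "((\<lambda>t. C * exp (- (x / 4) * (t + 1 / t))) \<longlongrightarrow> 0) (at_right 0)"
      using x C by real_asymp
  qed
  have lim1: "(F \<longlongrightarrow> 0) at_top"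
  proof (rule Lim_null_comparison)
    show "\<forall>\<^sub>F t in at_top. norm (F t) \<le> C * exp (- (x / 4) * (t + 1 / t))"
      using eventually_gt_at_top[of 0] by eventually_elim (rule bound)
    show "((\<lambda>t. C * exp (- (x / 4) * (t + 1 / t))) \<longlongrightarrow> 0) at_top"
      using x C by real_asymp
  qed
  have ein: "einterval (ereal 0) \<infinity> = {0<..}" by (auto simp: einterval_def)
  have "(LBINT t=ereal 0..\<infinity>. f t) = 0 - 0"
  proof (rule interval_integral_FTC_integrable[where F = F])
    fix t :: real assume "ereal 0 < ereal t"
    then have t: "t > 0" by simp
    show "(F has_vector_derivative f t) (at t)" by (rule deriv[OF t])
    have "isCont e t"
      using continuous_on_bessel_integrand[of "x/2" "x/2"] t by (auto simp: continuous_on_eq_continuous_at e_def)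
    then show "isCont f t" unfolding f_def
      by (intro continuous_add continuous_diff continuous_mult continuous_const isCont_powr_pos[OF t])
  qed (use fi lim0 lim1 in \<open>auto simp: ereal_tendsto_simps ein\<close>)
  then have "(LBINT t:{0<..}. f t) = 0" by (simp add: interval_lebesgue_integral_def ein)
  moreover have "(LBINT t:{0<..}. f t) = \<nu> * (2 * bessel_K \<nu> x) - of_real (x / 2) * (2 * bessel_K (\<nu> + 1) x) +
      of_real (x / 2) * (2 * bessel_K (\<nu> - 1) x)"
  proof -
    have b: "2 * bessel_K \<mu> x = (LBINT t:{0<..}. e t * of_real t powr (\<mu> - 1))" for \<mu>
      unfolding bessel_K_eq_bessel_int bessel_int_def e_def by simp
    have m: "set_integrable lborel {0<..} (\<lambda>t. a * (e t * of_real t powr s))" for a s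
      by (intro set_integrable_mult_right i)
    show ?thesis
      unfolding f_def b
      by (simp only: set_integral_add(2)[OF set_integral_diff(1)[OF m m] m] set_integral_diff(2)[OF m m]
          set_integral_mult_right)
  qed
  ultimately have "of_real x * (bessel_K (\<nu> + 1) x - bessel_K (\<nu> - 1) x) = 2 * \<nu> * bessel_K \<nu> x"
    by (simp add: algebra_simps)
  then show ?thesis using x by (simp add: field_simps)
qed

section \<open>Poisson summation\<close>

lemma lattice_form_ge:
  fixes x y c d :: real
  shows "y\<^sup>2 / (x\<^sup>2 + y\<^sup>2 + 1) * (c\<^sup>2 + d\<^sup>2) \<le> (c * x + d)\<^sup>2 + (c * y)\<^sup>2"
proof -
  have pos: "x\<^sup>2 + y\<^sup>2 + 1 > 0" by (smt (verit) zero_le_power2)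
  \<comment> \<open>Cayley--Hamilton for the Gram matrix of the form\<close>
  have "(x\<^sup>2 + y\<^sup>2 + 1) * ((c * x + d)\<^sup>2 + (c * y)\<^sup>2) - y\<^sup>2 * (c\<^sup>2 + d\<^sup>2) =
      ((x\<^sup>2 + y\<^sup>2) * c + x * d)\<^sup>2 + (x * c + d)\<^sup>2"
    by (simp add: power2_eq_square algebra_simps)
  moreover have "\<dots> \<ge> 0" by simp
  ultimately have "y\<^sup>2 * (c\<^sup>2 + d\<^sup>2) \<le> (x\<^sup>2 + y\<^sup>2 + 1) * ((c * x + d)\<^sup>2 + (c * y)\<^sup>2)"
    by linarith
  then show ?thesis using pos by (simp add: pos_divide_le_eq mult.commute)
qed

text \<open>The value 1 at d = 0 lets negative powers be summed over all integers without a separate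
  case.\<close>

definition int_wt :: "int \<Rightarrow> real" where
  "int_wt d = max 1 \<bar>of_int d\<bar>"

lemma int_wt_ge_1: "int_wt d \<ge> 1" by (simp add: int_wt_def)

lemma int_wt_pos: "int_wt d > 0" using int_wt_ge_1[of d] by linarith

lemma int_wt_square_le: "(int_wt d)\<^sup>2 \<le> 1 + (of_int d)\<^sup>2"
  by (cases "\<bar>of_int d\<bar> \<ge> (1::real)") (auto simp: int_wt_def max_def)

lemma summable_int_wt:
  assumes "p > 1"
  shows "summable (\<lambda>k. int_wt (int_decode k) powr (- p))"
proof -
  have s: "summable (\<lambda>n. real n powr (- p))" using assms by (simp add: summable_real_powr_iff)
  have "summable (\<lambda>n. int_wt (int n) powr (- p))"
    by (rule summable_cong[THEN iffD1, OF _ s], rule eventually_mono[OF eventually_ge_at_top[of 1]])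
      (simp add: int_wt_def max_def)
  moreover have "int_wt (- int n) = int_wt (int n)" for n by (simp add: int_wt_def)
  ultimately show ?thesis by (intro summable_int_decode) auto
qed

lemma summable_on_int_wt:
  assumes "p > 1"
  shows "(\<lambda>d. int_wt d powr (- p)) summable_on UNIV"
proof -
  have "(\<lambda>k. int_wt (int_decode k) powr (- p)) summable_on UNIV"
    using summable_int_wt[OF assms] by (simp add: summable_on_UNIV_nonneg_real_iff)
  then show ?thesis by (subst (asm) summable_on_reindex_bij_betw[OF bij_int_decode])
qed

text \<open>This is \<open>lattice_form_ge\<close> with c = 1. The bound is uniform for |a| <= A, as
  needed for differentiating the sum with respect to a.\<close>

lemma quadratic_powr_le:
  assumes v: "v > 0" and a: "\<bar>a\<bar> \<le> A" and \<sigma>: "\<sigma> \<ge> 0"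
  shows "((a + of_int d)\<^sup>2 + v\<^sup>2) powr (- \<sigma>) \<le>
    (v\<^sup>2 / (A\<^sup>2 + v\<^sup>2 + 1)) powr (- \<sigma>) * int_wt d powr (- (2 * \<sigma>))"
proof -
  have pos: "A\<^sup>2 + v\<^sup>2 + 1 > 0" "a\<^sup>2 + v\<^sup>2 + 1 > 0" by (smt (verit) zero_le_power2)+
  have "a\<^sup>2 \<le> A\<^sup>2" using a by (simp add: abs_le_square_iff[symmetric])
  then have "v\<^sup>2 / (A\<^sup>2 + v\<^sup>2 + 1) * (int_wt d)\<^sup>2 \<le> v\<^sup>2 / (a\<^sup>2 + v\<^sup>2 + 1) * (1\<^sup>2 + (of_int d)\<^sup>2)"
    using pos int_wt_square_le[of d] by (intro mult_mono divide_left_mono) auto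
  also have "\<dots> \<le> (1 * a + of_int d)\<^sup>2 + (1 * v)\<^sup>2" by (rule lattice_form_ge)
  finally have le: "v\<^sup>2 / (A\<^sup>2 + v\<^sup>2 + 1) * (int_wt d)\<^sup>2 \<le> (a + of_int d)\<^sup>2 + v\<^sup>2" by simp
  have pos': "0 < v\<^sup>2 / (A\<^sup>2 + v\<^sup>2 + 1) * (int_wt d)\<^sup>2"
    using pos v int_wt_pos[of d] by simp
  have "((a + of_int d)\<^sup>2 + v\<^sup>2) powr (- \<sigma>) \<le> (v\<^sup>2 / (A\<^sup>2 + v\<^sup>2 + 1) * (int_wt d)\<^sup>2) powr (- \<sigma>)"
    using le pos' \<sigma> by (intro powr_mono2') auto
  also have "(int_wt d)\<^sup>2 = int_wt d powr 2" using int_wt_pos[of d] by (simp add: powr_numeral)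
  also have "(v\<^sup>2 / (A\<^sup>2 + v\<^sup>2 + 1) * int_wt d powr 2) powr (- \<sigma>) =
      (v\<^sup>2 / (A\<^sup>2 + v\<^sup>2 + 1)) powr (- \<sigma>) * int_wt d powr (- (2 * \<sigma>))"
    by (simp only: powr_mult powr_powr) simp
  finally show ?thesis .
qed

text \<open>The inequality v^2 t + M^2/t >= 2 v M, applied to half of the exponent, gives the decay
  exp(-pi v M); the other half, with M lowered to 1, stays in the integral.\<close>

lemma bessel_int_real_fourier_le:
  assumes v: "v > 0"
  shows "bessel_int_real \<sigma> (pi * v\<^sup>2) (pi * (real (Suc m))\<^sup>2) \<le>
    exp (- (pi * v)) ^ Suc m * bessel_int_real \<sigma> (pi * v\<^sup>2 / 2) (pi / 2)"
proof -
  define M where "M = real (Suc m)"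
  have M: "M \<ge> 1" by (simp add: M_def)
  have "bessel_int_real \<sigma> (pi * v\<^sup>2) (pi * M\<^sup>2) \<le>
      exp (- (pi * v * M)) * bessel_int_real \<sigma> (pi * v\<^sup>2 / 2) (pi / 2)"
  proof (rule bessel_int_real_le)
    fix t :: real assume t: "t > 0"
    have "0 \<le> (v * t - M)\<^sup>2 / t" using t by simp
    also have "(v * t - M)\<^sup>2 / t = v\<^sup>2 * t + M\<^sup>2 / t - 2 * (v * M)"
      using t by (simp add: power2_eq_square field_simps)
    finally have 1: "2 * (v * M) \<le> v\<^sup>2 * t + M\<^sup>2 / t" by simp
    have "1 \<le> M\<^sup>2" using M by simp
    then have 2: "v\<^sup>2 * t + 1 / t \<le> v\<^sup>2 * t + M\<^sup>2 / t" using t by (simp add: divide_right_mono)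
    have "v * M + v\<^sup>2 / 2 * t + 1 / 2 / t \<le> v\<^sup>2 * t + M\<^sup>2 / t"
      using 1 2 by (simp add: field_simps)
    then have "pi * (v * M + v\<^sup>2 / 2 * t + 1 / 2 / t) \<le> pi * (v\<^sup>2 * t + M\<^sup>2 / t)"
      by (intro mult_left_mono) auto
    then show "pi * v * M + pi * v\<^sup>2 / 2 * t + pi / 2 / t \<le> pi * v\<^sup>2 * t + pi * M\<^sup>2 / t"
      by (simp add: distrib_left mult.assoc)
  qed (use v M in auto)
  also have "exp (- (pi * v * M)) = exp (- (pi * v)) ^ Suc m"
    unfolding M_def exp_of_nat_mult[symmetric] by (simp add: mult_ac)
  finally show ?thesis by (simp add: M_def)
qed

lemma norm_bessel_int_fourier_le:
  assumes v: "v > 0"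
  shows "norm (bessel_int \<nu> (pi * v\<^sup>2) (pi * (real (Suc m))\<^sup>2)) \<le>
    exp (- (pi * v)) ^ Suc m * bessel_int_real (Re \<nu>) (pi * v\<^sup>2 / 2) (pi / 2)"
  by (rule order_trans[OF norm_bessel_int_le_real bessel_int_real_fourier_le[OF v]])
    (use v in auto)

lemma summable_exp_power:
  assumes "c > 0"
  shows "summable (\<lambda>m. exp (- c) ^ Suc m)" "summable (\<lambda>m. real (Suc m) * exp (- c) ^ Suc m)"
proof -
  show "summable (\<lambda>m. exp (- c) ^ Suc m)"
    using assms by (subst summable_Suc_iff) (auto intro!: summable_geometric)
  have "summable (\<lambda>n. real n * exp (- c) ^ n)"
    using assms sums_summable[OF geometric_deriv_sums[of "exp (- c)"]]
    by (subst summable_Suc_iff[symmetric]) (simp add: mult.left_commute[of _ "exp (- c)"] summable_mult)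
  then show "summable (\<lambda>m. real (Suc m) * exp (- c) ^ Suc m)" by (subst summable_Suc_iff)
qed

text \<open>Gamma(u) pi^(-u) q^(-u) is the Mellin integral of exp(-pi q t). Summed over d, the
  integrand becomes exp(-pi v^2 t) times a theta series, and the integral is evaluated a second time
  through \<open>dual_theta\<close>: the constant term gives the Gamma value at u - 1/2, each
  frequency a Bessel integral.\<close>

theorem poisson_quadratic:
  fixes a v :: real
  assumes u: "Re u > 1/2" and v: "v > 0"
  defines "q \<equiv> \<lambda>d::int. (a + of_int d)\<^sup>2 + v\<^sup>2"
  shows "((\<lambda>d. complex_of_real (q d) powr (- u)) has_sum
      of_real pi powr u / Gamma u * (Gamma (u - 1/2) * of_real (pi * v\<^sup>2) powr (1/2 - u) +
        (\<Sum>m. 2 * cos_mode a (Suc m) *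
          bessel_int (u - 1/2) (pi * v\<^sup>2) (pi * (real (Suc m))\<^sup>2)))) UNIV"
proof -
  let ?Z = "\<lambda>m t. exp (- (pi * v\<^sup>2) * t - (pi * (real (Suc m))\<^sup>2) / t)"
  let ?X = "\<lambda>m t. exp (- pi * (real (Suc m))\<^sup>2 / t)"
  let ?G = "\<lambda>t. complex_of_real t powr (u - 1) * of_real (exp (- (pi * v\<^sup>2) * t)) * of_real (dual_theta t a)"
  have qpos: "q d > 0" for d using v by (simp add: q_def add_nonneg_pos)
  have sm_on: "(\<lambda>d. q d powr (- Re u)) summable_on UNIV"
  proof (rule summable_on_comparison_test)
    show "(\<lambda>d. (v\<^sup>2 / (\<bar>a\<bar>\<^sup>2 + v\<^sup>2 + 1)) powr (- Re u) * int_wt d powr (- (2 * Re u))) summable_on UNIV"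
      using u by (intro summable_on_cmult_right summable_on_int_wt) auto
    show "q d powr (- Re u) \<le> (v\<^sup>2 / (\<bar>a\<bar>\<^sup>2 + v\<^sup>2 + 1)) powr (- Re u) * int_wt d powr (- (2 * Re u))" for d
      unfolding q_def using u by (intro quadratic_powr_le v) auto
  qed auto
  define Q where "Q = (\<lambda>k. q (int_decode k))"
  have Qpos: "Q k > 0" for k using qpos by (simp add: Q_def)
  have Qsm: "summable (\<lambda>k. Q k powr (- Re u))"
  proof (rule summable_on_imp_summable)
    show "(\<lambda>k. Q k powr (- Re u)) summable_on UNIV"
      unfolding Q_def using sm_on by (subst summable_on_reindex_bij_betw[OF bij_int_decode])
  qed
  have u0: "Re u > 0" using u by simp
  define f where "f = (\<lambda>k t. indicat_real {0<..} t *\<^sub>R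
      (complex_of_real t powr (u - 1) * of_real (exp (- (pi * Q k) * t))))"
  note g = gamma_integral_lborel[OF _ u0]
  have piQ: "pi * Q k > 0" for k using Qpos by simp
  have fi: "integrable lborel (f k)" for k
    using g(1)[OF piQ, of k] by (simp add: set_integrable_def f_def)
  have fval: "integral\<^sup>L lborel (f k) = Gamma u * of_real pi powr (- u) * of_real (Q k) powr (- u)" for k
  proof -
    have "integral\<^sup>L lborel (f k) = Gamma u * of_real (pi * Q k) powr (- u)"
      using g(2)[OF piQ, of k] by (simp add: set_lebesgue_integral_def f_def)
    then show ?thesis using Qpos[of k] by (simp add: powr_times_real)
  qed
  have nval: "(LBINT t. norm (f k t)) = Gamma (Re u) * pi powr (- Re u) * Q k powr (- Re u)" for k
  proof -
    have "(LBINT t. norm (f k t)) = (LBINT t:{0<..}. t powr (Re u - 1) * exp (- (pi * Q k) * t))"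
      unfolding set_lebesgue_integral_def
      by (intro Bochner_Integration.integral_cong) (auto simp: f_def indicator_def norm_mult norm_powr_pos)
    also have "\<dots> = Gamma (Re u) * (pi * Q k) powr (- Re u)"
      by (rule gamma_integral_lborel_real(2)[OF piQ u0])
    finally show ?thesis using Qpos[of k] by (simp add: powr_mult)
  qed
  have sm: "summable (\<lambda>k. LBINT t. norm (f k t))"
    unfolding nval by (intro summable_mult Qsm)
  have theta: "(\<lambda>k. exp (- pi * t * (a + of_int (int_decode k))\<^sup>2)) sums dual_theta t a" if "t > 0" for t
    by (rule has_sum_imp_sums, subst has_sum_reindex_bij_betw[OF bij_int_decode])
      (rule theta_transformation[OF that])
  have fk: "f k t = (complex_of_real t powr (u - 1) * of_real (exp (- (pi * v\<^sup>2) * t))) *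
      of_real (exp (- pi * t * (a + of_int (int_decode k))\<^sup>2))" if "t > 0" for k t
  proof -
    have "exp (- (pi * Q k) * t) = exp (- (pi * v\<^sup>2) * t) * exp (- pi * t * (a + of_int (int_decode k))\<^sup>2)"
      unfolding exp_add[symmetric] by (simp add: Q_def q_def algebra_simps)
    then show ?thesis using that by (simp add: f_def)
  qed
  have ae: "AE t in lborel. summable (\<lambda>k. norm (f k t))"
  proof (rule AE_I2)
    fix t :: real
    show "summable (\<lambda>k. norm (f k t))"
    proof (cases "t > 0")
      case True
      have "summable (\<lambda>k. norm (complex_of_real t powr (u - 1) * of_real (exp (- (pi * v\<^sup>2) * t))) *
          exp (- pi * t * (a + of_int (int_decode k))\<^sup>2))"
        by (intro summable_mult sums_summable[OF theta[OF True]])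
      then show ?thesis using True by (simp add: fk norm_mult)
    qed (simp add: f_def)
  qed
  have eq: "(\<Sum>k. f k t) = indicat_real {0<..} t *\<^sub>R (?G t)" for t
  proof (cases "t > 0")
    case True
    have "(\<lambda>k. f k t) sums (?G t)"
      unfolding fk[OF True] by (intro sums_mult sums_of_real theta True)
    then show ?thesis using True by (simp add: sums_unique[symmetric])
  qed (simp add: f_def)
  \<comment> \<open>First evaluation: \<open>?G\<close> is the integrand summed over the integers
    d.\<close>
  have L: "(\<lambda>k. Gamma u * of_real pi powr (- u) * of_real (Q k) powr (- u)) sums
      (LBINT t:{0<..}. ?G t)"
    using sums_integral[OF fi ae sm] unfolding eq fval set_lebesgue_integral_def .
  define C where "C = (\<lambda>m. 2 * cos_mode a (Suc m))"
  have C: "norm (C m) \<le> 2" for m by (simp add: C_def norm_mult)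
  define b where "b = (\<lambda>m. bessel_int (u - 1/2) (pi * v\<^sup>2) (pi * (real (Suc m))\<^sup>2))"
  define h where "h = (\<lambda>m t. indicat_real {0<..} t *\<^sub>R (C m *
      (of_real (?Z m t) * complex_of_real t powr (u - 1/2 - 1))))"
  have A: "pi * v\<^sup>2 > 0" using v by simp
  have B: "pi * (real (Suc m))\<^sup>2 > 0" for m by simp
  have hi: "integrable lborel (h m)" for m
    using set_integrable_mult_right[OF set_integrable_bessel_int[OF A B[of m]], of "C m" "u - 1/2 - 1"]
    by (simp add: set_integrable_def h_def)
  have hval: "integral\<^sup>L lborel (h m) = C m * b m" for m
  proof -
    have "integral\<^sup>L lborel (h m) = (LBINT t:{0<..}. C m *
      (of_real (?Z m t) * complex_of_real t powr (u - 1/2 - 1)))"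
      by (simp only: h_def set_lebesgue_integral_def)
    then show ?thesis by (simp only: set_integral_mult_right b_def bessel_int_def)
  qed
  have hn: "(LBINT t. norm (h m t)) \<le> 2 * (exp (- (pi * v)) ^ Suc m * bessel_int_real (Re u - 1/2) (pi * v\<^sup>2 / 2) (pi / 2))" for m
  proof -
    have i: "set_integrable lborel {0<..} (\<lambda>t. ?Z m t * t powr (Re u - 1/2 - 1))"
      by (rule set_integrable_bessel_int_real[OF A B])
    have "(LBINT t. norm (h m t)) = (LBINT t:{0<..}. norm (C m) *
        (?Z m t * t powr (Re u - 1/2 - 1)))"
      unfolding set_lebesgue_integral_def
      by (intro Bochner_Integration.integral_cong) (auto simp: h_def indicator_def norm_mult norm_powr_pos)
    also have "\<dots> = norm (C m) * (LBINT t:{0<..}.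
        ?Z m t * t powr (Re u - 1/2 - 1))"
      by (rule set_integral_mult_right)
    also have "\<dots> = norm (C m) * bessel_int_real (Re u - 1/2) (pi * v\<^sup>2) (pi * (real (Suc m))\<^sup>2)"
      by (simp only: bessel_int_real_def)
    also have "\<dots> \<le> 2 * (exp (- (pi * v)) ^ Suc m * bessel_int_real (Re u - 1/2) (pi * v\<^sup>2 / 2) (pi / 2))"
      by (intro mult_mono C bessel_int_real_fourier_le v bessel_int_real_nonneg) simp
    finally show ?thesis .
  qed
  have "pi * v > 0" using v by simp
  from summable_exp_power(1)[OF this]
  have "summable (\<lambda>m. 2 * (exp (- (pi * v)) ^ Suc m * bessel_int_real (Re u - 1/2) (pi * v\<^sup>2 / 2) (pi / 2)))"
    by (intro summable_mult summable_mult2)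
  then have hs: "summable (\<lambda>m. LBINT t. norm (h m t))"
  proof (rule summable_comparison_test'[of _ 0])
    fix m
    have "0 \<le> (LBINT t. norm (h m t))" by (rule Bochner_Integration.integral_nonneg) simp
    with hn[of m] show "norm (LBINT t. norm (h m t)) \<le>
        2 * (exp (- (pi * v)) ^ Suc m * bessel_int_real (Re u - 1/2) (pi * v\<^sup>2 / 2) (pi / 2))"
      by (simp only: real_norm_def abs_of_nonneg)
  qed
  have dual: "(\<lambda>m. ?X m t * cos (2 * pi * real (Suc m) * a)) sums
      ((dual_theta t a * sqrt t - 1) / 2)" "summable (\<lambda>m. ?X m t)" if t: "t > 0" for t
  proof -
    have "summable (\<lambda>m. ?X m t * cos (2 * pi * real (Suc m) * a))"
      by (rule summable_comparison_test'[OF summable_exp_square[OF t], of 0]) (auto simp: abs_mult intro!: mult_left_le)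
    then show "(\<lambda>m. ?X m t * cos (2 * pi * real (Suc m) * a)) sums
      ((dual_theta t a * sqrt t - 1) / 2)"
      using t by (simp add: dual_theta_def summable_sums)
  qed (rule summable_exp_square[OF t])
  have hm: "h m t = (2 * (of_real (exp (- (pi * v\<^sup>2) * t)) * complex_of_real t powr (u - 1/2 - 1))) *
      of_real (?X m t * cos (2 * pi * real (Suc m) * a))" if "t > 0" for m t
  proof -
    have "?Z m t =
        exp (- (pi * v\<^sup>2) * t) * ?X m t"
      unfolding exp_add[symmetric] by simp
    then show ?thesis using that by (simp add: h_def C_def)
  qed
  have hae: "AE t in lborel. summable (\<lambda>m. norm (h m t))"
  proof (rule AE_I2)
    fix t :: real
    show "summable (\<lambda>m. norm (h m t))"
    proof (cases "t > 0")
      case True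
      show ?thesis
      proof (rule summable_comparison_test'[OF summable_mult[OF dual(2)[OF True]], of 0])
        show "norm (norm (h m t)) \<le> norm (2 * (of_real (exp (- (pi * v\<^sup>2) * t)) * complex_of_real t powr (u - 1/2 - 1))) *
            ?X m t" for m
          unfolding hm[OF True] by (simp only: norm_mult norm_of_real abs_mult real_norm_def)
            (auto simp: abs_mult intro!: mult_left_mono mult_left_le)
      qed
    qed (simp add: h_def)
  qed
  have heq: "(\<Sum>m. h m t) = indicat_real {0<..} t *\<^sub>R
      (?G t -
       complex_of_real t powr (u - 1/2 - 1) * of_real (exp (- (pi * v\<^sup>2) * t)))" for t
  proof (cases "t > 0")
    case True
    have p: "complex_of_real t powr (u - 1) = complex_of_real t powr (u - 1/2 - 1) * of_real (sqrt t)"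
    proof -
      have "complex_of_real (sqrt t) = of_real t powr (1/2)"
        using True by (simp add: powr_half_sqrt[symmetric] powr_of_pos_real powr_def Ln_of_real flip: exp_of_real)
      then show ?thesis by (simp flip: powr_add)
    qed
    have "(\<lambda>m. h m t) sums (2 * (of_real (exp (- (pi * v\<^sup>2) * t)) * complex_of_real t powr (u - 1/2 - 1)) *
        of_real ((dual_theta t a * sqrt t - 1) / 2))"
      unfolding hm[OF True] by (intro sums_mult sums_of_real dual True)
    then have S: "(\<Sum>m. h m t) = 2 * (of_real (exp (- (pi * v\<^sup>2) * t)) * complex_of_real t powr (u - 1/2 - 1)) *
        of_real ((dual_theta t a * sqrt t - 1) / 2)"
      by (rule sums_unique[symmetric])
    have T: "2 * X * of_real ((D * r - 1) / 2) = X * (of_real D * of_real r - 1)"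
      for X :: complex and D r :: real
    proof -
      have "of_real ((D * r - 1) / 2) = (complex_of_real D * of_real r - 1) / 2" by simp
      then show ?thesis by (simp only:) simp
    qed
    show ?thesis using True unfolding S T p by (simp add: algebra_simps)
  qed (simp add: h_def)
  \<comment> \<open>Second evaluation: the constant term 1 / sqrt t of \<open>dual_theta\<close> is
    taken out of \<open>?G\<close>, and the remainder is summed over the frequencies.\<close>
  have H: "(\<lambda>m. C m * b m) sums (LBINT t:{0<..}. ?G t -
       complex_of_real t powr (u - 1/2 - 1) * of_real (exp (- (pi * v\<^sup>2) * t)))"
    using sums_integral[OF hi hae hs] unfolding heq hval set_lebesgue_integral_def .
  have Li: "set_integrable lborel {0<..} (\<lambda>t. ?G t)"
    using integrable_suminf[OF fi ae sm] unfolding eq set_integrable_def .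
  have "Re (u - 1/2) > 0" using u by simp
  note g0 = gamma_integral_lborel[OF A this]
  have "(\<Sum>m. C m * b m) = (LBINT t:{0<..}. ?G t) -
     Gamma (u - 1/2) * of_real (pi * v\<^sup>2) powr (- (u - 1/2))"
    using sums_unique[OF H] unfolding set_integral_diff(2)[OF Li g0(1)] g0(2) by simp
  then have I: "(LBINT t:{0<..}. ?G t) =
     Gamma (u - 1/2) * of_real (pi * v\<^sup>2) powr (1/2 - u) + (\<Sum>m. C m * b m)" by simp
  have Gu: "Gamma u \<noteq> 0" using u0 by (auto simp: Gamma_eq_zero_iff elim!: nonpos_Ints_cases)
  have pipi: "of_real pi powr u * of_real pi powr (- u) = (1::complex)" by (simp add: powr_minus)
  have "(\<lambda>k. of_real pi powr u / Gamma u * (Gamma u * of_real pi powr (- u) * of_real (Q k) powr (- u))) sums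
      (of_real pi powr u / Gamma u * (Gamma (u - 1/2) * of_real (pi * v\<^sup>2) powr (1/2 - u) + (\<Sum>m. C m * b m)))"
    using sums_mult[OF L] unfolding I .
  moreover have "of_real pi powr u / Gamma u * (Gamma u * of_real pi powr (- u) * of_real (Q k) powr (- u)) =
      of_real (Q k) powr (- u)" for k
  proof -
    have "of_real pi powr u / Gamma u * (Gamma u * of_real pi powr (- u) * of_real (Q k) powr (- u)) =
      (of_real pi powr u * of_real pi powr (- u)) * of_real (Q k) powr (- u)"
      using Gu by (simp add: field_simps)
    then show ?thesis unfolding pipi by simp
  qed
  ultimately have "(\<lambda>k. complex_of_real (Q k) powr (- u)) sums
      (of_real pi powr u / Gamma u * (Gamma (u - 1/2) * of_real (pi * v\<^sup>2) powr (1/2 - u) + (\<Sum>m. C m * b m)))"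
    by simp
  moreover have "summable (\<lambda>k. norm (complex_of_real (Q k) powr (- u)))"
    using Qsm Qpos by (simp add: norm_powr_pos)
  ultimately have "((\<lambda>k. complex_of_real (Q k) powr (- u)) has_sum
      (of_real pi powr u / Gamma u * (Gamma (u - 1/2) * of_real (pi * v\<^sup>2) powr (1/2 - u) + (\<Sum>m. C m * b m)))) UNIV"
    by (intro norm_summable_imp_has_sum)
  then show "((\<lambda>d. complex_of_real (q d) powr (- u)) has_sum
      of_real pi powr u / Gamma u * (Gamma (u - 1/2) * of_real (pi * v\<^sup>2) powr (1/2 - u) +
        (\<Sum>m. 2 * cos_mode a (Suc m) *
          bessel_int (u - 1/2) (pi * v\<^sup>2) (pi * (real (Suc m))\<^sup>2)))) UNIV"
    unfolding Q_def C_def b_def by (subst (asm) has_sum_reindex_bij_betw[OF bij_int_decode])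
qed

lemma has_vector_derivative_suminf:
  fixes f :: "nat \<Rightarrow> real \<Rightarrow> complex"
  assumes S: "convex S" "open S"
    and deriv: "\<And>n x. x \<in> S \<Longrightarrow> (f n has_vector_derivative f' n x) (at x)"
    and bound: "\<And>n x. x \<in> S \<Longrightarrow> norm (f' n x) \<le> M n" and M: "summable M"
    and x: "x \<in> S" and sm: "summable (\<lambda>n. f n x)"
  shows "((\<lambda>x. \<Sum>n. f n x) has_vector_derivative (\<Sum>n. f' n x)) (at x)"
proof -
  have ul: "uniform_limit S (\<lambda>n x. \<Sum>i<n. f' i x) (\<lambda>x. \<Sum>i. f' i x) sequentially"
    by (rule Weierstrass_m_test[OF bound M])
  have "\<exists>g. \<forall>x\<in>S. (\<lambda>n. f n x) sums (g x) \<and>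
      (g has_derivative (\<lambda>h. h *\<^sub>R (\<Sum>i. f' i x))) (at x within S)"
  proof (rule has_derivative_series[where S = S and f = f and x = x])
    show "convex S" "x \<in> S" "(\<lambda>n. f n x) sums (\<Sum>n. f n x)"
      by (rule S x summable_sums[OF sm])+
    show "(f n has_derivative (\<lambda>h. h *\<^sub>R f' n x)) (at x within S)" if "x \<in> S" for n x
      using deriv[OF that, of n] by (auto simp: has_vector_derivative_def intro: has_derivative_at_withinI)
    show "\<forall>\<^sub>F n in sequentially. \<forall>x\<in>S. \<forall>h.
        norm ((\<Sum>i<n. h *\<^sub>R f' i x) - h *\<^sub>R (\<Sum>i. f' i x)) \<le> e * norm h" if "e > 0" for e
    proof -
      have "\<forall>\<^sub>F n in sequentially. \<forall>x\<in>S. dist (\<Sum>i<n. f' i x) (\<Sum>i. f' i x) < e"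
        using ul that by (auto simp: uniform_limit_iff)
      then show ?thesis
      proof eventually_elim
        case (elim n)
        show ?case
        proof (intro ballI allI)
          fix x and h :: real assume "x \<in> S"
          have "norm ((\<Sum>i<n. h *\<^sub>R f' i x) - h *\<^sub>R (\<Sum>i. f' i x)) =
              \<bar>h\<bar> * norm ((\<Sum>i<n. f' i x) - (\<Sum>i. f' i x))"
            by (simp add: scaleR_sum_right[symmetric] scaleR_diff_right[symmetric])
          also have "\<dots> \<le> \<bar>h\<bar> * e"
            using elim \<open>x \<in> S\<close> by (intro mult_left_mono) (auto simp: dist_norm less_imp_le)
          finally show "norm ((\<Sum>i<n. h *\<^sub>R f' i x) - h *\<^sub>R (\<Sum>i. f' i x)) \<le> e * norm h"
            by (simp add: mult.commute)
        qed
      qed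
    qed
  qed
  then obtain g where g: "\<And>x. x \<in> S \<Longrightarrow> (\<lambda>n. f n x) sums (g x)"
    "\<And>x. x \<in> S \<Longrightarrow> (g has_derivative (\<lambda>h. h *\<^sub>R (\<Sum>i. f' i x))) (at x within S)" by blast
  have "(g has_derivative (\<lambda>h. h *\<^sub>R (\<Sum>i. f' i x))) (at x)"
    using g(2)[OF x] S x by (simp add: at_within_open[of x S])
  then have "((\<lambda>x. \<Sum>n. f n x) has_derivative (\<lambda>h. h *\<^sub>R (\<Sum>i. f' i x))) (at x)"
    by (rule has_derivative_transform_within_open[OF _ S(2) x]) (use g(1) in \<open>simp add: sums_iff\<close>)
  then show ?thesis by (simp add: has_vector_derivative_def)
qed

text \<open>The derivative of \<open>poisson_quadratic\<close> at u = w - 1 with respect to the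
  shift a. On the left q^(-u) yields -2u (a + d) q^(-w); on the right the constant term disappears
  and each cosine becomes a sine with factor -2 pi m. The relation Gamma(w) = u Gamma(u) removes the
  factor u.\<close>

theorem poisson_linear:
  fixes a v :: real
  assumes w: "Re w > 3/2" and v: "v > 0"
  defines "q \<equiv> \<lambda>d::int. (a + of_int d)\<^sup>2 + v\<^sup>2"
  shows "((\<lambda>d. of_real (a + of_int d) * complex_of_real (q d) powr (- w)) has_sum
      of_real pi powr w / Gamma w * (\<Sum>m. 2 * of_real (real (Suc m) * sin (2 * pi * real (Suc m) * a)) *
          bessel_int (w - 3/2) (pi * v\<^sup>2) (pi * (real (Suc m))\<^sup>2))) UNIV"
proof -
  let ?e = "\<lambda>m. real (Suc m) * exp (- (pi * v)) ^ Suc m"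
  define u where "u = w - 1"
  have u: "Re u > 1/2" using w by (simp add: u_def)
  define Q where "Q = (\<lambda>k x. (x + real_of_int (int_decode k))\<^sup>2 + v\<^sup>2)"
  have Qpos: "Q k x > 0" for k x using v by (simp add: Q_def add_nonneg_pos)
  let ?g = "\<lambda>k. of_real (a + of_int (int_decode k)) * complex_of_real (Q k a) powr (- w)"
  \<comment> \<open>A neighbourhood of a on which both differentiated series have majorants
    independent of x.\<close>
  define S where "S = {a - 1<..<a + 1}"
  have S: "convex S" "open S" "a \<in> S" by (auto simp: S_def)
  define A where "A = \<bar>a\<bar> + 1"
  define f where "f = (\<lambda>k x. complex_of_real (Q k x) powr (- u))"
  define f' where "f' = (\<lambda>k x. - 2 * u * (of_real (x + of_int (int_decode k)) * complex_of_real (Q k x) powr (- w)))"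
  define D where "D = (v\<^sup>2 / (A\<^sup>2 + v\<^sup>2 + 1)) powr (- (Re w - 1/2))"
  have term_le: "norm (of_real (x + of_int (int_decode k)) * complex_of_real (Q k x) powr (- w)) \<le>
      D * int_wt (int_decode k) powr (- (2 * (Re w - 1/2)))" if "\<bar>x\<bar> \<le> A" for k x
  proof -
    have "\<bar>x + of_int (int_decode k)\<bar> \<le> sqrt (Q k x)"
      by (rule real_le_rsqrt) (simp add: Q_def)
    also have "\<dots> = Q k x powr (1/2)" using Qpos[of k x] by (simp add: powr_half_sqrt)
    finally have "\<bar>x + of_int (int_decode k)\<bar> * Q k x powr (- Re w) \<le> Q k x powr (1/2) * Q k x powr (- Re w)"
      by (rule mult_right_mono) simp
    then have "norm (of_real (x + of_int (int_decode k)) * complex_of_real (Q k x) powr (- w)) \<le>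
        Q k x powr (1/2) * Q k x powr (- Re w)"
      by (simp only: norm_mult norm_of_real norm_powr_pos[OF Qpos] uminus_complex.simps)
    also have "\<dots> = Q k x powr (- (Re w - 1/2))" by (simp flip: powr_add)
    also have "\<dots> \<le> D * int_wt (int_decode k) powr (- (2 * (Re w - 1/2)))"
      unfolding D_def Q_def by (rule quadratic_powr_le[OF v that]) (use w in simp)
    finally show ?thesis .
  qed
  have SA: "\<bar>x\<bar> \<le> A" if "x \<in> S" for x using that by (auto simp: S_def A_def)
  have sm1: "summable (\<lambda>k. D * int_wt (int_decode k) powr (- (2 * (Re w - 1/2))))"
    using w by (intro summable_mult summable_int_wt) simp
  have nsm: "summable (\<lambda>k. norm (?g k))"
    by (rule summable_comparison_test'[OF sm1, of 0]) (use term_le SA S(3) in auto)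
  have qQ: "q (int_decode k) = Q k a" for k by (simp add: q_def Q_def)
  define c where "c = of_real pi powr u / Gamma u"
  define b where "b = (\<lambda>m. bessel_int (u - 1/2) (pi * v\<^sup>2) (pi * (real (Suc m))\<^sup>2))"
  define B where "B = bessel_int_real (Re u - 1/2) (pi * v\<^sup>2 / 2) (pi / 2)"
  have bB: "norm (b m) \<le> exp (- (pi * v)) ^ Suc m * B" for m
    using norm_bessel_int_fourier_le[OF v, of "u - 1/2" m] by (simp add: b_def B_def)
  have "pi * v > 0" using v by simp
  note e = summable_exp_power[OF this]
  define h where "h = (\<lambda>m x. 2 * cos_mode x (Suc m) * b m)"
  define h' where "h' = (\<lambda>m x. (- (4 * pi * real (Suc m) * sin (2 * pi * real (Suc m) * x))) *\<^sub>R b m)"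
  have hsm: "summable (\<lambda>m. h m x)" for x
  proof (rule summable_comparison_test'[OF summable_mult[OF summable_mult2[OF e(1)]], of 0])
    show "norm (h m x) \<le> 2 * (exp (- (pi * v)) ^ Suc m * B)" for m
    proof -
      have "norm (h m x) = 2 * \<bar>cos (2 * pi * real (Suc m) * x)\<bar> * norm (b m)"
        by (simp add: h_def norm_mult)
      also have "\<dots> \<le> 2 * 1 * (exp (- (pi * v)) ^ Suc m * B)"
        by (intro mult_mono bB) auto
      finally show ?thesis by simp
    qed
  qed
  have h'_le: "norm (h' m x) \<le> 4 * pi * B * (?e m)" for m x
  proof -
    have "norm (h' m x) = (4 * pi * real (Suc m) * \<bar>sin (2 * pi * real (Suc m) * x)\<bar>) * norm (b m)"
      by (simp add: h'_def abs_mult)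
    also have "\<dots> \<le> (4 * pi * real (Suc m) * 1) * (exp (- (pi * v)) ^ Suc m * B)"
      by (intro mult_mono mult_left_mono bB) auto
    finally show ?thesis by (simp only: mult_ac mult_1_right)
  qed
  define E where "E = c * (Gamma (u - 1/2) * of_real (pi * v\<^sup>2) powr (1/2 - u))"
  have eq: "(\<Sum>k. f k x) = E + c * (\<Sum>m. h m x)" and fsm: "summable (\<lambda>k. f k x)" for x
  proof -
    have "((\<lambda>k. f k x) has_sum E + c * (\<Sum>m. h m x)) UNIV"
      using poisson_quadratic[OF u v, of x]
      unfolding f_def Q_def E_def c_def h_def b_def distrib_left
      by (subst has_sum_reindex_bij_betw[OF bij_int_decode])
    then have "(\<lambda>k. f k x) sums (E + c * (\<Sum>m. h m x))" by (rule has_sum_imp_sums)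
    then show "(\<Sum>k. f k x) = E + c * (\<Sum>m. h m x)" "summable (\<lambda>k. f k x)"
      by (auto simp: sums_iff)
  qed
  have 1: "((\<lambda>x. \<Sum>k. f k x) has_vector_derivative (\<Sum>k. f' k a)) (at a)"
  proof (rule has_vector_derivative_suminf[OF S(1,2) _ _ _ S(3) fsm])
    show "summable (\<lambda>k. norm (2 * u) * (D * int_wt (int_decode k) powr (- (2 * (Re w - 1/2)))))"
      by (rule summable_mult[OF sm1])
    fix k x assume x: "x \<in> S"
    show "norm (f' k x) \<le> norm (2 * u) * (D * int_wt (int_decode k) powr (- (2 * (Re w - 1/2))))"
      using mult_left_mono[OF term_le[OF SA[OF x], of k], of "norm (2 * u)"]
      by (simp add: f'_def norm_mult)
    have "((\<lambda>x. Q k x) has_vector_derivative 2 * (x + of_int (int_decode k))) (at x)"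
      unfolding Q_def has_real_derivative_iff_has_vector_derivative[symmetric]
      by (auto intro!: derivative_eq_intros)
    from vector_diff_chain_at[OF this powr_complex_has_real_derivative[OF Qpos, of "- u"]]
    have "(f k has_vector_derivative (2 * (x + of_int (int_decode k))) *\<^sub>R (- u * of_real (Q k x) powr (- u - 1))) (at x)"
      by (simp add: f_def o_def)
    also have "(2 * (x + of_int (int_decode k))) *\<^sub>R (- u * of_real (Q k x) powr (- u - 1)) = f' k x"
      by (simp add: f'_def u_def scaleR_conv_of_real algebra_simps)
    finally show "(f k has_vector_derivative f' k x) (at x)" .
  qed
  have 2: "((\<lambda>x. \<Sum>m. h m x) has_vector_derivative (\<Sum>m. h' m a)) (at a)"
  proof (rule has_vector_derivative_suminf[OF S(1,2) _ _ _ S(3) hsm])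
    show "summable (\<lambda>m. 4 * pi * B * (?e m))"
      by (rule summable_mult[OF e(2)])
    fix m x
    show "norm (h' m x) \<le> 4 * pi * B * (?e m)" by (rule h'_le)
    have "((\<lambda>x. 2 * cos (2 * pi * real (Suc m) * x)) has_real_derivative
        - (4 * pi * real (Suc m) * sin (2 * pi * real (Suc m) * x))) (at x)"
      by (auto intro!: derivative_eq_intros)
    then have "((\<lambda>x. (2 * cos (2 * pi * real (Suc m) * x)) *\<^sub>R b m) has_vector_derivative h' m x) (at x)"
      unfolding h'_def by (rule has_vector_derivative_scaleR[OF _ has_vector_derivative_const, simplified])
    then show "(h m has_vector_derivative h' m x) (at x)"
      by (simp add: h_def scaleR_conv_of_real)
  qed
  have "((\<lambda>x. E + c * (\<Sum>m. h m x)) has_vector_derivative 0 + c * (\<Sum>m. h' m a)) (at a)"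
    by (intro has_vector_derivative_add has_vector_derivative_const has_vector_derivative_mult_right 2)
  then have main: "(\<Sum>k. f' k a) = c * (\<Sum>m. h' m a)"
    using 1 unfolding eq by (simp add: vector_derivative_unique_at)
  have u0: "u \<noteq> 0" using u by auto
  have Gu: "u \<notin> \<int>\<^sub>\<le>\<^sub>0" using u by (auto elim!: nonpos_Ints_cases)
  have Gw: "Gamma w = u * Gamma u" using Gamma_plus1[OF Gu] by (simp add: u_def)
  have piw: "of_real pi powr w = complex_of_real pi powr u * of_real pi"
    by (simp add: u_def powr_diff)
  have L: "(\<Sum>k. f' k a) = - 2 * u * (\<Sum>k. ?g k)"
    unfolding f'_def by (rule suminf_mult[OF summable_norm_cancel[OF nsm]])
  have h'eq: "h' m a = - 2 * of_real pi * (2 * of_real (real (Suc m) * sin (2 * pi * real (Suc m) * a)) * b m)" for m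
    by (simp add: h'_def scaleR_conv_of_real)
  have h'sm: "summable (\<lambda>m. h' m a)"
    by (rule summable_comparison_test'[OF summable_mult[OF e(2), of "4 * pi * B"], of 0]) (rule h'_le)
  have "summable (\<lambda>m. 2 * of_real (real (Suc m) * sin (2 * pi * real (Suc m) * a)) * b m)"
    using h'sm unfolding h'eq by (subst (asm) summable_cmult_iff) simp
  then have R: "(\<Sum>m. h' m a) = - 2 * of_real pi * (\<Sum>m. 2 * of_real (real (Suc m) * sin (2 * pi * real (Suc m) * a)) * b m)"
    unfolding h'eq by (rule suminf_mult)
  have "(\<Sum>k. ?g k) =
      of_real pi powr w / Gamma w * (\<Sum>m. 2 * of_real (real (Suc m) * sin (2 * pi * real (Suc m) * a)) * b m)"
  proof -
    have alg: "X = P * p / (u * G) * Y" if "- 2 * u * X = P / G * (- 2 * p * Y)" for X Y P G p :: complex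
      using that u0 by (cases "G = 0") (simp_all add: field_simps)
    show ?thesis
      unfolding Gw piw by (rule alg) (use main in \<open>simp only: L R c_def\<close>)
  qed
  moreover have "((\<lambda>k. ?g k) has_sum
      (\<Sum>k. ?g k)) UNIV"
    by (rule norm_summable_imp_has_sum[OF nsm summable_sums[OF summable_norm_cancel[OF nsm]]])
  ultimately have hs: "((\<lambda>k. of_real (a + of_int (int_decode k)) * complex_of_real (q (int_decode k)) powr (- w)) has_sum
      of_real pi powr w / Gamma w * (\<Sum>m. 2 * of_real (real (Suc m) * sin (2 * pi * real (Suc m) * a)) * b m)) UNIV"
    by (simp only: qQ)
  have "b m = bessel_int (w - 3/2) (pi * v\<^sup>2) (pi * (real (Suc m))\<^sup>2)" for m
  proof -
    have "u - 1/2 = w - 3/2" by (simp add: u_def)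
    then show ?thesis by (simp only: b_def)
  qed
  then show "((\<lambda>d. of_real (a + of_int d) * complex_of_real (q d) powr (- w)) has_sum
      of_real pi powr w / Gamma w * (\<Sum>m. 2 * of_real (real (Suc m) * sin (2 * pi * real (Suc m) * a)) *
          bessel_int (w - 3/2) (pi * v\<^sup>2) (pi * (real (Suc m))\<^sup>2))) UNIV"
    using hs by (subst (asm) has_sum_reindex_bij_betw[OF bij_int_decode]) simp
qed

section \<open>Lattice sums\<close>

definition lattice_pairs :: "(nat \<times> int) set" where
  "lattice_pairs = {1..} \<times> UNIV"

definition coprime_pairs :: "(nat \<times> int) set" where
  "coprime_pairs = {(c, d). c \<ge> 1 \<and> coprime (int c) d}"

lemma coprime_pairs_subset: "coprime_pairs \<subseteq> lattice_pairs"
  by (auto simp: coprime_pairs_def lattice_pairs_def)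

lemma bij_betw_coprime_pairs:
  "bij_betw (\<lambda>(g, c, d). (g * c, int g * d)) ({1..} \<times> coprime_pairs) lattice_pairs"
proof (rule bij_betwI)
  let ?f = "\<lambda>(g :: nat, c :: nat, d :: int). (g * c, int g * d)"
  let ?h = "\<lambda>(c :: nat, d :: int). (nat (gcd (int c) d), c div nat (gcd (int c) d), d div gcd (int c) d)"
  show "?f \<in> {1..} \<times> coprime_pairs \<rightarrow> lattice_pairs"
    by (auto simp: coprime_pairs_def lattice_pairs_def)
  show "?h \<in> lattice_pairs \<rightarrow> {1..} \<times> coprime_pairs"
  proof safe
    fix c :: nat and d :: int assume cd: "(c, d) \<in> lattice_pairs"
    define g where "g = gcd (int c) d"
    have c: "c \<ge> 1" using cd by (simp add: lattice_pairs_def)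
    have g: "g > 0" using c by (simp add: g_def)
    then show "nat (gcd (int c) d) \<ge> 1" unfolding g_def by linarith
    have "int (c div nat g) = int c div g" using g by (simp add: zdiv_int)
    moreover have "coprime (int c div g) (d div g)"
      unfolding g_def by (rule div_gcd_coprime) (use c in simp)
    moreover have "int c div g > 0"
      using c g by (simp add: g_def pos_imp_zdiv_pos_iff zdvd_imp_le)
    ultimately show "(c div nat (gcd (int c) d), d div gcd (int c) d) \<in> coprime_pairs"
      by (simp add: coprime_pairs_def g_def[symmetric])
  qed
  show "?h (?f p) = p" if "p \<in> {1..} \<times> coprime_pairs" for p
  proof -
    obtain g c d where p: "p = (g, c, d)" by (cases p) auto
    have "gcd (int g * int c) (int g * d) = int g"
      using that by (simp add: p coprime_pairs_def gcd_mult_left coprime_imp_gcd_eq_1)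
    then show ?thesis using that by (simp add: p)
  qed
  show "?f (?h p) = p" if "p \<in> lattice_pairs" for p
  proof -
    obtain c d where p: "p = (c, d)" by (cases p) auto
    have c: "c \<ge> 1" using that by (simp add: p lattice_pairs_def)
    define g where "g = gcd (int c) d"
    have g: "g > 0" using c by (simp add: g_def)
    have "nat g dvd c" using g by (simp add: g_def nat_dvd_iff)
    then show ?thesis using g by (simp add: p g_def[symmetric]) (simp add: g_def)
  qed
qed

text \<open>Sorting the pairs by their gcd and using homogeneity of degree -z, the lattice sum
  factors as zeta(z) times the coprime sum; zeta does not vanish for Re z > 1.\<close>

lemma coprime_has_sum:
  fixes \<phi> :: "nat \<times> int \<Rightarrow> complex"
  assumes sm: "(\<phi> has_sum S) lattice_pairs" and z: "Re z > 1"
    and hom: "\<And>g c d. g \<ge> 1 \<Longrightarrow> c \<ge> 1 \<Longrightarrow> \<phi> (g * c, int g * d) = of_nat g powr (- z) * \<phi> (c, d)"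
  shows "(\<phi> has_sum (S / zeta z)) coprime_pairs"
proof -
  have "\<phi> summable_on coprime_pairs"
    using sm coprime_pairs_subset by (meson has_sum_imp_summable summable_on_subset)
  then obtain T where T: "(\<phi> has_sum T) coprime_pairs" by (auto simp: summable_on_def)
  have "((\<lambda>p. \<phi> ((\<lambda>(g, c, d). (g * c, int g * d)) p)) has_sum S) ({1..} \<times> coprime_pairs)"
    using sm by (subst has_sum_reindex_bij_betw[OF bij_betw_coprime_pairs])
  then have "((\<lambda>g. of_nat g powr (- z) * T) has_sum S) {1..}"
  proof (rule has_sum_SigmaD)
    fix g :: nat assume g: "g \<in> {1..}"
    have "((\<lambda>p. of_nat g powr (- z) * \<phi> p) has_sum of_nat g powr (- z) * T) coprime_pairs"
      by (rule has_sum_cmult_right[OF T])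
    then show "((\<lambda>p. \<phi> ((\<lambda>(g, c, d). (g * c, int g * d)) (g, p))) has_sum of_nat g powr (- z) * T) coprime_pairs"
      by (rule has_sum_cong[THEN iffD1, rotated]) (use g hom in \<open>auto simp: coprime_pairs_def\<close>)
  qed
  moreover have "((\<lambda>g. of_nat g powr (- z) * T) has_sum zeta z * T) {1..}"
    by (rule has_sum_cmult_left[OF zeta_has_sum[OF z]])
  ultimately have "S = zeta z * T" by (rule has_sum_unique)
  moreover have "zeta z \<noteq> 0"
    using norm_inverse_zeta_le[OF z] by (metis order_refl)
  ultimately show ?thesis using T by simp
qed

section \<open>Absolute convergence over all pairs, and divisor sums from row sums\<close>

definition lattice_form :: "real \<Rightarrow> real \<Rightarrow> nat \<times> int \<Rightarrow> real" where
  "lattice_form x y = (\<lambda>(c, d). (real c * x + of_int d)\<^sup>2 + (real c * y)\<^sup>2)"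

lemma lattice_form_pos: "y > 0 \<Longrightarrow> p \<in> lattice_pairs \<Longrightarrow> lattice_form x y p > 0"
  by (auto simp: lattice_form_def lattice_pairs_def intro!: add_nonneg_pos)

lemma lattice_form_mult:
  "lattice_form x y (g * c, int g * d) = (real g)\<^sup>2 * lattice_form x y (c, d)"
  by (simp add: lattice_form_def power2_eq_square algebra_simps)

text \<open>The form dominates c^2 + d^2 and hence the product of c and the weight of d. The sum is
  thus bounded by a product of two one-dimensional series, each convergent for \<sigma> > 1.\<close>

lemma summable_lattice_form_powr:
  assumes y: "y > 0" and \<sigma>: "\<sigma> > 1"
  shows "(\<lambda>p. lattice_form x y p powr (- \<sigma>)) summable_on lattice_pairs"
proof -
  define \<delta> where "\<delta> = y\<^sup>2 / (x\<^sup>2 + y\<^sup>2 + 1)"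
  have "x\<^sup>2 + y\<^sup>2 + 1 > 0" by (smt (verit) zero_le_power2)
  then have \<delta>: "\<delta> > 0" using y by (simp add: \<delta>_def)
  have "(\<lambda>(c, d). real c powr (- \<sigma>) * int_wt d powr (- \<sigma>)) summable_on lattice_pairs"
    unfolding lattice_pairs_def
  proof (rule summable_on_SigmaI[where g = "\<lambda>c. real c powr (- \<sigma>) * infsum (\<lambda>d. int_wt d powr (- \<sigma>)) UNIV"])
    show "((\<lambda>d. case (c, d) of (c, d) \<Rightarrow> real c powr (- \<sigma>) * int_wt d powr (- \<sigma>)) has_sum
        real c powr (- \<sigma>) * infsum (\<lambda>d. int_wt d powr (- \<sigma>)) UNIV) UNIV" for c
      using summable_on_int_wt[OF \<sigma>] by (simp add: has_sum_cmult_right has_sum_infsum)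
    have "(\<lambda>c. real c powr (- \<sigma>)) summable_on UNIV"
      using \<sigma> by (simp add: summable_on_UNIV_nonneg_real_iff summable_real_powr_iff)
    then have "(\<lambda>c. real c powr (- \<sigma>)) summable_on {1..}" by (rule summable_on_subset) auto
    then show "(\<lambda>c. real c powr (- \<sigma>) * infsum (\<lambda>d. int_wt d powr (- \<sigma>)) UNIV) summable_on {1..}"
      by (rule summable_on_cmult_left)
  qed auto
  then have "(\<lambda>p. \<delta> powr (- \<sigma>) * (case p of (c, d) \<Rightarrow> real c powr (- \<sigma>) * int_wt d powr (- \<sigma>))) summable_on lattice_pairs"
    by (rule summable_on_cmult_right)
  then show ?thesis
  proof (rule summable_on_comparison_test)
    fix p assume p: "p \<in> lattice_pairs"
    obtain c d where cd: "p = (c, d)" by (cases p)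
    have c: "real c \<ge> 1" using p by (simp add: cd lattice_pairs_def)
    have "real c * int_wt d \<le> (real c)\<^sup>2 + (of_int d)\<^sup>2"
    proof (cases "d = 0")
      case True
      then show ?thesis using c by (simp add: int_wt_def power2_eq_square)
    next
      case False
      then have w: "int_wt d = \<bar>of_int d\<bar>" by (simp add: int_wt_def)
      have "2 * (real c * \<bar>of_int d\<bar>) \<le> (real c)\<^sup>2 + (of_int d)\<^sup>2"
        using zero_le_power2[of "real c - \<bar>of_int d\<bar>"] by (simp add: power2_diff)
      moreover have "0 \<le> real c * \<bar>real_of_int d\<bar>" by simp
      ultimately show ?thesis unfolding w by linarith
    qed
    then have "\<delta> * (real c * int_wt d) \<le> \<delta> * ((real c)\<^sup>2 + (of_int d)\<^sup>2)"
      using \<delta> by simp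
    also have "\<dots> \<le> lattice_form x y p"
      unfolding \<delta>_def cd lattice_form_def using lattice_form_ge[of y x "real c" "of_int d"] by simp
    finally have "lattice_form x y p powr (- \<sigma>) \<le> (\<delta> * (real c * int_wt d)) powr (- \<sigma>)"
      using \<delta> c int_wt_pos[of d] \<sigma> by (intro powr_mono2') auto
    then show "lattice_form x y p powr (- \<sigma>) \<le>
        \<delta> powr (- \<sigma>) * (case p of (c, d) \<Rightarrow> real c powr (- \<sigma>) * int_wt d powr (- \<sigma>))"
      by (simp add: cd powr_mult)
  qed auto
qed

text \<open>Half of the exponent absorbs the square, and c + M <= 2 c M separates the rest into a
  product of geometric series.\<close>

lemma summable_square_exp_mult:
  assumes a: "a > (0::real)"
  shows "(\<lambda>(c, M). (real (c * M))\<^sup>2 * exp (- a * real (c * M))) summable_on {1..} \<times> {1..}"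
proof -
  \<comment> \<open>The remaining exponent satisfies (a/2) c M >= (a/4) (c + M), whence the
    quarter.\<close>
  define r where "r = exp (- (a / 4))"
  define C where "C = 2 / (a / 2)\<^sup>2"
  have r: "0 < r" "r < 1" using a by (simp_all add: r_def)
  have g: "(\<lambda>n. r ^ n) summable_on {1..}"
    by (rule summable_on_subset[of _ UNIV]) (use r in \<open>auto simp: summable_on_UNIV_nonneg_real_iff summable_geometric\<close>)
  have "(\<lambda>(c, M). r ^ c * r ^ M) summable_on {1..} \<times> {1..}"
  proof (rule summable_on_SigmaI[where g = "\<lambda>c. r ^ c * infsum (\<lambda>n. r ^ n) {1..}"])
    show "((\<lambda>M. case (c, M) of (c, M) \<Rightarrow> r ^ c * r ^ M) has_sum r ^ c * infsum (\<lambda>n. r ^ n) {1..}) {1..}" for c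
      using g by (simp add: has_sum_cmult_right has_sum_infsum)
  qed (use g r in \<open>auto intro!: summable_on_cmult_left\<close>)
  then have "(\<lambda>p. C * (case p of (c, M) \<Rightarrow> r ^ c * r ^ M)) summable_on {1..} \<times> {1..}"
    by (rule summable_on_cmult_right)
  then show ?thesis
  proof (rule summable_on_comparison_test)
    fix p :: "nat \<times> nat" assume p: "p \<in> {1..} \<times> {1..}"
    obtain c M where cM: "p = (c, M)" by (cases p)
    define N where "N = real (c * M)"
    have "(a / 2 * N) ^ 2 / fact 2 \<le> exp (a / 2 * N)"
      by (rule power_div_fact_le_exp) (use a in \<open>simp add: N_def\<close>)
    then have "N\<^sup>2 \<le> C * exp (a / 2 * N)"
      using a by (simp add: C_def power_mult_distrib field_simps)
    then have "N\<^sup>2 * exp (- a * N) \<le> C * exp (a / 2 * N) * exp (- a * N)"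
      by (intro mult_right_mono) auto
    also have "\<dots> = C * exp (- (a / 2) * N)" by (simp add: mult.assoc flip: exp_add)
    also have "\<dots> \<le> C * (r ^ c * r ^ M)"
    proof -
      have "(real c - 1) * (real M - 1) \<ge> 0" using p by (simp add: cM)
      moreover have "real c \<ge> 1" "real M \<ge> 1" using p by (simp_all add: cM)
      ultimately have "real c + real M \<le> 2 * N" by (simp add: N_def algebra_simps)
      then have "a / 4 * (real c + real M) \<le> a / 4 * (2 * N)" using a by (intro mult_left_mono) auto
      then have "exp (- (a / 2) * N) \<le> exp (real c * (- (a / 4)) + real M * (- (a / 4)))"
        by (simp add: algebra_simps)
      then have "exp (- (a / 2) * N) \<le> r ^ c * r ^ M"
        by (simp only: r_def exp_of_nat_mult[symmetric] exp_add[symmetric])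
      then show ?thesis by (intro mult_left_mono) (auto simp: C_def)
    qed
    finally show "(case p of (c, M) \<Rightarrow> (real (c * M))\<^sup>2 * exp (- a * real (c * M))) \<le>
        C * (case p of (c, M) \<Rightarrow> r ^ c * r ^ M)" by (simp add: cM N_def)
  qed auto
qed

text \<open>The terms \<open>\<psi> c M\<close> of the rows are regrouped by N = c M, which turns
  the double sum into a series in N with divisor sums as coefficients. The square in the bound
  leaves room for a factor c^j with j <= 2 and for the factor c M.\<close>

lemma lattice_fourier:
  fixes \<phi> :: "nat \<times> int \<Rightarrow> complex" and \<psi> :: "nat \<Rightarrow> nat \<Rightarrow> complex"
  assumes sm: "\<phi> summable_on lattice_pairs"
    and inner: "\<And>c. c \<ge> 1 \<Longrightarrow> ((\<lambda>d. \<phi> (c, d)) has_sum (K0 c + (\<Sum>m. \<psi> c (Suc m)))) UNIV"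
    and bound: "\<And>c M. c \<ge> 1 \<Longrightarrow> M \<ge> 1 \<Longrightarrow> norm (\<psi> c M) \<le> C * ((real (c * M))\<^sup>2 * exp (- a * real (c * M)))"
    and a: "a > 0" and K0: "(K0 has_sum K) {1..}"
  shows "(\<phi> has_sum (K + (\<Sum>m. \<Sum>c | c dvd Suc m. \<psi> c (Suc m div c)))) lattice_pairs"
proof -
  obtain S where S: "(\<phi> has_sum S) lattice_pairs" using sm by (auto simp: summable_on_def)
  have "(\<lambda>p. C * (case p of (c, M) \<Rightarrow> (real (c * M))\<^sup>2 * exp (- a * real (c * M)))) summable_on {1..} \<times> {1..}"
    by (rule summable_on_cmult_right[OF summable_square_exp_mult[OF a]])
  then have nsm: "(\<lambda>p. norm (case p of (c, M) \<Rightarrow> \<psi> c M)) summable_on {1..} \<times> {1..}"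
    by (rule Infinite_Sum.abs_summable_on_comparison_test') (use bound in auto)
  then have psm: "(\<lambda>p. case p of (c, M) \<Rightarrow> \<psi> c M) summable_on {1..} \<times> {1..}"
    by (rule Infinite_Sum.abs_summable_summable)
  then obtain P where P: "((\<lambda>p. case p of (c, M) \<Rightarrow> \<psi> c M) has_sum P) ({1..} \<times> {1..})"
    by (auto simp: summable_on_def)
  have psi_row: "((\<lambda>M. \<psi> c M) has_sum (\<Sum>m. \<psi> c (Suc m))) {1..}" if c: "c \<ge> 1" for c
  proof -
    have "(\<lambda>M. \<psi> c M) summable_on {1..}"
      using summable_on_SigmaD1[of \<psi> "{1..}" "\<lambda>_. {1..}" c] psm c by simp
    then obtain R where R: "((\<lambda>M. \<psi> c M) has_sum R) {1..}" by (auto simp: summable_on_def)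
    also have "?this \<longleftrightarrow> ((\<lambda>m. \<psi> c (Suc m)) has_sum R) UNIV"
      by (rule has_sum_reindex_bij_witness[of _ Suc "\<lambda>n. n - 1"]) auto
    finally have "(\<lambda>m. \<psi> c (Suc m)) sums R" by (rule has_sum_imp_sums)
    with R show ?thesis by (simp add: sums_iff)
  qed
  have 1: "((\<lambda>c. \<Sum>m. \<psi> c (Suc m)) has_sum P) {1..}"
    using P by (rule has_sum_SigmaD) (use psi_row in auto)
  have "((\<lambda>c. K0 c + (\<Sum>m. \<psi> c (Suc m))) has_sum S) {1..}"
    using S unfolding lattice_pairs_def by (rule has_sum_SigmaD) (use inner in auto)
  moreover have "((\<lambda>c. K0 c + (\<Sum>m. \<psi> c (Suc m))) has_sum (K + P)) {1..}"
    by (rule has_sum_add[OF K0 1])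
  ultimately have SKP: "S = K + P" by (rule has_sum_unique)
  have "((\<lambda>p. case p of (c, M) \<Rightarrow> \<psi> c M) has_sum P) ({1..} \<times> {1..}) \<longleftrightarrow>
     ((\<lambda>(N, c). \<psi> c (N div c)) has_sum P) (Sigma {1..} (\<lambda>N. {c. c dvd N}))"
    by (rule has_sum_reindex_bij_witness[of _ "\<lambda>(N, c). (c, N div c)" "\<lambda>(c, M). (c * M, c)"])
      (auto elim!: dvdE simp: Suc_le_eq)
  with P have "((\<lambda>(N, c). \<psi> c (N div c)) has_sum P) (Sigma {1..} (\<lambda>N. {c. c dvd N}))" by simp
  then have "((\<lambda>N. \<Sum>c | c dvd N. \<psi> c (N div c)) has_sum P) {1..}"
    by (rule has_sum_SigmaD) (auto intro!: has_sum_finiteI finite_divisors_nat)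
  also have "?this \<longleftrightarrow> ((\<lambda>m. \<Sum>c | c dvd Suc m. \<psi> c (Suc m div c)) has_sum P) UNIV"
    by (rule has_sum_reindex_bij_witness[of _ Suc "\<lambda>n. n - 1"]) auto
  finally have "(\<lambda>m. \<Sum>c | c dvd Suc m. \<psi> c (Suc m div c)) sums P" by (rule has_sum_imp_sums)
  then show ?thesis using S SKP by (simp add: sums_iff)
qed

text \<open>The involution g -> m/g of the divisors. It exchanges a divisor sum of growing order for
  one of decaying order.\<close>

lemma divisor_sigma_flip:
  assumes "m \<ge> 1"
  shows "of_nat m powr \<nu> * divisor_sigma (- (2 * \<nu>)) m = of_nat m powr (- \<nu>) * divisor_sigma (2 * \<nu>) m"
proof -
  have "of_nat m powr \<nu> * divisor_sigma (- (2 * \<nu>)) m = (\<Sum>g | g dvd m. of_nat m powr \<nu> * of_nat g powr (- (2 * \<nu>)))"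
    by (simp add: divisor_sigma_def sum_distrib_left)
  also have "\<dots> = (\<Sum>g | g dvd m. of_nat m powr (- \<nu>) * of_nat g powr (2 * \<nu>))"
  proof (rule sum.reindex_bij_witness[of _ "\<lambda>g. m div g" "\<lambda>g. m div g"])
    fix g assume "g \<in> {g. g dvd m}"
    then obtain h where h: "m = g * h" by (auto elim: dvdE)
    have gh: "real g > 0" "real h > 0" using assms h by (auto simp: Suc_le_eq)
    have mp: "complex_of_nat m powr s = exp (s * (of_real (ln (real g)) + of_real (ln (real h))))" for s
      using powr_of_pos_real[of "real g * real h" s] gh by (simp add: h ln_mult_pos)
    have gp: "complex_of_nat g powr s = exp (s * of_real (ln (real g)))" for s
      using powr_of_pos_real[of "real g" s] gh by simp
    have hp: "complex_of_nat h powr s = exp (s * of_real (ln (real h)))" for s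
      using powr_of_pos_real[of "real h" s] gh by simp
    have dv: "m div g = h" using gh by (simp add: h)
    show "of_nat m powr (- \<nu>) * of_nat (m div g) powr (2 * \<nu>) = complex_of_nat m powr \<nu> * of_nat g powr (- (2 * \<nu>))"
      unfolding dv mp gp hp exp_add[symmetric] by (simp add: algebra_simps)
  qed (use assms in \<open>auto elim!: dvdE\<close>)
  also have "\<dots> = of_nat m powr (- \<nu>) * divisor_sigma (2 * \<nu>) m"
    by (simp add: divisor_sigma_def sum_distrib_left)
  finally show ?thesis .
qed

text \<open>The coefficient of \<open>cos (2\<pi>mx)\<close> in the Fourier expansion of a lattice sum of exponent \<open>u\<close>,
  divided by \<open>4\<close>.\<close>

definition lattice_coeff :: "real \<Rightarrow> complex \<Rightarrow> nat \<Rightarrow> complex \<Rightarrow> complex" where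
  "lattice_coeff y u m e = of_real pi powr u / Gamma u * of_real y powr (1/2 - u) *
     of_nat m powr (u - 1/2) * divisor_sigma e m * bessel_mode (u - 1/2) y m"

lemma bessel_int_fourier:
  assumes y: "y > 0" and c: "c \<ge> (1::nat)" and M: "M \<ge> (1::nat)"
  shows "bessel_int \<nu> (pi * (real c * y)\<^sup>2) (pi * (real M)\<^sup>2) =
    2 * of_real y powr (- \<nu>) * of_nat (c * M) powr \<nu> * of_nat c powr (- (2 * \<nu>)) *
      bessel_K \<nu> (2 * pi * real (c * M) * y)"
proof -
  \<comment> \<open>The scale at which the two parts (c y)^2 t and M^2 / t of the exponent
    balance.\<close>
  define r where "r = real M / (real c * y)"
  have pos: "real c > 0" "real M > 0" using c M by simp_all
  have r: "r > 0" using pos y by (simp add: r_def)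
  have "pi * (real M)\<^sup>2 = r\<^sup>2 * (pi * (real c * y)\<^sup>2)"
    using pos y by (simp add: r_def power_divide power_mult_distrib)
  from bessel_int_eq_bessel_K[OF r this]
  have "bessel_int \<nu> (pi * (real c * y)\<^sup>2) (pi * (real M)\<^sup>2) =
    2 * of_real r powr \<nu> * bessel_K \<nu> (2 * r * (pi * (real c * y)\<^sup>2))" .
  moreover have "2 * r * (pi * (real c * y)\<^sup>2) = 2 * pi * real (c * M) * y"
    using pos y by (simp add: r_def power2_eq_square field_simps)
  moreover have "of_real r powr \<nu> = of_real y powr (- \<nu>) * of_nat (c * M) powr \<nu> * of_nat c powr (- (2 * \<nu>))"
  proof -
    have mp: "complex_of_nat (c * M) powr s = exp (s * (of_real (ln (real c)) + of_real (ln (real M))))" for s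
      using powr_of_pos_real[of "real c * real M" s] pos by (simp add: ln_mult_pos)
    have cp: "complex_of_nat c powr s = exp (s * of_real (ln (real c)))" for s
      using powr_of_pos_real[of "real c" s] pos by simp
    have lr: "ln r = ln (real M) - (ln (real c) + ln y)"
      using pos y by (simp add: r_def ln_div ln_mult_pos)
    show ?thesis
      unfolding mp cp lr powr_of_pos_real[OF r] lr powr_of_pos_real[OF y] exp_add[symmetric]
      by (simp add: algebra_simps)
  qed
  ultimately show ?thesis by simp
qed

lemma of_nat_powr_exp: "c \<ge> 1 \<Longrightarrow> complex_of_nat c powr s = exp (s * of_real (ln (real c)))"
  using powr_of_pos_real[of "real c" s] by simp

lemma of_nat_power_exp: "c \<ge> 1 \<Longrightarrow> complex_of_nat c ^ j = exp (of_nat j * of_real (ln (real c)))"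
  by (simp add: exp_of_nat_mult exp_of_real)

text \<open>Used to add up the constant terms of the Poisson formula over the rows c; the weight c^j
  lowers the argument of zeta by j.\<close>

lemma zeta_has_sum_scaled:
  assumes s: "Re s > 1 + real j" and y: "y > 0" and b: "b > 0"
  shows "((\<lambda>c. of_nat c ^ j * of_real ((real c * y)\<^sup>2 * b) powr (- (s / 2))) has_sum
    of_real (y\<^sup>2 * b) powr (- (s / 2)) * zeta (s - of_nat j)) {1..}"
proof -
  have s': "Re (s - of_nat j) > 1" using s by simp
  have "((\<lambda>c. of_real (y\<^sup>2 * b) powr (- (s / 2)) * of_nat c powr (- (s - of_nat j))) has_sum
      of_real (y\<^sup>2 * b) powr (- (s / 2)) * zeta (s - of_nat j)) {1..}"
    by (rule has_sum_cmult_right[OF zeta_has_sum[OF s']])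
  then show ?thesis
  proof (rule has_sum_cong[THEN iffD1, rotated])
    fix c :: nat assume "c \<in> {1..}"
    then have c: "c \<ge> 1" "real c > 0" by simp_all
    have yb: "y\<^sup>2 * b > 0" using y b by simp
    have pos: "(real c * y)\<^sup>2 * b > 0" using c y b by simp
    have "ln ((real c * y)\<^sup>2 * b) = 2 * ln (real c) + ln (y\<^sup>2 * b)"
      using c yb ln_mult_pos[of "(real c)\<^sup>2" "y\<^sup>2 * b"] by (simp add: power_mult_distrib ln_realpow mult.assoc)
    then show "of_real (y\<^sup>2 * b) powr (- (s / 2)) * of_nat c powr (- (s - of_nat j)) =
        of_nat c ^ j * complex_of_real ((real c * y)\<^sup>2 * b) powr (- (s / 2))"
      unfolding of_nat_powr_exp[OF c(1)] of_nat_power_exp[OF c(1)] powr_of_pos_real[OF yb] powr_of_pos_real[OF pos] exp_add[symmetric]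
      by (simp add: algebra_simps)
  qed
qed

text \<open>The constant does not depend on the row: replacing y^2 by (c y)^2 only makes the
  remaining integral smaller.\<close>

lemma lattice_bound_aux:
  assumes y: "y > 0"
  obtains B where "B \<ge> 0" "\<And>c M. c \<ge> (1::nat) \<Longrightarrow> M \<ge> (1::nat) \<Longrightarrow>
     norm (bessel_int \<nu> (pi * (real c * y)\<^sup>2) (pi * (real M)\<^sup>2)) \<le> B * exp (- (pi * y) * real (c * M))"
proof
  define B where "B = bessel_int_real (Re \<nu>) (pi * y\<^sup>2 / 2) (pi / 2)"
  show "B \<ge> 0" by (simp add: B_def bessel_int_real_nonneg)
  fix c M :: nat assume c: "c \<ge> 1" and M: "M \<ge> 1"
  have cy: "real c * y > 0" using c y by simp
  obtain m where m: "M = Suc m" using M by (cases M) auto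
  have "norm (bessel_int \<nu> (pi * (real c * y)\<^sup>2) (pi * (real M)\<^sup>2)) \<le>
      exp (- (pi * (real c * y))) ^ Suc m * bessel_int_real (Re \<nu>) (pi * (real c * y)\<^sup>2 / 2) (pi / 2)"
    unfolding m by (rule norm_bessel_int_fourier_le[OF cy])
  also have "\<dots> \<le> exp (- (pi * (real c * y))) ^ Suc m * B"
  proof (intro mult_left_mono)
    have "bessel_int_real (Re \<nu>) (pi * (real c * y)\<^sup>2 / 2) (pi / 2) \<le> exp (- 0) * B"
      unfolding B_def
    proof (rule bessel_int_real_le)
      fix t :: real assume t: "t > 0"
      have "y\<^sup>2 \<le> (real c * y)\<^sup>2" using c y by (intro power_mono) auto
      then have "pi * y\<^sup>2 / 2 * t \<le> pi * (real c * y)\<^sup>2 / 2 * t"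
        using t by (intro mult_right_mono divide_right_mono mult_left_mono) auto
      then show "0 + pi * y\<^sup>2 / 2 * t + pi / 2 / t \<le> pi * (real c * y)\<^sup>2 / 2 * t + pi / 2 / t" by simp
    qed (use cy y in \<open>auto intro!: mult_pos_pos zero_less_power\<close>)
    then show "bessel_int_real (Re \<nu>) (pi * (real c * y)\<^sup>2 / 2) (pi / 2) \<le> B" by simp
  qed simp
  also have "exp (- (pi * (real c * y))) ^ Suc m = exp (- (pi * y) * real (c * M))"
    unfolding m exp_of_nat_mult[symmetric] by (simp add: algebra_simps)
  finally show "norm (bessel_int \<nu> (pi * (real c * y)\<^sup>2) (pi * (real M)\<^sup>2)) \<le> B * exp (- (pi * y) * real (c * M))"
    by (simp add: mult.commute)
qed

lemma Gamma_pi_powr: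
  fixes u :: complex
  assumes "y > 0"
  shows "of_real pi powr u / Gamma u * (Gamma (u - 1/2) * of_real (y\<^sup>2 * pi) powr (1/2 - u)) =
    of_real pi powr (1/2) * Gamma (u - 1/2) / Gamma u * of_real y powr (1 - 2 * u)"
proof -
  have "y\<^sup>2 * pi > 0" using assms by simp
  moreover have "ln (y\<^sup>2 * pi) = 2 * ln y + ln pi" using assms by (simp add: ln_mult_pos ln_realpow)
  ultimately have "of_real pi powr u * of_real (y\<^sup>2 * pi) powr (1/2 - u) =
      of_real pi powr (1/2) * (of_real y powr (1 - 2 * u) :: complex)"
    using assms by (simp only: powr_of_pos_real pi_gt_zero exp_add[symmetric]) (simp add: algebra_simps)
  then show ?thesis by (simp add: field_simps)
qed

lemma lattice_form_ge_square: "(real c * y)\<^sup>2 \<le> lattice_form x y (c, d)"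
  "(real c * x + of_int d)\<^sup>2 \<le> lattice_form x y (c, d)"
  by (simp_all add: lattice_form_def)

lemma real_mult_ge_1:
  assumes "c \<ge> 1" "M \<ge> (1::nat)"
  shows "real c \<le> real (c * M)" "1 \<le> real (c * M)"
proof -
  show "real c \<le> real (c * M)" using assms by simp
  then show "1 \<le> real (c * M)" using assms by linarith
qed

text \<open>Row by row this is \<open>poisson_quadratic\<close> with shift c x and height c y. The
  case j = 0 serves pure powers of q and j = 2 the weight c^2. As c y <= sqrt q, the weight costs
  j/2 in the exponent, whence the condition on u.\<close>

theorem lattice_sum_even:
  assumes y: "y > 0" and u: "Re u > 1 + real j / 2" and j: "j \<le> 2"
  shows "((\<lambda>p. of_nat (fst p) ^ j * of_real (lattice_form x y p) powr (- u)) has_sum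
     (of_real pi powr (1/2) * Gamma (u - 1/2) / Gamma u * of_real y powr (1 - 2 * u) * zeta (2 * u - 1 - of_nat j) +
      (\<Sum>m. 4 * cos_mode x (Suc m) * lattice_coeff y u (Suc m) (1 - 2 * u + of_nat j)))) lattice_pairs"
proof -
  define P where "P = of_real pi powr u / Gamma u"
  define G where "G = P * Gamma (u - 1/2)"
  define \<psi> where "\<psi> = (\<lambda>c M. P * of_nat c ^ j * (2 * cos_mode (real c * x) M *
      bessel_int (u - 1/2) (pi * (real c * y)\<^sup>2) (pi * (real M)\<^sup>2)))"
  define \<phi> where "\<phi> = (\<lambda>p. of_nat (fst p) ^ j * complex_of_real (lattice_form x y p) powr (- u))"
  have "(\<lambda>p. (1 / y) ^ j * lattice_form x y p powr (- (Re u - real j / 2))) summable_on lattice_pairs"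
    using u by (intro summable_on_cmult_right summable_lattice_form_powr y) simp
  then have nsm: "(\<lambda>p. norm (\<phi> p)) summable_on lattice_pairs"
  proof (rule summable_on_comparison_test)
    fix p assume p: "p \<in> lattice_pairs"
    obtain c d where cd: "p = (c, d)" by (cases p)
    note q = lattice_form_pos[OF y p, of x]
    note q' = q[unfolded cd]
    have "real c * y \<le> sqrt (lattice_form x y p)"
      unfolding cd by (rule real_le_rsqrt[OF lattice_form_ge_square(1)])
    then have "real c \<le> 1 / y * lattice_form x y p powr (1/2)"
      using y q by (simp add: powr_half_sqrt field_simps)
    then have "real c ^ j \<le> (1 / y * lattice_form x y p powr (1/2)) ^ j"
      by (intro power_mono) auto
    also have "\<dots> = (1 / y) ^ j * lattice_form x y p powr (real j / 2)"
      using q by (simp add: power_mult_distrib powr_powr power_divide flip: powr_realpow)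
    finally have "real c ^ j * lattice_form x y p powr (- Re u) \<le>
        (1 / y) ^ j * lattice_form x y p powr (real j / 2) * lattice_form x y p powr (- Re u)"
      by (rule mult_right_mono) simp
    also have "\<dots> = (1 / y) ^ j * lattice_form x y p powr (- (Re u - real j / 2))"
      by (simp add: mult.assoc flip: powr_add)
    finally show "norm (\<phi> p) \<le> (1 / y) ^ j * lattice_form x y p powr (- (Re u - real j / 2))"
      by (simp add: \<phi>_def norm_mult norm_power norm_powr_pos[OF q'] cd)
  qed simp
  obtain B where B: "B \<ge> 0" "\<And>c M. c \<ge> (1::nat) \<Longrightarrow> M \<ge> (1::nat) \<Longrightarrow>
     norm (bessel_int (u - 1/2) (pi * (real c * y)\<^sup>2) (pi * (real M)\<^sup>2)) \<le> B * exp (- (pi * y) * real (c * M))"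
    using lattice_bound_aux[OF y] by blast
  have "(\<phi> has_sum (G * (of_real (y\<^sup>2 * pi) powr (- ((2 * u - 1) / 2)) * zeta (2 * u - 1 - of_nat j)) +
      (\<Sum>m. \<Sum>c | c dvd Suc m. \<psi> c (Suc m div c)))) lattice_pairs"
  proof (rule lattice_fourier[where C = "norm P * (2 * B)" and a = "pi * y" and
        ?K0.0 = "\<lambda>c. G * (of_nat c ^ j * of_real ((real c * y)\<^sup>2 * pi) powr (- ((2 * u - 1) / 2)))"])
    show "\<phi> summable_on lattice_pairs" by (rule Infinite_Sum.abs_summable_summable[OF nsm])
    show "((\<lambda>c. G * (of_nat c ^ j * of_real ((real c * y)\<^sup>2 * pi) powr (- ((2 * u - 1) / 2)))) has_sum
        G * (of_real (y\<^sup>2 * pi) powr (- ((2 * u - 1) / 2)) * zeta (2 * u - 1 - of_nat j))) {1..}"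
      by (intro has_sum_cmult_right zeta_has_sum_scaled) (use u y in auto)
    fix c :: nat assume c: "c \<ge> 1"
    have cy: "real c * y > 0" using c y by simp
    have u2: "Re u > 1/2" using u by simp
    \<comment> \<open>The exponent is brought into the form of \<open>zeta_has_sum_scaled\<close>
      with s = 2u - 1.\<close>
    have e: "1/2 - u = - ((2 * u - 1) / 2)" by (simp add: field_simps)
    define \<beta> where "\<beta> = (\<lambda>m. 2 * cos_mode (real c * x) (Suc m) *
          bessel_int (u - 1/2) (pi * (real c * y)\<^sup>2) (pi * (real (Suc m))\<^sup>2))"
    have "pi * y * real c > 0" using c y by simp
    from summable_exp_power(1)[OF this]
    have "summable (\<lambda>m. 2 * (B * exp (- (pi * y * real c)) ^ Suc m))"
      by (intro summable_mult)
    then have sm: "summable \<beta>"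
    proof (rule summable_comparison_test'[of _ 0])
      fix m
      have "norm (\<beta> m) \<le> 2 * 1 * (B * exp (- (pi * y) * real (c * Suc m)))"
        unfolding \<beta>_def norm_mult by (intro mult_mono B c) auto
      also have "exp (- (pi * y) * real (c * Suc m)) = exp (- (pi * y * real c)) ^ Suc m"
        unfolding exp_of_nat_mult[symmetric] by (simp add: algebra_simps)
      finally show "norm (\<beta> m) \<le> 2 * (B * exp (- (pi * y * real c)) ^ Suc m)" by simp
    qed
    have "((\<lambda>d. of_nat c ^ j * complex_of_real ((real c * x + of_int d)\<^sup>2 + (real c * y)\<^sup>2) powr (- u)) has_sum
        of_nat c ^ j * (P * (Gamma (u - 1/2) * of_real (pi * (real c * y)\<^sup>2) powr (1/2 - u) + (\<Sum>m. \<beta> m)))) UNIV"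
      unfolding P_def \<beta>_def by (intro has_sum_cmult_right poisson_quadratic[OF u2 cy])
    moreover have "of_nat c ^ j * (P * (Gamma (u - 1/2) * of_real (pi * (real c * y)\<^sup>2) powr (1/2 - u) + (\<Sum>m. \<beta> m))) =
       G * (of_nat c ^ j * of_real ((real c * y)\<^sup>2 * pi) powr (- ((2 * u - 1) / 2))) + (\<Sum>m. \<psi> c (Suc m))"
    proof -
      have "(\<Sum>m. \<psi> c (Suc m)) = P * of_nat c ^ j * (\<Sum>m. \<beta> m)"
        unfolding \<psi>_def \<beta>_def[symmetric] by (rule suminf_mult[OF sm[unfolded \<beta>_def], folded \<beta>_def])
      then show ?thesis unfolding e G_def by (simp add: distrib_left mult_ac)
    qed
    ultimately show "((\<lambda>d. \<phi> (c, d)) has_sum (G * (of_nat c ^ j * of_real ((real c * y)\<^sup>2 * pi) powr (- ((2 * u - 1) / 2))) +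
        (\<Sum>m. \<psi> c (Suc m)))) UNIV"
      unfolding \<phi>_def lattice_form_def by simp
    fix M :: nat assume M: "M \<ge> 1"
    note N = real_mult_ge_1[OF c M]
    have "real c ^ j \<le> real (c * M) ^ j" using N by (intro power_mono) auto
    also have "\<dots> \<le> (real (c * M))\<^sup>2" using N j by (intro power_increasing) auto
    finally have cj: "real c ^ j \<le> (real (c * M))\<^sup>2" .
    have "norm (\<psi> c M) \<le> norm P * real c ^ j * (2 * 1 * (B * exp (- (pi * y) * real (c * M))))"
      unfolding \<psi>_def norm_mult norm_power norm_of_nat by (intro mult_mono mult_left_mono B c M) auto
    also have "\<dots> = norm P * (2 * B) * (real c ^ j * exp (- (pi * y) * real (c * M)))" by simp
    also have "\<dots> \<le> norm P * (2 * B) * ((real (c * M))\<^sup>2 * exp (- (pi * y) * real (c * M)))"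
      using cj B by (intro mult_left_mono mult_right_mono) auto
    finally show "norm (\<psi> c M) \<le> norm P * (2 * B) * ((real (c * M))\<^sup>2 * exp (- (pi * y) * real (c * M)))" .
  qed (use y in simp)
  moreover have "G * (of_real (y\<^sup>2 * pi) powr (- ((2 * u - 1) / 2)) * zeta (2 * u - 1 - of_nat j)) =
     of_real pi powr (1/2) * Gamma (u - 1/2) / Gamma u * of_real y powr (1 - 2 * u) * zeta (2 * u - 1 - of_nat j)"
  proof -
    have "- ((2 * u - 1) / 2) = 1/2 - u" by (simp add: field_simps)
    then show ?thesis using Gamma_pi_powr[OF y, of u] by (simp only: G_def P_def mult.assoc[symmetric])
  qed
  moreover have "(\<Sum>c | c dvd Suc m. \<psi> c (Suc m div c)) =
      4 * cos_mode x (Suc m) * lattice_coeff y u (Suc m) (1 - 2 * u + of_nat j)" for m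
  proof -
    have "(\<Sum>c | c dvd Suc m. \<psi> c (Suc m div c)) =
      (\<Sum>c | c dvd Suc m. 4 * cos_mode x (Suc m) * (P * of_real y powr (1/2 - u) *
         of_nat (Suc m) powr (u - 1/2) * bessel_mode (u - 1/2) y (Suc m)) * of_nat c powr (1 - 2 * u + of_nat j))"
    proof (rule sum.cong[OF refl])
      fix c assume "c \<in> {c. c dvd Suc m}"
      then obtain M where cM: "Suc m = c * M" by (auto elim: dvdE)
      then have c: "c \<ge> 1" "M \<ge> 1" by (metis One_nat_def Suc_leI mult_is_0 nat.distinct(1) not_gr_zero)+
      have div: "Suc m div c = M" using c by (simp add: cM)
      have e: "- (u - 1/2) = 1/2 - u" "- (2 * (u - 1/2)) = 1 - 2 * u" by (simp_all add: algebra_simps)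
      have arg: "2 * pi * real M * (real c * x) = 2 * pi * real (Suc m) * x" by (simp add: cM)
      have pw: "of_nat c powr (1 - 2 * u + of_nat j) = of_nat c ^ j * complex_of_nat c powr (1 - 2 * u)"
        unfolding of_nat_powr_exp[OF c(1)] of_nat_power_exp[OF c(1)] exp_add[symmetric]
        by (simp add: algebra_simps)
      show "\<psi> c (Suc m div c) = 4 * cos_mode x (Suc m) * (P * of_real y powr (1/2 - u) *
         of_nat (Suc m) powr (u - 1/2) * bessel_mode (u - 1/2) y (Suc m)) * of_nat c powr (1 - 2 * u + of_nat j)"
        unfolding div \<psi>_def bessel_int_fourier[OF y c] e arg pw cM[symmetric] by simp
    qed
    also have "\<dots> = 4 * cos_mode x (Suc m) * lattice_coeff y u (Suc m) (1 - 2 * u + of_nat j)"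
      unfolding sum_distrib_left[symmetric] divisor_sigma_def[symmetric] lattice_coeff_def P_def
      by (simp only: mult_ac)
    finally show ?thesis .
  qed
  ultimately show ?thesis by (simp only: \<phi>_def)
qed

text \<open>Row by row this is \<open>poisson_linear\<close>, whose sine series has no constant
  term, so no zeta value appears. Since c |c x + d| <= q / y, the weight costs 1 in the exponent,
  whence Re w > 2.\<close>

theorem lattice_sum_odd:
  assumes y: "y > 0" and w: "Re w > 2"
  shows "((\<lambda>p. of_real (real (fst p) * (real (fst p) * x + of_int (snd p))) * of_real (lattice_form x y p) powr (- w)) has_sum
     (\<Sum>m. 4 * sin_mode x (Suc m) * (of_real pi powr w / Gamma w * of_real y powr (3/2 - w) *
       of_nat (Suc m) powr (w - 1/2) * divisor_sigma (3 - 2 * w) (Suc m) * bessel_mode (w - 3/2) y (Suc m)))) lattice_pairs"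
proof -
  define P where "P = of_real pi powr w / Gamma w"
  define \<psi> where "\<psi> = (\<lambda>c M. P * of_nat c * (2 * of_real (real M * sin (2 * pi * real M * (real c * x))) *
      bessel_int (w - 3/2) (pi * (real c * y)\<^sup>2) (pi * (real M)\<^sup>2)))"
  define \<phi> where "\<phi> = (\<lambda>p. of_real (real (fst p) * (real (fst p) * x + of_int (snd p))) * complex_of_real (lattice_form x y p) powr (- w))"
  have "(\<lambda>p. 1 / y * lattice_form x y p powr (- (Re w - 1))) summable_on lattice_pairs"
    using w by (intro summable_on_cmult_right summable_lattice_form_powr y) simp
  then have nsm: "(\<lambda>p. norm (\<phi> p)) summable_on lattice_pairs"
  proof (rule summable_on_comparison_test)
    fix p assume p: "p \<in> lattice_pairs"
    obtain c d where cd: "p = (c, d)" by (cases p)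
    note q = lattice_form_pos[OF y p, of x]
    note q' = q[unfolded cd]
    have "real c * y \<le> sqrt (lattice_form x y p)"
      unfolding cd by (rule real_le_rsqrt[OF lattice_form_ge_square(1)])
    moreover have "\<bar>real c * x + of_int d\<bar> \<le> sqrt (lattice_form x y p)"
      unfolding cd by (rule real_le_rsqrt) (simp add: lattice_form_ge_square(2))
    ultimately have "(real c * y) * \<bar>real c * x + of_int d\<bar> \<le> sqrt (lattice_form x y p) * sqrt (lattice_form x y p)"
      using y less_imp_le[OF q] by (intro mult_mono) auto
    then have "real c * \<bar>real c * x + of_int d\<bar> \<le> 1 / y * lattice_form x y p"
      using y less_imp_le[OF q] by (simp add: field_simps)
    then have "real c * \<bar>real c * x + of_int d\<bar> * lattice_form x y p powr (- Re w) \<le>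
        1 / y * lattice_form x y p * lattice_form x y p powr (- Re w)"
      by (rule mult_right_mono) simp
    also have "\<dots> = 1 / y * lattice_form x y p powr (- (Re w - 1))"
      using q by (simp add: powr_diff powr_minus field_simps)
    finally show "norm (\<phi> p) \<le> 1 / y * lattice_form x y p powr (- (Re w - 1))"
      by (simp only: \<phi>_def norm_mult norm_of_real norm_powr_pos[OF q'] cd fst_conv snd_conv abs_mult abs_of_nat uminus_complex.simps)
  qed simp
  obtain B where B: "B \<ge> 0" "\<And>c M. c \<ge> (1::nat) \<Longrightarrow> M \<ge> (1::nat) \<Longrightarrow>
     norm (bessel_int (w - 3/2) (pi * (real c * y)\<^sup>2) (pi * (real M)\<^sup>2)) \<le> B * exp (- (pi * y) * real (c * M))"
    using lattice_bound_aux[OF y] by blast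
  have "(\<phi> has_sum (0 + (\<Sum>m. \<Sum>c | c dvd Suc m. \<psi> c (Suc m div c)))) lattice_pairs"
  proof (rule lattice_fourier[where C = "norm P * (2 * B)" and a = "pi * y" and ?K0.0 = "\<lambda>c. 0"])
    show "\<phi> summable_on lattice_pairs" by (rule Infinite_Sum.abs_summable_summable[OF nsm])
    fix c :: nat assume c: "c \<ge> 1"
    have cy: "real c * y > 0" using c y by simp
    have w2: "Re w > 3/2" using w by simp
    define \<beta> where "\<beta> = (\<lambda>m. 2 * of_real (real (Suc m) * sin (2 * pi * real (Suc m) * (real c * x))) *
          bessel_int (w - 3/2) (pi * (real c * y)\<^sup>2) (pi * (real (Suc m))\<^sup>2))"
    have "pi * y * real c > 0" using c y by simp
    from summable_exp_power(2)[OF this]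
    have "summable (\<lambda>m. 2 * (B * (real (Suc m) * exp (- (pi * y * real c)) ^ Suc m)))"
      by (intro summable_mult)
    then have sm: "summable \<beta>"
    proof (rule summable_comparison_test'[of _ 0])
      fix m
      have "norm (\<beta> m) \<le> 2 * (real (Suc m) * 1) * (B * exp (- (pi * y) * real (c * Suc m)))"
        unfolding \<beta>_def norm_mult norm_of_real abs_mult by (intro mult_mono B c) auto
      also have "exp (- (pi * y) * real (c * Suc m)) = exp (- (pi * y * real c)) ^ Suc m"
        unfolding exp_of_nat_mult[symmetric] by (simp add: algebra_simps)
      finally show "norm (\<beta> m) \<le> 2 * (B * (real (Suc m) * exp (- (pi * y * real c)) ^ Suc m))"
        by (simp only: mult_ac mult_1_right)
    qed
    have "((\<lambda>d. of_nat c * (of_real (real c * x + of_int d) * complex_of_real ((real c * x + of_int d)\<^sup>2 + (real c * y)\<^sup>2) powr (- w))) has_sum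
        of_nat c * (P * (\<Sum>m. \<beta> m))) UNIV"
      unfolding P_def \<beta>_def by (intro has_sum_cmult_right poisson_linear[OF w2 cy])
    moreover have "of_nat c * (P * (\<Sum>m. \<beta> m)) = 0 + (\<Sum>m. \<psi> c (Suc m))"
    proof -
      have "(\<Sum>m. \<psi> c (Suc m)) = P * of_nat c * (\<Sum>m. \<beta> m)"
        unfolding \<psi>_def \<beta>_def[symmetric] by (rule suminf_mult[OF sm[unfolded \<beta>_def], folded \<beta>_def])
      then show ?thesis by (simp add: mult_ac)
    qed
    ultimately show "((\<lambda>d. \<phi> (c, d)) has_sum (0 + (\<Sum>m. \<psi> c (Suc m)))) UNIV"
      unfolding \<phi>_def lattice_form_def by (simp add: mult_ac)
    fix M :: nat assume M: "M \<ge> 1"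
    note N = real_mult_ge_1[OF c M]
    have cM: "real c * real M \<le> (real (c * M))\<^sup>2" using self_le_power[OF N(2), of 2] by simp
    have "norm (\<psi> c M) \<le> norm P * real c * (2 * (real M * 1) * (B * exp (- (pi * y) * real (c * M))))"
      unfolding \<psi>_def norm_mult norm_of_real abs_mult norm_of_nat by (intro mult_mono mult_left_mono B c M) auto
    also have "\<dots> = norm P * (2 * B) * (real c * real M * exp (- (pi * y) * real (c * M)))" by simp
    also have "\<dots> \<le> norm P * (2 * B) * ((real (c * M))\<^sup>2 * exp (- (pi * y) * real (c * M)))"
      using cM B by (intro mult_left_mono mult_right_mono) auto
    finally show "norm (\<psi> c M) \<le> norm P * (2 * B) * ((real (c * M))\<^sup>2 * exp (- (pi * y) * real (c * M)))" .
  qed (use y in simp_all)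
  moreover have "(\<Sum>c | c dvd Suc m. \<psi> c (Suc m div c)) =
      4 * sin_mode x (Suc m) * (of_real pi powr w / Gamma w * of_real y powr (3/2 - w) *
       of_nat (Suc m) powr (w - 1/2) * divisor_sigma (3 - 2 * w) (Suc m) * bessel_mode (w - 3/2) y (Suc m))" for m
  proof -
    have "(\<Sum>c | c dvd Suc m. \<psi> c (Suc m div c)) =
      (\<Sum>c | c dvd Suc m. 4 * sin_mode x (Suc m) * (P * of_real y powr (3/2 - w) *
         of_nat (Suc m) powr (w - 1/2) * bessel_mode (w - 3/2) y (Suc m)) * of_nat c powr (3 - 2 * w))"
    proof (rule sum.cong[OF refl])
      fix c assume "c \<in> {c. c dvd Suc m}"
      then obtain M where cM: "Suc m = c * M" by (auto elim: dvdE)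
      then have c: "c \<ge> 1" "M \<ge> 1" by (metis One_nat_def Suc_leI mult_is_0 nat.distinct(1) not_gr_zero)+
      have div: "Suc m div c = M" using c by (simp add: cM)
      have e: "- (w - 3/2) = 3/2 - w" "- (2 * (w - 3/2)) = 3 - 2 * w" by (simp_all add: algebra_simps)
      have arg: "2 * pi * real M * (real c * x) = 2 * pi * real (Suc m) * x" by (simp add: cM)
      \<comment> \<open>The weight c and the factor M of the linear Poisson formula multiply to m +
        1 and raise the exponent from w - 3/2 to w - 1/2.\<close>
      have N: "complex_of_nat (Suc m) powr (w - 1/2) = of_nat c * of_nat M * of_nat (Suc m) powr (w - 3/2)"
      proof -
        have "w - 1/2 = 1 + (w - 3/2)" by simp
        then have "complex_of_nat (Suc m) powr (w - 1/2) = of_nat (Suc m) powr 1 * of_nat (Suc m) powr (w - 3/2)"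
          by (simp only: powr_add)
        also have "complex_of_nat (Suc m) powr 1 = of_nat c * of_nat M"
          unfolding cM using c by simp
        finally show ?thesis .
      qed
      show "\<psi> c (Suc m div c) = 4 * sin_mode x (Suc m) * (P * of_real y powr (3/2 - w) *
         of_nat (Suc m) powr (w - 1/2) * bessel_mode (w - 3/2) y (Suc m)) * of_nat c powr (3 - 2 * w)"
        unfolding div \<psi>_def bessel_int_fourier[OF y c] e arg cM[symmetric] N by simp
    qed
    also have "\<dots> = 4 * sin_mode x (Suc m) * (of_real pi powr w / Gamma w * of_real y powr (3/2 - w) *
       of_nat (Suc m) powr (w - 1/2) * divisor_sigma (3 - 2 * w) (Suc m) * bessel_mode (w - 3/2) y (Suc m))"
      unfolding sum_distrib_left[symmetric] divisor_sigma_def[symmetric] P_def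
      by (simp only: mult_ac)
    finally show ?thesis .
  qed
  ultimately show ?thesis by (simp only: \<phi>_def add_0_left)
qed

section \<open>Sums over coprime pairs\<close>

text \<open>With \<open>w = s + k\<close>, the definitions below are the scalar factors of the \<open>k\<close>-th terms of the
  series in the theorem, without the coefficient of the exponential series (and, in \<open>hs1\<close>, without
  the cosine). Thus each series in \<open>k\<close> samples one holomorphic function at \<open>s, s + 1, s + 2, \<dots>\<close>.\<close>

definition cs1 :: "real \<Rightarrow> complex \<Rightarrow> complex" where
  "cs1 y w = of_real pi powr (2 * w + 1) * remove_sings (\<lambda>u. Gamma (- u) * zeta (- 2 * u)) w /
     (Gamma (w + 1) * zeta (2 * w + 2)) * of_real y powr (- w - 1)"

definition cs2 :: "real \<Rightarrow> complex \<Rightarrow> complex" where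
  "cs2 y w = of_real pi powr (1/2) * of_real y powr (1 - w) * Gamma (w - 1/2) * zeta (2 * w - 3) /
     (Gamma w * zeta (2 * w - 2))"

definition hs1 :: "real \<Rightarrow> complex \<Rightarrow> nat \<Rightarrow> complex" where
  "hs1 y w m = of_real pi * divisor_sigma (2 * w + 1) m * bessel_mode (w + 1/2) y m /
     (of_nat m powr (w + 1/2) * Gamma (w + 1) * zeta (2 * w + 2) * of_real y powr (1/2))"

definition hs2 :: "real \<Rightarrow> complex \<Rightarrow> nat \<Rightarrow> complex" where
  "hs2 y w m = of_real y powr (1/2) * of_nat m powr (w - 1/2) * divisor_sigma (3 - 2 * w) m /
     (Gamma w * zeta (2 * w - 2))"

lemma Gamma_nonzero_Re_pos: "Re w > 0 \<Longrightarrow> Gamma w \<noteq> (0 :: complex)"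
  by (auto simp: Gamma_eq_zero_iff elim!: nonpos_Ints_cases)

lemma not_nonpos_Int_Re_pos: "Re w > 0 \<Longrightarrow> w \<notin> \<int>\<^sub>\<le>\<^sub>0"
  by (auto elim!: nonpos_Ints_cases)

lemma zeta_nonzero: "Re s > 1 \<Longrightarrow> zeta s \<noteq> 0"
  using norm_inverse_zeta_le[of "Re s"] by (metis order_refl)

text \<open>The functional equation turns Gamma(-w) zeta(-2w), the form used in the theorem, into
  the values at w + 1/2 and 2w + 1 that Poisson summation delivers.\<close>

lemma cs1_eq:
  assumes "Re w > 0"
  shows "cs1 y w = of_real pi powr (1/2) * Gamma (w + 1/2) * zeta (2 * w + 1) /
    (Gamma (w + 1) * zeta (2 * w + 2)) * of_real y powr (- w - 1)"
proof -
  have "complex_of_real pi powr (2 * w + 1) * of_real pi powr (- 2 * w - 1/2) = of_real pi powr (1/2)"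
    by (simp flip: powr_add)
  then have "complex_of_real pi powr (2 * w + 1) * (of_real pi powr (- 2 * w - 1/2) * X) = of_real pi powr (1/2) * X" for X
    by (simp only: mult.assoc[symmetric])
  then show ?thesis
    unfolding cs1_def remove_sings_Gamma_zeta[OF assms] by (simp only: mult.assoc)
qed

lemma lattice_form_homogeneous:
  assumes y: "y > 0" and g: "g \<ge> 1" and c: "c \<ge> 1"
  shows "complex_of_real (lattice_form x y (g * c, int g * d)) powr (- u) =
    of_nat g powr (- (2 * u)) * of_real (lattice_form x y (c, d)) powr (- u)"
proof -
  have q: "lattice_form x y (c, d) > 0"
    by (rule lattice_form_pos[OF y]) (use c in \<open>simp add: lattice_pairs_def\<close>)
  have g': "real g > 0" using g by simp
  have pos: "(real g)\<^sup>2 * lattice_form x y (c, d) > 0" using q g' by simp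
  have "ln ((real g)\<^sup>2 * lattice_form x y (c, d)) = 2 * ln (real g) + ln (lattice_form x y (c, d))"
    using q g' by (simp add: ln_mult_pos ln_realpow)
  then show ?thesis
    unfolding lattice_form_mult powr_of_pos_real[OF pos] powr_of_pos_real[OF q] of_nat_powr_exp[OF g] exp_add[symmetric]
    by (simp add: algebra_simps)
qed

lemma coprime_has_sum_series:
  fixes \<phi> :: "nat \<times> int \<Rightarrow> complex"
  assumes "(\<phi> has_sum (A + (\<Sum>m. L m))) lattice_pairs" "Re z > 1"
    and "\<And>g c d. g \<ge> 1 \<Longrightarrow> c \<ge> 1 \<Longrightarrow> \<phi> (g * c, int g * d) = of_nat g powr (- z) * \<phi> (c, d)"
    and "summable L" "a * A / zeta z = A'" "\<And>m. a / zeta z * L m = L' m"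
  shows "((\<lambda>p. a * \<phi> p) has_sum (A' + (\<Sum>m. L' m))) coprime_pairs"
proof -
  have "(\<Sum>m. L' m) = a / zeta z * (\<Sum>m. L m)"
    unfolding assms(6)[symmetric] by (rule suminf_mult[OF assms(4)])
  then have "a * ((A + (\<Sum>m. L m)) / zeta z) = A' + (\<Sum>m. L' m)"
    unfolding assms(5)[symmetric] by (simp add: distrib_left add_divide_distrib)
  then show ?thesis using has_sum_cmult_right[OF coprime_has_sum[OF assms(1-3)], of a] by simp
qed

lemma norm_divisor_sigma_le:
  assumes "Re e \<le> 0" "m \<ge> 1"
  shows "norm (divisor_sigma e m) \<le> real m"
proof -
  have "norm (divisor_sigma e m) \<le> (\<Sum>g | g dvd m. norm (complex_of_nat g powr e))"
    unfolding divisor_sigma_def by (rule norm_sum)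
  also have "\<dots> \<le> (\<Sum>g | g dvd m. 1)"
  proof (rule sum_mono)
    fix g assume "g \<in> {g. g dvd m}"
    then have "g \<ge> 1" using assms(2) by (auto simp: Suc_le_eq dest: dvd_pos_nat)
    then show "norm (complex_of_nat g powr e) \<le> 1"
      using assms(1) powr_mono[of "Re e" 0 "real g"] by (simp add: norm_powr_real_powr)
  qed
  also have "\<dots> = real (card {g. g dvd m})" by simp
  also have "\<dots> \<le> real (card {1..m})"
    using assms(2) by (intro of_nat_mono card_mono) (auto intro: dvd_imp_le simp: Suc_le_eq dest: dvd_pos_nat)
  finally show ?thesis by simp
qed

text \<open>The rescaling \<open>t \<mapsto> mt\<close> of the Bessel integral keeps the bound uniform in \<open>m\<close>.\<close>

lemma norm_powr_bessel_K_le: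
  assumes y: "y > 0" and m: "m \<ge> (1::nat)"
  shows "norm (of_nat m powr \<nu> * bessel_mode \<nu> y m) \<le>
    exp (- (pi * y)) ^ m * bessel_int_real (Re \<nu>) (pi * y / 2) (pi * y / 2)"
proof -
  have M: "real m > 0" "real m \<ge> 1" using m by simp_all
  have A: "pi * y > 0" using y by simp
  have B: "(real m)\<^sup>2 * (pi * y) > 0" using M A by simp
  have "bessel_int \<nu> (pi * y) ((real m)\<^sup>2 * (pi * y)) =
      2 * (of_nat m powr \<nu> * bessel_mode \<nu> y m)"
    using bessel_int_eq_bessel_K[OF M(1) refl, of \<nu> "pi * y"] by (simp add: mult_ac)
  then have "2 * norm (of_nat m powr \<nu> * bessel_mode \<nu> y m) =
      norm (bessel_int \<nu> (pi * y) ((real m)\<^sup>2 * (pi * y)))"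
    by (simp only: norm_mult norm_numeral)
  also have "\<dots> \<le> bessel_int_real (Re \<nu>) (pi * y) ((real m)\<^sup>2 * (pi * y))"
    by (rule norm_bessel_int_le_real[OF A B])
  also have "\<dots> \<le> exp (- (pi * y * real m)) * bessel_int_real (Re \<nu>) (pi * y / 2) (pi * y / 2)"
  proof (rule bessel_int_real_le[OF A B])
    fix t :: real assume t: "t > 0"
    have "0 \<le> (t - real m)\<^sup>2 / t" using t by simp
    also have "\<dots> = t + (real m)\<^sup>2 / t - 2 * real m"
      using t by (simp add: power2_eq_square field_simps)
    finally have 1: "2 * real m \<le> t + (real m)\<^sup>2 / t" by simp
    have "1 \<le> (real m)\<^sup>2" using M by simp
    then have 2: "t + 1 / t \<le> t + (real m)\<^sup>2 / t" using t by (simp add: divide_right_mono)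
    have "real m + 1 / 2 * t + 1 / 2 / t \<le> t + (real m)\<^sup>2 / t" using 1 2 by (simp add: field_simps)
    then have "pi * y * (real m + 1 / 2 * t + 1 / 2 / t) \<le> pi * y * (t + (real m)\<^sup>2 / t)"
      using A by (intro mult_left_mono) auto
    then show "pi * y * real m + pi * y / 2 * t + pi * y / 2 / t \<le> pi * y * t + (real m)\<^sup>2 * (pi * y) / t"
      by (simp add: distrib_left mult_ac)
  qed (use y in auto)
  also have "exp (- (pi * y * real m)) = exp (- (pi * y)) ^ m"
    unfolding exp_of_nat_mult[symmetric] by (simp add: mult_ac)
  finally have "2 * norm (of_nat m powr \<nu> * bessel_mode \<nu> y m) \<le>
      exp (- (pi * y)) ^ m * bessel_int_real (Re \<nu>) (pi * y / 2) (pi * y / 2)" .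
  then show ?thesis using norm_ge_zero[of "of_nat m powr \<nu> * bessel_mode \<nu> y m"] by linarith
qed

lemma summable_lattice_coeff:
  assumes y: "y > 0" and "Re e \<le> 0" and b: "\<And>m. norm (b m) \<le> B"
  shows "summable (\<lambda>m. b m * (of_nat (Suc m) powr \<nu> * divisor_sigma e (Suc m) * bessel_mode \<nu> y (Suc m)))"
proof (rule summable_comparison_test'[of _ 0])
  define D where "D = bessel_int_real (Re \<nu>) (pi * y / 2) (pi * y / 2)"
  have "pi * y > 0" using y by simp
  then show "summable (\<lambda>m. B * (D * (real (Suc m) * exp (- (pi * y)) ^ Suc m)))"
    by (intro summable_mult summable_exp_power(2))
  fix m
  have "norm (b m * (of_nat (Suc m) powr \<nu> * divisor_sigma e (Suc m) * bessel_mode \<nu> y (Suc m))) =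
      norm (b m) * (norm (divisor_sigma e (Suc m)) * norm (of_nat (Suc m) powr \<nu> * bessel_mode \<nu> y (Suc m)))"
    by (simp only: norm_mult mult_ac)
  also have "\<dots> \<le> B * (real (Suc m) * (exp (- (pi * y)) ^ Suc m * D))"
    unfolding D_def using order_trans[OF norm_ge_zero b]
    by (intro mult_mono b norm_divisor_sigma_le norm_powr_bessel_K_le y assms(2)) auto
  finally show "norm (b m * (of_nat (Suc m) powr \<nu> * divisor_sigma e (Suc m) * bessel_mode \<nu> y (Suc m))) \<le>
      B * (D * (real (Suc m) * exp (- (pi * y)) ^ Suc m))"
    by (simp only: mult_ac)
qed

lemma of_nat_powr_square:
  "g \<ge> 1 \<Longrightarrow> complex_of_nat g powr (- (2 * w - 2)) = of_nat g ^ 2 * of_nat g powr (- (2 * w))"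
  unfolding of_nat_powr_exp of_nat_power_exp exp_add[symmetric] by (simp add: algebra_simps)

lemma of_nat_powr_half:
  assumes "m \<ge> 1" shows "complex_of_nat m powr (w - 1/2) = of_nat m * of_nat m powr (w - 3/2)"
proof -
  have "w - 1/2 = 1 + (w - 3/2)" by simp
  then have "complex_of_nat m powr (w - 1/2) = of_nat m powr 1 * of_nat m powr (w - 3/2)" by (simp only: powr_add)
  then show ?thesis using assms by simp
qed

lemma summable_power_mult_power:
  fixes q :: real
  assumes q: "0 < q" "q < 1"
  shows "summable (\<lambda>m. real m ^ p * q ^ m)"
proof (rule summable_comparison_test'[of _ 0])
  define \<epsilon> where "\<epsilon> = - ln q / 2"
  have \<epsilon>: "\<epsilon> > 0" using q by (simp add: \<epsilon>_def ln_less_zero)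
  have qe: "q = exp (- (2 * \<epsilon>))" using q by (simp add: \<epsilon>_def)
  show "summable (\<lambda>m. fact p / \<epsilon> ^ p * exp (- \<epsilon>) ^ m)"
    using \<epsilon> by (intro summable_mult summable_geometric) simp
  fix m
  have "(\<epsilon> * real m) ^ p / fact p \<le> exp (\<epsilon> * real m)"
    by (rule power_div_fact_le_exp) (use \<epsilon> in simp)
  then have "real m ^ p \<le> fact p / \<epsilon> ^ p * exp (\<epsilon> * real m)"
    using \<epsilon> by (simp add: power_mult_distrib field_simps)
  then have "real m ^ p * q ^ m \<le> fact p / \<epsilon> ^ p * exp (\<epsilon> * real m) * q ^ m"
    using q by (intro mult_right_mono) auto
  also have "\<dots> = fact p / \<epsilon> ^ p * (exp (\<epsilon> * real m) * exp (- (2 * \<epsilon>)) ^ m)" by (simp add: qe)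
  also have "exp (\<epsilon> * real m) * exp (- (2 * \<epsilon>)) ^ m = exp (- \<epsilon>) ^ m"
    unfolding exp_of_nat_mult[symmetric] exp_add[symmetric] by (simp add: algebra_simps)
  finally show "norm (real m ^ p * q ^ m) \<le> fact p / \<epsilon> ^ p * exp (- \<epsilon>) ^ m"
    using q by simp
qed

lemma summable_lattice_cos:
  assumes "y > 0" "Re e \<le> 0"
  shows "summable (\<lambda>m. 4 * cos_mode x (Suc m) * lattice_coeff y u (Suc m) e)"
proof -
  define b where "b = (\<lambda>m. 4 * cos_mode x (Suc m) * (of_real pi powr u / Gamma u * of_real y powr (1/2 - u)))"
  have "norm (b m) \<le> 4 * 1 * norm (of_real pi powr u / Gamma u * of_real y powr (1/2 - u))" for m
    unfolding b_def norm_mult[of "4 * _"] norm_mult[of 4] by (intro mult_right_mono mult_mono) auto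
  from summable_lattice_coeff[where b = b, OF assms this, where \<nu> = "u - 1/2"] show ?thesis
    unfolding b_def lattice_coeff_def by (simp only: mult_ac)
qed

section \<open>The four scalar sums over coprime pairs\<close>

context
  fixes x y :: real and w :: complex
  assumes y: "y > 0" and w: "Re w > 2"
begin

text \<open>The summand 1/q of the upper left entry, with lattice exponent w + 1. The divisor sum
  arrives with order -(2w + 1) and is flipped to the order 2w + 1 of the theorem.\<close>

lemma coprime_sum_11a:
  "((\<lambda>p. of_real y powr w * of_real (lattice_form x y p) powr (- (w + 1))) has_sum
     (cs1 y w + (\<Sum>m. 4 * of_real pi powr w * (cos_mode x (Suc m) * hs1 y w (Suc m))))) coprime_pairs"
proof (rule coprime_has_sum_series[where z = "2 * w + 2"])
  let ?A = "of_real pi powr (1/2) * Gamma (w + 1 - 1/2) / Gamma (w + 1) * of_real y powr (1 - 2 * (w + 1)) * zeta (2 * (w + 1) - 1 - of_nat 0)"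
  let ?L = "\<lambda>m. 4 * cos_mode x (Suc m) * lattice_coeff y (w + 1) (Suc m) (1 - 2 * (w + 1) + of_nat 0)"
  have u: "Re (w + 1) > 1 + real 0 / 2" using w by simp
  show "((\<lambda>p. of_real (lattice_form x y p) powr (- (w + 1))) has_sum (?A + (\<Sum>m. ?L m))) lattice_pairs"
    using lattice_sum_even[OF y u, of x] by simp
  show "Re (2 * w + 2) > 1" using w by simp
  show "complex_of_real (lattice_form x y (g * c, int g * d)) powr (- (w + 1)) =
      of_nat g powr (- (2 * w + 2)) * of_real (lattice_form x y (c, d)) powr (- (w + 1))" if "g \<ge> 1" "c \<ge> 1" for g c d
    using lattice_form_homogeneous[OF y that, of x d "w + 1"] by (simp add: distrib_left)
  show "summable ?L" by (rule summable_lattice_cos[OF y]) (use w in simp)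
  show "of_real y powr w / zeta (2 * w + 2) * ?L m =
      4 * of_real pi powr w * (cos_mode x (Suc m) * hs1 y w (Suc m))" for m
  proof -
    have flip: "of_nat (Suc m) powr (w + 1/2) * divisor_sigma (- (2 * (w + 1/2))) (Suc m) =
        of_nat (Suc m) powr (- (w + 1/2)) * divisor_sigma (2 * (w + 1/2)) (Suc m)"
      by (rule divisor_sigma_flip) simp
    have e: "1 - 2 * (w + 1) + of_nat 0 = - (2 * (w + 1/2))" "w + 1 - 1/2 = w + 1/2" "2 * w + 1 = 2 * (w + 1/2)"
      by (simp_all add: algebra_simps)
    have yy: "of_real y powr w * of_real y powr (1/2 - (w + 1)) = inverse (complex_of_real y powr (1/2))"
      using y by (simp add: powr_minus[symmetric] flip: powr_add)
    have pp: "of_real pi powr (w + 1) = complex_of_real pi powr w * of_real pi"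
      by (simp add: powr_add)
    have mm: "of_nat (Suc m) powr (- (w + 1/2)) = inverse (complex_of_nat (Suc m) powr (w + 1/2))"
      by (rule powr_minus)
    have "of_real y powr w / zeta (2 * w + 2) * ?L m =
      4 * cos_mode x (Suc m) * (of_real pi powr (w + 1) / Gamma (w + 1)) / zeta (2 * w + 2) *
      (of_real y powr w * of_real y powr (1/2 - (w + 1))) *
      (of_nat (Suc m) powr (w + 1/2) * divisor_sigma (- (2 * (w + 1/2))) (Suc m)) * bessel_mode (w + 1/2) y (Suc m)"
      unfolding lattice_coeff_def e by (simp add: mult_ac)
    then show ?thesis
      unfolding flip yy pp mm hs1_def e by (simp only: divide_inverse inverse_mult_distrib mult_ac)
  qed
  have e: "w + 1 - 1/2 = w + 1/2" "2 * (w + 1) - 1 - of_nat 0 = 2 * w + 1" by (simp_all add: algebra_simps)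
  have yy: "of_real y powr (- w - 1) = complex_of_real y powr w * of_real y powr (1 - 2 * (w + 1))"
    by (simp flip: powr_add)
  have "Re w > 0" using w by simp
  then show "of_real y powr w * ?A / zeta (2 * w + 2) = cs1 y w"
    unfolding cs1_eq[OF \<open>Re w > 0\<close>] e yy by (simp only: divide_inverse inverse_mult_distrib mult_ac)
qed

text \<open>The summand c^2 of the upper left entry; multiplied by y it is also the imaginary part
  of c j off the diagonal.\<close>

lemma coprime_sum_11b:
  "((\<lambda>p. of_real y powr w * (of_nat (fst p) ^ 2 * of_real (lattice_form x y p) powr (- w))) has_sum
     (cs2 y w + (\<Sum>m. 4 * of_real pi powr w * (cos_mode x (Suc m) *
        (hs2 y w (Suc m) * bessel_mode (w - 1/2) y (Suc m)))))) coprime_pairs"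
proof (rule coprime_has_sum_series[where z = "2 * w - 2"])
  let ?A = "of_real pi powr (1/2) * Gamma (w - 1/2) / Gamma w * of_real y powr (1 - 2 * w) * zeta (2 * w - 1 - of_nat 2)"
  let ?L = "\<lambda>m. 4 * cos_mode x (Suc m) * lattice_coeff y w (Suc m) (1 - 2 * w + of_nat 2)"
  have u: "Re w > 1 + real 2 / 2" using w by simp
  show "((\<lambda>p. of_nat (fst p) ^ 2 * of_real (lattice_form x y p) powr (- w)) has_sum (?A + (\<Sum>m. ?L m))) lattice_pairs"
    by (rule lattice_sum_even[OF y u]) simp
  show "Re (2 * w - 2) > 1" using w by simp
  show "of_nat (fst (g * c, int g * d)) ^ 2 * complex_of_real (lattice_form x y (g * c, int g * d)) powr (- w) =
      of_nat g powr (- (2 * w - 2)) * (of_nat (fst (c, d)) ^ 2 * of_real (lattice_form x y (c, d)) powr (- w))"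
    if "g \<ge> 1" "c \<ge> 1" for g c d
    unfolding of_nat_powr_square[OF that(1)] using lattice_form_homogeneous[OF y that, of x d w] by (simp add: power_mult_distrib)
  show "summable ?L" by (rule summable_lattice_cos[OF y]) (use w in simp)
  have yy: "of_real y powr w * of_real y powr (1/2 - w) = complex_of_real y powr (1/2)"
    by (simp flip: powr_add)
  have e: "1 - 2 * w + of_nat 2 = 3 - 2 * w" "2 * w - 1 - of_nat 2 = 2 * w - 3" by simp_all
  show "of_real y powr w / zeta (2 * w - 2) * ?L m =
      4 * of_real pi powr w * (cos_mode x (Suc m) *
        (hs2 y w (Suc m) * bessel_mode (w - 1/2) y (Suc m)))" for m
    unfolding lattice_coeff_def e hs2_def yy[symmetric] by (simp only: divide_inverse inverse_mult_distrib mult_ac)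
  have yy: "of_real y powr (1 - w) = complex_of_real y powr w * of_real y powr (1 - 2 * w)"
    by (simp flip: powr_add)
  show "of_real y powr w * ?A / zeta (2 * w - 2) = cs2 y w"
    unfolding e cs2_def yy by (simp only: divide_inverse inverse_mult_distrib mult_ac)
qed

text \<open>The lower right entry q, with lattice exponent w - 1. Gamma(w - 1) and Gamma(w - 3/2)
  are each raised by one step to match the other entries, and this produces the factors w - 1 and
  (2w - 2) / (2w - 3).\<close>

lemma coprime_sum_22:
  "((\<lambda>p. of_real y powr w * of_real (lattice_form x y p) powr (- (w - 1))) has_sum
     (of_real y ^ 2 * ((2 * w - 2) / (2 * w - 3) * cs2 y w) +
      (\<Sum>m. 4 * of_real pi powr w * (cos_mode x (Suc m) * (hs2 y w (Suc m) *
        ((w - 1) * of_real y / (of_real pi * of_nat (Suc m)) * bessel_mode (w - 3/2) y (Suc m))))))) coprime_pairs"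
proof (rule coprime_has_sum_series[where z = "2 * w - 2"])
  let ?A = "of_real pi powr (1/2) * Gamma (w - 1 - 1/2) / Gamma (w - 1) * of_real y powr (1 - 2 * (w - 1)) * zeta (2 * (w - 1) - 1 - of_nat 0)"
  let ?L = "\<lambda>m. 4 * cos_mode x (Suc m) * lattice_coeff y (w - 1) (Suc m) (1 - 2 * (w - 1) + of_nat 0)"
  have u: "Re (w - 1) > 1 + real 0 / 2" using w by simp
  show "((\<lambda>p. of_real (lattice_form x y p) powr (- (w - 1))) has_sum (?A + (\<Sum>m. ?L m))) lattice_pairs"
    using lattice_sum_even[OF y u, of x] by simp
  show "Re (2 * w - 2) > 1" using w by simp
  show "complex_of_real (lattice_form x y (g * c, int g * d)) powr (- (w - 1)) =
      of_nat g powr (- (2 * w - 2)) * of_real (lattice_form x y (c, d)) powr (- (w - 1))" if "g \<ge> 1" "c \<ge> 1" for g c d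
    using lattice_form_homogeneous[OF y that, of x d "w - 1"] by (simp add: right_diff_distrib)
  show "summable ?L" by (rule summable_lattice_cos[OF y]) (use w in simp)
  have e: "w - 1 - 1/2 = w - 3/2" "1 - 2 * (w - 1) + of_nat 0 = 3 - 2 * w" "2 * (w - 1) - 1 - of_nat 0 = 2 * w - 3"
    "1 - 2 * (w - 1) = 3 - 2 * w" by (simp_all add: algebra_simps)
  have nz: "w - 1 \<noteq> 0" "w - 3/2 \<noteq> 0" using w by (auto simp: complex_eq_iff)
  have ni: "w - 1 \<notin> \<int>\<^sub>\<le>\<^sub>0" "w - 3/2 \<notin> \<int>\<^sub>\<le>\<^sub>0"
    using w by (auto intro!: not_nonpos_Int_Re_pos)
  have G1: "inverse (Gamma (w - 1)) = (w - 1) * inverse (Gamma w)"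
    using Gamma_plus1[OF ni(1)] nz by simp
  have G2: "Gamma (w - 3/2) = inverse (w - 3/2) * Gamma (w - 1/2)"
    using Gamma_plus1[OF ni(2)] nz by simp
  show "of_real y powr w / zeta (2 * w - 2) * ?L m =
      4 * of_real pi powr w * (cos_mode x (Suc m) * (hs2 y w (Suc m) *
        ((w - 1) * of_real y / (of_real pi * of_nat (Suc m)) * bessel_mode (w - 3/2) y (Suc m))))" for m
  proof -
    have yy: "of_real y powr w * of_real y powr (1/2 - (w - 1)) = complex_of_real y powr (1/2) * of_real y"
    proof -
      have "of_real y powr w * of_real y powr (1/2 - (w - 1)) = complex_of_real y powr (1/2 + 1)"
        by (simp flip: powr_add)
      then show ?thesis using y by (simp only: powr_add) simp
    qed
    have pp: "of_real pi powr (w - 1) = complex_of_real pi powr w / of_real pi" by (simp add: powr_diff)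
    have mm: "of_nat (Suc m) powr (w - 3/2) = complex_of_nat (Suc m) powr (w - 1/2) / of_nat (Suc m)"
      using of_nat_powr_half[of "Suc m" w] by (simp del: of_nat_Suc)
    have "of_real y powr w / zeta (2 * w - 2) * ?L m =
      4 * cos_mode x (Suc m) * (of_real pi powr (w - 1) / Gamma (w - 1)) / zeta (2 * w - 2) *
      (of_real y powr w * of_real y powr (1/2 - (w - 1))) *
      (of_nat (Suc m) powr (w - 3/2) * divisor_sigma (3 - 2 * w) (Suc m)) * bessel_mode (w - 3/2) y (Suc m)"
      unfolding lattice_coeff_def e by (simp add: mult_ac)
    then show ?thesis
      unfolding yy pp mm hs2_def by (simp only: divide_inverse inverse_mult_distrib G1 mult_ac)
  qed
  have yy: "of_real y powr w * of_real y powr (3 - 2 * w) = complex_of_real y powr (1 - w) * of_real y ^ 2"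
  proof -
    have "of_real y powr w * of_real y powr (3 - 2 * w) = complex_of_real y powr (1 - w + of_nat 2)"
      by (simp flip: powr_add)
    then show ?thesis using y by (simp only: powr_add powr_nat') simp
  qed
  have "2 * w - 2 = 2 * (w - 1)" "2 * w - 3 = 2 * (w - 3/2)" by (simp_all add: algebra_simps)
  then have r: "(2 * w - 2) / (2 * w - 3) = (w - 1) / (w - 3/2)"
    by (simp only: mult_divide_mult_cancel_left_if) simp
  have "of_real y powr w * ?A / zeta (2 * w - 2) = (of_real y powr w * of_real y powr (3 - 2 * w)) *
      (of_real pi powr (1/2) * Gamma (w - 3/2) / Gamma (w - 1) * zeta (2 * w - 3) / zeta (2 * w - 2))"
    unfolding e by (simp add: mult_ac)
  also have "\<dots> = of_real y ^ 2 * ((w - 1) / (w - 3/2) * cs2 y w)"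
    unfolding yy cs2_def G2 by (simp only: divide_inverse inverse_mult_distrib G1 mult_ac)
  finally show "of_real y powr w * ?A / zeta (2 * w - 2) = of_real y ^ 2 * ((2 * w - 2) / (2 * w - 3) * cs2 y w)"
    unfolding r .
qed

text \<open>The real part c (c x + d) of the off-diagonal entries. Like c^2, this weight is
  homogeneous of degree 2, so the divisor is again zeta(2w - 2).\<close>

lemma coprime_sum_odd:
  "((\<lambda>p. of_real y powr w * (of_real (real (fst p) * (real (fst p) * x + of_int (snd p))) * of_real (lattice_form x y p) powr (- w))) has_sum
     (0 + (\<Sum>m. 4 * of_real pi powr w * (sin_mode x (Suc m) * (hs2 y w (Suc m) *
        (of_real y * bessel_mode (w - 3/2) y (Suc m))))))) coprime_pairs"
proof (rule coprime_has_sum_series[where z = "2 * w - 2"])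
  let ?L = "\<lambda>m. 4 * sin_mode x (Suc m) * (of_real pi powr w / Gamma w * of_real y powr (3/2 - w) *
       of_nat (Suc m) powr (w - 1/2) * divisor_sigma (3 - 2 * w) (Suc m) * bessel_mode (w - 3/2) y (Suc m))"
  show "((\<lambda>p. of_real (real (fst p) * (real (fst p) * x + of_int (snd p))) * of_real (lattice_form x y p) powr (- w)) has_sum
     (0 + (\<Sum>m. ?L m))) lattice_pairs"
    unfolding add_0_left by (rule lattice_sum_odd[OF y w])
  show "Re (2 * w - 2) > 1" using w by simp
  show "complex_of_real (real (fst (g * c, int g * d)) * (real (fst (g * c, int g * d)) * x + of_int (snd (g * c, int g * d)))) *
        of_real (lattice_form x y (g * c, int g * d)) powr (- w) =
      of_nat g powr (- (2 * w - 2)) * (of_real (real (fst (c, d)) * (real (fst (c, d)) * x + of_int (snd (c, d)))) *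
        of_real (lattice_form x y (c, d)) powr (- w))"
    if "g \<ge> 1" "c \<ge> 1" for g c d
  proof -
    have "real (g * c) * (real (g * c) * x + of_int (int g * d)) = (real g)\<^sup>2 * (real c * (real c * x + of_int d))"
      by (simp add: power2_eq_square algebra_simps)
    then show ?thesis using lattice_form_homogeneous[OF y that, of x d w] of_nat_powr_square[OF that(1), of w]
      by (simp only: fst_conv snd_conv of_real_mult[of "(real g)\<^sup>2"] of_real_power of_real_of_nat_eq) (simp add: mult_ac)
  qed
  show "summable ?L"
  proof (rule summable_comparison_test'[of _ 0])
    define D where "D = bessel_int_real (Re (w - 3/2)) (pi * y / 2) (pi * y / 2)"
    define B where "B = 4 * norm (of_real pi powr w / Gamma w * of_real y powr (3/2 - w))"
    have q: "0 < exp (- (pi * y))" "exp (- (pi * y)) < 1" using y by simp_all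
    have "summable (\<lambda>m. real (Suc m) ^ 2 * exp (- (pi * y)) ^ Suc m)"
      using summable_power_mult_power[OF q, of 2] by (subst summable_Suc_iff)
    then show "summable (\<lambda>m. B * (D * (real (Suc m) ^ 2 * exp (- (pi * y)) ^ Suc m)))"
      by (intro summable_mult)
    fix m
    have half: "complex_of_nat (Suc m) powr (w - 1/2) = of_nat (Suc m) * of_nat (Suc m) powr (w - 3/2)"
      by (rule of_nat_powr_half) simp
    have "norm (?L m) = (4 * norm (sin_mode x (Suc m) :: complex) * norm (of_real pi powr w / Gamma w * of_real y powr (3/2 - w))) *
        real (Suc m) * (norm (divisor_sigma (3 - 2 * w) (Suc m)) * norm (of_nat (Suc m) powr (w - 3/2) * bessel_mode (w - 3/2) y (Suc m)))"
      unfolding half by (simp only: norm_mult norm_of_nat norm_numeral mult_ac)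
    also have "\<dots> \<le> (4 * 1 * norm (of_real pi powr w / Gamma w * of_real y powr (3/2 - w))) *
        real (Suc m) * (real (Suc m) * (exp (- (pi * y)) ^ Suc m * D))"
      unfolding D_def
      by (intro mult_mono mult_right_mono mult_left_mono norm_divisor_sigma_le norm_powr_bessel_K_le y) (use w in auto)
    finally show "norm (?L m) \<le> B * (D * (real (Suc m) ^ 2 * exp (- (pi * y)) ^ Suc m))"
      by (simp only: B_def power2_eq_square mult_ac mult_1_right)
  qed
  have "of_real y powr w * of_real y powr (3/2 - w) = complex_of_real y powr (1/2 + 1)"
    by (simp flip: powr_add)
  also have "\<dots> = complex_of_real y powr (1/2) * of_real y" unfolding powr_add using y by simp
  finally have yy: "of_real y powr w * of_real y powr (3/2 - w) = complex_of_real y powr (1/2) * of_real y" .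
  show "of_real y powr w / zeta (2 * w - 2) * ?L m = 4 * of_real pi powr w * (sin_mode x (Suc m) * (hs2 y w (Suc m) *
        (of_real y * bessel_mode (w - 3/2) y (Suc m))))" for m
  proof -
    have "of_real y powr w / zeta (2 * w - 2) * ?L m =
      4 * sin_mode x (Suc m) * (of_real pi powr w / Gamma w) / zeta (2 * w - 2) *
      (of_real y powr w * of_real y powr (3/2 - w)) *
      (of_nat (Suc m) powr (w - 1/2) * divisor_sigma (3 - 2 * w) (Suc m)) * bessel_mode (w - 3/2) y (Suc m)"
      by (simp add: mult_ac)
    then show ?thesis
      unfolding yy hs2_def by (simp only: divide_inverse inverse_mult_distrib mult_ac)
  qed
qed (simp_all)

end

section \<open>Growth under integer shifts\<close>

definition Re_gt :: "complex set" where
  "Re_gt = {w. 3/2 < Re w}"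

lemma open_Re_gt: "open Re_gt"
  unfolding Re_gt_def by (rule open_halfspace_Re_gt)

lemma Re_gt_add_nat: "s \<in> Re_gt \<Longrightarrow> s + of_nat k \<in> Re_gt"
  by (simp add: Re_gt_def)

text \<open>A locally uniform bound geometric in the shift: against the coefficients of an entire function
  it makes \<open>\<Sum>k. \<alpha> k * c (s + k)\<close> converge to a holomorphic function of \<open>s\<close>.\<close>

definition shift_growth :: "(complex \<Rightarrow> complex) \<Rightarrow> bool" where
  "shift_growth c \<longleftrightarrow> c holomorphic_on Re_gt \<and>
     (\<forall>z\<in>Re_gt. \<exists>r>0. \<exists>D E. 0 \<le> D \<and> 0 \<le> E \<and>
        (\<forall>s\<in>ball z r \<inter> Re_gt. \<forall>k. norm (c (s + of_nat k)) \<le> D * E ^ k))"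

text \<open>The analogue of \<open>shift_growth\<close> with decay in the frequency m. The bound is
  a product of a function of k and a function of m, which makes the double series absolutely
  convergent.\<close>

definition fourier_growth :: "real \<Rightarrow> nat \<Rightarrow> (complex \<Rightarrow> nat \<Rightarrow> complex) \<Rightarrow> bool" where
  "fourier_growth q p b \<longleftrightarrow> (\<forall>m\<ge>1. (\<lambda>w. b w m) holomorphic_on Re_gt) \<and>
     (\<forall>z\<in>Re_gt. \<exists>r>0. \<exists>D E. 0 \<le> D \<and> 0 \<le> E \<and>
        (\<forall>s\<in>ball z r \<inter> Re_gt. \<forall>k. \<forall>m\<ge>1. norm (b (s + of_nat k) m) \<le> D * E ^ k * (real m ^ p * q ^ m)))"

text \<open>An infinite radius of convergence is demanded because the geometric rate E of a growth
  bound can be arbitrarily large.\<close>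

definition entire_coeffs :: "(nat \<Rightarrow> complex) \<Rightarrow> bool" where
  "entire_coeffs \<alpha> \<longleftrightarrow> (\<forall>E\<ge>0. summable (\<lambda>k. norm (\<alpha> k) * E ^ k))"

lemma entire_coeffs_exp: "entire_coeffs (\<lambda>k. a ^ k / fact k)"
  unfolding entire_coeffs_def
proof (intro allI impI)
  fix E :: real
  have "summable (\<lambda>k. inverse (fact k) * (norm a * E) ^ k)" by (rule summable_exp)
  then show "summable (\<lambda>k. norm (a ^ k / fact k) * E ^ k)"
    by (simp add: norm_divide norm_power power_mult_distrib field_simps)
qed

lemma entire_coeffs_shift:
  assumes "entire_coeffs \<alpha>" shows "entire_coeffs (\<lambda>k. \<alpha> (Suc k))"
  unfolding entire_coeffs_def
proof (intro allI impI)
  fix E :: real assume E: "E \<ge> 0"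
  \<comment> \<open>E may be 0; the powers of E + 1 increase with the exponent and absorb the index
    shift.\<close>
  have "summable (\<lambda>k. norm (\<alpha> k) * (E + 1) ^ k)" using assms E by (simp add: entire_coeffs_def)
  then have "summable (\<lambda>k. norm (\<alpha> (Suc k)) * (E + 1) ^ Suc k)" by (subst summable_Suc_iff)
  then show "summable (\<lambda>k. norm (\<alpha> (Suc k)) * E ^ k)"
  proof (rule summable_comparison_test'[of _ 0])
    fix k
    have "E ^ k \<le> (E + 1) ^ k" using E by (intro power_mono) auto
    also have "\<dots> \<le> (E + 1) ^ Suc k" using E by (intro power_increasing) auto
    finally show "norm (norm (\<alpha> (Suc k)) * E ^ k) \<le> norm (\<alpha> (Suc k)) * (E + 1) ^ Suc k"
      using E by (simp add: abs_mult mult_left_mono)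
  qed
qed

lemma holomorphic_shift:
  assumes "c holomorphic_on Re_gt"
  shows "(\<lambda>s. c (s + of_nat k)) holomorphic_on Re_gt"
proof -
  have 1: "(\<lambda>s. s + of_nat k) holomorphic_on Re_gt" by (intro holomorphic_intros)
  have 2: "(\<lambda>s. s + of_nat k) ` Re_gt \<subseteq> Re_gt" by (auto simp: Re_gt_add_nat)
  show ?thesis using holomorphic_on_compose_gen[OF 1 assms 2] by (simp add: o_def)
qed

lemma shift_growth_series:
  assumes c: "shift_growth c" and \<alpha>: "entire_coeffs \<alpha>"
  shows "\<And>s. s \<in> Re_gt \<Longrightarrow> summable (\<lambda>k. norm (\<alpha> k * c (s + of_nat k)))"
    and "(\<lambda>s. \<Sum>k. \<alpha> k * c (s + of_nat k)) holomorphic_on Re_gt"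
proof -
  have dom: "\<exists>r>0. \<exists>M. summable M \<and> (\<forall>s\<in>ball z r \<inter> Re_gt. \<forall>k. norm (\<alpha> k * c (s + of_nat k)) \<le> M k)"
    if z: "z \<in> Re_gt" for z
  proof -
    obtain r D E where r: "r > 0" "0 \<le> D" "0 \<le> E"
      "\<And>s k. s \<in> ball z r \<inter> Re_gt \<Longrightarrow> norm (c (s + of_nat k)) \<le> D * E ^ k"
      using c z unfolding shift_growth_def by meson
    have "summable (\<lambda>k. D * (norm (\<alpha> k) * E ^ k))"
      using \<alpha> r by (intro summable_mult) (simp add: entire_coeffs_def)
    moreover have "norm (\<alpha> k * c (s + of_nat k)) \<le> D * (norm (\<alpha> k) * E ^ k)" if "s \<in> ball z r \<inter> Re_gt" for s k
      using mult_left_mono[OF r(4)[OF that, of k] norm_ge_zero[of "\<alpha> k"]] by (simp add: norm_mult mult_ac)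
    ultimately show ?thesis using r(1) by blast
  qed
  have hol: "(\<lambda>s. \<alpha> k * c (s + of_nat k)) holomorphic_on Re_gt" for k
    using c by (intro holomorphic_intros holomorphic_shift) (simp add: shift_growth_def)
  show "\<And>s. s \<in> Re_gt \<Longrightarrow> summable (\<lambda>k. norm (\<alpha> k * c (s + of_nat k)))"
    by (rule holomorphic_on_suminf(2)[OF open_Re_gt hol dom])
  show "(\<lambda>s. \<Sum>k. \<alpha> k * c (s + of_nat k)) holomorphic_on Re_gt"
    by (rule holomorphic_on_suminf(1)[OF open_Re_gt hol dom])
qed

lemma fourier_growth_imp_shift_growth:
  assumes "fourier_growth q p b" "0 < q" "m \<ge> 1"
  shows "shift_growth (\<lambda>w. b w m)"
  unfolding shift_growth_def
proof (intro conjI ballI)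
  show "(\<lambda>w. b w m) holomorphic_on Re_gt" using assms by (simp add: fourier_growth_def)
  fix z assume "z \<in> Re_gt"
  then obtain r D E where r: "r > 0" "0 \<le> D" "0 \<le> E"
    "\<And>s k m. s \<in> ball z r \<inter> Re_gt \<Longrightarrow> m \<ge> 1 \<Longrightarrow> norm (b (s + of_nat k) m) \<le> D * E ^ k * (real m ^ p * q ^ m)"
    using assms(1) unfolding fourier_growth_def by meson
  show "\<exists>r>0. \<exists>D E. 0 \<le> D \<and> 0 \<le> E \<and> (\<forall>s\<in>ball z r \<inter> Re_gt. \<forall>k. norm (b (s + of_nat k) m) \<le> D * E ^ k)"
  proof (intro exI conjI ballI allI)
    show "0 < r" "0 \<le> D * (real m ^ p * q ^ m)" "0 \<le> E" using r assms by simp_all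
    show "norm (b (s + of_nat k) m) \<le> D * (real m ^ p * q ^ m) * E ^ k" if "s \<in> ball z r \<inter> Re_gt" for s k
      using r(4)[OF that assms(3), of k] by (simp add: mult_ac)
  qed
qed

text \<open>The majorant is a product over k and m, so all rearrangements are legitimate. The last
  claim swaps the two summations: expanding the exponential puts k outermost, whereas the Fourier
  expansion has m outermost.\<close>

lemma fourier_growth_series:
  assumes b: "fourier_growth q p b" and q: "0 < q" "q < 1" and \<alpha>: "entire_coeffs \<alpha>"
  shows "\<And>s m. s \<in> Re_gt \<Longrightarrow> m \<ge> 1 \<Longrightarrow> summable (\<lambda>k. norm (\<alpha> k * b (s + of_nat k) m))"
    and "\<And>s. s \<in> Re_gt \<Longrightarrow> summable (\<lambda>m. norm (\<Sum>k. \<alpha> k * b (s + of_nat k) (Suc m)))"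
    and "(\<lambda>s. \<Sum>m. \<Sum>k. \<alpha> k * b (s + of_nat k) (Suc m)) holomorphic_on Re_gt"
    and "\<And>s. s \<in> Re_gt \<Longrightarrow> (\<lambda>k. \<Sum>m. \<alpha> k * b (s + of_nat k) (Suc m)) sums (\<Sum>m. \<Sum>k. \<alpha> k * b (s + of_nat k) (Suc m))"
proof -
  let ?B = "\<lambda>D E k m. D * (norm (\<alpha> k) * E ^ k) * (real (Suc m) ^ p * q ^ Suc m)"
  let ?g = "\<lambda>s k m. \<alpha> k * b (s + of_nat k) (Suc m)"
  note sg = fourier_growth_imp_shift_growth[OF b q(1)]
  show sm1: "summable (\<lambda>k. norm (\<alpha> k * b (s + of_nat k) m))" if "s \<in> Re_gt" "m \<ge> 1" for s m
    by (rule shift_growth_series(1)[OF sg[OF that(2)] \<alpha> that(1)])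
  have dom0: "\<exists>r>0. \<exists>D E. 0 \<le> D \<and> 0 \<le> E \<and> summable (\<lambda>k. norm (\<alpha> k) * E ^ k) \<and>
      (\<forall>s\<in>ball z r \<inter> Re_gt. \<forall>k m. norm (?g s k m) \<le> ?B D E k m)"
    if z: "z \<in> Re_gt" for z
  proof -
    obtain r D E where r: "r > 0" "0 \<le> D" "0 \<le> E"
      "\<And>s k m. s \<in> ball z r \<inter> Re_gt \<Longrightarrow> m \<ge> 1 \<Longrightarrow> norm (b (s + of_nat k) m) \<le> D * E ^ k * (real m ^ p * q ^ m)"
      using b z unfolding fourier_growth_def by meson
    have "norm (?g s k m) \<le> ?B D E k m"
      if "s \<in> ball z r \<inter> Re_gt" for s k m
      using mult_left_mono[OF r(4)[OF that, of "Suc m" k] norm_ge_zero[of "\<alpha> k"]] by (simp only: norm_mult mult_ac)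
    moreover have "summable (\<lambda>k. norm (\<alpha> k) * E ^ k)" using \<alpha> r by (simp add: entire_coeffs_def)
    ultimately show ?thesis using r(1,2,3) by blast
  qed
  have smq: "summable (\<lambda>m. real (Suc m) ^ p * q ^ Suc m)"
    using summable_power_mult_power[OF q, of p] by (subst summable_Suc_iff)
  have dom: "\<exists>r>0. \<exists>M. summable M \<and> (\<forall>s\<in>ball z r \<inter> Re_gt. \<forall>m. norm (\<Sum>k. ?g s k m) \<le> M m)"
    if z: "z \<in> Re_gt" for z
  proof -
    obtain r D E where r: "r > 0" "0 \<le> D" "0 \<le> E" "summable (\<lambda>k. norm (\<alpha> k) * E ^ k)"
      "\<And>s k m. s \<in> ball z r \<inter> Re_gt \<Longrightarrow> norm (?g s k m) \<le> ?B D E k m"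
      using dom0[OF z] by meson
    define A where "A = (\<Sum>k. norm (\<alpha> k) * E ^ k)"
    have "norm (\<Sum>k. ?g s k m) \<le> D * A * (real (Suc m) ^ p * q ^ Suc m)"
      if s: "s \<in> ball z r \<inter> Re_gt" for s m
    proof -
      have "norm (\<Sum>k. ?g s k m) \<le> (\<Sum>k. norm (?g s k m))"
        using s by (intro summable_norm sm1) auto
      also have "\<dots> \<le> (\<Sum>k. ?B D E k m)"
        using s r(4) by (intro suminf_le r(5) sm1 summable_mult2 summable_mult) auto
      also have "\<dots> = D * A * (real (Suc m) ^ p * q ^ Suc m)"
        unfolding A_def by (subst suminf_mult2[symmetric, OF summable_mult[OF r(4)]], subst suminf_mult[OF r(4)]) simp
      finally show ?thesis .
    qed
    then show ?thesis using r(1) summable_mult[OF smq, of "D * A"] by blast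
  qed
  have hol: "(\<lambda>s. \<Sum>k. ?g s k m) holomorphic_on Re_gt" for m
    by (rule shift_growth_series(2)[OF sg \<alpha>]) simp
  show "\<And>s. s \<in> Re_gt \<Longrightarrow> summable (\<lambda>m. norm (\<Sum>k. ?g s k m))"
    by (rule holomorphic_on_suminf(2)[OF open_Re_gt hol dom])
  show "(\<lambda>s. \<Sum>m. \<Sum>k. ?g s k m) holomorphic_on Re_gt"
    by (rule holomorphic_on_suminf(1)[OF open_Re_gt hol dom])
  fix s assume s: "s \<in> Re_gt"
  obtain r D E where r: "r > 0" "0 \<le> D" "0 \<le> E" "summable (\<lambda>k. norm (\<alpha> k) * E ^ k)"
      "\<And>s' k m. s' \<in> ball s r \<inter> Re_gt \<Longrightarrow> norm (\<alpha> k * b (s' + of_nat k) (Suc m)) \<le> ?B D E k m"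
    using dom0[OF s] by meson
  define f where "f = (\<lambda>k m. ?g s k m)"
  have bound: "norm (f k m) \<le> ?B D E k m" for k m
    unfolding f_def by (rule r(5)) (use s r in auto)
  have "(\<lambda>(k, m). ?B D E k m) summable_on UNIV \<times> UNIV"
  proof (rule summable_on_SigmaI[where g = "\<lambda>k. D * (norm (\<alpha> k) * E ^ k) * (\<Sum>m. real (Suc m) ^ p * q ^ Suc m)"])
    have "(\<lambda>m. real (Suc m) ^ p * q ^ Suc m) sums (\<Sum>m. real (Suc m) ^ p * q ^ Suc m)"
      by (rule summable_sums[OF smq])
    then have hs: "((\<lambda>m. real (Suc m) ^ p * q ^ Suc m) has_sum (\<Sum>m. real (Suc m) ^ p * q ^ Suc m)) UNIV"
      by (rule sums_nonneg_imp_has_sum) (use q in auto)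
    show "((\<lambda>m. case (k, m) of (k, m) \<Rightarrow> ?B D E k m) has_sum
        D * (norm (\<alpha> k) * E ^ k) * (\<Sum>m. real (Suc m) ^ p * q ^ Suc m)) UNIV" for k
      using has_sum_cmult_right[OF hs] by simp
    have "(\<lambda>k. norm (\<alpha> k) * E ^ k) summable_on UNIV"
      using r by (simp add: summable_on_UNIV_nonneg_real_iff)
    then show "(\<lambda>k. D * (norm (\<alpha> k) * E ^ k) * (\<Sum>m. real (Suc m) ^ p * q ^ Suc m)) summable_on UNIV"
      by (intro summable_on_cmult_left summable_on_cmult_right)
  qed (use r q in auto)
  then have "(\<lambda>p. norm (case p of (k, m) \<Rightarrow> f k m)) summable_on UNIV \<times> UNIV"
    by (rule Infinite_Sum.abs_summable_on_comparison_test') (use bound in auto)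
  then have "(\<lambda>p. case p of (k, m) \<Rightarrow> f k m) summable_on UNIV \<times> UNIV"
    by (rule Infinite_Sum.abs_summable_summable)
  then obtain T where T: "((\<lambda>p. case p of (k, m) \<Rightarrow> f k m) has_sum T) (UNIV \<times> UNIV)"
    by (auto simp: summable_on_def)
  have T': "((\<lambda>(m, k). f k m) has_sum T) (UNIV \<times> UNIV)"
    using T by (subst (asm) has_sum_swap) (simp add: case_prod_unfold)
  have smk: "summable (\<lambda>m. norm (f k m))" for k
    by (rule summable_comparison_test'[OF summable_mult[OF smq], of 0]) (use bound in auto)
  have smm: "summable (\<lambda>k. norm (f k m))" for m
    unfolding f_def by (rule sm1[OF s]) simp
  have "((\<lambda>k. \<Sum>m. f k m) has_sum T) UNIV"
    by (rule has_sum_SigmaD[OF T]) (auto intro!: norm_summable_imp_has_sum smk summable_sums[OF summable_norm_cancel[OF smk]])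
  then have 1: "(\<lambda>k. \<Sum>m. f k m) sums T" by (rule has_sum_imp_sums)
  have "((\<lambda>m. \<Sum>k. f k m) has_sum T) UNIV"
    by (rule has_sum_SigmaD[OF T']) (auto intro!: norm_summable_imp_has_sum smm summable_sums[OF summable_norm_cancel[OF smm]])
  then have "(\<lambda>m. \<Sum>k. f k m) sums T" by (rule has_sum_imp_sums)
  then have "T = (\<Sum>m. \<Sum>k. f k m)" by (simp add: sums_iff)
  with 1 show "(\<lambda>k. \<Sum>m. ?g s k m) sums (\<Sum>m. \<Sum>k. ?g s k m)"
    by (simp add: f_def)
qed

lemma fourier_growth_mult:
  assumes b: "fourier_growth q p b" and q: "0 < q" and c: "shift_growth c"
    and e: "\<And>m. m \<ge> 1 \<Longrightarrow> norm (e m) \<le> C * real m ^ j" and p': "p + j \<le> p'"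
  shows "fourier_growth q p' (\<lambda>w m. c w * e m * b w m)"
  unfolding fourier_growth_def
proof (intro conjI allI impI ballI)
  show "(\<lambda>w. c w * e m * b w m) holomorphic_on Re_gt" if "m \<ge> 1" for m
    using assms that by (intro holomorphic_intros) (auto simp: fourier_growth_def shift_growth_def)
  have C: "C \<ge> 0" using order_trans[OF norm_ge_zero e[of 1]] by simp
  fix z assume z: "z \<in> Re_gt"
  obtain r D E where r: "r > 0" "0 \<le> D" "0 \<le> E"
    "\<And>s k m. s \<in> ball z r \<inter> Re_gt \<Longrightarrow> m \<ge> 1 \<Longrightarrow> norm (b (s + of_nat k) m) \<le> D * E ^ k * (real m ^ p * q ^ m)"
    using b z unfolding fourier_growth_def by meson
  obtain r' D' E' where r': "r' > 0" "0 \<le> D'" "0 \<le> E'"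
    "\<And>s k. s \<in> ball z r' \<inter> Re_gt \<Longrightarrow> norm (c (s + of_nat k)) \<le> D' * E' ^ k"
    using c z unfolding shift_growth_def by meson
  show "\<exists>r>0. \<exists>D E. 0 \<le> D \<and> 0 \<le> E \<and> (\<forall>s\<in>ball z r \<inter> Re_gt. \<forall>k. \<forall>m\<ge>1.
      norm (c (s + of_nat k) * e m * b (s + of_nat k) m) \<le> D * E ^ k * (real m ^ p' * q ^ m))"
  proof (intro exI conjI ballI allI impI)
    show "0 < min r r'" "0 \<le> D' * C * D" "0 \<le> E' * E" using r r' C by auto
    fix s k and m :: nat assume s: "s \<in> ball z (min r r') \<inter> Re_gt" and m: "m \<ge> 1"
    have "norm (c (s + of_nat k) * e m * b (s + of_nat k) m) \<le>
        (D' * E' ^ k) * (C * real m ^ j) * (D * E ^ k * (real m ^ p * q ^ m))"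
      unfolding norm_mult using s m r r' C q by (intro mult_mono r(4) r'(4) e) auto
    also have "\<dots> = D' * C * D * (E' * E) ^ k * (real m ^ (p + j) * q ^ m)"
      by (simp add: power_add power_mult_distrib mult_ac)
    also have "\<dots> \<le> D' * C * D * (E' * E) ^ k * (real m ^ p' * q ^ m)"
      using r r' C q m p' by (intro mult_left_mono mult_right_mono power_increasing) auto
    finally show "norm (c (s + of_nat k) * e m * b (s + of_nat k) m) \<le> D' * C * D * (E' * E) ^ k * (real m ^ p' * q ^ m)" .
  qed
qed

lemma shift_growth_bounded:
  assumes "c holomorphic_on Re_gt"
    and "\<And>z. z \<in> Re_gt \<Longrightarrow> \<exists>r>0. \<exists>D. \<forall>s\<in>ball z r \<inter> Re_gt. \<forall>k. norm (c (s + of_nat k)) \<le> D"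
  shows "shift_growth c"
  unfolding shift_growth_def
proof (intro conjI ballI)
  fix z assume z: "z \<in> Re_gt"
  obtain r D where r: "r > 0" "\<And>s k. s \<in> ball z r \<inter> Re_gt \<Longrightarrow> norm (c (s + of_nat k)) \<le> D"
    using assms(2)[OF z] by meson
  have "D \<ge> 0" using r(1) z order_trans[OF norm_ge_zero r(2)[of z 0]] by simp
  then show "\<exists>r>0. \<exists>D E. 0 \<le> D \<and> 0 \<le> E \<and> (\<forall>s\<in>ball z r \<inter> Re_gt. \<forall>k. norm (c (s + of_nat k)) \<le> D * E ^ k)"
  proof (intro exI conjI ballI allI)
    show "0 < r" "0 \<le> D" "0 \<le> (1 :: real)" by (simp_all add: r \<open>D \<ge> 0\<close>)
    show "norm (c (s + of_nat k)) \<le> D * 1 ^ k" if "s \<in> ball z r \<inter> Re_gt" for s k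
      using r(2)[OF that] by simp
  qed
qed (fact assms(1))

section \<open>Shift growth of the elementary factors\<close>

lemma shift_growth_const: "shift_growth (\<lambda>w. a)"
proof (rule shift_growth_bounded)
  fix z assume "z \<in> Re_gt"
  have "\<forall>s\<in>ball z 1 \<inter> Re_gt. \<forall>k::nat. norm a \<le> norm a" by simp
  then show "\<exists>r>0. \<exists>D. \<forall>s\<in>ball z r \<inter> Re_gt. \<forall>k::nat. norm a \<le> D"
    using zero_less_one by blast
qed simp

lemma shift_growth_mult:
  assumes c: "shift_growth c" and d: "shift_growth d"
  shows "shift_growth (\<lambda>w. c w * d w)"
  unfolding shift_growth_def
proof (intro conjI ballI)
  show "(\<lambda>w. c w * d w) holomorphic_on Re_gt"
    using assms by (intro holomorphic_intros) (auto simp: shift_growth_def)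
  fix z assume z: "z \<in> Re_gt"
  obtain r D E where r: "r > 0" "0 \<le> D" "0 \<le> E"
    "\<And>s k. s \<in> ball z r \<inter> Re_gt \<Longrightarrow> norm (c (s + of_nat k)) \<le> D * E ^ k"
    using c z unfolding shift_growth_def by meson
  obtain r' D' E' where r': "r' > 0" "0 \<le> D'" "0 \<le> E'"
    "\<And>s k. s \<in> ball z r' \<inter> Re_gt \<Longrightarrow> norm (d (s + of_nat k)) \<le> D' * E' ^ k"
    using d z unfolding shift_growth_def by meson
  show "\<exists>r>0. \<exists>D E. 0 \<le> D \<and> 0 \<le> E \<and> (\<forall>s\<in>ball z r \<inter> Re_gt. \<forall>k. norm (c (s + of_nat k) * d (s + of_nat k)) \<le> D * E ^ k)"
  proof (intro exI conjI ballI allI)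
    show "0 < min r r'" "0 \<le> D * D'" "0 \<le> E * E'" using r r' by auto
    fix s k assume s: "s \<in> ball z (min r r') \<inter> Re_gt"
    have "norm (c (s + of_nat k) * d (s + of_nat k)) \<le> (D * E ^ k) * (D' * E' ^ k)"
      unfolding norm_mult using s r r' by (intro mult_mono r(4) r'(4)) auto
    then show "norm (c (s + of_nat k) * d (s + of_nat k)) \<le> D * D' * (E * E') ^ k"
      by (simp add: power_mult_distrib mult_ac)
  qed
qed

lemma shift_growth_add_const: "shift_growth (\<lambda>w. w + a)"
  unfolding shift_growth_def
proof (intro conjI ballI)
  fix z assume "z \<in> Re_gt"
  show "\<exists>r>0. \<exists>D E. 0 \<le> D \<and> 0 \<le> E \<and> (\<forall>s\<in>ball z r \<inter> Re_gt. \<forall>k. norm (s + of_nat k + a) \<le> D * E ^ k)"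
  proof (intro exI conjI ballI allI)
    fix s k assume s: "s \<in> ball z 1 \<inter> Re_gt"
    have "norm s \<le> norm z + 1"
      using s norm_triangle_ineq2[of s z] by (auto simp: dist_norm norm_minus_commute)
    then have "norm (s + of_nat k + a) \<le> norm z + 1 + real k + norm a"
      using norm_triangle_ineq[of "s + of_nat k" a] norm_triangle_ineq[of s "of_nat k"] by simp
    also have "\<dots> \<le> (norm z + 1 + norm a) * (1 + real k)"
      by (simp add: algebra_simps)
    also have "1 + real k \<le> 2 ^ k"
    proof -
      have "Suc k \<le> 2 ^ k" by (induction k) auto
      then have "real (Suc k) \<le> real (2 ^ k)" by (simp only: of_nat_le_iff)
      then show ?thesis by simp
    qed
    finally show "norm (s + of_nat k + a) \<le> (norm z + 1 + norm a) * 2 ^ k"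
      by (simp add: mult_left_mono)
  qed auto
qed (auto intro!: holomorphic_intros)

lemma shift_growth_inverse_zeta:
  assumes "\<And>w. w \<in> Re_gt \<Longrightarrow> Re (2 * w + a) > 1" "a \<in> \<real>"
  shows "shift_growth (\<lambda>w. 1 / zeta (2 * w + a))"
proof (rule shift_growth_bounded)
  have "2 * w + a \<noteq> 1" "zeta (2 * w + a) \<noteq> 0" if "w \<in> Re_gt" for w
    using assms(1)[OF that] zeta_nonzero[of "2 * w + a"] less_irrefl[of "1::real"] one_complex.sel(1) by metis+
  then show "(\<lambda>w. 1 / zeta (2 * w + a)) holomorphic_on Re_gt"
    by (intro holomorphic_intros) auto
  fix z assume z: "z \<in> Re_gt"
  \<comment> \<open>The midpoint between 1 and Re(2z + a). The radius below, a quarter of Re(2z + a)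
    - 1, keeps Re(2s + a) above it.\<close>
  define \<sigma> where "\<sigma> = (1 + Re (2 * z + a)) / 2"
  have \<sigma>: "\<sigma> > 1" using assms(1)[OF z] by (simp add: \<sigma>_def)
  obtain C where C: "\<And>s. Re s \<ge> \<sigma> \<Longrightarrow> norm (1 / zeta s) \<le> C"
    using norm_inverse_zeta_le[OF \<sigma>] by metis
  show "\<exists>r>0. \<exists>D. \<forall>s\<in>ball z r \<inter> Re_gt. \<forall>k. norm (1 / zeta (2 * (s + of_nat k) + a)) \<le> D"
  proof (intro exI conjI ballI allI)
    show "(Re (2 * z + a) - 1) / 4 > 0" using assms(1)[OF z] by simp
    fix s k assume "s \<in> ball z ((Re (2 * z + a) - 1) / 4) \<inter> Re_gt"
    then have "Re z - Re s < (Re (2 * z + a) - 1) / 4"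
      using abs_Re_le_cmod[of "z - s"] by (auto simp: dist_norm)
    then have "Re (2 * s + a) \<ge> \<sigma>" by (simp add: \<sigma>_def field_simps)
    then have "Re (2 * (s + of_nat k) + a) \<ge> \<sigma>" by (simp add: distrib_left)
    then show "norm (1 / zeta (2 * (s + of_nat k) + a)) \<le> C" by (rule C)
  qed
qed

lemma shift_growth_zeta:
  assumes "\<sigma> > 1" "\<And>w. w \<in> Re_gt \<Longrightarrow> Re (2 * w + a) \<ge> \<sigma>"
  shows "shift_growth (\<lambda>w. zeta (2 * w + a))"
proof (rule shift_growth_bounded)
  have "2 * w + a \<noteq> 1" if "w \<in> Re_gt" for w using assms(2)[OF that] assms(1) one_complex.sel(1) by (metis not_less)
  then show "(\<lambda>w. zeta (2 * w + a)) holomorphic_on Re_gt"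
    by (intro holomorphic_intros) auto
  obtain C where C: "\<And>s. Re s \<ge> \<sigma> \<Longrightarrow> norm (zeta s) \<le> C"
    using norm_zeta_le[OF assms(1)] by metis
  show "\<exists>r>0. \<exists>D. \<forall>s\<in>ball z r \<inter> Re_gt. \<forall>k. norm (zeta (2 * (s + of_nat k) + a)) \<le> D" for z
  proof (intro exI conjI ballI allI)
    show "(1 :: real) > 0" by simp
    show "norm (zeta (2 * (s + of_nat k) + a)) \<le> C" if "s \<in> ball z 1 \<inter> Re_gt" for s k
      using that by (intro C assms(2) Re_gt_add_nat) auto
  qed
qed

lemma Gamma_add_nat:
  assumes "Re s > 0"
  shows "Gamma (s + of_nat k) = pochhammer s k * (Gamma s :: complex)"
  unfolding pochhammer_Gamma[OF not_nonpos_Int_Re_pos[OF assms]]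
  using Gamma_nonzero_Re_pos[OF assms] by simp

text \<open>A shift by k multiplies the quotient by a quotient of Pochhammer symbols. Its factors
  have modulus at most 1, because numerator and denominator share the imaginary part and a <= b
  orders their positive real parts. A bound on a compact disc thus holds for all shifts.\<close>

lemma shift_growth_Gamma_quotient:
  assumes "0 \<le> a" "a \<le> b" "b > 0 \<or> a = b"
  shows "shift_growth (\<lambda>w. Gamma (w - 1/2 + of_real a) / Gamma (w - 1/2 + of_real b))"
proof (rule shift_growth_bounded)
  let ?g = "\<lambda>w :: complex. Gamma (w - 1/2 + of_real a) / Gamma (w - 1/2 + of_real b)"
  have pos: "Re (w - 1/2 + of_real a) > 0" "Re (w - 1/2 + of_real b) > 0" if "w \<in> Re_gt" for w
    using that assms by (auto simp: Re_gt_def)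
  then show hol: "?g holomorphic_on Re_gt"
    by (intro holomorphic_intros) (auto intro!: not_nonpos_Int_Re_pos Gamma_nonzero_Re_pos)
  fix z assume z: "z \<in> Re_gt"
  obtain r where r: "r > 0" "cball z r \<subseteq> Re_gt" using open_Re_gt z open_contains_cball by blast
  have "compact (?g ` cball z r)"
    by (intro compact_continuous_image continuous_on_subset[OF holomorphic_on_imp_continuous_on[OF hol] r(2)]) auto
  then obtain D where D: "\<And>s. s \<in> cball z r \<Longrightarrow> norm (?g s) \<le> D"
    by (meson bounded_iff compact_imp_bounded image_eqI)
  show "\<exists>r>0. \<exists>D. \<forall>s\<in>ball z r \<inter> Re_gt. \<forall>k. norm (?g (s + of_nat k)) \<le> D"
  proof (intro exI conjI ballI allI)
    show "r > 0" by fact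
    fix s k assume s: "s \<in> ball z r \<inter> Re_gt"
    have eq: "s + of_nat k - 1/2 + of_real c = s - 1/2 + of_real c + of_nat k" for c by simp
    have "?g (s + of_nat k) = pochhammer (s - 1/2 + of_real a) k / pochhammer (s - 1/2 + of_real b) k * ?g s"
      unfolding eq using s pos[of s] by (subst (1 2) Gamma_add_nat) auto
    moreover have "norm (pochhammer (s - 1/2 + of_real a) k / pochhammer (s - 1/2 + of_real b) k) \<le> 1"
    proof -
      have "norm (pochhammer (s - 1/2 + of_real a) k) \<le> norm (pochhammer (s - 1/2 + of_real b) k)"
        unfolding pochhammer_prod prod_norm[symmetric]
      proof (rule prod_mono, safe)
        fix i :: nat
        have "\<bar>Re (s - 1/2 + of_real a + of_nat i)\<bar> \<le> \<bar>Re (s - 1/2 + of_real b + of_nat i)\<bar>"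
          using s assms by (auto simp: Re_gt_def)
        then show "norm (s - 1/2 + of_real a + of_nat i) \<le> norm (s - 1/2 + of_real b + of_nat i)"
          by (simp add: cmod_def abs_le_square_iff)
      qed simp
      then show ?thesis by (simp add: norm_divide divide_le_eq_1)
    qed
    moreover have "norm (?g s) \<le> D" using s by (intro D) auto
    ultimately show "norm (?g (s + of_nat k)) \<le> D"
      using mult_mono[of "norm (pochhammer (s - 1/2 + of_real a) k / pochhammer (s - 1/2 + of_real b) k)" 1 "norm (?g s)" D]
      by (simp only: norm_mult) simp
  qed
qed

lemma shift_growth_powr:
  assumes y: "y > 0" shows "shift_growth (\<lambda>w. of_real y powr (- w))"
  unfolding shift_growth_def
proof (intro conjI ballI)
  show "(\<lambda>w. of_real y powr (- w)) holomorphic_on Re_gt" using y by (intro holomorphic_intros) auto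
  fix z assume "z \<in> Re_gt"
  show "\<exists>r>0. \<exists>D E. 0 \<le> D \<and> 0 \<le> E \<and> (\<forall>s\<in>ball z r \<inter> Re_gt. \<forall>k. norm (complex_of_real y powr (- (s + of_nat k))) \<le> D * E ^ k)"
  proof (intro exI conjI ballI allI)
    fix s k assume s: "s \<in> ball z 1 \<inter> Re_gt"
    have "\<bar>Re z - Re s\<bar> < 1"
      using s abs_Re_le_cmod[of "z - s"] by (auto simp: dist_norm)
    then have "- Re s * ln y \<le> (\<bar>Re z\<bar> + 1) * \<bar>ln y\<bar>"
      using order_trans[OF abs_ge_self[of "- Re s * ln y"], of "(\<bar>Re z\<bar> + 1) * \<bar>ln y\<bar>"]
      unfolding abs_mult abs_minus_cancel by (simp add: mult_right_mono)
    then have "y powr (- Re s) \<le> exp ((\<bar>Re z\<bar> + 1) * \<bar>ln y\<bar>)"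
      using y by (simp add: powr_def)
    moreover have "norm (complex_of_real y powr (- (s + of_nat k))) = y powr (- Re s) * (1 / y) ^ k"
      using y by (simp add: norm_powr_pos powr_diff powr_realpow power_one_over divide_inverse norm_mult norm_inverse norm_power power_inverse)
    ultimately show "norm (complex_of_real y powr (- (s + of_nat k))) \<le> exp ((\<bar>Re z\<bar> + 1) * \<bar>ln y\<bar>) * (1 / y) ^ k"
      using y by (simp add: mult_right_mono)
  qed (use y in auto)
qed


section \<open>Inverse Gamma values, divisor sums and Bessel functions under shifts\<close>

lemma pochhammer_ge_fact:
  assumes "Re s \<ge> 1" shows "fact k \<le> norm (pochhammer s k :: complex)"
proof -
  have "fact k = (\<Prod>i<k. real (Suc i))"
    by (simp add: fact_prod_Suc lessThan_atLeast0)
  also have "\<dots> \<le> (\<Prod>i<k. norm (s + of_nat i))"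
  proof (rule prod_mono, safe)
    fix i :: nat
    show "real (Suc i) \<le> norm (s + of_nat i)"
      using complex_Re_le_cmod[of "s + of_nat i"] assms by simp
  qed simp
  finally show ?thesis by (simp add: pochhammer_prod prod_norm lessThan_atLeast0)
qed

lemma holomorphic_on_inverse_Gamma [holomorphic_intros]:
  assumes "f holomorphic_on A" shows "(\<lambda>w. 1 / Gamma (f w)) holomorphic_on A"
  using assms by (simp add: rGamma_inverse_Gamma[symmetric] divide_inverse holomorphic_rGamma')

text \<open>Gamma(s + k) is Gamma(s) times a Pochhammer symbol, and for Re s >= 1 the latter has
  modulus at least k!.\<close>

lemma inverse_Gamma_bound:
  assumes z: "z \<in> Re_gt"
  shows "\<exists>r>0. \<exists>D\<ge>0. \<forall>s\<in>ball z r. s \<in> Re_gt \<and> (\<forall>k. norm (1 / Gamma (s + of_nat k)) \<le> D / fact k)"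
proof -
  have hol: "(\<lambda>w. 1 / Gamma w) holomorphic_on Re_gt"
    by (rule holomorphic_on_inverse_Gamma) (rule holomorphic_on_ident)
  obtain r where r: "r > 0" "cball z r \<subseteq> Re_gt" using open_Re_gt z open_contains_cball by blast
  have "compact ((\<lambda>w. 1 / Gamma w) ` cball z r)"
    by (intro compact_continuous_image continuous_on_subset[OF holomorphic_on_imp_continuous_on[OF hol] r(2)]) auto
  then obtain D where D: "\<And>s. s \<in> cball z r \<Longrightarrow> norm (1 / Gamma s) \<le> D"
    by (meson bounded_iff compact_imp_bounded image_eqI)
  have D0: "D \<ge> 0" using r(1) order_trans[OF norm_ge_zero D[of z]] by simp
  have "norm (1 / Gamma (s + of_nat k)) \<le> D / fact k" if s: "s \<in> ball z r" for s k
  proof -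
    have "s \<in> Re_gt" using s by (intro subsetD[OF r(2)]) auto
    then have "Re s \<ge> 1" by (simp add: Re_gt_def)
    have "norm (1 / Gamma (s + of_nat k)) = norm (1 / Gamma s) * (1 / norm (pochhammer s k))"
      using \<open>Re s \<ge> 1\<close> by (subst Gamma_add_nat) (auto simp: norm_divide norm_mult)
    also have "\<dots> \<le> D * (1 / fact k)"
      using s pochhammer_ge_fact[OF \<open>Re s \<ge> 1\<close>, of k] D0 by (intro mult_mono D frac_le) auto
    finally show ?thesis by simp
  qed
  moreover have "s \<in> Re_gt" if "s \<in> ball z r" for s using that by (intro subsetD[OF r(2)]) auto
  ultimately show ?thesis using r(1) D0 by blast
qed

lemma holomorphic_on_divisor_sigma [holomorphic_intros]:
  assumes "f holomorphic_on A" "m \<ge> 1"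
  shows "(\<lambda>w. divisor_sigma (f w) m) holomorphic_on A"
  unfolding divisor_sigma_def
proof (rule holomorphic_on_sum)
  fix g assume "g \<in> {g. g dvd m}"
  then have "g \<ge> 1" using assms(2) by (auto simp: Suc_le_eq dest: dvd_pos_nat)
  then show "(\<lambda>w. of_nat g powr f w) holomorphic_on A"
    unfolding of_nat_powr_exp[OF \<open>g \<ge> 1\<close>] using assms(1) by (intro holomorphic_intros)
qed

lemma holomorphic_on_bessel_K [holomorphic_intros]:
  assumes "f holomorphic_on A" "x > 0"
  shows "(\<lambda>w. bessel_K (f w) x) holomorphic_on A"
proof -
  have "(\<lambda>\<nu>. bessel_int \<nu> (x/2) (x/2) / 2) holomorphic_on UNIV"
    using assms(2) by (intro holomorphic_intros bessel_int_holomorphic) auto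
  from holomorphic_on_compose_gen[OF assms(1) this] show ?thesis
    using assms(2) by (simp add: o_def bessel_K_eq_bessel_int)
qed

text \<open>The factor \<open>1 / \<Gamma>\<close> is kept inside: it absorbs the factorial growth of the Bessel function
  under shifts of its order.\<close>

definition bessel_block :: "real \<Rightarrow> real \<Rightarrow> real \<Rightarrow> real \<Rightarrow> complex \<Rightarrow> nat \<Rightarrow> complex" where
  "bessel_block y a b e w m =
     of_nat m powr (w + of_real a) * bessel_mode (w + of_real a) y m *
       divisor_sigma (of_real e - 2 * w) m * (1 / Gamma (w + of_real b))"

text \<open>The k! of \<open>bessel_int_real_add_le\<close> meets the 1/k! of
  \<open>inverse_Gamma_bound\<close>, and (2/A)^k remains. The condition e <= 3 makes the order e -
  2w of the divisor sum negative in real part on \<open>Re_gt\<close>, so that this sum is at most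
  m; hence the exponent 1.\<close>

lemma fourier_growth_bessel_block:
  assumes y: "y > 0" and e: "e \<le> 3" and b: "b \<ge> 0"
  shows "fourier_growth (exp (- (pi * y))) 1 (bessel_block y a b e)"
  unfolding fourier_growth_def
proof (intro conjI allI impI ballI)
  fix m :: nat assume m: "m \<ge> 1"
  show "(\<lambda>w. bessel_block y a b e w m) holomorphic_on Re_gt"
    unfolding bessel_block_def of_nat_powr_exp[OF m]
    using y m b
    by (intro holomorphic_on_mult holomorphic_on_inverse_Gamma holomorphic_intros) auto
next
  fix z assume z: "z \<in> Re_gt"
  define A where "A = pi * y / 2"
  have A: "A > 0" using y by (simp add: A_def)
  have zb: "z + of_real b \<in> Re_gt" using z b by (simp add: Re_gt_def)
  obtain r D where r: "r > 0" "D \<ge> 0" "\<And>s k. s \<in> ball (z + of_real b) r \<Longrightarrow> s \<in> Re_gt \<and> norm (1 / Gamma (s + of_nat k)) \<le> D / fact k"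
    using inverse_Gamma_bound[OF zb] by meson
  define B where "B = bessel_int_real (Re z + a - r) (A/2) A + bessel_int_real (Re z + a + r) (A/2) A"
  have B0: "B \<ge> 0" unfolding B_def by (intro add_nonneg_nonneg bessel_int_real_nonneg)
  show "\<exists>r>0. \<exists>D E. 0 \<le> D \<and> 0 \<le> E \<and> (\<forall>s\<in>ball z r \<inter> Re_gt. \<forall>k. \<forall>m\<ge>1.
      norm (bessel_block y a b e (s + of_nat k) m) \<le> D * E ^ k * (real m ^ 1 * exp (- (pi * y)) ^ m))"
  proof (intro exI conjI ballI allI impI)
    show "r > 0" "0 \<le> B * D" "0 \<le> 2 / A" using r A B0 by auto
    fix s k and m :: nat assume s: "s \<in> ball z r \<inter> Re_gt" and m: "m \<ge> 1"
    have sre: "\<bar>Re z - Re s\<bar> < r"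
      using s abs_Re_le_cmod[of "z - s"] by (auto simp: dist_norm)
    have "norm (of_nat m powr (s + of_nat k + of_real a) * bessel_mode (s + of_nat k + of_real a) y m)
       \<le> exp (- (pi * y)) ^ m * bessel_int_real (Re (s + of_nat k + of_real a)) A A"
      unfolding A_def by (rule norm_powr_bessel_K_le[OF y m])
    also have "\<dots> \<le> exp (- (pi * y)) ^ m * (fact k * (2 / A) ^ k * B)"
    proof (rule mult_left_mono)
      have "bessel_int_real (Re (s + of_nat k + of_real a)) A A = bessel_int_real (Re s + a + real k) A A"
        by (simp add: add_ac)
      also have "\<dots> \<le> fact k * (2 / A) ^ k * bessel_int_real (Re s + a) (A / 2) A"
        by (rule bessel_int_real_add_le[OF A A])
      also have "\<dots> \<le> fact k * (2 / A) ^ k * B"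
        unfolding B_def using A sre by (intro mult_left_mono bessel_int_real_le_interval) auto
      finally show "bessel_int_real (Re (s + of_nat k + of_real a)) A A \<le> fact k * (2 / A) ^ k * B" .
    qed simp
    finally have 1: "norm (of_nat m powr (s + of_nat k + of_real a) * bessel_mode (s + of_nat k + of_real a) y m)
       \<le> exp (- (pi * y)) ^ m * (fact k * (2 / A) ^ k * B)" .
    have 2: "norm (divisor_sigma (of_real e - 2 * (s + of_nat k)) m) \<le> real m"
      using s e m by (intro norm_divisor_sigma_le) (auto simp: Re_gt_def)
    have "s + of_real b \<in> ball (z + of_real b) r" using s by (simp add: dist_norm)
    from r(3)[OF this, of k] have 3: "norm (1 / Gamma (s + of_nat k + of_real b)) \<le> D / fact k"
      by (simp add: add_ac)
    have "norm (bessel_block y a b e (s + of_nat k) m) \<le> (exp (- (pi * y)) ^ m * (fact k * (2 / A) ^ k * B)) * real m * (D / fact k)"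
      unfolding bessel_block_def norm_mult[of "_ * _" "1 / _"] norm_mult[of "_ * _" "divisor_sigma _ _"]
      using r A B0 by (intro mult_mono 1 2 3) auto
    also have "\<dots> = B * D * (2 / A) ^ k * (real m ^ 1 * exp (- (pi * y)) ^ m)"
      by (simp add: field_simps)
    finally show "norm (bessel_block y a b e (s + of_nat k) m) \<le> B * D * (2 / A) ^ k * (real m ^ 1 * exp (- (pi * y)) ^ m)" .
  qed
qed

section \<open>The pole at 2\<close>

text \<open>At most a simple pole at 2, with residue v. The value of f at 2 is left free: there the
  series contain zeta(1), which is a mere convention.\<close>

definition simple_at_2 :: "(complex \<Rightarrow> complex) \<Rightarrow> complex \<Rightarrow> bool" where
  "simple_at_2 f v \<longleftrightarrow> (\<exists>F. F holomorphic_on Re_gt \<and> F 2 = v \<and> (\<forall>s\<in>Re_gt - {2}. f s = F s / (s - 2)))"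

lemma two_in_Re_gt [simp]: "2 \<in> Re_gt"
  by (simp add: Re_gt_def)

lemma simple_at_2_cong:
  assumes "simple_at_2 f v" "\<And>s. s \<in> Re_gt - {2} \<Longrightarrow> g s = f s" "v = v'"
  shows "simple_at_2 g v'"
  using assms unfolding simple_at_2_def by metis

lemma simple_at_2_holomorphic:
  assumes "f holomorphic_on Re_gt" shows "simple_at_2 f 0"
  unfolding simple_at_2_def
proof (intro exI conjI ballI)
  show "(\<lambda>s. f s * (s - 2)) holomorphic_on Re_gt" using assms by (intro holomorphic_intros)
qed auto

lemma simple_at_2_add:
  assumes "simple_at_2 f v" "simple_at_2 g w" shows "simple_at_2 (\<lambda>s. f s + g s) (v + w)"
proof -
  obtain F where F: "F holomorphic_on Re_gt" "F 2 = v" "\<And>s. s \<in> Re_gt - {2} \<Longrightarrow> f s = F s / (s - 2)"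
    using assms(1) unfolding simple_at_2_def by auto
  obtain G where G: "G holomorphic_on Re_gt" "G 2 = w" "\<And>s. s \<in> Re_gt - {2} \<Longrightarrow> g s = G s / (s - 2)"
    using assms(2) unfolding simple_at_2_def by auto
  show ?thesis
    unfolding simple_at_2_def
  proof (intro exI conjI ballI)
    show "(\<lambda>s. F s + G s) holomorphic_on Re_gt" using F G by (intro holomorphic_intros)
    show "F 2 + G 2 = v + w" using F G by simp
    show "f s + g s = (F s + G s) / (s - 2)" if "s \<in> Re_gt - {2}" for s
      unfolding F(3)[OF that] G(3)[OF that] add_divide_distrib by (rule refl)
  qed
qed

lemma simple_at_2_mult:
  assumes "simple_at_2 f v" "h holomorphic_on Re_gt" shows "simple_at_2 (\<lambda>s. h s * f s) (h 2 * v)"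
proof -
  obtain F where F: "F holomorphic_on Re_gt" "F 2 = v" "\<And>s. s \<in> Re_gt - {2} \<Longrightarrow> f s = F s / (s - 2)"
    using assms(1) unfolding simple_at_2_def by auto
  show ?thesis
    unfolding simple_at_2_def
  proof (intro exI conjI ballI)
    show "(\<lambda>s. h s * F s) holomorphic_on Re_gt" using F assms by (intro holomorphic_intros)
    show "h 2 * F 2 = h 2 * v" using F by simp
    show "h s * f s = (h s * F s) / (s - 2)" if "s \<in> Re_gt - {2}" for s
      unfolding F(3)[OF that] by simp
  qed
qed

lemma simple_at_2_cmult: "simple_at_2 f v \<Longrightarrow> simple_at_2 (\<lambda>s. c * f s) (c * v)"
  using simple_at_2_mult[of f v "\<lambda>_. c"] by simp

lemma simple_at_2_imp:
  assumes "simple_at_2 f v"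
  shows "f holomorphic_on (Re_gt - {2})" and "f meromorphic_on Re_gt" and "residue f 2 = v"
    and "is_pole f 2 \<longleftrightarrow> v \<noteq> 0" and "is_pole f 2 \<Longrightarrow> zorder f 2 = -1"
proof -
  obtain F where F: "F holomorphic_on Re_gt" "F 2 = v" "\<And>s. s \<in> Re_gt - {2} \<Longrightarrow> f s = F s / (s - 2)"
    using assms unfolding simple_at_2_def by auto
  have "(\<lambda>s. F s / (s - 2)) holomorphic_on (Re_gt - {2})"
    by (intro holomorphic_intros holomorphic_on_subset[OF F(1)]) auto
  then show hol: "f holomorphic_on (Re_gt - {2})"
    by (subst holomorphic_cong[OF refl, of _ f]) (use F in auto)
  have ev: "eventually (\<lambda>w. f w = F w / (w - 2)) (at z)" if "z \<in> Re_gt" for z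
    using eventually_at_in_open[OF open_Re_gt that] eventually_neq_at_within[of 2 z UNIV]
    by eventually_elim (use F(3) in auto)
  have "F analytic_on Re_gt" using F(1) open_Re_gt by (simp add: analytic_on_open)
  then have "(\<lambda>s. F s / (s - 2)) meromorphic_on Re_gt"
    by (intro meromorphic_intros analytic_on_imp_meromorphic_on)
  then show "f meromorphic_on Re_gt"
    by (subst meromorphic_on_cong[OF ev refl])
  have "residue f 2 = residue (\<lambda>w. F w / (w - 2)) 2"
    by (rule residue_cong[OF ev]) auto
  then show "residue f 2 = v"
    using residue_simple[OF open_Re_gt _ F(1), of 2] F(2) by simp
  have pole: "is_pole f 2 \<longleftrightarrow> is_pole (\<lambda>w. F w / (w - 2)) 2"
    by (rule is_pole_cong[OF ev]) auto
  show iff: "is_pole f 2 \<longleftrightarrow> v \<noteq> 0"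
  proof
    assume "v \<noteq> 0"
    then show "is_pole f 2"
      unfolding pole using is_pole_basic[OF F(1) open_Re_gt, of 2 1] F(2) by simp
  next
    assume p: "is_pole f 2"
    show "v \<noteq> 0"
    proof
      \<comment> \<open>If F vanished at 2, the quotient F(w) / (w - 2) would have the finite limit
        F'(2).\<close>
      assume "v = 0"
      have "(F has_field_derivative deriv F 2) (at 2)"
        by (rule holomorphic_derivI[OF F(1) open_Re_gt]) simp
      then have "((\<lambda>w. (F w - F 2) / (w - 2)) \<longlongrightarrow> deriv F 2) (at 2)"
        by (simp add: has_field_derivative_iff)
      then have "((\<lambda>w. F w / (w - 2)) \<longlongrightarrow> deriv F 2) (at 2)" using F(2) \<open>v = 0\<close> by simp
      moreover have "filterlim (\<lambda>w. F w / (w - 2)) at_infinity (at 2)" using p pole by (simp add: is_pole_def)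
      ultimately show False
        using not_tendsto_and_filterlim_at_infinity[of "at (2::complex)"] by auto
    qed
  qed
  assume "is_pole f 2"
  then have "F 2 \<noteq> 0" using iff F by simp
  then show "zorder f 2 = -1"
    by (intro zorder_eqI[OF open_Re_gt _ F(1)]) (use F(3) in \<open>auto simp: divide_inverse power_int_minus\<close>)
qed

section \<open>Growth and pole of the factors of the Fourier coefficients\<close>

lemma shift_growth_cong:
  assumes "shift_growth c" "\<And>w. w \<in> Re_gt \<Longrightarrow> d w = c w" shows "shift_growth d"
proof -
  have "d holomorphic_on Re_gt \<longleftrightarrow> c holomorphic_on Re_gt" by (rule holomorphic_cong) (auto simp: assms(2))
  then show ?thesis using assms Re_gt_add_nat by (auto simp: shift_growth_def)
qed

lemma fourier_growth_cong:
  assumes "fourier_growth q p b" "\<And>w m. w \<in> Re_gt \<Longrightarrow> m \<ge> 1 \<Longrightarrow> b' w m = b w m" shows "fourier_growth q p b'"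
proof -
  have "(\<lambda>w. b' w m) holomorphic_on Re_gt \<longleftrightarrow> (\<lambda>w. b w m) holomorphic_on Re_gt" if "m \<ge> 1" for m
    by (rule holomorphic_cong[OF refl]) (rule assms(2)[OF _ that])
  then show ?thesis using assms Re_gt_add_nat by (auto simp: fourier_growth_def)
qed

lemma zeta_factor_growth: "shift_growth (\<lambda>w. 1 / zeta (2 * w - 2))" "shift_growth (\<lambda>w. 1 / zeta (2 * w + 2))"
  "shift_growth (\<lambda>w. 1 / zeta (2 * w))" "shift_growth (\<lambda>w. zeta (2 * w + 1))" "shift_growth (\<lambda>w. zeta (2 * w - 1))"
  using shift_growth_inverse_zeta[of "-2"] shift_growth_inverse_zeta[of 2] shift_growth_inverse_zeta[of 0]
    shift_growth_zeta[of 2 1] shift_growth_zeta[of 2 "-1"] by (auto simp: Re_gt_def)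

lemma norm_mult_le_left: "norm e \<le> 1 \<Longrightarrow> norm (a * e) \<le> norm (a :: complex)"
  using mult_left_mono[of "norm e" 1 "norm a"] by (simp add: norm_mult)

text \<open>Flipping the divisors trades the sum of order 2w + 1, which grows with w, for one of
  order -1 - 2w, and \<open>fourier_growth_bessel_block\<close> applies with e = -1.\<close>

lemma fourier_growth_hs1:
  assumes y: "y > 0" and e: "\<And>m. norm (e m) \<le> 1"
  shows "fourier_growth (exp (- (pi * y))) 2 (\<lambda>w m. e m * hs1 y w m)"
proof (rule fourier_growth_cong)
  show "fourier_growth (exp (- (pi * y))) 2 (\<lambda>w m. 1 / zeta (2 * w + 2) *
     (of_real pi / of_real y powr (1/2) * e m) * bessel_block y (1/2) 1 (-1) w m)"
    by (rule fourier_growth_mult[where j = 0 and C = "norm (complex_of_real pi / of_real y powr (1/2))", OF fourier_growth_bessel_block])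
       (simp_all add: y e zeta_factor_growth norm_mult_le_left del: times_divide_eq_left)
  fix w and m :: nat assume "w \<in> Re_gt" and m: "m \<ge> 1"
  define a where "a = complex_of_nat m powr (w + 1/2)"
  have a: "a \<noteq> 0" using m by (simp add: a_def)
  have "a * divisor_sigma (- (2 * (w + 1/2))) m = complex_of_nat m powr (- (w + 1/2)) * divisor_sigma (2 * (w + 1/2)) m"
    unfolding a_def by (rule divisor_sigma_flip[OF m])
  also have "complex_of_nat m powr (- (w + 1/2)) = 1 / a"
    unfolding a_def by (simp only: powr_minus divide_inverse mult_1)
  finally have fl: "a * divisor_sigma (- 1 - 2 * w) m = 1 / a * divisor_sigma (2 * w + 1) m"
    by (simp add: algebra_simps)
  have "bessel_block y (1/2) 1 (-1) w m = (a * divisor_sigma (- 1 - 2 * w) m) * bessel_mode (w + 1/2) y m * (1 / Gamma (w + 1))"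
    by (simp add: bessel_block_def a_def)
  then show "e m * hs1 y w m = 1 / zeta (2 * w + 2) * (of_real pi / of_real y powr (1/2) * e m) * bessel_block y (1/2) 1 (-1) w m"
    unfolding fl hs1_def a_def[symmetric] by (simp add: mult_ac)
qed

text \<open>The recurrence at order w - 1/2 collapses the bracket of the sine term in the theorem to
  the single Bessel function that the odd lattice sum produces.\<close>

lemma bessel_K_bracket:
  assumes y: "y > 0" and m: "m \<ge> 1"
  shows "(1 - 2 * w) / (2 * of_real pi * of_nat m) * bessel_mode (w - 1/2) y m +
         of_real y * bessel_mode (w + 1/2) y m = of_real y * bessel_mode (w - 3/2) y m"
proof -
  have x: "2 * pi * real m * y > 0" using m y by simp
  define A B where "A = bessel_mode (w - 3/2) y m" and "B = bessel_mode (w - 1/2) y m"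
  have "w - 1/2 + 1 = w + 1/2" "w - 1/2 - 1 = w - 3/2" by simp_all
  with bessel_K_recurrence[OF x, of "w - 1/2"]
  have rec: "bessel_mode (w + 1/2) y m = A + 2 * (w - 1/2) / of_real (2 * pi * real m * y) * B"
    unfolding A_def B_def by (simp only: diff_eq_eq add.commute)
  show ?thesis
    unfolding rec A_def[symmetric] B_def[symmetric] using m y by (simp add: field_simps)
qed

text \<open>In the last two claims the Bessel order is w - 3/2, so m^(w - 1/2) is split as m times
  m^(w - 3/2). The additional m cancels against 1/m in the second claim and is paid for by j = 1 in
  the third.\<close>

lemma fourier_growth_hs2:
  assumes y: "y > 0" and e: "\<And>m. norm (e m) \<le> 1"
  shows "fourier_growth (exp (- (pi * y))) 2 (\<lambda>w m. e m * (hs2 y w m * bessel_mode (w - 1/2) y m))"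
    and "fourier_growth (exp (- (pi * y))) 2 (\<lambda>w m. e m * (hs2 y w m *
        ((w - 1) * of_real y / (of_real pi * of_nat m) * bessel_mode (w - 3/2) y m)))"
    and "fourier_growth (exp (- (pi * y))) 2 (\<lambda>w m. e m * (hs2 y w m *
        (of_real y * bessel_mode (w - 3/2) y m)))"
proof -
  define Y where "Y = complex_of_real y powr (1/2)"
  show "fourier_growth (exp (- (pi * y))) 2 (\<lambda>w m. e m * (hs2 y w m * bessel_mode (w - 1/2) y m))"
  proof (rule fourier_growth_cong)
    show "fourier_growth (exp (- (pi * y))) 2 (\<lambda>w m. 1 / zeta (2 * w - 2) * (Y * e m) * bessel_block y (-1/2) 0 3 w m)"
      by (rule fourier_growth_mult[where j = 0 and C = "norm Y", OF fourier_growth_bessel_block])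
         (simp_all add: y e zeta_factor_growth norm_mult_le_left)
    show "e m * (hs2 y w m * bessel_mode (w - 1/2) y m) =
      1 / zeta (2 * w - 2) * (Y * e m) * bessel_block y (-1/2) 0 3 w m" for w and m :: nat
      by (simp add: bessel_block_def hs2_def Y_def mult_ac)
  qed
  show "fourier_growth (exp (- (pi * y))) 2 (\<lambda>w m. e m * (hs2 y w m *
        ((w - 1) * of_real y / (of_real pi * of_nat m) * bessel_mode (w - 3/2) y m)))"
  proof (rule fourier_growth_cong)
    have g: "shift_growth (\<lambda>w. (w + (- 1)) * (1 / zeta (2 * w - 2)))"
      by (intro shift_growth_mult shift_growth_add_const zeta_factor_growth)
    show "fourier_growth (exp (- (pi * y))) 2 (\<lambda>w m. ((w + (- 1)) * (1 / zeta (2 * w - 2))) *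
        (Y * of_real y / of_real pi * e m) * bessel_block y (-3/2) 0 3 w m)"
      by (rule fourier_growth_mult[OF fourier_growth_bessel_block[OF y] _ g, where j = 0 and C = "norm (Y * of_real y / of_real pi)"])
         (simp_all add: e norm_mult_le_left del: times_divide_eq_left)
    fix w and m :: nat assume m: "m \<ge> 1"
    show "e m * (hs2 y w m * ((w - 1) * of_real y / (of_real pi * of_nat m) * bessel_mode (w - 3/2) y m)) =
      ((w + (- 1)) * (1 / zeta (2 * w - 2))) * (Y * of_real y / of_real pi * e m) * bessel_block y (-3/2) 0 3 w m"
      unfolding bessel_block_def hs2_def Y_def[symmetric] of_nat_powr_half[OF m] using m by (simp add: mult_ac)
  qed
  show "fourier_growth (exp (- (pi * y))) 2 (\<lambda>w m. e m * (hs2 y w m *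
        (of_real y * bessel_mode (w - 3/2) y m)))"
  proof (rule fourier_growth_cong)
    show "fourier_growth (exp (- (pi * y))) 2 (\<lambda>w m. 1 / zeta (2 * w - 2) *
        (Y * of_real y * (e m * of_nat m)) * bessel_block y (-3/2) 0 3 w m)"
    proof (rule fourier_growth_mult[where j = 1 and C = "norm (Y * of_real y)", OF fourier_growth_bessel_block])
      show "norm (Y * of_real y * (e m * of_nat m)) \<le> norm (Y * of_real y) * real m ^ 1" for m
        using mult_left_mono[OF e[of m], of "norm (Y * of_real y) * real m"] by (simp add: norm_mult mult_ac)
    qed (use y in \<open>auto intro!: zeta_factor_growth\<close>)
    fix w and m :: nat assume m: "m \<ge> 1"
    show "e m * (hs2 y w m * (of_real y * bessel_mode (w - 3/2) y m)) =
      1 / zeta (2 * w - 2) * (Y * of_real y * (e m * of_nat m)) * bessel_block y (-3/2) 0 3 w m"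
      unfolding bessel_block_def hs2_def Y_def[symmetric] of_nat_powr_half[OF m] by (simp add: mult_ac)
  qed
qed

lemma shift_growth_cs1:
  assumes y: "y > 0" shows "shift_growth (cs1 y)"
proof (rule shift_growth_cong)
  show "shift_growth (\<lambda>w. (of_real pi powr (1/2) / of_real y) * ((Gamma (w - 1/2 + of_real 1) / Gamma (w - 1/2 + of_real (3/2))) *
     (zeta (2 * w + 1) * (1 / zeta (2 * w + 2)) * of_real y powr (- w))))"
    by (intro shift_growth_mult shift_growth_const shift_growth_Gamma_quotient zeta_factor_growth shift_growth_powr y) auto
  fix w assume "w \<in> Re_gt"
  then have w: "Re w > 0" by (simp add: Re_gt_def)
  have eq: "w - 1/2 + of_real 1 = w + 1/2" "w - 1/2 + of_real (3/2) = w + 1" by simp_all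
  show "cs1 y w = (of_real pi powr (1/2) / of_real y) * ((Gamma (w - 1/2 + of_real 1) / Gamma (w - 1/2 + of_real (3/2))) *
     (zeta (2 * w + 1) * (1 / zeta (2 * w + 2)) * of_real y powr (- w)))"
    using y unfolding cs1_eq[OF w] eq by (simp add: powr_diff mult_ac)
qed

text \<open>\<open>cs2\<close> itself carries the pole of zeta(2w - 3) at w = 2. After the shift by
  1 it contains zeta(2w - 1), whose argument has real part above 2.\<close>

lemma shift_growth_cs2_shift:
  assumes y: "y > 0" shows "shift_growth (\<lambda>w. cs2 y (w + 1))"
proof (rule shift_growth_cong)
  show "shift_growth (\<lambda>w. of_real pi powr (1/2) * ((Gamma (w - 1/2 + of_real 1) / Gamma (w - 1/2 + of_real (3/2))) *
     (zeta (2 * w - 1) * (1 / zeta (2 * w)) * of_real y powr (- w))))"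
    by (intro shift_growth_mult shift_growth_const shift_growth_Gamma_quotient zeta_factor_growth shift_growth_powr y) auto
  fix w assume "w \<in> Re_gt"
  have eq: "w - 1/2 + of_real 1 = w + 1/2" "w - 1/2 + of_real (3/2) = w + 1" by simp_all
  have eq': "w + 1 - 1/2 = w + 1/2" "2 * (w + 1) - 3 = 2 * w - 1" "2 * (w + 1) - 2 = 2 * w" "1 - (w + 1) = - w"
    by (simp_all add: algebra_simps)
  show "cs2 y (w + 1) = of_real pi powr (1/2) * ((Gamma (w - 1/2 + of_real 1) / Gamma (w - 1/2 + of_real (3/2))) *
     (zeta (2 * w - 1) * (1 / zeta (2 * w)) * of_real y powr (- w)))"
    unfolding cs2_def eq eq' by simp
qed

lemma shift_growth_cs2_shift_quotient:
  assumes y: "y > 0" shows "shift_growth (\<lambda>w. (2 * (w + 1) - 2) / (2 * (w + 1) - 3) * cs2 y (w + 1))"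
proof -
  have ne: "2 * w - 1 \<noteq> 0" if "w \<in> Re_gt" for w :: complex
  proof
    assume "2 * w - 1 = 0"
    then have "Re (2 * w - 1) = 0" by simp
    with that show False by (simp add: Re_gt_def)
  qed
  have "shift_growth (\<lambda>w. 1 / (2 * w - 1))"
  proof (rule shift_growth_bounded)
    show "(\<lambda>w. 1 / (2 * w - 1)) holomorphic_on Re_gt" using ne by (intro holomorphic_intros) auto
    show "\<exists>r>0. \<exists>D. \<forall>s\<in>ball z r \<inter> Re_gt. \<forall>k. norm (1 / (2 * (s + of_nat k) - 1)) \<le> D" for z :: complex
    proof (intro exI conjI ballI allI)
      show "(1::real) > 0" by simp
      fix s k assume "s \<in> ball z 1 \<inter> Re_gt"
      then have "Re (2 * (s + of_nat k) - 1) \<ge> 1" by (simp add: Re_gt_def)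
      then have "norm (2 * (s + of_nat k) - 1) \<ge> 1" by (rule order_trans[OF _ complex_Re_le_cmod])
      then show "norm (1 / (2 * (s + of_nat k) - 1)) \<le> 1" by (simp add: norm_divide divide_le_eq_1)
    qed
  qed
  then have "shift_growth (\<lambda>w. (2 * (w + 0)) * (1 / (2 * w - 1)) * cs2 y (w + 1))"
    by (intro shift_growth_mult shift_growth_const shift_growth_add_const shift_growth_cs2_shift y)
  then show ?thesis by (rule shift_growth_cong) (simp add: algebra_simps)
qed

text \<open>Near 2, zeta(2s - 3) is g(2s - 3) / (2 (s - 2)) with g(1) = 1. The other factors at 2
  are sqrt(pi), Gamma(3/2) = sqrt(pi)/2, 1/y and 6/pi^2, the inverse of zeta(2).\<close>

lemma simple_at_2_cs2:
  assumes y: "y > 0"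
  shows "simple_at_2 (cs2 y) (of_real (3 / (2 * pi * y)))"
proof -
  obtain g where g: "g holomorphic_on UNIV" "g 1 = 1" "\<And>s. s \<noteq> 1 \<Longrightarrow> zeta s = g s / (s - 1)"
    using zeta_pole by metis
  define F where "F = (\<lambda>s. of_real pi powr (1/2) / 2 * (of_real y powr (1 - s) * (Gamma (s - 1/2) * (1 / Gamma s) * (g (2 * s - 3) * (1 / zeta (2 * s - 2))))))"
  have "(\<lambda>s. g (2 * s - 3)) holomorphic_on Re_gt"
  proof -
    have "(\<lambda>s. 2 * s - 3) holomorphic_on Re_gt" by (intro holomorphic_intros)
    from holomorphic_on_compose_gen[OF this g(1)] show ?thesis by (simp add: o_def)
  qed
  moreover have "(\<lambda>s. Gamma (s - 1/2)) holomorphic_on Re_gt"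
    by (intro holomorphic_intros) (auto simp: Re_gt_def intro!: not_nonpos_Int_Re_pos)
  moreover have "(\<lambda>s. 1 / zeta (2 * s - 2)) holomorphic_on Re_gt"
    using zeta_factor_growth(1) by (simp add: shift_growth_def)
  moreover have "(\<lambda>s. of_real y powr (1 - s)) holomorphic_on Re_gt" using y by (intro holomorphic_intros) auto
  ultimately have hol: "F holomorphic_on Re_gt"
    unfolding F_def by (intro holomorphic_on_mult holomorphic_on_inverse_Gamma holomorphic_on_const holomorphic_on_ident)
  have eq: "cs2 y s = F s / (s - 2)" if "s \<in> Re_gt - {2}" for s
  proof -
    have "2 * s - 3 \<noteq> 1" using that by auto
    have "zeta (2 * s - 3) = g (2 * s - 3) / (2 * (s - 2))"
      unfolding g(3)[OF \<open>2 * s - 3 \<noteq> 1\<close>] by (simp add: right_diff_distrib)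
    then show ?thesis
      unfolding cs2_def F_def by (simp only: divide_inverse inverse_mult_distrib mult_ac mult_1_left mult_1_right)
  qed
  have G32: "Gamma (2 - 1/2) = complex_of_real (sqrt pi / 2)"
  proof -
    have "Gamma (1/2 + 1) = complex_of_real (1/2) * Gamma (1/2)"
      by (subst Gamma_plus1) (auto elim!: nonpos_Ints_cases simp: complex_eq_iff)
    then show ?thesis by (simp add: Gamma_one_half_complex)
  qed
  have "complex_of_real pi powr (1/2) = of_real (pi powr (1/2))"
    by (subst powr_of_real[symmetric]) auto
  then have pi12: "complex_of_real pi powr (1/2) = of_real (sqrt pi)"
    by (simp add: powr_half_sqrt)
  have sq: "complex_of_real (sqrt pi) * of_real (sqrt pi) = of_real pi"
    by (simp flip: of_real_mult)
  have "F 2 = of_real (sqrt pi) / 2 * (1 / of_real y * (of_real (sqrt pi / 2) * (1 / of_real (pi\<^sup>2 / 6))))"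
  proof -
    have "complex_of_real y powr (1 - 2) = 1 / of_real y"
      using powr_minus[of "complex_of_real y" 1] y by (simp add: divide_inverse)
    moreover have "Gamma (2 :: complex) = 1" using Gamma_fact[of 1, where ?'a = complex] by simp
    moreover have "g (2 * 2 - 3) = 1" "zeta (2 * 2 - 2) = of_real (pi\<^sup>2 / 6)" using g(2) zeta_2 by simp_all
    ultimately show ?thesis unfolding F_def pi12 G32 by (simp only: div_by_1 mult_1_left mult_1_right)
  qed
  also have "\<dots> = (of_real (sqrt pi) * of_real (sqrt pi)) * (6 / (4 * of_real y * of_real (pi\<^sup>2)))"
    by simp
  also have "\<dots> = of_real (3 / (2 * pi * y))"
    unfolding sq using y by (simp add: power2_eq_square field_simps)
  finally show ?thesis unfolding simple_at_2_def using hol eq by blast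
qed

section \<open>The Fourier expansion in matrix form\<close>

lemma mat22_nth [simp]:
  "mat22 a b c d $ 1 $ 1 = a" "mat22 a b c d $ 1 $ 2 = b" "mat22 a b c d $ 2 $ 1 = c" "mat22 a b c d $ 2 $ 2 = d"
  by (simp_all add: mat22_def)

lemma mat22_eqI:
  fixes A B :: "'a::zero^2^2"
  assumes "A $ 1 $ 1 = B $ 1 $ 1" "A $ 1 $ 2 = B $ 1 $ 2" "A $ 2 $ 1 = B $ 2 $ 1" "A $ 2 $ 2 = B $ 2 $ 2"
  shows "A = B"
  using assms by (simp add: vec_eq_iff forall_2)

lemma mat22_collapse: "mat22 (A $ 1 $ 1) (A $ 1 $ 2) (A $ 2 $ 1) (A $ 2 $ 2) = A"
  by (rule mat22_eqI) simp_all

lemma mat22_add: "mat22 a b c d + mat22 a' b' c' d' = mat22 (a + a') (b + b') (c + c') (d + d' :: 'a::monoid_add)"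
  by (rule mat22_eqI) simp_all

lemma mscale_mat22: "t *m mat22 a b c d = mat22 (t * a) (t * b) (t * c) (t * d)"
  by (rule mat22_eqI) (simp_all add: map_matrix_def)

lemma mat_1_eq_mat22: "mat 1 = mat22 1 0 0 (1 :: 'a::zero_neq_one)"
  by (rule mat22_eqI) (simp_all add: mat_def)

lemma mat22_mult: "mat22 a b c d ** mat22 a' b' c' d' =
   mat22 (a * a' + b * c') (a * b' + b * d') (c * a' + d * c') (c * b' + d * d' :: 'a::semiring_1)"
  by (rule mat22_eqI) (simp_all add: matrix_matrix_mult_def sum_2)

lemma conj_by_tau_mat22:
  "conj_by_tau \<tau> (mat22 a b c d) =
   mat22 a (b - cnj \<tau> * a) (c - \<tau> * a) (d - \<tau> * b - cnj \<tau> * c + \<tau> * cnj \<tau> * a)"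
  unfolding conj_by_tau_def mat22_mult by (rule mat22_eqI) (simp_all add: algebra_simps)

lemma tendsto_mat22:
  fixes a b c d :: "'b \<Rightarrow> 'a::{zero,topological_space}"
  assumes "(a \<longlongrightarrow> A) F" "(b \<longlongrightarrow> B) F" "(c \<longlongrightarrow> C) F" "(d \<longlongrightarrow> D) F"
  shows "((\<lambda>x. mat22 (a x) (b x) (c x) (d x)) \<longlongrightarrow> mat22 A B C D) F"
proof (rule vec_tendstoI, rule vec_tendstoI)
  fix i j :: 2
  show "((\<lambda>x. mat22 (a x) (b x) (c x) (d x) $ i $ j) \<longlongrightarrow> mat22 A B C D $ i $ j) F"
    using exhaust_2[of i] exhaust_2[of j] assms by auto
qed

lemma sum_mat22: "(\<Sum>k\<in>S. mat22 (a k) (b k) (c k) (d k)) =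
   mat22 (\<Sum>k\<in>S. a k) (\<Sum>k\<in>S. b k) (\<Sum>k\<in>S. c k) (\<Sum>k\<in>S. d k :: 'a::comm_monoid_add)"
  by (rule mat22_eqI) (simp_all add: sum_component)

lemma sums_mat22:
  fixes a b c d :: "nat \<Rightarrow> complex"
  assumes "a sums A" "b sums B" "c sums C" "d sums D"
  shows "(\<lambda>k. mat22 (a k) (b k) (c k) (d k)) sums mat22 A B C D"
  unfolding sums_def sum_mat22 using assms by (intro tendsto_mat22) (simp_all add: sums_def)

lemma has_sum_mat22:
  fixes a b c d :: "'b \<Rightarrow> complex"
  assumes "(a has_sum A) S" "(b has_sum B) S" "(c has_sum C) S" "(d has_sum D) S"
  shows "((\<lambda>k. mat22 (a k) (b k) (c k) (d k)) has_sum mat22 A B C D) S"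
  unfolding has_sum_def sum_mat22 using assms by (intro tendsto_mat22) (simp_all add: has_sum_def)

section \<open>The series in k and m as functions of s\<close>

definition exp_coeff :: "complex \<Rightarrow> nat \<Rightarrow> complex" where
  "exp_coeff a k = a ^ k / fact k"

definition hb1 :: "real \<Rightarrow> real \<Rightarrow> complex \<Rightarrow> nat \<Rightarrow> complex" where
  "hb1 x y w m = cos_mode x m * hs1 y w m"
definition hb2 :: "real \<Rightarrow> real \<Rightarrow> complex \<Rightarrow> nat \<Rightarrow> complex" where
  "hb2 x y w m = cos_mode x m * (hs2 y w m * bessel_mode (w - 1/2) y m)"
definition hb3 :: "real \<Rightarrow> real \<Rightarrow> complex \<Rightarrow> nat \<Rightarrow> complex" where
  "hb3 x y w m = cos_mode x m *
     (hs2 y w m * ((w - 1) * of_real y / (of_real pi * of_nat m) * bessel_mode (w - 3/2) y m))"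
definition hb4 :: "real \<Rightarrow> real \<Rightarrow> complex \<Rightarrow> nat \<Rightarrow> complex" where
  "hb4 x y w m = sin_mode x m *
     (hs2 y w m * (of_real y * bessel_mode (w - 3/2) y m))"

lemma fourier_growth_hb:
  assumes "y > 0"
  shows "fourier_growth (exp (- (pi * y))) 2 (hb1 x y)" "fourier_growth (exp (- (pi * y))) 2 (hb2 x y)"
    "fourier_growth (exp (- (pi * y))) 2 (hb3 x y)" "fourier_growth (exp (- (pi * y))) 2 (hb4 x y)"
  unfolding hb1_def[abs_def] hb2_def[abs_def] hb3_def[abs_def] hb4_def[abs_def]
  by (intro fourier_growth_hs1 fourier_growth_hs2 assms; simp)+

text \<open>The factor pi^k of pi^(s + k) is counted into the coefficients of the exponential
  series, whence \<open>of_real pi * a\<close>.\<close>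

definition bessel_part :: "complex \<Rightarrow> (complex \<Rightarrow> nat \<Rightarrow> complex) \<Rightarrow> complex \<Rightarrow> nat \<Rightarrow> complex" where
  "bessel_part a b s m = 4 * of_real pi powr s * (\<Sum>k. exp_coeff (of_real pi * a) k * b (s + of_nat k) m)"

definition shift_series :: "complex \<Rightarrow> (complex \<Rightarrow> complex) \<Rightarrow> complex \<Rightarrow> complex" where
  "shift_series a c s = (\<Sum>k. exp_coeff a k * c (s + of_nat k))"

text \<open>The lower right counterpart of \<open>cs2\<close>, with the factor y^2 left
  outside.\<close>

definition cs2' :: "real \<Rightarrow> complex \<Rightarrow> complex" where
  "cs2' y w = (2 * w - 2) / (2 * w - 3) * cs2 y w"

definition fourier_total :: "complex \<Rightarrow> (complex \<Rightarrow> nat \<Rightarrow> complex) \<Rightarrow> complex \<Rightarrow> complex" where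
  "fourier_total a b s = (\<Sum>m. bessel_part a b s (Suc m))"

lemma entire_exp_coeff: "entire_coeffs (exp_coeff a)"
  using entire_coeffs_exp[of a] by (simp add: exp_coeff_def[abs_def])

lemma summable_bessel_part:
  assumes "fourier_growth q p b" "0 < q" "q < 1" "s \<in> Re_gt"
  shows "summable (\<lambda>m. bessel_part a b s (Suc m))"
  unfolding bessel_part_def
  by (intro summable_mult summable_norm_cancel[OF fourier_growth_series(2)[OF assms(1-3) entire_exp_coeff assms(4)]])

lemma holomorphic_fourier_total:
  assumes "fourier_growth q p b" "0 < q" "q < 1"
  shows "fourier_total a b holomorphic_on Re_gt"
proof -
  have eq: "fourier_total a b s = 4 * of_real pi powr s * (\<Sum>m. \<Sum>k. exp_coeff (of_real pi * a) k * b (s + of_nat k) (Suc m))"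
    if s: "s \<in> Re_gt" for s
    unfolding fourier_total_def bessel_part_def
    by (intro suminf_mult summable_norm_cancel[OF fourier_growth_series(2)[OF assms entire_exp_coeff s]])
  have "(\<lambda>s. 4 * of_real pi powr s * (\<Sum>m. \<Sum>k. exp_coeff (of_real pi * a) k * b (s + of_nat k) (Suc m))) holomorphic_on Re_gt"
    by (intro holomorphic_on_mult holomorphic_on_const fourier_growth_series(3)[OF assms entire_exp_coeff])
       (intro holomorphic_intros; simp)
  then show ?thesis by (subst holomorphic_cong[OF refl eq])
qed

lemma sums_bessel_part:
  assumes "fourier_growth q p b" "0 < q" "s \<in> Re_gt" "m \<ge> 1"
  shows "(\<lambda>k. 4 * of_real pi powr s * (exp_coeff (of_real pi * a) k * b (s + of_nat k) m)) sums bessel_part a b s m"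
  unfolding bessel_part_def
  using fourier_growth_imp_shift_growth[OF assms(1,2,4)]
  by (intro sums_mult summable_sums summable_norm_cancel[OF shift_growth_series(1)[OF _ entire_exp_coeff assms(3)]])

lemma sums_shift_series:
  assumes "shift_growth c" "s \<in> Re_gt"
  shows "(\<lambda>k. exp_coeff a k * c (s + of_nat k)) sums shift_series a c s"
  unfolding shift_series_def
  by (intro summable_sums summable_norm_cancel[OF shift_growth_series(1)[OF assms(1) entire_exp_coeff assms(2)]])

lemma holomorphic_shift_series:
  assumes "shift_growth c" shows "shift_series a c holomorphic_on Re_gt"
  using shift_growth_series(2)[OF assms entire_exp_coeff[of a]] by (simp add: shift_series_def[abs_def])

text \<open>Peeling off the term \<open>k = 0\<close>: the remaining terms only involve arguments with real part
  above \<open>5/2\<close>, away from the pole.\<close>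

lemma shift_series_split:
  assumes c: "shift_growth (\<lambda>w. c (w + 1))"
  shows "s \<in> Re_gt \<Longrightarrow> summable (\<lambda>k. exp_coeff a k * c (s + of_nat k))"
    and "\<exists>h. h holomorphic_on Re_gt \<and> (\<forall>s\<in>Re_gt. shift_series a c s = c s + h s)"
proof -
  note sg = shift_growth_series[OF c entire_coeffs_shift[OF entire_exp_coeff[of a]]]
  define h where "h = (\<lambda>s. \<Sum>k. exp_coeff a (Suc k) * c (s + of_nat k + 1))"
  have sm: "summable (\<lambda>k. exp_coeff a (Suc k) * c (s + of_nat (Suc k)))" if "s \<in> Re_gt" for s
    using summable_norm_cancel[OF sg(1)[OF that]] by (simp add: add_ac)
  then show sm': "summable (\<lambda>k. exp_coeff a k * c (s + of_nat k))" if "s \<in> Re_gt" for s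
    using that by (subst (asm) summable_Suc_iff) auto
  have "shift_series a c s = c s + h s" if "s \<in> Re_gt" for s
    unfolding shift_series_def h_def
    using suminf_split_head[OF sm'[OF that]] by (simp add: exp_coeff_def add_ac)
  moreover have "h holomorphic_on Re_gt" using sg(2) by (simp add: h_def)
  ultimately show "\<exists>h. h holomorphic_on Re_gt \<and> (\<forall>s\<in>Re_gt. shift_series a c s = c s + h s)" by blast
qed

lemma shift_growth_cs2'_shift: "y > 0 \<Longrightarrow> shift_growth (\<lambda>w. cs2' y (w + 1))"
  using shift_growth_cs2_shift_quotient by (simp add: cs2'_def[abs_def])

lemma simple_at_2_shift_series:
  assumes "shift_growth (\<lambda>w. c (w + 1))" "simple_at_2 c v"
  shows "simple_at_2 (shift_series a c) v"
proof -
  obtain h where h: "h holomorphic_on Re_gt" "\<And>s. s \<in> Re_gt \<Longrightarrow> shift_series a c s = c s + h s"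
    using shift_series_split(2)[OF assms(1), of a] by blast
  show ?thesis
    by (rule simple_at_2_cong[OF simple_at_2_add[OF assms(2) simple_at_2_holomorphic[OF h(1)]]]) (use h(2) in auto)
qed

text \<open>The additional quotient has the value 2 at w = 2 and doubles the residue of
  \<open>cs2\<close>.\<close>

lemma simple_at_2_cs2':
  assumes y: "y > 0" shows "simple_at_2 (cs2' y) (of_real (3 / (pi * y)))"
proof -
  have "2 * w - 3 \<noteq> 0" if "w \<in> Re_gt" for w
  proof
    assume "2 * w - 3 = 0"
    then have "Re (2 * w - 3) = 0" by simp
    with that show False by (simp add: Re_gt_def)
  qed
  then have "(\<lambda>w. (2 * w - 2) / (2 * w - 3)) holomorphic_on Re_gt" by (intro holomorphic_intros) auto
  from simple_at_2_mult[OF simple_at_2_cs2[OF y] this] show ?thesis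
    unfolding cs2'_def[abs_def] using y by (auto elim!: simple_at_2_cong simp: field_simps)
qed

text \<open>The common shape of all coefficients before conjugation: A and C belong to the diagonal
  alone, B is the sum with weight c^2 and enters three entries, D is the symmetric sine
  part.\<close>

definition fourier_matrix :: "complex \<Rightarrow> complex \<Rightarrow> complex \<Rightarrow> complex \<Rightarrow> complex \<Rightarrow> complex^2^2" where
  "fourier_matrix y A B C D = mat22 (A + B) (- \<i> * y * B + D) (\<i> * y * B + D) C"

lemma const_coeff_eq:
  fixes n :: int
  assumes y: "Im \<tau> > 0" and s: "s \<in> Re_gt"
  defines "a \<equiv> complex_of_real (4 * pi * of_int n)" and "Y \<equiv> complex_of_real (Im \<tau>)"
  shows "summable (const_series1 (- n) \<tau> s)" "summable (const_series2 (- n) \<tau> s)"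
    and "const_coeff (- n) \<tau> s = (Y powr s * exp (a * Y)) *m mat 1 +
      fourier_matrix Y (shift_series a (cs1 (Im \<tau>)) s) (shift_series a (cs2 (Im \<tau>)) s)
        (Y\<^sup>2 * shift_series a (cs2' (Im \<tau>)) s) 0"
proof -
  \<comment> \<open>At -n the sign in the series turns into the exponent 4 pi n of the Eisenstein
    summands.\<close>
  have e: "- 4 * complex_of_real pi * of_int (- n) = a" by (simp add: a_def)
  have cs1: "(\<lambda>k. exp_coeff a k * cs1 (Im \<tau>) (s + of_nat k)) sums shift_series a (cs1 (Im \<tau>)) s"
    by (rule sums_shift_series[OF shift_growth_cs1[OF y] s])
  have cs2: "(\<lambda>k. exp_coeff a k * cs2 (Im \<tau>) (s + of_nat k)) sums shift_series a (cs2 (Im \<tau>)) s"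
    unfolding shift_series_def by (rule summable_sums[OF shift_series_split(1)[OF shift_growth_cs2_shift[OF y] s]])
  have cs2': "(\<lambda>k. exp_coeff a k * cs2' (Im \<tau>) (s + of_nat k)) sums shift_series a (cs2' (Im \<tau>)) s"
    unfolding shift_series_def by (rule summable_sums[OF shift_series_split(1)[OF shift_growth_cs2'_shift[OF y] s]])
  have c1: "const_series1 (- n) \<tau> s k = mat22 (exp_coeff a k * cs1 (Im \<tau>) (s + of_nat k)) 0 0 0" for k
    unfolding const_series1_def Let_def e mscale_mat22 exp_coeff_def cs1_def
    by (simp add: algebra_simps)
  have "const_series1 (- n) \<tau> s sums mat22 (shift_series a (cs1 (Im \<tau>)) s) 0 0 0"
    unfolding c1[abs_def] by (intro sums_mat22 cs1 sums_zero)
  then have sm1: "summable (const_series1 (- n) \<tau> s)" and S1: "suminf (const_series1 (- n) \<tau> s) = mat22 (shift_series a (cs1 (Im \<tau>)) s) 0 0 0"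
    by (simp_all add: sums_iff)
  have c2: "const_series2 (- n) \<tau> s k = mat22 (exp_coeff a k * cs2 (Im \<tau>) (s + of_nat k))
     (- \<i> * Y * (exp_coeff a k * cs2 (Im \<tau>) (s + of_nat k))) (\<i> * Y * (exp_coeff a k * cs2 (Im \<tau>) (s + of_nat k)))
     (Y\<^sup>2 * (exp_coeff a k * cs2' (Im \<tau>) (s + of_nat k)))" for k
  proof -
    have 1: "2 * (s + of_nat k) - 3 = 2 * s + 2 * of_nat k - 3" "2 * (s + of_nat k) - 2 = 2 * s + 2 * of_nat k - 2"
      "1 - (s + of_nat k) = 1 - s - of_nat k" by (simp_all add: algebra_simps)
    show ?thesis
      unfolding const_series2_def Let_def e mscale_mat22 exp_coeff_def cs2'_def cs2_def 1 Y_def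
      by (rule mat22_eqI) (simp_all add: mult_ac)
  qed
  have "const_series2 (- n) \<tau> s sums mat22 (shift_series a (cs2 (Im \<tau>)) s) (- \<i> * Y * shift_series a (cs2 (Im \<tau>)) s)
      (\<i> * Y * shift_series a (cs2 (Im \<tau>)) s) (Y\<^sup>2 * shift_series a (cs2' (Im \<tau>)) s)"
    unfolding c2[abs_def] by (intro sums_mat22 sums_mult cs2 cs2')
  then have sm2: "summable (const_series2 (- n) \<tau> s)" and S2: "suminf (const_series2 (- n) \<tau> s) = mat22 (shift_series a (cs2 (Im \<tau>)) s) (- \<i> * Y * shift_series a (cs2 (Im \<tau>)) s)
      (\<i> * Y * shift_series a (cs2 (Im \<tau>)) s) (Y\<^sup>2 * shift_series a (cs2' (Im \<tau>)) s)"
    by (simp_all add: sums_iff)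
  show "summable (const_series1 (- n) \<tau> s)" "summable (const_series2 (- n) \<tau> s)" by fact+
  show "const_coeff (- n) \<tau> s = (Y powr s * exp (a * Y)) *m mat 1 +
      fourier_matrix Y (shift_series a (cs1 (Im \<tau>)) s) (shift_series a (cs2 (Im \<tau>)) s)
        (Y\<^sup>2 * shift_series a (cs2' (Im \<tau>)) s) 0"
    unfolding const_coeff_def Let_def e S1 S2 fourier_matrix_def mat_1_eq_mat22 mscale_mat22 mat22_add Y_def
    by (rule mat22_eqI) simp_all
qed

lemma higher_coeff_eq:
  fixes n :: int
  assumes y: "Im \<tau> > 0" and s: "s \<in> Re_gt" and m: "m \<ge> 1"
  defines "a \<equiv> complex_of_real (4 * pi * of_int n)" and "Y \<equiv> complex_of_real (Im \<tau>)"
  shows "summable (higher_series (- n) \<tau> s m)"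
    and "higher_coeff (- n) \<tau> s m =
      fourier_matrix Y (bessel_part a (hb1 (Re \<tau>) (Im \<tau>)) s m) (bessel_part a (hb2 (Re \<tau>) (Im \<tau>)) s m)
        (bessel_part a (hb3 (Re \<tau>) (Im \<tau>)) s m) (bessel_part a (hb4 (Re \<tau>) (Im \<tau>)) s m)"
proof -
  define P where "P = 4 * complex_of_real pi powr s"
  have P: "P \<noteq> 0" by (simp add: P_def)
  have e: "- 4 * (complex_of_real pi)\<^sup>2 * of_int (- n) = of_real pi * a" by (simp add: a_def power2_eq_square)
  let ?x = "Re \<tau>" and ?y = "Im \<tau>"
  define F where "F = (\<lambda>b k. exp_coeff (of_real pi * a) k * b (s + of_nat k) m :: complex)"
  have q: "0 < exp (- (pi * ?y))" by simp
  have S: "F b sums (bessel_part a b s m / P)" if "fourier_growth (exp (- (pi * ?y))) 2 b" for b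
    using sums_divide[OF sums_bessel_part[OF that q s m, of a], of P] P by (simp add: F_def P_def[symmetric])
  have h: "higher_series (- n) \<tau> s m k = mat22 (F (hb1 ?x ?y) k + F (hb2 ?x ?y) k)
     (- \<i> * Y * F (hb2 ?x ?y) k + F (hb4 ?x ?y) k) (\<i> * Y * F (hb2 ?x ?y) k + F (hb4 ?x ?y) k) (F (hb3 ?x ?y) k)" for k
  proof -
    \<comment> \<open>What \<open>bessel_K_bracket\<close> leaves of the sine bracket; the
      abbreviation keeps it atomic in the comparison of entries.\<close>
    define Z where "Z = of_real (Im \<tau>) * bessel_mode (s + of_nat k - 3/2) (Im \<tau>) m"
    show ?thesis
      unfolding higher_series_def Let_def e bessel_K_bracket[OF y m] F_def hb1_def hb2_def hb3_def hb4_def Z_def[symmetric] hs1_def hs2_def[symmetric] exp_coeff_def Y_def mscale_mat22 mat22_add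
      by (rule mat22_eqI) (simp_all only: mat22_nth distrib_left mult_zero_right mult_zero_left mult_1_left mult_1_right div_0 mult_minus_left mult_minus_right divide_minus_left add_0_left add_0_right times_divide_eq_left times_divide_eq_right mult_ac)
  qed
  have sums: "higher_series (- n) \<tau> s m sums mat22 (bessel_part a (hb1 ?x ?y) s m / P + bessel_part a (hb2 ?x ?y) s m / P)
     (- \<i> * Y * (bessel_part a (hb2 ?x ?y) s m / P) + bessel_part a (hb4 ?x ?y) s m / P)
     (\<i> * Y * (bessel_part a (hb2 ?x ?y) s m / P) + bessel_part a (hb4 ?x ?y) s m / P) (bessel_part a (hb3 ?x ?y) s m / P)"
    unfolding h[abs_def] by (intro sums_mat22 sums_add sums_mult S fourier_growth_hb y)
  then show "summable (higher_series (- n) \<tau> s m)" by (simp add: sums_iff)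
  show "higher_coeff (- n) \<tau> s m =
      fourier_matrix Y (bessel_part a (hb1 (Re \<tau>) (Im \<tau>)) s m) (bessel_part a (hb2 (Re \<tau>) (Im \<tau>)) s m)
        (bessel_part a (hb3 (Re \<tau>) (Im \<tau>)) s m) (bessel_part a (hb4 (Re \<tau>) (Im \<tau>)) s m)"
    unfolding higher_coeff_def sums_unique[OF sums, symmetric] P_def[symmetric] mscale_mat22 fourier_matrix_def
    using P by (intro mat22_eqI) (simp_all add: field_simps)
qed

lemma sums_fourier_matrix:
  assumes "A sums A'" "B sums B'" "C sums C'" "D sums D'"
  shows "(\<lambda>m. fourier_matrix y (A m) (B m) (C m) (D m)) sums fourier_matrix y A' B' C' D'"
  unfolding fourier_matrix_def by (intro sums_mat22 sums_add sums_mult assms)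

lemma fourier_matrix_add:
  "fourier_matrix y A B C D + fourier_matrix y A' B' C' D' = fourier_matrix y (A + A') (B + B') (C + C') (D + D')"
  unfolding fourier_matrix_def mat22_add by (rule mat22_eqI) (simp_all add: algebra_simps)

text \<open>The total of the Fourier expansion before conjugation, with the summations carried out
  entry by entry. It is compared with the coset sum for Re s > 2 and is the continuation
  beyond.\<close>

definition eisenstein_matrix :: "int \<Rightarrow> complex \<Rightarrow> complex \<Rightarrow> complex^2^2" where
  "eisenstein_matrix n \<tau> s = (let a = complex_of_real (4 * pi * of_int n); x = Re \<tau>; y = Im \<tau>; Y = complex_of_real y in
     (Y powr s * exp (a * Y)) *m mat 1 +
     fourier_matrix Y (shift_series a (cs1 y) s + fourier_total a (hb1 x y) s) (shift_series a (cs2 y) s + fourier_total a (hb2 x y) s)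
        (Y\<^sup>2 * shift_series a (cs2' y) s + fourier_total a (hb3 x y) s) (fourier_total a (hb4 x y) s))"

lemma fourier_coeff_sums:
  fixes n :: int
  assumes y: "Im \<tau> > 0" and s: "s \<in> Re_gt"
  defines "a \<equiv> complex_of_real (4 * pi * of_int n)" and "Y \<equiv> complex_of_real (Im \<tau>)"
  shows "(\<lambda>m. higher_coeff (- n) \<tau> s (Suc m)) sums
      fourier_matrix Y (fourier_total a (hb1 (Re \<tau>) (Im \<tau>)) s) (fourier_total a (hb2 (Re \<tau>) (Im \<tau>)) s)
        (fourier_total a (hb3 (Re \<tau>) (Im \<tau>)) s) (fourier_total a (hb4 (Re \<tau>) (Im \<tau>)) s)"
    and "fourier_coeff (- n) \<tau> s sums eisenstein_matrix n \<tau> s"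
proof -
  let ?F = "fourier_matrix Y (fourier_total a (hb1 (Re \<tau>) (Im \<tau>)) s) (fourier_total a (hb2 (Re \<tau>) (Im \<tau>)) s)
        (fourier_total a (hb3 (Re \<tau>) (Im \<tau>)) s) (fourier_total a (hb4 (Re \<tau>) (Im \<tau>)) s)"
  let ?x = "Re \<tau>" and ?y = "Im \<tau>"
  have q: "0 < exp (- (pi * ?y))" "exp (- (pi * ?y)) < 1" using y by simp_all
  have S: "(\<lambda>m. bessel_part a b s (Suc m)) sums fourier_total a b s" if "fourier_growth (exp (- (pi * ?y))) 2 b" for b
    unfolding fourier_total_def by (rule summable_sums[OF summable_bessel_part[OF that q s]])
  show *: "(\<lambda>m. higher_coeff (- n) \<tau> s (Suc m)) sums
      ?F"
    unfolding higher_coeff_eq(2)[OF y s le_add1[of 1, simplified plus_1_eq_Suc]] a_def[symmetric] Y_def[symmetric]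
    by (intro sums_fourier_matrix S fourier_growth_hb y)
  have "(\<lambda>m. fourier_coeff (- n) \<tau> s (Suc m)) sums
      ?F"
    using * by (simp add: fourier_coeff_def)
  then have "fourier_coeff (- n) \<tau> s sums (?F + fourier_coeff (- n) \<tau> s 0)"
    by (rule sums_Suc)
  also have "fourier_coeff (- n) \<tau> s 0 = const_coeff (- n) \<tau> s" by (simp add: fourier_coeff_def)
  finally show "fourier_coeff (- n) \<tau> s sums eisenstein_matrix n \<tau> s"
    unfolding const_coeff_eq(3)[OF y s] a_def[symmetric] Y_def[symmetric] eisenstein_matrix_def Let_def
    by (simp only: add.left_commute add.assoc fourier_matrix_add) (simp add: add_ac)
qed

section \<open>Conjugation by the unipotent matrix and matrix functions with a simple pole\<close>

lemma conj_by_tau_nth: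
  "conj_by_tau \<tau> A $ 1 $ 1 = A $ 1 $ 1"
  "conj_by_tau \<tau> A $ 1 $ 2 = A $ 1 $ 2 - cnj \<tau> * A $ 1 $ 1"
  "conj_by_tau \<tau> A $ 2 $ 1 = A $ 2 $ 1 - \<tau> * A $ 1 $ 1"
  "conj_by_tau \<tau> A $ 2 $ 2 = A $ 2 $ 2 - \<tau> * A $ 1 $ 2 - cnj \<tau> * A $ 2 $ 1 + \<tau> * cnj \<tau> * A $ 1 $ 1"
  by (subst (1) mat22_collapse[of A, symmetric], subst conj_by_tau_mat22, simp)+

lemma simple_at_2_diff:
  assumes "simple_at_2 f v" "simple_at_2 g w" shows "simple_at_2 (\<lambda>s. f s - g s) (v - w)"
  using simple_at_2_add[OF assms(1) simple_at_2_cmult[OF assms(2), of "-1"]] by simp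

definition mat_simple_at_2 :: "(complex \<Rightarrow> complex^2^2) \<Rightarrow> complex^2^2 \<Rightarrow> bool" where
  "mat_simple_at_2 F V \<longleftrightarrow> (\<forall>i j. simple_at_2 (\<lambda>s. F s $ i $ j) (V $ i $ j))"

lemma mat_simple_at_2I:
  fixes F :: "complex \<Rightarrow> complex^2^2" and V :: "complex^2^2"
  assumes "simple_at_2 (\<lambda>s. F s $ 1 $ 1) (V $ 1 $ 1)" "simple_at_2 (\<lambda>s. F s $ 1 $ 2) (V $ 1 $ 2)"
    "simple_at_2 (\<lambda>s. F s $ 2 $ 1) (V $ 2 $ 1)" "simple_at_2 (\<lambda>s. F s $ 2 $ 2) (V $ 2 $ 2)"
  shows "mat_simple_at_2 F V"
  using assms by (simp add: mat_simple_at_2_def forall_2)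

lemma mat_simple_at_2_conj_by_tau:
  fixes F :: "complex \<Rightarrow> complex^2^2"
  assumes "mat_simple_at_2 F V" shows "mat_simple_at_2 (\<lambda>s. conj_by_tau \<tau> (F s)) (conj_by_tau \<tau> V)"
proof -
  have 1: "simple_at_2 (\<lambda>s. F s $ i $ j) (V $ i $ j)" for i j using assms by (simp add: mat_simple_at_2_def)
  show ?thesis
    by (rule mat_simple_at_2I; unfold conj_by_tau_nth;
        rule 1 simple_at_2_diff simple_at_2_add simple_at_2_cmult)
       (rule 1 simple_at_2_diff simple_at_2_add simple_at_2_cmult)+
qed

lemma mat_simple_at_2_add:
  assumes "mat_simple_at_2 F V" "mat_simple_at_2 G W" shows "mat_simple_at_2 (\<lambda>s. F s + G s) (V + W)"
  using assms simple_at_2_add by (simp add: mat_simple_at_2_def)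

lemma mat_simple_at_2_holomorphic:
  fixes F :: "complex \<Rightarrow> complex^2^2"
  assumes "mat_holomorphic_on F Re_gt" shows "mat_simple_at_2 F 0"
  using assms simple_at_2_holomorphic by (simp add: mat_simple_at_2_def mat_holomorphic_on_def)

lemma mat_simple_at_2_cong:
  fixes F :: "complex \<Rightarrow> complex^2^2"
  assumes "mat_simple_at_2 F V" "\<And>s. s \<in> Re_gt - {2} \<Longrightarrow> G s = F s"
  shows "mat_simple_at_2 G V"
  unfolding mat_simple_at_2_def
proof (intro allI)
  fix i j
  have "simple_at_2 (\<lambda>s. F s $ i $ j) (V $ i $ j)" using assms(1) by (simp add: mat_simple_at_2_def)
  then show "simple_at_2 (\<lambda>s. G s $ i $ j) (V $ i $ j)"
    by (rule simple_at_2_cong) (simp_all add: assms(2))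
qed

lemma mat_simple_at_2_imp:
  fixes F :: "complex \<Rightarrow> complex^2^2"
  assumes "mat_simple_at_2 F V"
  shows "mat_holomorphic_on F (Re_gt - {2})" "\<And>i j. (\<lambda>s. F s $ i $ j) meromorphic_on Re_gt" "mat_residue F 2 = V"
    and "V \<noteq> 0 \<Longrightarrow> mat_simple_pole F 2"
proof -
  note * = simple_at_2_imp[OF assms[unfolded mat_simple_at_2_def, THEN spec, THEN spec]]
  show "mat_holomorphic_on F (Re_gt - {2})" using *(1) by (simp add: mat_holomorphic_on_def)
  show "(\<lambda>s. F s $ i $ j) meromorphic_on Re_gt" for i j by (rule *(2))
  show "mat_residue F 2 = V" using *(3) by (simp add: mat_residue_def vec_eq_iff)
  assume "V \<noteq> 0"
  then obtain i j where "V $ i $ j \<noteq> 0" by (auto simp: vec_eq_iff)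
  then have "mat_pole F 2" using *(4) unfolding mat_pole_def by blast
  then show "mat_simple_pole F 2" using *(5) by (simp add: mat_simple_pole_def)
qed

lemma mat_holomorphic_fourier_matrix:
  assumes "A holomorphic_on S" "B holomorphic_on S" "C holomorphic_on S" "D holomorphic_on S"
  shows "mat_holomorphic_on (\<lambda>s. fourier_matrix Y (A s) (B s) (C s) (D s)) S"
  unfolding mat_holomorphic_on_def fourier_matrix_def forall_2 mat22_nth
  using assms by (auto intro!: holomorphic_intros)

lemma mat_holomorphic_on_cong:
  assumes "mat_holomorphic_on F S" "\<And>s. s \<in> S \<Longrightarrow> G s = F s" shows "mat_holomorphic_on G S"
  unfolding mat_holomorphic_on_def
proof (intro allI)
  fix i j
  have "(\<lambda>s. F s $ i $ j) holomorphic_on S" using assms(1) by (simp add: mat_holomorphic_on_def)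
  then show "(\<lambda>s. G s $ i $ j) holomorphic_on S"
    by (rule holomorphic_transform) (simp add: assms(2))
qed

lemma mat_holomorphic_higher:
  fixes n :: int
  assumes y: "Im \<tau> > 0"
  shows "mat_holomorphic_on (\<lambda>s. \<Sum>m. higher_coeff (- n) \<tau> s (Suc m)) Re_gt"
  by (rule mat_holomorphic_on_cong[OF mat_holomorphic_fourier_matrix sums_unique[OF fourier_coeff_sums(1)[OF y], symmetric]])
     (rule holomorphic_fourier_total[OF fourier_growth_hb(1)[OF y]] holomorphic_fourier_total[OF fourier_growth_hb(2)[OF y]]
       holomorphic_fourier_total[OF fourier_growth_hb(3)[OF y]] holomorphic_fourier_total[OF fourier_growth_hb(4)[OF y]]
      | simp add: y)+

text \<open>The residue before conjugation. Its off-diagonal entries are -3i/(2 pi) and 3i/(2 pi);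
  conjugation cancels these imaginary parts against those of the multiples of the corner 3/(2 pi y),
  which leaves a real matrix.\<close>

definition const_residue :: "complex \<Rightarrow> complex^2^2" where
  "const_residue \<tau> = fourier_matrix (of_real (Im \<tau>)) 0 (of_real (3 / (2 * pi * Im \<tau>))) (of_real (3 * Im \<tau> / pi)) 0"

lemma conj_const_residue:
  assumes y: "Im \<tau> > 0"
  shows "conj_by_tau \<tau> (const_residue \<tau>) = (3 / (2 * of_real pi)) *m K_metric \<tau>"
proof -
  obtain x y where \<tau>: "\<tau> = Complex x y" by (cases \<tau>)
  have y': "y > 0" using y by (simp add: \<tau>)
  show ?thesis
    unfolding const_residue_def fourier_matrix_def conj_by_tau_mat22 K_metric_def Let_def mscale_mat22
    using y' by (intro mat22_eqI) (simp_all add: \<tau> complex_eq_iff field_simps power2_eq_square)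
qed

lemma const_residue_nonzero: "Im \<tau> > 0 \<Longrightarrow> (3 / (2 * of_real pi)) *m K_metric \<tau> \<noteq> 0"
  by (auto simp: K_metric_def Let_def mscale_mat22 vec_eq_iff forall_2)

text \<open>The leading term and the series of \<open>cs1\<close> are holomorphic on the region, so
  only \<open>cs2\<close> and \<open>cs2'\<close> contribute to the residue.\<close>

lemma mat_simple_const_coeff:
  fixes n :: int
  assumes y: "Im \<tau> > 0"
  shows "mat_simple_at_2 (const_coeff (- n) \<tau>) (const_residue \<tau>)"
proof -
  define a where "a = complex_of_real (4 * pi * of_int n)"
  define Y where "Y = complex_of_real (Im \<tau>)"
  have 1: "mat_simple_at_2 (\<lambda>s. (Y powr s * exp (a * Y)) *m mat 1) 0"
    unfolding mat_1_eq_mat22 mscale_mat22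
    by (rule mat_simple_at_2_holomorphic)
       (use y in \<open>auto simp: mat_holomorphic_on_def forall_2 Y_def intro!: holomorphic_intros\<close>)
  have c1: "simple_at_2 (shift_series a (cs1 (Im \<tau>))) 0"
    by (rule simple_at_2_holomorphic[OF holomorphic_shift_series[OF shift_growth_cs1[OF y]]])
  note c2 = simple_at_2_shift_series[OF shift_growth_cs2_shift[OF y] simple_at_2_cs2[OF y], of a]
  note c3 = simple_at_2_shift_series[OF shift_growth_cs2'_shift[OF y] simple_at_2_cs2'[OF y], of a]
  have 2: "mat_simple_at_2 (\<lambda>s. fourier_matrix Y (shift_series a (cs1 (Im \<tau>)) s) (shift_series a (cs2 (Im \<tau>)) s)
        (Y\<^sup>2 * shift_series a (cs2' (Im \<tau>)) s) 0) (const_residue \<tau>)"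
  proof (rule mat_simple_at_2I; unfold const_residue_def fourier_matrix_def mat22_nth Y_def[symmetric] add_0_right)
    show "simple_at_2 (\<lambda>s. shift_series a (cs1 (Im \<tau>)) s + shift_series a (cs2 (Im \<tau>)) s) (0 + of_real (3 / (2 * pi * Im \<tau>)))"
      by (rule simple_at_2_add[OF c1 c2])
    show "simple_at_2 (\<lambda>s. - \<i> * Y * shift_series a (cs2 (Im \<tau>)) s) (- \<i> * Y * of_real (3 / (2 * pi * Im \<tau>)))"
      by (rule simple_at_2_cmult[OF c2])
    show "simple_at_2 (\<lambda>s. \<i> * Y * shift_series a (cs2 (Im \<tau>)) s) (\<i> * Y * of_real (3 / (2 * pi * Im \<tau>)))"
      by (rule simple_at_2_cmult[OF c2])
    have "complex_of_real (3 * Im \<tau> / pi) = Y\<^sup>2 * of_real (3 / (pi * Im \<tau>))"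
      using y by (simp add: Y_def field_simps power2_eq_square)
    then show "simple_at_2 (\<lambda>s. Y\<^sup>2 * shift_series a (cs2' (Im \<tau>)) s) (of_real (3 * Im \<tau> / pi))"
      using simple_at_2_cmult[OF c3, of "Y\<^sup>2"] by simp
  qed
  show ?thesis
    by (rule mat_simple_at_2_cong[OF mat_simple_at_2_add[OF 1 2, unfolded add_0_left]])
       (use const_coeff_eq(3)[OF y, of _ n] in \<open>simp add: a_def Y_def\<close>)
qed

lemma eisenstein_matrix_split:
  fixes n :: int
  assumes "Im \<tau> > 0" "s \<in> Re_gt"
  shows "eisenstein_matrix n \<tau> s = const_coeff (- n) \<tau> s + (\<Sum>m. higher_coeff (- n) \<tau> s (Suc m))"
proof -
  have "(\<lambda>m. fourier_coeff (- n) \<tau> s (Suc m)) sums (\<Sum>m. higher_coeff (- n) \<tau> s (Suc m))"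
    using fourier_coeff_sums(1)[OF assms, of n] by (simp add: fourier_coeff_def sums_iff)
  from sums_Suc[OF this]
  have "fourier_coeff (- n) \<tau> s sums ((\<Sum>m. higher_coeff (- n) \<tau> s (Suc m)) + fourier_coeff (- n) \<tau> s 0)" .
  moreover have "fourier_coeff (- n) \<tau> s 0 = const_coeff (- n) \<tau> s" by (simp add: fourier_coeff_def)
  ultimately show ?thesis
    using sums_unique2[OF fourier_coeff_sums(2)[OF assms, of n]] by (simp add: add.commute)
qed

lemma mat_simple_eisenstein:
  fixes n :: int
  assumes y: "Im \<tau> > 0"
  shows "mat_simple_at_2 (\<lambda>s. conj_by_tau \<tau> (eisenstein_matrix n \<tau> s)) ((3 / (2 * of_real pi)) *m K_metric \<tau>)"
proof -
  have "mat_simple_at_2 (eisenstein_matrix n \<tau>) (const_residue \<tau> + 0)"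
    by (rule mat_simple_at_2_cong[OF mat_simple_at_2_add[OF mat_simple_const_coeff[OF y, of n]
          mat_simple_at_2_holomorphic[OF mat_holomorphic_higher[OF y, of n]]]])
       (use eisenstein_matrix_split[OF y] in auto)
  from mat_simple_at_2_conj_by_tau[OF this, of \<tau>] show ?thesis
    by (simp add: conj_const_residue[OF y])
qed

section \<open>The exponential series under the sum over pairs\<close>

lemma exp_interchange:
  fixes g :: "'a \<Rightarrow> complex" and t :: "'a \<Rightarrow> real"
  assumes sm: "g summable_on A" and t: "\<And>p. p \<in> A \<Longrightarrow> 0 \<le> t p \<and> t p \<le> T"
    and \<Phi>: "\<And>k. ((\<lambda>p. g p * of_real (t p) ^ k) has_sum \<Phi> k) A"
  shows "((\<lambda>p. g p * exp (a * of_real (t p))) has_sum (\<Sum>k. exp_coeff a k * \<Phi> k)) A"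
proof -
  define f where "f = (\<lambda>p k. g p * (exp_coeff a k * of_real (t p) ^ k))"
  \<comment> \<open>Since t is bounded on A, the double family is dominated by the norm of g p times
    \<open>B k\<close>, a product, and the two summations commute.\<close>
  define B where "B = (\<lambda>k. norm (exp_coeff a k) * \<bar>T\<bar> ^ k)"
  have "summable B"
    using entire_exp_coeff[of a] by (simp add: entire_coeffs_def B_def)
  then have B: "(B has_sum suminf B) UNIV"
    by (intro norm_summable_imp_has_sum summable_sums) (simp_all add: B_def)
  have bound: "norm (f p k) \<le> norm (g p) * B k" if "p \<in> A" for p k
    unfolding f_def B_def norm_mult norm_power norm_of_real
    using t[OF that] by (intro mult_left_mono power_mono) auto
  have sg: "(\<lambda>p. norm (g p)) summable_on A" using sm by (simp add: summable_on_iff_abs_summable_on_complex)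
  have "(\<lambda>(p, k). norm (g p) * B k) summable_on A \<times> UNIV"
  proof (rule summable_on_SigmaI[where g = "\<lambda>p. norm (g p) * suminf B"])
    show "((\<lambda>k. case (p, k) of (p, k) \<Rightarrow> norm (g p) * B k) has_sum norm (g p) * suminf B) UNIV" for p
      using has_sum_cmult_right[OF B] by simp
    show "(\<lambda>p. norm (g p) * suminf B) summable_on A" by (rule summable_on_cmult_left[OF sg])
  qed (simp add: B_def)
  then have "(\<lambda>q. norm (case q of (p, k) \<Rightarrow> f p k)) summable_on A \<times> UNIV"
    by (rule Infinite_Sum.abs_summable_on_comparison_test') (use bound in auto)
  then have "(\<lambda>q. case q of (p, k) \<Rightarrow> f p k) summable_on A \<times> UNIV"
    by (rule Infinite_Sum.abs_summable_summable)
  then obtain S where S: "((\<lambda>q. case q of (p, k) \<Rightarrow> f p k) has_sum S) (A \<times> UNIV)"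
    by (auto simp: summable_on_def)
  have S': "((\<lambda>(k, p). f p k) has_sum S) (UNIV \<times> A)"
    using S by (subst (asm) has_sum_swap) (simp add: case_prod_unfold)
  have inner: "((\<lambda>k. f p k) has_sum (g p * exp (a * of_real (t p)))) UNIV" for p
  proof -
    have "(\<lambda>k. inverse (fact k) * norm (a * of_real (t p)) ^ k) sums exp (norm (a * of_real (t p)))"
      using exp_converges[of "norm (a * of_real (t p))"] by (simp add: scaleR_conv_of_real)
    then have "summable (\<lambda>k. norm ((a * of_real (t p)) ^ k /\<^sub>R fact k))"
      by (simp add: sums_iff norm_power)
    then have "((\<lambda>k. (a * of_real (t p)) ^ k /\<^sub>R fact k) has_sum exp (a * of_real (t p))) UNIV"
      by (intro norm_summable_imp_has_sum exp_converges)
    from has_sum_cmult_right[OF this, of "g p"] show ?thesis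
      by (simp add: f_def exp_coeff_def power_mult_distrib scaleR_conv_of_real field_simps)
  qed
  have A1: "((\<lambda>p. g p * exp (a * of_real (t p))) has_sum S) A"
    by (rule has_sum_SigmaD[OF S]) (simp add: inner)
  have "((\<lambda>k. exp_coeff a k * \<Phi> k) has_sum S) UNIV"
  proof (rule has_sum_SigmaD[OF S'])
    show "((\<lambda>p. case (k, p) of (k, p) \<Rightarrow> f p k) has_sum exp_coeff a k * \<Phi> k) A" for k
      using has_sum_cmult_right[OF \<Phi>[of k], of "exp_coeff a k"] by (simp add: f_def mult_ac)
  qed
  then have "S = (\<Sum>k. exp_coeff a k * \<Phi> k)" by (metis has_sum_imp_sums sums_unique)
  with A1 show ?thesis by simp
qed

lemma powr_add_nat_pos: "x > 0 \<Longrightarrow> complex_of_real x powr (w + of_nat k) = of_real x powr w * of_real x ^ k"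
  by (simp add: powr_of_pos_real distrib_right exp_add exp_of_nat_mult exp_of_real)

lemma summable_fourier_growth:
  assumes b: "fourier_growth q p b" and q: "0 < q" "q < 1" and w: "w \<in> Re_gt"
  shows "summable (\<lambda>m. b w (Suc m))"
proof -
  obtain D E where "\<And>k m. m \<ge> 1 \<Longrightarrow> norm (b (w + of_nat k) m) \<le> D * E ^ k * (real m ^ p * q ^ m)"
    using b w unfolding fourier_growth_def by (metis IntI centre_in_ball)
  then have bd: "norm (b w (Suc m)) \<le> D * (real (Suc m) ^ p * q ^ Suc m)" for m
    by (metis Suc_le_mono One_nat_def add_0_right le0 mult_1_right of_nat_0 power_0)
  have "summable (\<lambda>m. real (Suc m) ^ p * q ^ Suc m)"
    using summable_power_mult_power[OF q, of p] by (subst summable_Suc_iff)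
  from summable_mult[OF this, of D] show ?thesis
    by (rule summable_comparison_test'[of _ 0]) (rule bd)
qed

text \<open>The k-th power of y/q raises w by k, so the k-th term of the exponential is the given
  sum at s + k. The interchange is legitimate because q >= y^2 on coprime pairs, hence y/q <=
  1/y.\<close>

lemma coprime_exp_sum:
  fixes u :: "nat \<times> int \<Rightarrow> complex"
  assumes y: "y > 0" and s: "Re s > 2"
    and HS: "\<And>w. Re w > 2 \<Longrightarrow> ((\<lambda>p. of_real y powr w * (u p * of_real (lattice_form x y p) powr (- w))) has_sum
       (c w + (\<Sum>m. 4 * of_real pi powr w * b w (Suc m)))) coprime_pairs"
    and b: "fourier_growth (exp (- (pi * y))) 2 b"
    and c: "summable (\<lambda>k. exp_coeff a k * c (s + of_nat k))"
  shows "((\<lambda>p. of_real y powr s * (u p * of_real (lattice_form x y p) powr (- s)) * exp (a * of_real (y / lattice_form x y p)))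
     has_sum (shift_series a c s + fourier_total a b s)) coprime_pairs"
proof -
  have q: "0 < exp (- (pi * y))" "exp (- (pi * y)) < 1" using y by simp_all
  have sR: "s \<in> Re_gt" using s by (simp add: Re_gt_def)
  have qp: "lattice_form x y p \<ge> y\<^sup>2" if "p \<in> coprime_pairs" for p
  proof -
    obtain m d where p: "p = (m, d)" by (cases p)
    have "m \<ge> 1" using that by (auto simp: p coprime_pairs_def)
    then have "1 * y\<^sup>2 \<le> (real m)\<^sup>2 * y\<^sup>2" by (intro mult_right_mono) (auto simp: one_le_power)
    then show ?thesis by (simp add: p lattice_form_def power_mult_distrib add_increasing)
  qed
  have q0: "lattice_form x y p > 0" if "p \<in> coprime_pairs" for p
    using qp[OF that] y by (meson less_le_trans zero_less_power)
  define g where "g = (\<lambda>p. complex_of_real y powr s * (u p * of_real (lattice_form x y p) powr (- s)))"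
  define \<Phi> where "\<Phi> = (\<lambda>k. c (s + of_nat k) + (\<Sum>m. 4 * of_real pi powr (s + of_nat k) * b (s + of_nat k) (Suc m)))"
  have "((\<lambda>p. g p * exp (a * of_real (y / lattice_form x y p))) has_sum (\<Sum>k. exp_coeff a k * \<Phi> k)) coprime_pairs"
  proof (rule exp_interchange[where T = "1 / y"])
    show "g summable_on coprime_pairs" using HS[OF s] unfolding g_def summable_on_def by blast
    show "0 \<le> y / lattice_form x y p \<and> y / lattice_form x y p \<le> 1 / y" if "p \<in> coprime_pairs" for p
      using q0[OF that] qp[OF that] y by (simp add: field_simps power2_eq_square)
    fix k
    have "((\<lambda>p. of_real y powr (s + of_nat k) * (u p * of_real (lattice_form x y p) powr (- (s + of_nat k)))) has_sum \<Phi> k) coprime_pairs"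
      unfolding \<Phi>_def by (rule HS) (use s in simp)
    then show "((\<lambda>p. g p * of_real (y / lattice_form x y p) ^ k) has_sum \<Phi> k) coprime_pairs"
    proof (rule has_sum_cong[THEN iffD1, rotated])
      fix p assume "p \<in> coprime_pairs"
      note q0 = q0[OF this]
      show "complex_of_real y powr (s + of_nat k) * (u p * of_real (lattice_form x y p) powr (- (s + of_nat k))) =
          g p * of_real (y / lattice_form x y p) ^ k"
        unfolding powr_add_nat_pos[OF y] powr_minus powr_add_nat_pos[OF q0] g_def
        by (simp add: divide_inverse power_mult_distrib power_inverse mult_ac)
    qed
  qed
  moreover have "(\<Sum>k. exp_coeff a k * \<Phi> k) = shift_series a c s + fourier_total a b s"
  proof -
    have 1: "exp_coeff a k * (\<Sum>m. 4 * of_real pi powr (s + of_nat k) * b (s + of_nat k) (Suc m)) =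
       4 * of_real pi powr s * (\<Sum>m. exp_coeff (of_real pi * a) k * b (s + of_nat k) (Suc m))" for k
    proof -
      have sm: "summable (\<lambda>m. b (s + of_nat k) (Suc m))"
        by (rule summable_fourier_growth[OF b q Re_gt_add_nat[OF sR]])
      show ?thesis
        unfolding suminf_mult[OF sm] powr_add_nat_pos[OF pi_gt_zero] exp_coeff_def by (simp add: power_mult_distrib)
    qed
    have F: "(\<lambda>k. 4 * of_real pi powr s * (\<Sum>m. exp_coeff (of_real pi * a) k * b (s + of_nat k) (Suc m))) sums fourier_total a b s"
      unfolding fourier_total_def bessel_part_def
      suminf_mult[OF summable_norm_cancel[OF fourier_growth_series(2)[OF b q entire_exp_coeff sR]]]
      by (intro sums_mult fourier_growth_series(4)[OF b q entire_exp_coeff sR])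
    have "(\<lambda>k. exp_coeff a k * \<Phi> k) sums (shift_series a c s + fourier_total a b s)"
      unfolding \<Phi>_def distrib_left 1 by (intro sums_add F) (use c in \<open>simp add: shift_series_def summable_sums\<close>)
    then show ?thesis by (simp add: sums_iff)
  qed
  ultimately show ?thesis by (simp add: g_def)
qed


lemma lattice_form_0_1: "lattice_form x y (0, 1) = 1"
  by (simp add: lattice_form_def)

definition pair_matrix :: "int \<Rightarrow> complex \<Rightarrow> complex \<Rightarrow> nat \<times> int \<Rightarrow> complex^2^2" where
  "pair_matrix n \<tau> s p = (let c = complex_of_nat (fst p); j = c * \<tau> + of_int (snd p);
      q = lattice_form (Re \<tau>) (Im \<tau>) p; t = Im \<tau> / q in
     (of_real t powr s * exp (of_real (4 * pi * of_int n) * of_real t)) *m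
       mat22 (1 / of_real q + c\<^sup>2) (c * cnj j) (c * j) (of_real q))"

text \<open>Four scalar sums determine all four entries, because c j = c (c x + d) + i y c^2 splits
  the off-diagonal entries into the odd sum and the sum with weight c^2.\<close>

lemma has_sum_pair_matrix:
  fixes n :: int
  assumes y: "Im \<tau> > 0" and s: "Re s > 2"
  shows "(pair_matrix n \<tau> s has_sum eisenstein_matrix n \<tau> s) (insert (0, 1) coprime_pairs)"
proof -
  define a where "a = complex_of_real (4 * pi * of_int n)"
  define Y where "Y = complex_of_real (Im \<tau>)"
  let ?x = "Re \<tau>" and ?y = "Im \<tau>"
  define q where "q = lattice_form ?x ?y"
  have sR: "s \<in> Re_gt" using s by (simp add: Re_gt_def)
  have q0: "q p > 0" if "p \<in> coprime_pairs" for p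
    unfolding q_def using lattice_form_pos[OF y] coprime_pairs_subset that by blast
  define G where "G = (\<lambda>u p. Y powr s * (u p * of_real (q p) powr (- s)) * exp (a * of_real (?y / q p)))"
  define ua :: "nat \<times> int \<Rightarrow> complex" where "ua = (\<lambda>p. 1 / of_real (q p))"
  define ub :: "nat \<times> int \<Rightarrow> complex" where "ub = (\<lambda>p. of_nat (fst p) ^ 2)"
  define uc :: "nat \<times> int \<Rightarrow> complex" where "uc = (\<lambda>p. of_real (q p))"
  define ud :: "nat \<times> int \<Rightarrow> complex" where "ud = (\<lambda>p. of_real (real (fst p) * (real (fst p) * ?x + of_int (snd p))))"
  have pw: "z powr (- (w + 1)) = 1 / z * z powr (- w)" "z powr (- (w - 1)) = z * z powr (- w)" if "z \<noteq> 0" for z w :: complex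
    using that by (simp_all add: powr_add powr_diff powr_minus divide_inverse)
  have Ga: "(G ua has_sum (shift_series a (cs1 ?y) s + fourier_total a (hb1 ?x ?y) s)) coprime_pairs"
    unfolding G_def q_def Y_def
  proof (rule coprime_exp_sum[OF y s _ fourier_growth_hb(1)[OF y]])
    show "summable (\<lambda>k. exp_coeff a k * cs1 ?y (s + of_nat k))"
      by (rule sums_summable[OF sums_shift_series[OF shift_growth_cs1[OF y] sR]])
    show "((\<lambda>p. of_real ?y powr w * (ua p * of_real (lattice_form ?x ?y p) powr (- w))) has_sum
       (cs1 ?y w + (\<Sum>m. 4 * of_real pi powr w * hb1 ?x ?y w (Suc m)))) coprime_pairs" if "Re w > 2" for w
      using coprime_sum_11a[OF y that, of ?x] unfolding hb1_def
    proof (rule has_sum_cong[THEN iffD1, rotated])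
      fix p assume p: "p \<in> coprime_pairs"
      have "complex_of_real (lattice_form ?x ?y p) \<noteq> 0" using q0[OF p] by (simp add: q_def)
      from pw(1)[OF this] show "of_real ?y powr w * of_real (lattice_form ?x ?y p) powr (- (w + 1)) = of_real ?y powr w * (ua p * of_real (lattice_form ?x ?y p) powr (- w))"
        unfolding ua_def q_def by (simp only:)
    qed
  qed
  have Gb: "(G ub has_sum (shift_series a (cs2 ?y) s + fourier_total a (hb2 ?x ?y) s)) coprime_pairs"
    unfolding G_def q_def Y_def
  proof (rule coprime_exp_sum[OF y s _ fourier_growth_hb(2)[OF y]])
    show "summable (\<lambda>k. exp_coeff a k * cs2 ?y (s + of_nat k))"
      by (rule shift_series_split(1)[OF shift_growth_cs2_shift[OF y] sR])
    show "((\<lambda>p. of_real ?y powr w * (ub p * of_real (lattice_form ?x ?y p) powr (- w))) has_sum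
       (cs2 ?y w + (\<Sum>m. 4 * of_real pi powr w * hb2 ?x ?y w (Suc m)))) coprime_pairs" if "Re w > 2" for w
      using coprime_sum_11b[OF y that, of ?x] unfolding hb2_def ub_def .
  qed
  have Gc: "(G uc has_sum (shift_series a (\<lambda>w. Y\<^sup>2 * cs2' ?y w) s + fourier_total a (hb3 ?x ?y) s)) coprime_pairs"
    unfolding G_def q_def Y_def
  proof (rule coprime_exp_sum[OF y s _ fourier_growth_hb(3)[OF y]])
    show "summable (\<lambda>k. exp_coeff a k * ((of_real ?y)\<^sup>2 * cs2' ?y (s + of_nat k)))"
      using summable_mult[OF shift_series_split(1)[OF shift_growth_cs2'_shift[OF y] sR, of a], of "(of_real ?y)\<^sup>2"]
      by (simp only: mult_ac)
    show "((\<lambda>p. of_real ?y powr w * (uc p * of_real (lattice_form ?x ?y p) powr (- w))) has_sum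
       ((of_real ?y)\<^sup>2 * cs2' ?y w + (\<Sum>m. 4 * of_real pi powr w * hb3 ?x ?y w (Suc m)))) coprime_pairs" if "Re w > 2" for w
      using coprime_sum_22[OF y that, of ?x] unfolding hb3_def cs2'_def
    proof (rule has_sum_cong[THEN iffD1, rotated])
      fix p assume p: "p \<in> coprime_pairs"
      have "complex_of_real (lattice_form ?x ?y p) \<noteq> 0" using q0[OF p] by (simp add: q_def)
      from pw(2)[OF this] show "of_real ?y powr w * of_real (lattice_form ?x ?y p) powr (- (w - 1)) = of_real ?y powr w * (uc p * of_real (lattice_form ?x ?y p) powr (- w))"
        unfolding uc_def q_def by (simp only:)
    qed
  qed
  have c3: "shift_series a (\<lambda>w. Y\<^sup>2 * cs2' ?y w) s = Y\<^sup>2 * shift_series a (cs2' ?y) s"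
    unfolding shift_series_def
    using suminf_mult[OF shift_series_split(1)[OF shift_growth_cs2'_shift[OF y] sR, of a], of "Y\<^sup>2"] by (simp only: mult_ac)
  have Gd: "(G ud has_sum (shift_series a (\<lambda>w. 0) s + fourier_total a (hb4 ?x ?y) s)) coprime_pairs"
    unfolding G_def q_def Y_def
  proof (rule coprime_exp_sum[OF y s _ fourier_growth_hb(4)[OF y]])
    show "summable (\<lambda>k. exp_coeff a k * 0)" by simp
    show "((\<lambda>p. of_real ?y powr w * (ud p * of_real (lattice_form ?x ?y p) powr (- w))) has_sum
       (0 + (\<Sum>m. 4 * of_real pi powr w * hb4 ?x ?y w (Suc m)))) coprime_pairs" if "Re w > 2" for w
      using coprime_sum_odd[OF y that, of ?x] unfolding ud_def hb4_def .
  qed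
  let ?R = "fourier_matrix Y (shift_series a (cs1 ?y) s + fourier_total a (hb1 ?x ?y) s) (shift_series a (cs2 ?y) s + fourier_total a (hb2 ?x ?y) s)
        (Y\<^sup>2 * shift_series a (cs2' ?y) s + fourier_total a (hb3 ?x ?y) s) (fourier_total a (hb4 ?x ?y) s)"
  have "((\<lambda>p. fourier_matrix Y (G ua p) (G ub p) (G uc p) (G ud p)) has_sum
     ?R) coprime_pairs"
    unfolding fourier_matrix_def using Ga Gb Gc Gd unfolding c3
    by (intro has_sum_mat22 has_sum_add has_sum_cmult_right) (simp_all add: shift_series_def)
  then have "(pair_matrix n \<tau> s has_sum
     ?R) coprime_pairs"
  proof (rule has_sum_cong[THEN iffD1, rotated])
    fix p assume p: "p \<in> coprime_pairs"
    define c where "c = complex_of_nat (fst p)"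
    define j where "j = c * \<tau> + of_int (snd p)"
    define X where "X = Y powr s * of_real (q p) powr (- s) * exp (a * of_real (?y / q p))"
    have "complex_of_real (?y / q p) powr s = Y powr s * of_real (q p) powr (- s)"
    proof -
      have d: "?y / q p > 0" using y q0[OF p] by simp
      show ?thesis
        unfolding Y_def powr_of_pos_real[OF d] powr_of_pos_real[OF y] powr_of_pos_real[OF q0[OF p]] exp_add[symmetric]
        using y q0[OF p] by (simp add: ln_div algebra_simps)
    qed
    then have pm: "pair_matrix n \<tau> s p = X *m mat22 (1 / of_real (q p) + c\<^sup>2) (c * cnj j) (c * j) (of_real (q p))"
      by (simp add: pair_matrix_def Let_def X_def c_def j_def q_def a_def)
    have Gu: "G u p = X * u p" for u by (simp add: G_def X_def)
    have cj: "c * j = ud p + \<i> * Y * ub p" "c * cnj j = ud p - \<i> * Y * ub p"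
      by (simp_all add: ud_def ub_def Y_def c_def j_def complex_eq_iff power2_eq_square algebra_simps)
    show "fourier_matrix Y (G ua p) (G ub p) (G uc p) (G ud p) = pair_matrix n \<tau> s p"
      unfolding fourier_matrix_def pm Gu cj mscale_mat22
      by (intro mat22_eqI) (simp_all add: ua_def uc_def ub_def c_def algebra_simps)
  qed
  \<comment> \<open>The identity coset: here q = 1, and the summand is the leading constant term of
    the expansion.\<close>
  moreover have "pair_matrix n \<tau> s (0, 1) = (Y powr s * exp (a * Y)) *m mat 1"
    unfolding pair_matrix_def Let_def lattice_form_0_1 mat_1_eq_mat22 by (simp add: Y_def a_def)
  moreover have "(0, 1) \<notin> coprime_pairs" by (simp add: coprime_pairs_def)
  ultimately show ?thesis
    unfolding eisenstein_matrix_def Let_def a_def[symmetric] Y_def[symmetric] by (metis has_sum_insert)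
qed

text \<open>For complex-valued families summability is already absolute, so it suffices to pass to
  the four entries and back.\<close>

lemma norm_summable_on_mat22:
  fixes f :: "'b \<Rightarrow> complex^2^2"
  assumes "f summable_on S" shows "(\<lambda>p. norm (f p)) summable_on S"
proof -
  have "(\<lambda>p. norm (f p $ i $ j)) summable_on S" for i j
  proof -
    have bl: "bounded_linear (\<lambda>A :: complex^2^2. A $ i $ j)"
      by (intro bounded_linear_compose[OF bounded_linear_vec_nth bounded_linear_vec_nth])
    obtain A where "(f has_sum A) S" using assms by (auto simp: summable_on_def)
    from has_sum_bounded_linear[OF bl this] have "(\<lambda>p. f p $ i $ j) summable_on S"
      by (auto simp: summable_on_def o_def)
    then show ?thesis by (simp add: summable_on_iff_abs_summable_on_complex)
  qed
  then have "(\<lambda>p. \<Sum>i\<in>UNIV. \<Sum>j\<in>UNIV. norm (f p $ i $ j)) summable_on S"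
    unfolding sum_2 by (intro summable_on_add)
  then show ?thesis
  proof (rule summable_on_comparison_test)
    fix p
    have "norm (f p) \<le> (\<Sum>i\<in>UNIV. norm (f p $ i))"
      unfolding norm_vec_def by (rule L2_set_le_sum) simp
    also have "\<dots> \<le> (\<Sum>i\<in>UNIV. \<Sum>j\<in>UNIV. norm (f p $ i $ j))"
      unfolding norm_vec_def[where 'a = complex] by (intro sum_mono L2_set_le_sum) simp
    finally show "norm (f p) \<le> (\<Sum>i\<in>UNIV. \<Sum>j\<in>UNIV. norm (f p $ i $ j))" .
  qed simp
qed

lemma has_sum_conj_by_tau:
  fixes f :: "'b \<Rightarrow> complex^2^2"
  assumes "(f has_sum A) S" shows "((\<lambda>p. conj_by_tau \<tau> (f p)) has_sum conj_by_tau \<tau> A) S"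
proof -
  have e: "((\<lambda>p. f p $ i $ j) has_sum A $ i $ j) S" for i j
    using has_sum_bounded_linear[OF bounded_linear_compose[OF bounded_linear_vec_nth bounded_linear_vec_nth] assms, of i j]
    by (simp add: o_def)
  have c: "((\<lambda>p. conj_by_tau \<tau> (f p) $ 1 $ 1) has_sum conj_by_tau \<tau> A $ 1 $ 1) S"
    "((\<lambda>p. conj_by_tau \<tau> (f p) $ 1 $ 2) has_sum conj_by_tau \<tau> A $ 1 $ 2) S"
    "((\<lambda>p. conj_by_tau \<tau> (f p) $ 2 $ 1) has_sum conj_by_tau \<tau> A $ 2 $ 1) S"
    "((\<lambda>p. conj_by_tau \<tau> (f p) $ 2 $ 2) has_sum conj_by_tau \<tau> A $ 2 $ 2) S"
    using e[of 1 1] has_sum_add[OF e[of 1 2] has_sum_cmult_right[OF e[of 1 1], of "- cnj \<tau>"]]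
      has_sum_add[OF e[of 2 1] has_sum_cmult_right[OF e[of 1 1], of "- \<tau>"]]
      has_sum_add[OF has_sum_add[OF has_sum_add[OF e[of 2 2] has_sum_cmult_right[OF e[of 1 2], of "- \<tau>"]]
        has_sum_cmult_right[OF e[of 2 1], of "- cnj \<tau>"]] has_sum_cmult_right[OF e[of 1 1], of "\<tau> * cnj \<tau>"]]
    by (simp_all add: conj_by_tau_nth)
  from has_sum_mat22[OF c] show ?thesis by (simp only: mat22_collapse)
qed

section \<open>Cosets and summands of the Eisenstein series\<close>

lemma power_coeff_sums:
  fixes \<alpha> \<beta> :: complex
  shows "(\<lambda>k. \<alpha> ^ k / fact k) sums exp \<alpha>"
    and "(\<lambda>k. of_nat k * \<alpha> ^ (k - 1) * \<beta> / fact k) sums (\<beta> * exp \<alpha>)"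
proof -
  show 1: "(\<lambda>k. \<alpha> ^ k / fact k) sums exp \<alpha>"
    using exp_converges[of \<alpha>] by (simp add: scaleR_conv_of_real field_simps)
  have "of_nat (Suc k) * \<alpha> ^ (Suc k - 1) * \<beta> / fact (Suc k) = \<beta> * (\<alpha> ^ k / fact k)" for k
    by (simp add: field_simps del: of_nat_Suc)
  then have "(\<lambda>k. of_nat (Suc k) * \<alpha> ^ (Suc k - 1) * \<beta> / fact (Suc k)) sums (\<beta> * exp \<alpha>)"
    using sums_mult[OF 1, of \<beta>] by simp
  from sums_Suc[OF this] show "(\<lambda>k. of_nat k * \<alpha> ^ (k - 1) * \<beta> / fact k) sums (\<beta> * exp \<alpha>)" by simp
qed

lemma scaleR_mat22: "r *\<^sub>R mat22 a b c d = mat22 (r *\<^sub>R a) (r *\<^sub>R b) (r *\<^sub>R c) (r *\<^sub>R d :: 'a::real_vector)"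
  by (rule mat22_eqI) simp_all

text \<open>With b c = 0 the off-diagonal part squares to zero and commutes with the scalar part, so
  each power is linear in b and c. Both triangular shapes occur, for L and for its
  transpose.\<close>

lemma mat_e_triangular:
  fixes a b c :: complex
  assumes "b * c = 0"
  defines "E \<equiv> exp (2 * of_real pi * \<i> * a)"
  shows "mat_e (mat22 a b c a) = mat22 E (2 * of_real pi * \<i> * b * E) (2 * of_real pi * \<i> * c * E) E"
proof -
  define \<alpha> \<beta> \<gamma> where "\<alpha> = 2 * of_real pi * \<i> * a" and "\<beta> = 2 * of_real pi * \<i> * b" and "\<gamma> = 2 * of_real pi * \<i> * c"
  have bc: "\<beta> = 0 \<or> \<gamma> = 0" using assms by (auto simp: \<beta>_def \<gamma>_def)
  have M: "(2 * of_real pi * \<i>) *m mat22 a b c a = mat22 \<alpha> \<beta> \<gamma> \<alpha>"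
    unfolding mscale_mat22 \<alpha>_def \<beta>_def \<gamma>_def ..
  have pow: "((**) (mat22 \<alpha> \<beta> \<gamma> \<alpha>) ^^ k) (mat 1) =
      mat22 (\<alpha> ^ k) (of_nat k * \<alpha> ^ (k - 1) * \<beta>) (of_nat k * \<alpha> ^ (k - 1) * \<gamma>) (\<alpha> ^ k)" for k
  proof (induction k)
    case (Suc k)
    have "of_nat k * \<alpha> ^ (k - 1) * \<alpha> = of_nat k * \<alpha> ^ k" by (cases k) simp_all
    then show ?case unfolding funpow.simps o_apply Suc.IH mat22_mult
      using bc by (intro mat22_eqI) (auto simp: algebra_simps)
  qed (simp add: mat_1_eq_mat22)
  have "(\<lambda>k. (1 / fact k) *\<^sub>R ((**) (mat22 \<alpha> \<beta> \<gamma> \<alpha>) ^^ k) (mat 1)) =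
     (\<lambda>k. mat22 (\<alpha> ^ k / fact k) (of_nat k * \<alpha> ^ (k - 1) * \<beta> / fact k) (of_nat k * \<alpha> ^ (k - 1) * \<gamma> / fact k) (\<alpha> ^ k / fact k))"
    unfolding pow scaleR_mat22 by (intro ext mat22_eqI) (simp_all add: scaleR_conv_of_real)
  moreover have "\<dots> sums mat22 (exp \<alpha>) (\<beta> * exp \<alpha>) (\<gamma> * exp \<alpha>) (exp \<alpha>)"
    by (intro sums_mat22 power_coeff_sums)
  ultimately show ?thesis unfolding mat_e_def M by (simp add: sums_iff \<alpha>_def \<beta>_def \<gamma>_def E_def)
qed

lemma transpose_mat22: "transpose (mat22 a b c d) = mat22 a c b d"
  by (rule mat22_eqI) (simp_all add: transpose_def)

lemma mcnj_mat22: "mcnj (mat22 a b c d) = mat22 (cnj a) (cnj b) (cnj c) (cnj d)"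
  by (rule mat22_eqI) (simp_all add: map_matrix_def)

lemma mat_e_exponent_mat:
  "mat_e (z *m exponent_mat n) = exp (2 * of_real pi * \<i> * of_int n * z) *m mat22 1 z 0 1"
  "mat_e (z *m transpose (exponent_mat n)) = exp (2 * of_real pi * \<i> * of_int n * z) *m mat22 1 0 z 1"
  unfolding exponent_mat_def transpose_mat22 mscale_mat22 mult_zero_right
  by (subst mat_e_triangular; auto intro!: mat22_eqI simp: mult_ac)+

lemma incl_rep_eq: "incl_rep \<gamma> = mat22 (of_int (\<gamma> $ 1 $ 1)) (of_int (\<gamma> $ 1 $ 2)) (of_int (\<gamma> $ 2 $ 1)) (of_int (\<gamma> $ 2 $ 2))"
  by (rule mat22_eqI) (simp_all add: incl_rep_def map_matrix_def)

lemma choice_of_exponents_exponent_mat: "choice_of_exponents incl_rep (exponent_mat n)"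
proof -
  have "exp (2 * complex_of_real pi * \<i> * of_int n) = 1"
    by (rule exp_eq_1[THEN iffD2]) (auto intro!: exI[of _ n])
  then have "mat_e (1 *m exponent_mat n) = mat22 1 1 0 1"
    unfolding mat_e_exponent_mat mscale_mat22 by simp
  moreover have "1 *m exponent_mat n = exponent_mat n" by (rule mat22_eqI) (simp_all add: map_matrix_def)
  ultimately show ?thesis
    unfolding choice_of_exponents_def incl_rep_eq T_mat_def by simp
qed

lemma summable_mat22:
  fixes f :: "nat \<Rightarrow> complex^2^2"
  assumes "\<And>i j. summable (\<lambda>k. f k $ i $ j)" shows "summable f"
proof -
  note s = summable_sums[OF assms]
  from sums_mat22[OF s[of 1 1] s[of 1 2] s[of 2 1] s[of 2 2]] show ?thesis
    by (simp only: mat22_collapse sums_iff)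
qed

lemma mat22_eq_iff: "mat22 a b c d = mat22 a' b' c' d' \<longleftrightarrow> a = a' \<and> b = b' \<and> c = c' \<and> d = (d' :: 'a::zero)"
  by (metis mat22_nth)

lemma sums_mat_e:
  fixes L :: "complex^2^2"
  shows "(\<lambda>k. (1 / fact k) *\<^sub>R (((**) ((2 * of_real pi * \<i>) *m L)) ^^ k) (mat 1)) sums mat_e L"
proof -
  define M where "M = (2 * of_real pi * \<i>) *m L"
  define B where "B = norm (M $ 1 $ 1) + norm (M $ 1 $ 2) + norm (M $ 2 $ 1) + norm (M $ 2 $ 2)"
  have B: "norm (M $ i $ j) \<le> B" for i j
    using exhaust_2[of i] exhaust_2[of j] by (auto simp: B_def)
  have B0: "B \<ge> 0" by (simp add: B_def)
  have bd: "norm ((((**) M) ^^ k) (mat 1) $ i $ j) \<le> (2 * B) ^ k" for i j k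
  proof (induction k arbitrary: i j)
    case 0
    show ?case by (simp add: mat_def)
  next
    case (Suc k)
    have "(((**) M) ^^ Suc k) (mat 1) $ i $ j = M $ i $ 1 * (((**) M) ^^ k) (mat 1) $ 1 $ j + M $ i $ 2 * (((**) M) ^^ k) (mat 1) $ 2 $ j"
      by (simp add: matrix_matrix_mult_def sum_2)
    also have "norm \<dots> \<le> B * (2 * B) ^ k + B * (2 * B) ^ k"
      by (intro order_trans[OF norm_triangle_ineq add_mono]; unfold norm_mult; rule mult_mono[OF B Suc.IH B0 norm_ge_zero])
    finally show ?case by (simp add: mult_ac)
  qed
  have "summable (\<lambda>k. (1 / fact k) *\<^sub>R (((**) M) ^^ k) (mat 1) $ i $ j)" for i j
  proof (rule summable_comparison_test'[of _ 0])
    show "summable (\<lambda>k. inverse (fact k) * (2 * B) ^ k)" by (rule summable_exp)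
    fix k
    show "norm ((1 / fact k) *\<^sub>R (((**) M) ^^ k) (mat 1) $ i $ j) \<le> inverse (fact k) * (2 * B) ^ k"
      using bd[of k i j] by (simp add: divide_inverse mult_left_mono)
  qed
  then have "summable (\<lambda>k. (1 / fact k) *\<^sub>R (((**) M) ^^ k) (mat 1))"
    by (intro summable_mat22) simp
  then show ?thesis unfolding mat_e_def M_def[symmetric] by (rule summable_sums)
qed

text \<open>L commutes with every partial sum, and the commutator with L is a bounded linear map, so
  it vanishes on the limit too.\<close>

lemma mat_e_commute:
  fixes L :: "complex^2^2"
  shows "L ** mat_e L = mat_e L ** L"
proof -
  define M where "M = (2 * of_real pi * \<i>) *m L"
  have M: "L ** M = M ** L"
    unfolding M_def by (rule mat22_eqI) (simp_all add: matrix_matrix_mult_def map_matrix_def sum_2 algebra_simps)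
  have comm: "L ** (((**) M) ^^ k) (mat 1) = (((**) M) ^^ k) (mat 1) ** L" for k
  proof (induction k)
    case (Suc k)
    then show ?case by (simp add: matrix_mul_assoc M) (simp add: matrix_mul_assoc[symmetric])
  qed simp
  define f where "f = (\<lambda>A :: complex^2^2. L ** A - A ** L)"
  have "linear f"
  proof
    show "f (A + B) = f A + f B" for A B
      unfolding f_def by (rule mat22_eqI) (simp_all add: matrix_matrix_mult_def sum_2 algebra_simps)
    show "f (r *\<^sub>R A) = r *\<^sub>R f A" for r A
      unfolding f_def by (rule mat22_eqI) (simp_all add: matrix_matrix_mult_def sum_2 algebra_simps)
  qed
  then have bl: "bounded_linear f" by (simp add: linear_conv_bounded_linear)
  have f0: "f ((1 / fact k) *\<^sub>R (((**) M) ^^ k) (mat 1)) = 0" for k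
    using comm[of k] linear_scale[OF \<open>linear f\<close>] by (simp add: f_def)
  from bounded_linear.sums[OF bl sums_mat_e[of L]]
  have "(\<lambda>k. 0) sums f (mat_e L)" unfolding M_def[symmetric] f0 .
  then have "f (mat_e L) = 0" by (simp add: sums_iff)
  then show ?thesis by (simp add: f_def)
qed

text \<open>Commuting with T forces L to be upper triangular with equal diagonal entries. Then
  \<open>mat_e_triangular\<close> determines the corner and shows that the diagonal entry is an
  integer.\<close>

lemma choice_of_exponents_unique:
  assumes "choice_of_exponents incl_rep L"
  obtains n where "L = exponent_mat n"
proof -
  have e: "mat_e L = mat22 1 1 0 1"
    using assms unfolding choice_of_exponents_def incl_rep_eq T_mat_def by simp
  obtain a b c d where L: "L = mat22 a b c d" using mat22_collapse[of L] by metis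
  have "mat22 a b c d ** mat22 1 1 0 1 = mat22 1 1 0 1 ** mat22 a b c d"
    using mat_e_commute[of L] unfolding e unfolding L .
  note eq = this[unfolded mat22_mult]
  have c: "c = 0" using eq by (simp add: mat22_eq_iff)
  have d: "d = a" using eq by (simp add: mat22_eq_iff add.commute)
  have E: "mat22 1 1 0 1 = mat22 (exp (2 * of_real pi * \<i> * a)) (2 * of_real pi * \<i> * b * exp (2 * of_real pi * \<i> * a)) 0 (exp (2 * of_real pi * \<i> * a))"
    using mat_e_triangular[of b 0 a] e unfolding L c d by simp
  have ex: "exp (2 * of_real pi * \<i> * a) = 1" using E by (simp add: mat22_eq_iff)
  have "2 * of_real pi * \<i> * b = 1" using E ex by (simp add: mat22_eq_iff)
  then have b: "b = 1 / (2 * of_real pi * \<i>)" by (simp add: field_simps)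
  from ex obtain n :: int where "Re (2 * of_real pi * \<i> * a) = 0" "Im (2 * of_real pi * \<i> * a) = of_int (2 * n) * pi"
    unfolding exp_eq_1 by auto
  then have "a = of_int n" by (simp add: complex_eq_iff)
  then have "L = exponent_mat n" unfolding exponent_mat_def L c d b by simp
  then show ?thesis by (rule that)
qed

text \<open>For \<gamma> with rows (a, b) and (c, d), w the image of \<tau> and j = c \<tau> + d,
  the determinant gives a - c w = 1/j and b - d w = -\<tau>/j. This is how \<gamma> and the
  unipotent factor of the exponential combine into the unipotent matrix of \<tau>. The sign
  \<open>e\<close> enters each product twice and cancels, so only the pair p matters.\<close>

lemma eisenstein_summand_eq:
  fixes \<gamma> :: "int^2^2" and n :: int
  assumes \<tau>: "Im \<tau> > 0" and \<gamma>: "det \<gamma> = 1" and e: "e = 1 \<or> e = -1" and p: "p \<noteq> (0, 0)"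
    and c: "\<gamma> $ 2 $ 1 = e * int (fst p)" and d: "\<gamma> $ 2 $ 2 = e * snd p"
  shows "eisenstein_summand incl_rep (exponent_mat n) (mat 1) \<tau> s \<gamma> = conj_by_tau \<tau> (pair_matrix n \<tau> s p)"
proof -
  define a b where "a = complex_of_int (\<gamma> $ 1 $ 1)" and "b = complex_of_int (\<gamma> $ 1 $ 2)"
  define C D where "C = complex_of_nat (fst p)" and "D = complex_of_int (snd p)"
  define E where "E = complex_of_int e"
  have E2: "E * E = 1" using e by (auto simp: E_def)
  have EE: "E * (E * z) = z" for z using E2 by (simp add: mult.assoc[symmetric])
  define j where "j = C * \<tau> + D"
  define q where "q = complex_of_real (lattice_form (Re \<tau>) (Im \<tau>) p)"
  have C': "complex_of_int (\<gamma> $ 2 $ 1) = E * C" and D': "complex_of_int (\<gamma> $ 2 $ 2) = E * D"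
    by (simp_all add: c d E_def C_def D_def)
  have real: "cnj C = C" "cnj D = D" "cnj a = a" "cnj b = b" "cnj E = E"
    by (simp_all add: C_def D_def a_def b_def E_def)
  have qj: "q = j * cnj j"
    by (cases p) (simp add: q_def j_def C_def D_def lattice_form_def complex_eq_iff power2_eq_square algebra_simps)
  have j0: "j \<noteq> 0"
  proof
    assume "j = 0"
    then have "Im j = 0" "Re j = 0" by simp_all
    then have "fst p = 0" using \<tau> by (simp add: j_def C_def D_def)
    with \<open>Re j = 0\<close> have "snd p = 0" by (simp add: j_def C_def D_def)
    with p \<open>fst p = 0\<close> show False by (cases p) simp
  qed
  have dt: "E * (a * D - b * C) = 1"
  proof -
    have "\<gamma> $ 1 $ 1 * \<gamma> $ 2 $ 2 - \<gamma> $ 1 $ 2 * \<gamma> $ 2 $ 1 = 1" using \<gamma> by (simp add: det_2)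
    then have "complex_of_int (\<gamma> $ 1 $ 1 * \<gamma> $ 2 $ 2 - \<gamma> $ 1 $ 2 * \<gamma> $ 2 $ 1) = 1" by simp
    then show ?thesis by (simp add: C' D' a_def[symmetric] b_def[symmetric] algebra_simps)
  qed
  define w where "w = moebius_act \<gamma> \<tau>"
  have w: "w = (a * \<tau> + b) / (E * j)"
    unfolding w_def moebius_act_def C' D' a_def[symmetric] b_def[symmetric] by (simp add: j_def algebra_simps)
  have E0: "E \<noteq> 0" using E2 by auto
  have w1: "a - E * C * w = E / j"
  proof -
    have "a * (E * j) - E * C * (a * \<tau> + b) = 1" using dt by (simp add: j_def algebra_simps)
    then have "a * (E * j) - E * C * (a * \<tau> + b) = E * E" by (simp add: E2)
    then show ?thesis unfolding w using E0 j0 by (simp add: field_simps)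
  qed
  have w2: "b - E * D * w = - (E * \<tau> / j)"
  proof -
    have "b * (E * j) - E * D * (a * \<tau> + b) = - \<tau> * (E * (a * D - b * C))" by (simp add: j_def algebra_simps)
    then have "b * (E * j) - E * D * (a * \<tau> + b) = - (E * E * \<tau>)" by (simp add: dt E2)
    moreover have "b - E * D * w = (b * (E * j) - E * D * (a * \<tau> + b)) / (E * j)"
      unfolding w using E0 j0 by (simp add: diff_divide_distrib)
    ultimately show ?thesis using E0 j0 by simp
  qed
  have q0: "q \<noteq> 0" using j0 by (simp add: qj)
  have Imw: "Im w = Im \<tau> / lattice_form (Re \<tau>) (Im \<tau>) p"
  proof -
    have "w = (a * \<tau> + b) * cnj j * E / q"
      unfolding w qj using E0 j0 by (simp add: field_simps EE)
    then have "Im w = Im ((a * \<tau> + b) * cnj j * E / of_real (lattice_form (Re \<tau>) (Im \<tau>) p))"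
      unfolding q_def by (rule arg_cong)
    also have "\<dots> = Im ((a * \<tau> + b) * cnj j * E) / lattice_form (Re \<tau>) (Im \<tau>) p"
      by (rule Im_divide_of_real)
    also have "Im ((a * \<tau> + b) * cnj j * E) = Im \<tau> * Re (E * (a * D - b * C))"
      by (simp add: j_def real) (simp add: a_def b_def C_def D_def E_def algebra_simps)
    finally show ?thesis unfolding dt by simp
  qed
  \<comment> \<open>The scalar part of the exponential. Its squared modulus carries the whole
    dependence on n, as -2 pi i n w has real part 2 pi n Im w.\<close>
  define x where "x = exp (2 * of_real pi * \<i> * of_int n * - w)"
  have xx: "x * cnj x = exp (of_real (4 * pi * of_int n) * of_real (Im w))"
  proof -
    have "x * cnj x = exp (2 * of_real pi * \<i> * of_int n * - w + cnj (2 * of_real pi * \<i> * of_int n * - w))"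
      by (simp only: x_def exp_add exp_cnj)
    also have "2 * of_real pi * \<i> * of_int n * - w + cnj (2 * of_real pi * \<i> * of_int n * - w) = of_real (4 * pi * of_int n) * of_real (Im w)"
      by (simp add: complex_eq_iff)
    finally show ?thesis .
  qed
  define W where "W = complex_of_real (Im w) powr s"
  have "eisenstein_summand incl_rep (exponent_mat n) (mat 1) \<tau> s \<gamma> =
     W *m (mat22 a (E * C) b (E * D) ** (x *m mat22 1 0 (- w) 1) ** mat 1 ** mcnj (x *m mat22 1 (- w) 0 1) ** mcnj (mat22 a b (E * C) (E * D)))"
    unfolding eisenstein_summand_def Let_def w_def[symmetric] W_def[symmetric] mat_e_exponent_mat x_def[symmetric]
      incl_rep_eq C' D' a_def[symmetric] b_def[symmetric] transpose_mat22 ..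
  also have "mat22 a (E * C) b (E * D) ** (x *m mat22 1 0 (- w) 1) = x *m mat22 (E / j) (E * C) (- (E * \<tau> / j)) (E * D)"
    unfolding mscale_mat22 mat22_mult w1[symmetric] w2[symmetric] by (rule mat22_eqI) (simp_all add: algebra_simps)
  also have "\<dots> ** mat 1 = \<dots>" by simp
  also have "x *m mat22 (E / j) (E * C) (- (E * \<tau> / j)) (E * D) ** mcnj (x *m mat22 1 (- w) 0 1) ** mcnj (mat22 a b (E * C) (E * D)) =
    x *m mat22 (E / j) (E * C) (- (E * \<tau> / j)) (E * D) ** (mcnj (x *m mat22 1 (- w) 0 1) ** mcnj (mat22 a b (E * C) (E * D)))"
    by (simp add: matrix_mul_assoc)
  also have "mcnj (x *m mat22 1 (- w) 0 1) ** mcnj (mat22 a b (E * C) (E * D)) =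
    cnj x *m mat22 (cnj (E / j)) (cnj (- (E * \<tau> / j))) (E * C) (E * D)"
    unfolding mscale_mat22 mcnj_mat22 mat22_mult w1[symmetric] w2[symmetric]
    by (rule mat22_eqI) (simp_all add: algebra_simps real)
  also have "x *m mat22 (E / j) (E * C) (- (E * \<tau> / j)) (E * D) ** cnj x *m mat22 (cnj (E / j)) (cnj (- (E * \<tau> / j))) (E * C) (E * D) =
     (x * cnj x) *m mat22 (1 / q + C\<^sup>2) (C * D - cnj \<tau> / q) (C * D - \<tau> / q) (\<tau> * cnj \<tau> / q + D\<^sup>2)"
  proof -
    show ?thesis
      unfolding mscale_mat22 mat22_mult qj
      by (rule mat22_eqI) (simp_all add: real EE power2_eq_square algebra_simps)
  qed
  also have "W *m (x * cnj x) *m mat22 (1 / q + C\<^sup>2) (C * D - cnj \<tau> / q) (C * D - \<tau> / q) (\<tau> * cnj \<tau> / q + D\<^sup>2) =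
    (W * (x * cnj x)) *m conj_by_tau \<tau> (mat22 (1 / q + C\<^sup>2) (C * cnj j) (C * j) q)"
    unfolding conj_by_tau_mat22 mscale_mat22
    by (rule mat22_eqI) (simp_all add: qj j_def real power2_eq_square algebra_simps)
  also have "\<dots> = conj_by_tau \<tau> ((W * (x * cnj x)) *m mat22 (1 / q + C\<^sup>2) (C * cnj j) (C * j) q)"
    unfolding conj_by_tau_mat22 mscale_mat22 by (rule mat22_eqI) (simp_all add: algebra_simps)
  also have "(W * (x * cnj x)) *m mat22 (1 / q + C\<^sup>2) (C * cnj j) (C * j) q = pair_matrix n \<tau> s p"
    unfolding pair_matrix_def Let_def xx W_def Imw q_def j_def C_def D_def ..
  finally show ?thesis .
qed

section \<open>Cosets of the subgroup generated by T and -I\<close>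

lemma det_mat22: "det (mat22 a b c d) = a * d - b * (c :: 'a::comm_ring_1)"
  by (simp add: det_2)

lemma mat22_cases:
  fixes A :: "'a::zero^2^2"
  obtains a b c d where "A = mat22 a b c d"
  by (metis mat22_collapse)

lemma carrier_SL2Z: "mat22 a b c d \<in> carrier SL2Z \<longleftrightarrow> a * d - b * c = 1"
  by (simp add: SL2Z_def det_mat22)

lemma mult_SL2Z: "A \<otimes>\<^bsub>SL2Z\<^esub> B = A ** B"
  by (simp add: SL2Z_def)

lemma one_SL2Z: "\<one>\<^bsub>SL2Z\<^esub> = mat22 1 0 0 1"
  by (simp add: SL2Z_def mat_1_eq_mat22)

lemma group_SL2Z: "group SL2Z"
proof (rule groupI)
  show "\<one>\<^bsub>SL2Z\<^esub> \<in> carrier SL2Z" by (simp add: one_SL2Z carrier_SL2Z)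
  fix A assume A: "A \<in> carrier SL2Z"
  show "\<one>\<^bsub>SL2Z\<^esub> \<otimes>\<^bsub>SL2Z\<^esub> A = A" by (simp add: SL2Z_def)
  show "A \<otimes>\<^bsub>SL2Z\<^esub> B \<otimes>\<^bsub>SL2Z\<^esub> C = A \<otimes>\<^bsub>SL2Z\<^esub> (B \<otimes>\<^bsub>SL2Z\<^esub> C)" for B C
    by (simp add: SL2Z_def matrix_mul_assoc)
  show "A \<otimes>\<^bsub>SL2Z\<^esub> B \<in> carrier SL2Z" if "B \<in> carrier SL2Z" for B
    using A that by (simp add: SL2Z_def det_mul)
  obtain a b c d where [simp]: "A = mat22 a b c d" by (rule mat22_cases)
  have "a * d - b * c = 1" using A by (simp add: carrier_SL2Z)
  then show "\<exists>B\<in>carrier SL2Z. B \<otimes>\<^bsub>SL2Z\<^esub> A = \<one>\<^bsub>SL2Z\<^esub>"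
    by (intro bexI[of _ "mat22 d (- b) (- c) a"])
       (simp_all add: carrier_SL2Z mult_SL2Z one_SL2Z mat22_mult mat22_eq_iff algebra_simps)
qed

lemma inv_SL2Z:
  assumes "a * d - b * c = 1" shows "inv\<^bsub>SL2Z\<^esub> (mat22 a b c d) = mat22 d (- b) (- c) a"
  by (rule group.inv_equality[OF group_SL2Z])
     (use assms in \<open>simp_all add: carrier_SL2Z mult_SL2Z one_SL2Z mat22_mult mat22_eq_iff algebra_simps\<close>)

lemma pm_T_eq: "pm_T = {mat22 e j 0 e | e j. e = 1 \<or> e = -1}"
proof (intro equalityI subsetI)
  have neg: "- mat 1 = mat22 (-1) 0 0 (-1 :: int)"
    unfolding mat_1_eq_mat22 by (rule mat22_eqI) simp_all
  fix A assume "A \<in> pm_T"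
  then show "A \<in> {mat22 e j 0 e | e j. e = 1 \<or> e = -1}"
    unfolding pm_T_def
  proof (induction rule: generate.induct)
    case one
    show ?case unfolding one_SL2Z by blast
  next
    case (incl h)
    then show ?case unfolding T_mat_def neg by blast
  next
    case (inv h)
    then have "h = mat22 1 1 0 1 \<or> h = mat22 (-1) 0 0 (-1)" unfolding T_mat_def neg by blast
    then have "inv\<^bsub>SL2Z\<^esub> h = mat22 1 (-1) 0 1 \<or> inv\<^bsub>SL2Z\<^esub> h = mat22 (-1) 0 0 (-1)"
      by (auto simp: inv_SL2Z)
    then show ?case by blast
  next
    case (eng h1 h2)
    then obtain e j e' j' where "h1 = mat22 e j 0 e" "h2 = mat22 e' j' 0 e'" "e = 1 \<or> e = -1" "e' = 1 \<or> e' = -1"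
      by blast
    then have "h1 \<otimes>\<^bsub>SL2Z\<^esub> h2 = mat22 (e * e') (e * j' + j * e') 0 (e * e') \<and> (e * e' = 1 \<or> e * e' = -1)"
      by (auto simp: mult_SL2Z mat22_mult)
    then show ?case by blast
  qed
next
  have neg: "- mat 1 = mat22 (-1) 0 0 (-1 :: int)"
    unfolding mat_1_eq_mat22 by (rule mat22_eqI) simp_all
  have T: "mat22 1 1 0 1 \<in> pm_T" "mat22 (-1) 0 0 (-1) \<in> pm_T"
    unfolding pm_T_def T_mat_def neg by (auto intro: generate.incl)
  have "inv\<^bsub>SL2Z\<^esub> (mat22 1 1 0 1) \<in> pm_T"
    unfolding pm_T_def T_mat_def by (rule generate.inv) simp
  then have T': "mat22 1 (-1) 0 1 \<in> pm_T" by (simp add: inv_SL2Z)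
  have mult: "A ** B \<in> pm_T" if "A \<in> pm_T" "B \<in> pm_T" for A B
    using generate.eng[of A SL2Z _ B] that by (simp add: pm_T_def mult_SL2Z)
  have 1: "mat22 1 (int k) 0 1 \<in> pm_T \<and> mat22 1 (- int k) 0 1 \<in> pm_T" for k
  proof (induction k)
    case 0
    show ?case using generate.one[of SL2Z] by (simp add: pm_T_def one_SL2Z)
  next
    case (Suc k)
    then have "mat22 1 (int k) 0 1 ** mat22 1 1 0 1 \<in> pm_T" "mat22 1 (- int k) 0 1 ** mat22 1 (-1) 0 1 \<in> pm_T"
      using T T' by (auto intro: mult)
    then show ?case by (simp add: mat22_mult algebra_simps)
  qed
  have Tj: "mat22 1 j 0 1 \<in> pm_T" for j :: int
    using 1[of "nat j"] 1[of "nat (- j)"] by (cases "j \<ge> 0") auto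
  fix A assume "A \<in> {mat22 e j 0 e | e j. e = 1 \<or> e = (-1 :: int)}"
  then obtain e j where A: "A = mat22 e j 0 e" "e = 1 \<or> e = -1" by blast
  show "A \<in> pm_T"
  proof (cases "e = 1")
    case False
    then have "A = mat22 (-1) 0 0 (-1) ** mat22 1 (- j) 0 1" using A by (simp add: mat22_mult)
    then show ?thesis using mult[OF T(2) Tj] by simp
  qed (use A Tj in simp)
qed

text \<open>Left multiplication by T keeps the bottom row and -I changes its sign; the set turns out
  to be exactly one coset.\<close>

definition row_class :: "nat \<times> int \<Rightarrow> (int^2^2) set" where
  "row_class p = {\<gamma> \<in> carrier SL2Z. \<exists>e. (e = 1 \<or> e = -1) \<and> \<gamma> $ 2 $ 1 = e * int (fst p) \<and> \<gamma> $ 2 $ 2 = e * snd p}"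

lemma mat22_in_row_class:
  "mat22 a b c d \<in> row_class p \<longleftrightarrow> a * d - b * c = 1 \<and> (\<exists>e. (e = 1 \<or> e = -1) \<and> c = e * int (fst p) \<and> d = e * snd p)"
  by (auto simp: row_class_def carrier_SL2Z)

lemma row_class_eq_coset:
  assumes "\<gamma> \<in> row_class p" shows "row_class p = pm_T #>\<^bsub>SL2Z\<^esub> \<gamma>"
proof -
  obtain a b c d where \<gamma>: "\<gamma> = mat22 a b c d" by (rule mat22_cases)
  obtain e where e: "e = 1 \<or> e = -1" and c: "c = e * int (fst p)" and d: "d = e * snd p" and det: "a * d - b * c = 1"
    using assms unfolding \<gamma> mat22_in_row_class by blast
  have ee: "e * e = 1" using e by auto
  show ?thesis
  proof (intro equalityI subsetI)
    fix A assume A: "A \<in> row_class p"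
    obtain a' b' c' d' where A': "A = mat22 a' b' c' d'" by (rule mat22_cases)
    obtain e' where e': "e' = 1 \<or> e' = -1" and c': "c' = e' * int (fst p)" and d': "d' = e' * snd p" and det': "a' * d' - b' * c' = 1"
      using A unfolding A' mat22_in_row_class by blast
    define E where "E = e * e'"
    have E: "E = 1 \<or> E = -1" using e e' by (auto simp: E_def)
    have cE: "c' = E * c" and dE: "d' = E * d"
      using e e' unfolding c c' d d' E_def by auto
    have EE: "E * E = 1" using E by auto
    have "E * (a' * d - b' * c) = 1" using det' unfolding cE dE by (simp add: algebra_simps)
    then have adE: "a' * d - b' * c = E" using E by auto
    \<comment> \<open>\<open>E\<close> and \<open>j\<close> are the upper entries of A times the
      inverse of \<gamma>.\<close>
    define j where "j = b' * a - a' * b"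
    have "E * a + j * c = (a' * d - b' * c) * a + (b' * a - a' * b) * c" by (simp add: adE j_def)
    also have "\<dots> = a' * (a * d - b * c)" by (simp add: algebra_simps)
    finally have 1: "E * a + j * c = a'" by (simp add: det)
    have "E * b + j * d = (a' * d - b' * c) * b + (b' * a - a' * b) * d" by (simp add: adE j_def)
    also have "\<dots> = b' * (a * d - b * c)" by (simp add: algebra_simps)
    finally have 2: "E * b + j * d = b'" by (simp add: det)
    have "A = mat22 E j 0 E \<otimes>\<^bsub>SL2Z\<^esub> \<gamma>"
      unfolding A' \<gamma> mult_SL2Z mat22_mult by (simp add: 1 2 cE dE)
    moreover have "mat22 E j 0 E \<in> pm_T" unfolding pm_T_eq using E by blast
    ultimately show "A \<in> pm_T #>\<^bsub>SL2Z\<^esub> \<gamma>" unfolding r_coset_def by blast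
  next
    fix A assume "A \<in> pm_T #>\<^bsub>SL2Z\<^esub> \<gamma>"
    then obtain E j where E: "E = 1 \<or> E = -1" and A: "A = mat22 E j 0 E ** mat22 a b c d"
      unfolding r_coset_def pm_T_eq \<gamma> mult_SL2Z by blast
    have EE: "E * (E * z) = z" for z using E by auto
    have "(E * a + j * c) * (E * d) - (E * b + j * d) * (E * c) = E * E * (a * d - b * c)" by (simp add: algebra_simps)
    then have "(E * a + j * c) * (E * d) - (E * b + j * d) * (E * c) = 1" using E det by auto
    moreover have "(E * e = 1 \<or> E * e = -1) \<and> E * c = E * e * int (fst p) \<and> E * d = E * e * snd p"
      using E e by (auto simp: c d)
    ultimately show "A \<in> row_class p" unfolding A mat22_mult mat22_in_row_class
      by (simp only: mult_zero_left add_0_left) blast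
  qed
qed

lemma row_class_nonempty:
  assumes "coprime (int (fst p)) (snd p)"
  obtains \<gamma> where "\<gamma> \<in> row_class p"
proof -
  obtain u v where uv: "u * int (fst p) + v * snd p = 1"
    using bezout_int[of "int (fst p)" "snd p"] assms by (auto simp: coprime_iff_gcd_eq_1)
  have "mat22 v (- u) (int (fst p)) (snd p) \<in> row_class p"
    unfolding mat22_in_row_class using uv by (auto intro!: exI[of _ 1] simp: algebra_simps)
  then show ?thesis by (rule that)
qed

lemma coprime_bottom_row:
  assumes "a * d - b * c = (1 :: int)" shows "coprime c d"
proof (rule coprimeI)
  fix g assume "g dvd c" "g dvd d"
  then have "g dvd a * d - b * c" by (intro dvd_diff dvd_mult)
  then show "is_unit g" using assms by simp
qed

lemma bij_betw_row_class: "bij_betw row_class (insert (0, 1) coprime_pairs) (rcosets\<^bsub>SL2Z\<^esub> pm_T)"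
  unfolding bij_betw_def
proof (rule conjI)
  have cop: "coprime (int (fst p)) (snd p)" if "p \<in> insert (0, 1) coprime_pairs" for p
    using that by (auto simp: coprime_pairs_def)
  show "inj_on row_class (insert (0, 1) coprime_pairs)"
  proof (rule inj_onI)
    fix p p' assume p: "p \<in> insert (0, 1) coprime_pairs" and p': "p' \<in> insert (0, 1) coprime_pairs"
      and eq: "row_class p = row_class p'"
    obtain \<gamma> where \<gamma>: "\<gamma> \<in> row_class p" using row_class_nonempty[OF cop[OF p]] .
    with eq have \<gamma>': "\<gamma> \<in> row_class p'" by simp
    obtain a b c d where g: "\<gamma> = mat22 a b c d" by (rule mat22_cases)
    obtain e where e: "e = 1 \<or> e = -1" "c = e * int (fst p)" "d = e * snd p"
      using \<gamma> unfolding g mat22_in_row_class by blast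
    obtain e' where e': "e' = 1 \<or> e' = -1" "c = e' * int (fst p')" "d = e' * snd p'"
      using \<gamma>' unfolding g mat22_in_row_class by blast
    have f: "fst p = fst p'" using e e' by auto
    show "p = p'"
    proof (cases "fst p = 0")
      case True
      then have "p = (0, 1)" "p' = (0, 1)" using p p' f by (auto simp: coprime_pairs_def)
      then show ?thesis by simp
    next
      case False
      then have "e = e'" using e e' f by auto
      then have "snd p = snd p'" using e e' by auto
      with f show ?thesis by (rule prod_eqI)
    qed
  qed
  show "row_class ` insert (0, 1) coprime_pairs = rcosets\<^bsub>SL2Z\<^esub> pm_T"
  proof (intro equalityI subsetI)
    fix S assume "S \<in> row_class ` insert (0, 1) coprime_pairs"
    then obtain p where p: "p \<in> insert (0, 1) coprime_pairs" "S = row_class p" by blast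
    obtain \<gamma> where \<gamma>: "\<gamma> \<in> row_class p" using row_class_nonempty[OF cop[OF p(1)]] .
    then have "\<gamma> \<in> carrier SL2Z" by (simp add: row_class_def)
    then show "S \<in> rcosets\<^bsub>SL2Z\<^esub> pm_T"
      unfolding p row_class_eq_coset[OF \<gamma>] RCOSETS_def by blast
  next
    fix S assume "S \<in> rcosets\<^bsub>SL2Z\<^esub> pm_T"
    then obtain \<gamma> where \<gamma>: "\<gamma> \<in> carrier SL2Z" "S = pm_T #>\<^bsub>SL2Z\<^esub> \<gamma>" unfolding RCOSETS_def by blast
    obtain a b c d where g: "\<gamma> = mat22 a b c d" by (rule mat22_cases)
    have det: "a * d - b * c = 1" using \<gamma>(1) by (simp add: g carrier_SL2Z)
    have cd: "coprime c d" by (rule coprime_bottom_row[OF det])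
    \<comment> \<open>The sign is normalised so that the bottom row has c > 0, or c = 0 and d =
      1.\<close>
    define e where "e = (if c > 0 \<or> c = 0 \<and> d > 0 then 1 else -1 :: int)"
    define p where "p = (nat \<bar>c\<bar>, e * d)"
    have e: "e = 1 \<or> e = -1" by (simp add: e_def)
    have "\<gamma> \<in> row_class p"
      unfolding g mat22_in_row_class using det e by (intro conjI exI[of _ e]) (auto simp: p_def e_def)
    then have S: "S = row_class p" using row_class_eq_coset \<gamma>(2) by simp
    have "p \<in> insert (0, 1) coprime_pairs"
    proof (cases "c = 0")
      case True
      then have "\<bar>d\<bar> = 1" using cd by simp
      then have "p = (0, 1)" using True by (auto simp: p_def e_def)
      then show ?thesis by simp
    next
      case False
      then have "p \<in> coprime_pairs" using cd e by (auto simp: coprime_pairs_def p_def)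
      then show ?thesis by simp
    qed
    with S show "S \<in> row_class ` insert (0, 1) coprime_pairs" by blast
  qed
qed

text \<open>By \<open>eisenstein_summand_eq\<close> the summand is the same for all representatives
  of a coset, so whichever matrix \<open>SOME\<close> picks will do.\<close>

lemma has_sum_eisenstein:
  fixes n :: int
  assumes \<tau>: "Im \<tau> > 0" and s: "Re s > 2"
  shows "(eisenstein_coset_term incl_rep (exponent_mat n) (mat 1) \<tau> s has_sum conj_by_tau \<tau> (eisenstein_matrix n \<tau> s))
     (rcosets\<^bsub>SL2Z\<^esub> pm_T)"
proof -
  have eq: "eisenstein_coset_term incl_rep (exponent_mat n) (mat 1) \<tau> s (row_class p) = conj_by_tau \<tau> (pair_matrix n \<tau> s p)"
    if p: "p \<in> insert (0, 1) coprime_pairs" for p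
  proof -
    define \<gamma> where "\<gamma> = (SOME \<gamma>. \<gamma> \<in> row_class p)"
    have "coprime (int (fst p)) (snd p)" using p by (auto simp: coprime_pairs_def)
    then obtain \<gamma>0 where "\<gamma>0 \<in> row_class p" by (rule row_class_nonempty)
    then have "\<gamma> \<in> row_class p" unfolding \<gamma>_def by (rule someI)
    then obtain e where "det \<gamma> = 1" "e = 1 \<or> e = -1" "\<gamma> $ 2 $ 1 = e * int (fst p)" "\<gamma> $ 2 $ 2 = e * snd p"
      by (auto simp: row_class_def SL2Z_def)
    moreover have "p \<noteq> (0, 0)" using p by (auto simp: coprime_pairs_def)
    ultimately show ?thesis
      unfolding eisenstein_coset_term_def \<gamma>_def[symmetric] by (intro eisenstein_summand_eq[OF \<tau>])
  qed
  have "((\<lambda>p. conj_by_tau \<tau> (pair_matrix n \<tau> s p)) has_sum conj_by_tau \<tau> (eisenstein_matrix n \<tau> s)) (insert (0, 1) coprime_pairs)"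
    by (rule has_sum_conj_by_tau[OF has_sum_pair_matrix[OF \<tau> s]])
  then have "((\<lambda>p. eisenstein_coset_term incl_rep (exponent_mat n) (mat 1) \<tau> s (row_class p)) has_sum conj_by_tau \<tau> (eisenstein_matrix n \<tau> s)) (insert (0, 1) coprime_pairs)"
    by (rule has_sum_cong[THEN iffD1, rotated]) (simp add: eq)
  then show ?thesis by (subst (asm) has_sum_reindex_bij_betw[OF bij_betw_row_class])
qed

section \<open>The harmonic metric\<close>

definition has_partials :: "(complex \<Rightarrow> complex^2^2) \<Rightarrow> complex^2^2 \<Rightarrow> complex^2^2 \<Rightarrow> complex \<Rightarrow> bool" where
  "has_partials f A B \<tau> \<longleftrightarrow> (f has_derivative (\<lambda>v. Re v *\<^sub>R A + Im v *\<^sub>R B)) (at \<tau>)"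

definition laurent_mono :: "nat \<Rightarrow> int \<Rightarrow> complex \<Rightarrow> real" where
  "laurent_mono a b \<tau> = Re \<tau> ^ a * Im \<tau> powi b"

text \<open>For a = 0 the truncated exponent a - 1 is harmless, since the factor
  \<open>real a\<close> vanishes.\<close>

lemma has_partials_mono:
  assumes "Im \<tau> > 0"
  shows "has_partials (\<lambda>\<tau>. laurent_mono a b \<tau> *\<^sub>R A)
     (laurent_mono (a - 1) b \<tau> *\<^sub>R (real a *\<^sub>R A)) (laurent_mono a (b - 1) \<tau> *\<^sub>R (of_int b *\<^sub>R A)) \<tau>"
proof -
  have i: "Im \<tau> \<noteq> 0" using assms by simp
  have "((\<lambda>\<tau>. Im \<tau> powi b) has_derivative (\<lambda>v. Im v *\<^sub>R (of_int b * Im \<tau> powi (b - 1)))) (at \<tau>)"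
  proof -
    have "((\<lambda>t. t powi b) has_field_derivative (of_int b * Im \<tau> powi (b - 1) * 1)) (at (Im \<tau>))"
      by (rule DERIV_power_int[OF DERIV_ident]) (use i in simp)
    from has_derivative_compose[OF bounded_linear_imp_has_derivative[OF bounded_linear_Im] this[unfolded has_field_derivative_def]]
    show ?thesis by (simp add: mult_ac)
  qed
  moreover have "((\<lambda>\<tau>. Re \<tau> ^ a) has_derivative (\<lambda>v. Re v *\<^sub>R (real a * Re \<tau> ^ (a - 1)))) (at \<tau>)"
  proof -
    have "((\<lambda>t. t ^ a) has_field_derivative (real a * (1 * Re \<tau> ^ (a - 1)))) (at (Re \<tau>))"
      using DERIV_power[OF DERIV_ident, of a "Re \<tau>" UNIV] by simp
    from has_derivative_compose[OF bounded_linear_imp_has_derivative[OF bounded_linear_Re] this[unfolded has_field_derivative_def]]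
    show ?thesis by (simp add: mult_ac)
  qed
  ultimately have "((\<lambda>\<tau>. Re \<tau> ^ a * Im \<tau> powi b) has_derivative
      (\<lambda>v. Re \<tau> ^ a * (Im v *\<^sub>R (of_int b * Im \<tau> powi (b - 1))) + (Re v *\<^sub>R (real a * Re \<tau> ^ (a - 1))) * Im \<tau> powi b)) (at \<tau>)"
    by (rule has_derivative_mult[rotated])
  then have "((\<lambda>\<tau>. (Re \<tau> ^ a * Im \<tau> powi b) *\<^sub>R A) has_derivative
      (\<lambda>v. (Re \<tau> ^ a * (Im v *\<^sub>R (of_int b * Im \<tau> powi (b - 1))) + (Re v *\<^sub>R (real a * Re \<tau> ^ (a - 1))) * Im \<tau> powi b) *\<^sub>R A)) (at \<tau>)"
    by (rule has_derivative_scaleR_left)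
  then show ?thesis
    unfolding has_partials_def laurent_mono_def
    by (rule has_derivative_eq_rhs) (simp add: fun_eq_iff scaleR_add_left mult_ac)
qed

lemma has_partials_add:
  assumes "has_partials f A B \<tau>" "has_partials g A' B' \<tau>"
  shows "has_partials (\<lambda>\<tau>. f \<tau> + g \<tau>) (A + A') (B + B') \<tau>"
  using has_derivative_add[OF assms[unfolded has_partials_def]] unfolding has_partials_def
  by (rule has_derivative_eq_rhs) (simp add: fun_eq_iff scaleR_add_right)

lemma has_partials_cong:
  assumes "has_partials f A B \<tau>" "Im \<tau> > 0" "\<And>z. Im z > 0 \<Longrightarrow> g z = f z"
  shows "has_partials g A B \<tau>"
  using assms(1) unfolding has_partials_def
  by (rule has_derivative_transform_within_open[OF _ open_halfspace_Im_gt[of 0]]) (use assms in auto)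

lemma has_partials_imp:
  assumes "has_partials f A B \<tau>"
  shows "f differentiable (at \<tau>)" "dx f \<tau> = A" "dy f \<tau> = B"
proof -
  note d = assms[unfolded has_partials_def]
  show "f differentiable (at \<tau>)" using d by (rule differentiableI)
  show "dx f \<tau> = A" "dy f \<tau> = B" unfolding dx_def dy_def frechet_derivative_at[OF d, symmetric] by simp_all
qed

text \<open>Matrix combinations of x^a y^b with integral b are closed under both partial derivatives
  on the upper half-plane, so smoothness of every order follows by induction. The metric and its
  logarithmic derivatives are of this form.\<close>

inductive laurent_mat :: "(complex \<Rightarrow> complex^2^2) \<Rightarrow> bool" where
  mono: "laurent_mat (\<lambda>\<tau>. laurent_mono a b \<tau> *\<^sub>R A)"
| add: "laurent_mat f \<Longrightarrow> laurent_mat g \<Longrightarrow> laurent_mat (\<lambda>\<tau>. f \<tau> + g \<tau>)"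

lemma laurent_mat_partials:
  assumes "laurent_mat f"
  obtains g h where "laurent_mat g" "laurent_mat h" "\<And>\<tau>. Im \<tau> > 0 \<Longrightarrow> has_partials f (g \<tau>) (h \<tau>) \<tau>"
proof -
  have "\<exists>g h. laurent_mat g \<and> laurent_mat h \<and> (\<forall>\<tau>. Im \<tau> > 0 \<longrightarrow> has_partials f (g \<tau>) (h \<tau>) \<tau>)"
    using assms
  proof induction
    case (mono a b A)
    show ?case by (intro exI conjI allI impI) (rule laurent_mat.mono has_partials_mono; assumption?)+
  next
    case (add f f')
    then obtain g h g' h' where "laurent_mat g" "laurent_mat h" "laurent_mat g'" "laurent_mat h'"
      "\<And>\<tau>. Im \<tau> > 0 \<Longrightarrow> has_partials f (g \<tau>) (h \<tau>) \<tau>" "\<And>\<tau>. Im \<tau> > 0 \<Longrightarrow> has_partials f' (g' \<tau>) (h' \<tau>) \<tau>" by blast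
    then show ?case
      by (intro exI[of _ "\<lambda>\<tau>. g \<tau> + g' \<tau>"] exI[of _ "\<lambda>\<tau>. h \<tau> + h' \<tau>"] conjI allI impI has_partials_add laurent_mat.add)
  qed
  then show ?thesis using that by blast
qed

lemma k_smooth_on_laurent:
  assumes "laurent_mat f" "\<And>\<tau>. Im \<tau> > 0 \<Longrightarrow> F \<tau> = f \<tau>"
  shows "k_smooth_on k \<H> F"
  using assms
proof (induction k arbitrary: f F)
  case (0 f F)
  obtain g h where "\<And>\<tau>. Im \<tau> > 0 \<Longrightarrow> has_partials f (g \<tau>) (h \<tau>) \<tau>"
    using laurent_mat_partials[OF 0(1)] by metis
  then have "has_partials F (g \<tau>) (h \<tau>) \<tau>" if "Im \<tau> > 0" for \<tau> using has_partials_cong 0(2) that by blast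
  then have "isCont F \<tau>" if "Im \<tau> > 0" for \<tau>
    using has_partials_imp(1) that by (blast intro: differentiable_imp_continuous_within)
  then show ?case by (auto simp: upper_half_plane_def intro!: continuous_at_imp_continuous_on)
next
  case (Suc k f F)
  obtain g h where gh: "laurent_mat g" "laurent_mat h" "\<And>\<tau>. Im \<tau> > 0 \<Longrightarrow> has_partials f (g \<tau>) (h \<tau>) \<tau>"
    using laurent_mat_partials[OF Suc.prems(1)] by metis
  then have p: "has_partials F (g \<tau>) (h \<tau>) \<tau>" if "Im \<tau> > 0" for \<tau> using has_partials_cong Suc.prems(2) that by blast
  have "F differentiable_on \<H>"
    using has_partials_imp(1)[OF p] by (auto simp: upper_half_plane_def intro!: differentiable_at_imp_differentiable_on)
  then show ?case
    using Suc.IH[OF gh(1)] Suc.IH[OF gh(2)] has_partials_imp(2,3)[OF p] by simp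
qed

section \<open>Positivity, invariance, harmonicity and growth of K\<close>

lemma scaled_K_metric_eq:
  "of_real c *m K_metric \<tau> = mat22 (of_real (c / Im \<tau>)) (of_real (- c * Re \<tau> / Im \<tau>)) (of_real (- c * Re \<tau> / Im \<tau>))
   (of_real (c * ((Re \<tau>)\<^sup>2 + (Im \<tau>)\<^sup>2) / Im \<tau>))"
  unfolding K_metric_def Let_def mscale_mat22 by (rule mat22_eqI) simp_all

lemma pos_def_scaled_K_metric:
  assumes c: "c > 0" and y: "Im \<tau> > 0"
  shows "pos_def_mat (of_real c *m K_metric \<tau>)"
  unfolding pos_def_mat_def hermitian_mat_def scaled_K_metric_eq
proof (intro conjI allI impI)
  let ?M = "mat22 (complex_of_real (c / Im \<tau>)) (of_real (- c * Re \<tau> / Im \<tau>)) (of_real (- c * Re \<tau> / Im \<tau>))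
   (of_real (c * ((Re \<tau>)\<^sup>2 + (Im \<tau>)\<^sup>2) / Im \<tau>))"
  show "transpose (?M) = mcnj (?M)"
    unfolding transpose_mat22 mcnj_mat22 by simp
  fix v :: "complex^2" assume v: "v \<noteq> 0"
  obtain a b where a: "v $ 1 = Complex a b" by (cases "v $ 1")
  obtain d e where d: "v $ 2 = Complex d e" by (cases "v $ 2")
  define x y where "x = Re \<tau>" and "y = Im \<tau>"
  have y': "y > 0" using y by (simp add: y_def)
  have ne: "a \<noteq> 0 \<or> b \<noteq> 0 \<or> d \<noteq> 0 \<or> e \<noteq> 0"
    using v a d by (auto simp: vec_eq_iff forall_2 complex_eq_iff)
  \<comment> \<open>Completing the square: the Hermitian form is c/y times |v1 - x v2|^2 + y^2
    |v2|^2.\<close>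
  have "(a - x * d)\<^sup>2 + (b - x * e)\<^sup>2 + y\<^sup>2 * (d\<^sup>2 + e\<^sup>2) > 0"
  proof (cases "d = 0 \<and> e = 0")
    case True
    then show ?thesis using ne by (simp add: sum_power2_gt_zero_iff)
  next
    case False
    then have "y\<^sup>2 * (d\<^sup>2 + e\<^sup>2) > 0" using y' by (auto simp: sum_power2_gt_zero_iff)
    then show ?thesis by (intro add_nonneg_pos) auto
  qed
  moreover have "Re (\<Sum>i\<in>UNIV. \<Sum>j\<in>UNIV. cnj (v $ i) * ?M $ i $ j * v $ j) = c / y * ((a - x * d)\<^sup>2 + (b - x * e)\<^sup>2 + y\<^sup>2 * (d\<^sup>2 + e\<^sup>2))"
    unfolding sum_2 mat22_nth a d x_def[symmetric] y_def[symmetric]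
    using y' by (simp add: field_simps power2_eq_square)
  ultimately show "Re (\<Sum>i\<in>UNIV. \<Sum>j\<in>UNIV. cnj (v $ i) * ?M $ i $ j * v $ j) > 0"
    using c y' by simp
qed

lemma scaled_K_metric_equivariant:
  assumes \<gamma>: "\<gamma> \<in> carrier SL2Z" and y: "Im \<tau> > 0"
  shows "transpose (incl_rep \<gamma>) ** (of_real c *m K_metric (moebius_act \<gamma> \<tau>)) ** mcnj (incl_rep \<gamma>) = of_real c *m K_metric \<tau>"
proof -
  obtain k l m n where g: "\<gamma> = mat22 k l m n" by (rule mat22_cases)
  define a b d e where "a = real_of_int k" and "b = real_of_int l" and "d = real_of_int m" and "e = real_of_int n"
  have "k * n - l * m = 1" using \<gamma> by (simp add: g carrier_SL2Z)
  then have "real_of_int (k * n - l * m) = 1" by simp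
  then have det: "a * e - b * d = 1" by (simp add: a_def b_def d_def e_def)
  define x t where "x = Re \<tau>" and "t = Im \<tau>"
  have t: "t > 0" using y by (simp add: t_def)
  define w where "w = moebius_act \<gamma> \<tau>"
  define u j where "u = of_real a * \<tau> + of_real b" and "j = of_real d * \<tau> + of_real e"
  have w: "w = u / j" by (simp add: w_def moebius_act_def g u_def j_def a_def b_def d_def e_def)
  \<comment> \<open>These are |j|^2, the real part of u times the conjugate of j, and |u|^2; they
    determine the real part, imaginary part and modulus of w = u/j.\<close>
  define q N U where "q = (d * x + e)\<^sup>2 + (d * t)\<^sup>2" and "N = (a * x + b) * (d * x + e) + a * t * (d * t)" and "U = (a * x + b)\<^sup>2 + (a * t)\<^sup>2"
  have q: "q > 0"
  proof (cases "d = 0")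
    case True
    then have "e \<noteq> 0" using det by auto
    then show ?thesis using True by (simp add: q_def)
  next
    case False
    then show ?thesis unfolding q_def using t by (intro add_nonneg_pos) auto
  qed
  have Re_w: "Re w = N / q"
    unfolding w Re_divide by (simp add: u_def j_def N_def q_def x_def t_def)
  have "(a * t) * (d * x + e) - (a * x + b) * (d * t) = t * (a * e - b * d)" by (simp add: algebra_simps)
  then have Im_w: "Im w = t / q"
    unfolding w Im_divide by (simp add: det u_def j_def q_def x_def t_def)
  have S: "(Re w)\<^sup>2 + (Im w)\<^sup>2 = U / q"
  proof -
    have "(Re w)\<^sup>2 + (Im w)\<^sup>2 = (cmod u)\<^sup>2 / (cmod j)\<^sup>2"
      by (simp add: w norm_divide power_divide flip: cmod_power2)
    then show ?thesis by (simp add: cmod_power2 u_def j_def U_def q_def x_def t_def)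
  qed
  have K: "of_real c *m K_metric w = mat22 (of_real (c * q / t)) (of_real (- c * N / t)) (of_real (- c * N / t)) (of_real (c * U / t))"
    unfolding scaled_K_metric_eq S unfolding Re_w Im_w mat22_eq_iff using q t by (simp add: field_simps)
  have r: "incl_rep \<gamma> = mat22 (of_real a) (of_real b) (of_real d) (of_real e)"
    by (simp add: incl_rep_eq g a_def b_def d_def e_def)
  \<comment> \<open>Up to c/t, the entries of the transformed matrix; each equals the corresponding
    entry at \<tau> times the squared determinant.\<close>
  have "a * a * q - 2 * a * d * N + d * d * U = t\<^sup>2 * 0 + (a * e - b * d)\<^sup>2"
    by (simp add: q_def N_def U_def power2_eq_square algebra_simps)
  then have 11: "a * a * q - 2 * a * d * N + d * d * U = 1" by (simp add: det)
  have "a * b * q - (a * e + b * d) * N + d * e * U = - x * (a * e - b * d)\<^sup>2"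
    by (simp add: q_def N_def U_def power2_eq_square algebra_simps)
  then have 12: "a * b * q - (a * e + b * d) * N + d * e * U = - x" by (simp add: det)
  have "b * b * q - 2 * b * e * N + e * e * U = (x\<^sup>2 + t\<^sup>2) * (a * e - b * d)\<^sup>2"
    by (simp add: q_def N_def U_def power2_eq_square algebra_simps)
  then have 22: "b * b * q - 2 * b * e * N + e * e * U = x\<^sup>2 + t\<^sup>2" by (simp add: det)
  have "transpose (incl_rep \<gamma>) ** (of_real c *m K_metric w) ** mcnj (incl_rep \<gamma>) =
     mat22 (of_real (c / t * (a * a * q - 2 * a * d * N + d * d * U))) (of_real (c / t * (a * b * q - (a * e + b * d) * N + d * e * U)))
       (of_real (c / t * (a * b * q - (a * e + b * d) * N + d * e * U))) (of_real (c / t * (b * b * q - 2 * b * e * N + e * e * U)))"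
    unfolding r K transpose_mat22 mcnj_mat22 mat22_mult mat22_eq_iff
    using t by (simp add: field_simps flip: of_real_mult of_real_add of_real_diff of_real_divide of_real_minus)
  then show ?thesis
    unfolding 11 12 22 w_def[symmetric] scaled_K_metric_eq x_def[symmetric] t_def[symmetric] by simp
qed

lemma scaled_K_metric_laurent:
  assumes "Im \<tau> > 0"
  shows "of_real c *m K_metric \<tau> = laurent_mono 0 (-1) \<tau> *\<^sub>R mat22 (of_real c) 0 0 0 + laurent_mono 1 (-1) \<tau> *\<^sub>R mat22 0 (- of_real c) (- of_real c) 0 +
     laurent_mono 2 (-1) \<tau> *\<^sub>R mat22 0 0 0 (of_real c) + laurent_mono 0 1 \<tau> *\<^sub>R mat22 0 0 0 (of_real c)"
  unfolding scaled_K_metric_eq scaleR_mat22 mat22_add mat22_eq_iff laurent_mono_def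
  using assms by (simp add: scaleR_conv_of_real power_int_minus field_simps power2_eq_square)

lemma metric_for_scaled_K_metric:
  assumes c: "c > 0" shows "metric_for incl_rep (\<lambda>\<tau>. of_real c *m K_metric \<tau>)"
  unfolding metric_for_def
proof (intro conjI allI ballI)
  show "k_smooth_on k \<H> (\<lambda>\<tau>. of_real c *m K_metric \<tau>)" for k
    by (rule k_smooth_on_laurent[OF _ scaled_K_metric_laurent]) (rule laurent_mat.intros)+
qed (auto simp: upper_half_plane_def pos_def_scaled_K_metric[OF c] scaled_K_metric_equivariant)

lemma matrix_inv_mat22:
  assumes "a * d - b * c = (1 :: complex)" "k \<noteq> 0"
  shows "matrix_inv (k *m mat22 a b c d) = (1 / k) *m mat22 d (- b) (- c) a"
proof -
  define A where "A = k *m mat22 a b c d"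
  define B where "B = (1 / k) *m mat22 d (- b) (- c) a"
  have AB: "A ** B = mat 1" "B ** A = mat 1"
    unfolding A_def B_def mscale_mat22 mat22_mult mat_1_eq_mat22 mat22_eq_iff
    using assms by (simp_all add: field_simps)
  then have "\<exists>B. A ** B = mat 1 \<and> B ** A = mat 1" by blast
  then have "A ** matrix_inv A = mat 1 \<and> matrix_inv A ** A = mat 1"
    unfolding matrix_inv_def by (rule someI_ex)
  then have "matrix_inv A = B"
    using AB by (metis matrix_mul_assoc matrix_mul_lid)
  then show ?thesis by (simp add: A_def B_def)
qed

text \<open>The constant c drops out of the logarithmic derivatives. \<open>X\<close> and
  \<open>Y\<close> are the inverse of K times its partial derivatives in x and y; in terms of them
  the equation becomes an identity of rational functions in each entry.\<close>

lemma harmonic_scaled_K_metric: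
  assumes c: "c > 0" shows "harmonic_metric incl_rep (\<lambda>\<tau>. of_real c *m K_metric \<tau>)"
  unfolding harmonic_metric_def
proof (intro conjI ballI)
  show "metric_for incl_rep (\<lambda>\<tau>. of_real c *m K_metric \<tau>)" by (rule metric_for_scaled_K_metric[OF c])
  define K where "K = (\<lambda>\<tau>. complex_of_real c *m K_metric \<tau>)"
  define X where "X = (\<lambda>\<tau>. let x = complex_of_real (Re \<tau>); y = complex_of_real (Im \<tau>) in
     mat22 (- x / y^2) (x^2 / y^2 - 1) (- 1 / y^2) (x / y^2))"
  define Y where "Y = (\<lambda>\<tau>. let x = complex_of_real (Re \<tau>); y = complex_of_real (Im \<tau>) in
     mat22 (- 1 / y) (2 * x / y) 0 (1 / y))"
  have logs: "del_log K \<tau> = (1/2) *m (X \<tau> - \<i> *m Y \<tau>)" "delbar_log K \<tau> = (1/2) *m (X \<tau> + \<i> *m Y \<tau>)"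
    if t: "Im \<tau> > 0" for \<tau>
  proof -
    define x y where "x = complex_of_real (Re \<tau>)" and "y = complex_of_real (Im \<tau>)"
    have y0: "y \<noteq> 0" using t by (simp add: y_def)
    have p: "has_partials K
       (laurent_mono (0 - 1) (-1) \<tau> *\<^sub>R (real 0 *\<^sub>R mat22 (of_real c) 0 0 0) + laurent_mono (1 - 1) (-1) \<tau> *\<^sub>R (real 1 *\<^sub>R mat22 0 (- of_real c) (- of_real c) 0) +
         laurent_mono (2 - 1) (-1) \<tau> *\<^sub>R (real 2 *\<^sub>R mat22 0 0 0 (of_real c)) + laurent_mono (0 - 1) 1 \<tau> *\<^sub>R (real 0 *\<^sub>R mat22 0 0 0 (of_real c)))
       (laurent_mono 0 (-1 - 1) \<tau> *\<^sub>R (of_int (-1) *\<^sub>R mat22 (of_real c) 0 0 0) + laurent_mono 1 (-1 - 1) \<tau> *\<^sub>R (of_int (-1) *\<^sub>R mat22 0 (- of_real c) (- of_real c) 0) +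
         laurent_mono 2 (-1 - 1) \<tau> *\<^sub>R (of_int (-1) *\<^sub>R mat22 0 0 0 (of_real c)) + laurent_mono 0 (1 - 1) \<tau> *\<^sub>R (of_int 1 *\<^sub>R mat22 0 0 0 (of_real c))) \<tau>"
      unfolding K_def
      by (rule has_partials_cong[OF _ t scaled_K_metric_laurent]) (intro has_partials_add has_partials_mono t)
    have dxK: "dx K \<tau> = of_real c *m mat22 0 (- 1 / y) (- 1 / y) (2 * x / y)"
      unfolding has_partials_imp(2)[OF p] scaleR_mat22 mat22_add mscale_mat22 mat22_eq_iff laurent_mono_def x_def y_def
      by (simp add: scaleR_conv_of_real power_int_minus field_simps)
    have dyK: "dy K \<tau> = of_real c *m mat22 (- 1 / y^2) (x / y^2) (x / y^2) (1 - x^2 / y^2)"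
      unfolding has_partials_imp(3)[OF p] scaleR_mat22 mat22_add mscale_mat22 mat22_eq_iff laurent_mono_def x_def y_def
      by (simp add: scaleR_conv_of_real power_int_minus field_simps)
    have "K \<tau> = of_real c *m mat22 (1 / y) (- x / y) (- x / y) ((x^2 + y^2) / y)"
      unfolding K_def K_metric_def Let_def mscale_mat22 mat22_eq_iff x_def y_def by simp
    then have inv: "matrix_inv (K \<tau>) = (1 / of_real c) *m mat22 ((x^2 + y^2) / y) (x / y) (x / y) (1 / y)"
      using matrix_inv_mat22[of "1 / y" "(x^2 + y^2) / y" "- x / y" "- x / y" "of_real c"] y0 c
      by (simp add: field_simps power2_eq_square)
    have IX: "matrix_inv (K \<tau>) ** dx K \<tau> = X \<tau>"
      unfolding inv dxK X_def Let_def x_def[symmetric] y_def[symmetric] mscale_mat22 mat22_mult mat22_eq_iff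
      using y0 c by (simp add: field_simps power2_eq_square)
    have IY: "matrix_inv (K \<tau>) ** dy K \<tau> = Y \<tau>"
      unfolding inv dyK Y_def Let_def x_def[symmetric] y_def[symmetric] mscale_mat22 mat22_mult mat22_eq_iff
      using y0 c by (simp add: field_simps power2_eq_square)
    have lin: "A ** ((1/2) *m (B - \<i> *m C)) = (1/2) *m (A ** B - \<i> *m (A ** C))"
      "A ** ((1/2) *m (B + \<i> *m C)) = (1/2) *m (A ** B + \<i> *m (A ** C))" for A B C :: "complex^2^2"
      by (rule mat22_eqI; simp add: matrix_matrix_mult_def map_matrix_def sum_2 algebra_simps)+
    show "del_log K \<tau> = (1/2) *m (X \<tau> - \<i> *m Y \<tau>)" unfolding del_log_def del_def lin IX IY ..
    show "delbar_log K \<tau> = (1/2) *m (X \<tau> + \<i> *m Y \<tau>)" unfolding delbar_log_def delbar_def lin IX IY ..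
  qed
  fix \<tau> assume "\<tau> \<in> \<H>"
  then have t: "Im \<tau> > 0" by (simp add: upper_half_plane_def)
  define x y where "x = complex_of_real (Re \<tau>)" and "y = complex_of_real (Im \<tau>)"
  have y0: "y \<noteq> 0" using t by (simp add: y_def)
  have V: "delbar_log K z = laurent_mono 1 (-2) z *\<^sub>R mat22 (-1/2) 0 0 (1/2) + laurent_mono 2 (-2) z *\<^sub>R mat22 0 (1/2) 0 0 +
     laurent_mono 0 0 z *\<^sub>R mat22 0 (-1/2) 0 0 + laurent_mono 0 (-2) z *\<^sub>R mat22 0 0 (-1/2) 0 +
     laurent_mono 0 (-1) z *\<^sub>R mat22 (- \<i> / 2) 0 0 (\<i> / 2) + laurent_mono 1 (-1) z *\<^sub>R mat22 0 \<i> 0 0" if z: "Im z > 0" for z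
    unfolding logs(2)[OF z] X_def Y_def Let_def mscale_mat22 mat22_add scaleR_mat22 mat22_eq_iff laurent_mono_def
    using z by (simp add: scaleR_conv_of_real power_int_minus field_simps)
  have p: "has_partials (delbar_log K)
     (laurent_mono (1 - 1) (-2) \<tau> *\<^sub>R (real 1 *\<^sub>R mat22 (-1/2) 0 0 (1/2)) + laurent_mono (2 - 1) (-2) \<tau> *\<^sub>R (real 2 *\<^sub>R mat22 0 (1/2) 0 0) +
     laurent_mono (0 - 1) 0 \<tau> *\<^sub>R (real 0 *\<^sub>R mat22 0 (-1/2) 0 0) + laurent_mono (0 - 1) (-2) \<tau> *\<^sub>R (real 0 *\<^sub>R mat22 0 0 (-1/2) 0) +
     laurent_mono (0 - 1) (-1) \<tau> *\<^sub>R (real 0 *\<^sub>R mat22 (- \<i> / 2) 0 0 (\<i> / 2)) + laurent_mono (1 - 1) (-1) \<tau> *\<^sub>R (real 1 *\<^sub>R mat22 0 \<i> 0 0))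
     (laurent_mono 1 (-2 - 1) \<tau> *\<^sub>R (of_int (-2) *\<^sub>R mat22 (-1/2) 0 0 (1/2)) + laurent_mono 2 (-2 - 1) \<tau> *\<^sub>R (of_int (-2) *\<^sub>R mat22 0 (1/2) 0 0) +
     laurent_mono 0 (0 - 1) \<tau> *\<^sub>R (of_int 0 *\<^sub>R mat22 0 (-1/2) 0 0) + laurent_mono 0 (-2 - 1) \<tau> *\<^sub>R (of_int (-2) *\<^sub>R mat22 0 0 (-1/2) 0) +
     laurent_mono 0 (-1 - 1) \<tau> *\<^sub>R (of_int (-1) *\<^sub>R mat22 (- \<i> / 2) 0 0 (\<i> / 2)) + laurent_mono 1 (-1 - 1) \<tau> *\<^sub>R (of_int (-1) *\<^sub>R mat22 0 \<i> 0 0)) \<tau>"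
    by (rule has_partials_cong[OF _ t V]) (intro has_partials_add has_partials_mono t)
  have dxV: "dx (delbar_log K) \<tau> = mat22 (- 1 / (2 * y^2)) (x / y^2 + \<i> / y) 0 (1 / (2 * y^2))"
    unfolding has_partials_imp(2)[OF p] scaleR_mat22 mat22_add mat22_eq_iff laurent_mono_def x_def y_def
    using t by (simp add: scaleR_conv_of_real power_int_minus field_simps)
  have dyV: "dy (delbar_log K) \<tau> = mat22 (x / y^3 + \<i> / (2 * y^2)) (- (x^2) / y^3 - \<i> * x / y^2) (1 / y^3) (- x / y^3 - \<i> / (2 * y^2))"
    unfolding has_partials_imp(3)[OF p] scaleR_mat22 mat22_add mat22_eq_iff laurent_mono_def x_def y_def
    using t by (simp add: scaleR_conv_of_real power_int_minus field_simps)
  have minus: "A - B = A + (-1) *m B" for A B :: "complex^2^2"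
    by (rule mat22_eqI) (simp_all add: map_matrix_def)
  have "del (delbar_log K) \<tau> = (1/2) *m (delbar_log K \<tau> ** del_log K \<tau> - del_log K \<tau> ** delbar_log K \<tau>)"
    unfolding del_def dxV dyV logs[OF t] X_def Y_def Let_def x_def[symmetric] y_def[symmetric] minus mscale_mat22 mat22_add mat22_mult mat22_eq_iff
    using y0 by (simp add: field_simps power2_eq_square power3_eq_cube)
  then show "del (delbar_log (\<lambda>\<tau>. complex_of_real c *m K_metric \<tau>)) \<tau> =
     (1/2) *m (delbar_log (\<lambda>\<tau>. complex_of_real c *m K_metric \<tau>) \<tau> ** del_log (\<lambda>\<tau>. complex_of_real c *m K_metric \<tau>) \<tau> -
       del_log (\<lambda>\<tau>. complex_of_real c *m K_metric \<tau>) \<tau> ** delbar_log (\<lambda>\<tau>. complex_of_real c *m K_metric \<tau>) \<tau>)"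
    unfolding K_def .
qed

lemma mat_supnorm_le:
  assumes "norm a \<le> M" "norm b \<le> M" "norm c \<le> M" "norm d \<le> M"
  shows "mat_supnorm (mat22 a b c d) \<le> M"
  unfolding mat_supnorm_def
proof (rule Max.boundedI)
  fix t assume "t \<in> range (\<lambda>(i, j). cmod (mat22 a b c d $ i $ j))"
  then obtain i j :: 2 where "t = cmod (mat22 a b c d $ i $ j)" by auto
  then show "t \<le> M" using exhaust_2[of i] exhaust_2[of j] assms by auto
qed auto

text \<open>The unipotent part of the exponential removes x and leaves the entries 1, -iy, iy and 2
  y^2 over y, which grow at most linearly. The scalar part has modulus exp(-2 pi n y): bounded for n
  >= 0, but exponentially growing for n < 0, whence the restriction.\<close>

lemma tame_scaled_K_metric:
  assumes c: "c > 0" and n: "n \<ge> 0"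
  shows "tame_metric incl_rep (exponent_mat n) (\<lambda>\<tau>. of_real c *m K_metric \<tau>)"
  unfolding tame_metric_def
proof (intro conjI metric_for_scaled_K_metric c choice_of_exponents_exponent_mat,
    rule exI[of _ "2 * c"], rule exI[of _ 1], intro allI impI)
  fix \<tau> assume t1: "1 \<le> Im \<tau>"
  define y where "y = Im \<tau>"
  have y: "y \<ge> 1" using t1 by (simp add: y_def)
  define u where "u = exp (2 * of_real pi * \<i> * of_int n * \<tau>)"
  define X where "X = u * cnj u * of_real (c / y)"
  have "norm u \<le> 1"
    unfolding u_def norm_exp_eq_Re using n y by (simp add: y_def[symmetric])
  then have "norm u * norm u \<le> 1" by (simp add: mult_le_one)
  moreover have "norm X = norm u * norm u * (c / y)"
    unfolding X_def using c y by (simp add: norm_mult norm_divide)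
  ultimately have "norm X \<le> c / y"
    using c y mult_right_mono[of "norm u * norm u" 1 "c / y"] by simp
  have "mat_e (\<tau> *m transpose (exponent_mat n)) ** (of_real c *m K_metric \<tau>) ** mcnj (mat_e (\<tau> *m exponent_mat n)) =
     mat22 X (X * (- \<i> * of_real y)) (X * (\<i> * of_real y)) (X * of_real (2 * y\<^sup>2))"
  proof -
    obtain x where \<tau>: "\<tau> = Complex x y" unfolding y_def by (cases \<tau>) simp
    have M1: "mat22 1 0 \<tau> 1 ** mat22 1 (- of_real x) (- of_real x) (of_real (x^2 + y^2)) ** mat22 1 (cnj \<tau>) 0 1 =
       mat22 1 (- \<i> * of_real y) (\<i> * of_real y) (of_real (2 * y\<^sup>2))"
      unfolding mat22_mult mat22_eq_iff by (simp add: \<tau> complex_eq_iff power2_eq_square algebra_simps)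
    have M2: "of_real c *m K_metric \<tau> = of_real (c / y) *m mat22 1 (- of_real x) (- of_real x) (of_real (x^2 + y^2))"
      unfolding scaled_K_metric_eq mscale_mat22 mat22_eq_iff \<tau> by simp
    have M3: "(u *m A) ** (of_real (c / y) *m B) ** mcnj (u *m C) = X *m (A ** B ** mcnj C)" for A B C :: "complex^2^2"
      unfolding X_def by (rule mat22_eqI) (simp_all add: matrix_matrix_mult_def map_matrix_def sum_2 algebra_simps)
    show ?thesis
      unfolding mat_e_exponent_mat u_def[symmetric] M2
      unfolding M3 mcnj_mat22 complex_cnj_one complex_cnj_zero
      unfolding M1 mscale_mat22 by simp
  qed
  moreover have "mat_supnorm (mat22 X (X * (- \<i> * of_real y)) (X * (\<i> * of_real y)) (X * of_real (2 * y\<^sup>2))) \<le> 2 * c * y"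
  proof (rule mat_supnorm_le)
    have "c / y \<le> c" using c y by (simp add: divide_le_eq mult_le_cancel_left1)
    have cy: "c \<le> c * y" using c y by simp
    show "norm X \<le> 2 * c * y" using \<open>norm X \<le> c / y\<close> \<open>c / y \<le> c\<close> cy c by linarith
    have Xy: "norm X * y \<le> c" using mult_right_mono[OF \<open>norm X \<le> c / y\<close>, of y] y by simp
    have "norm X \<le> 2 * c" using \<open>norm X \<le> c / y\<close> \<open>c / y \<le> c\<close> c by linarith
    then show "norm (X * (- \<i> * of_real y)) \<le> 2 * c * y" "norm (X * (\<i> * of_real y)) \<le> 2 * c * y"
      using y c by (simp_all add: norm_mult)
    have "norm X * (2 * y\<^sup>2) = 2 * (norm X * y) * y" by (simp add: power2_eq_square)
    also have "\<dots> \<le> 2 * c * y" using Xy y by simp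
    finally show "norm (X * of_real (2 * y\<^sup>2)) \<le> 2 * c * y" using y by (simp add: norm_mult norm_power)
  qed
  ultimately show "mat_supnorm (mat_e (\<tau> *m transpose (exponent_mat n)) ** (of_real c *m K_metric \<tau>) ** mcnj (mat_e (\<tau> *m exponent_mat n))) \<le> 2 * c * Im \<tau> powr 1"
    using t1 by (simp add: y_def)
qed

section \<open>The continued Eisenstein metric and its residue\<close>

lemma mat_continuation_eisenstein:
  fixes n :: int
  assumes y: "Im \<tau> > 0"
  shows "mat_continuation (eisenstein_metric incl_rep (exponent_mat n) (mat 1) \<tau>) {s. 2 < Re s}
    (\<lambda>s. conj_by_tau \<tau> (eisenstein_matrix n \<tau> s)) {s. 3/2 < Re s}"
  unfolding mat_continuation_def
proof (intro conjI ballI allI)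
  show "conj_by_tau \<tau> (eisenstein_matrix n \<tau> s) = eisenstein_metric incl_rep (exponent_mat n) (mat 1) \<tau> s"
    if "s \<in> {s. 2 < Re s}" for s
    using infsumI[OF has_sum_eisenstein[OF y, of s n]] that by (simp add: eisenstein_metric_def)
  show "(\<lambda>s. conj_by_tau \<tau> (eisenstein_matrix n \<tau> s) $ i $ j) meromorphic_on {s. 3/2 < Re s}" for i j
    using mat_simple_at_2_imp(2)[OF mat_simple_eisenstein[OF y, of n]] by (simp add: Re_gt_def)
qed auto

lemma mat_simple_at_2_fraction: "mat_simple_at_2 (\<lambda>s. (1 / (s - 2)) *m V) V"
  unfolding mat_simple_at_2_def simple_at_2_def
proof (intro allI)
  fix i j
  show "\<exists>F. F holomorphic_on Re_gt \<and> F 2 = V $ i $ j \<and>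
      (\<forall>s\<in>Re_gt - {2}. ((1 / (s - 2)) *m V) $ i $ j = F s / (s - 2))"
    by (rule exI[of _ "\<lambda>_. V $ i $ j"]) (simp add: map_matrix_def)
qed

theorem theorem4p1:
  fixes n :: int
  shows "choice_of_exponents incl_rep (exponent_mat n) \<and>
    (\<forall>\<tau>\<in>\<H>. \<forall>s. 2 < Re s \<longrightarrow>
       (\<lambda>C. norm (eisenstein_coset_term incl_rep (exponent_mat n) (mat 1) \<tau> s C))
         summable_on (rcosets\<^bsub>SL2Z\<^esub> pm_T)) \<and>
    (\<exists>H :: complex \<Rightarrow> complex \<Rightarrow> complex^2^2.
       (\<forall>\<tau>\<in>\<H>.
          mat_continuation (eisenstein_metric incl_rep (exponent_mat n) (mat 1) \<tau>) {s. 2 < Re s}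
            (H \<tau>) {s. 3/2 < Re s} \<and>
          (\<forall>s. 3/2 < Re s \<and> s \<noteq> 2 \<longrightarrow>
             summable (const_series1 (- n) \<tau> s) \<and>
             summable (const_series2 (- n) \<tau> s) \<and>
             (\<forall>m\<ge>1. summable (higher_series (- n) \<tau> s m)) \<and>
             summable (fourier_coeff (- n) \<tau> s) \<and>
             H \<tau> s = conj_by_tau \<tau> (\<Sum>m. fourier_coeff (- n) \<tau> s m)) \<and>
          mat_holomorphic_on (H \<tau>) ({s. 3/2 < Re s} - {2}) \<and>
          mat_simple_pole (H \<tau>) 2 \<and>
          mat_holomorphic_on (\<lambda>s. \<Sum>m. higher_coeff (- n) \<tau> s (Suc m)) {s. 3/2 < Re s} \<and>
          mat_residue (\<lambda>s. conj_by_tau \<tau> (const_coeff (- n) \<tau> s)) 2 = mat_residue (H \<tau>) 2 \<and>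
          mat_residue (H \<tau>) 2 = (3 / (2 * of_real pi)) *m K_metric \<tau>) \<and>
       harmonic_metric incl_rep (\<lambda>\<tau>. mat_residue (H \<tau>) 2) \<and>
       (\<forall>k\<ge>0. tame_metric incl_rep (exponent_mat k) (\<lambda>\<tau>. mat_residue (H \<tau>) 2))) \<and>
    (\<forall>L. choice_of_exponents incl_rep L \<longrightarrow>
       (\<forall>\<tau>\<in>\<H>. \<exists>G.
          mat_continuation (eisenstein_metric incl_rep L (mat 1) \<tau>) {s. 2 < Re s} G {s. 3/2 < Re s} \<and>
          mat_residue G 2 = (3 / (2 * of_real pi)) *m K_metric \<tau>))"
proof -
  define c where "c = 3 / (2 * pi)"
  have c: "c > 0" by (simp add: c_def)
  have c': "3 / (2 * complex_of_real pi) = of_real c" by (simp add: c_def)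
  have norm_summable: "(\<lambda>C. norm (eisenstein_coset_term incl_rep (exponent_mat n) (mat 1) \<tau> s C)) summable_on (rcosets\<^bsub>SL2Z\<^esub> pm_T)"
    if "\<tau> \<in> \<H>" "2 < Re s" for \<tau> s
  proof (rule norm_summable_on_mat22)
    have "Im \<tau> > 0" using that by (simp add: upper_half_plane_def)
    then show "eisenstein_coset_term incl_rep (exponent_mat n) (mat 1) \<tau> s summable_on (rcosets\<^bsub>SL2Z\<^esub> pm_T)"
      using has_sum_eisenstein that(2) unfolding summable_on_def by blast
  qed
  \<comment> \<open>Off the upper half-plane \<open>H\<close> is an artificial function with the
    same form of residue. The residue is then a multiple of \<open>K_metric\<close> for every
    complex \<tau>, an equality of functions that can be inserted into
    \<open>harmonic_metric\<close> and \<open>tame_metric\<close>.\<close>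
  define H where "H = (\<lambda>\<tau> s. if Im \<tau> > 0 then conj_by_tau \<tau> (eisenstein_matrix n \<tau> s)
    else (1 / (s - 2)) *m (of_real c *m K_metric \<tau>))"
  have Hy: "H \<tau> = (\<lambda>s. conj_by_tau \<tau> (eisenstein_matrix n \<tau> s))" if "Im \<tau> > 0" for \<tau>
    using that by (simp add: H_def)
  have simple: "mat_simple_at_2 (H \<tau>) (of_real c *m K_metric \<tau>)" for \<tau>
  proof (cases "Im \<tau> > 0")
    case True
    then show ?thesis using mat_simple_eisenstein[OF True, of n] by (simp add: Hy c')
  next
    case False
    then show ?thesis by (simp add: H_def mat_simple_at_2_fraction)
  qed
  have res: "mat_residue (H \<tau>) 2 = of_real c *m K_metric \<tau>" for \<tau>
    by (rule mat_simple_at_2_imp(3)[OF simple])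
  have Re_gt: "{s. 3/2 < Re s} = Re_gt" by (simp add: Re_gt_def)
  have pointwise: "mat_continuation (eisenstein_metric incl_rep (exponent_mat n) (mat 1) \<tau>) {s. 2 < Re s} (H \<tau>) {s. 3/2 < Re s}"
    "mat_holomorphic_on (H \<tau>) ({s. 3/2 < Re s} - {2})" "mat_simple_pole (H \<tau>) 2"
    "mat_holomorphic_on (\<lambda>s. \<Sum>m. higher_coeff (- n) \<tau> s (Suc m)) {s. 3/2 < Re s}"
    "mat_residue (\<lambda>s. conj_by_tau \<tau> (const_coeff (- n) \<tau> s)) 2 = mat_residue (H \<tau>) 2"
    if "\<tau> \<in> \<H>" for \<tau>
  proof -
    have y: "Im \<tau> > 0" using that by (simp add: upper_half_plane_def)
    show "mat_continuation (eisenstein_metric incl_rep (exponent_mat n) (mat 1) \<tau>) {s. 2 < Re s} (H \<tau>) {s. 3/2 < Re s}"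
      unfolding Hy[OF y] by (rule mat_continuation_eisenstein[OF y])
    show "mat_holomorphic_on (H \<tau>) ({s. 3/2 < Re s} - {2})"
      unfolding Re_gt by (rule mat_simple_at_2_imp(1)[OF simple])
    show "mat_simple_pole (H \<tau>) 2"
      by (rule mat_simple_at_2_imp(4)[OF simple]) (use const_residue_nonzero[OF y] in \<open>simp add: c'\<close>)
    show "mat_holomorphic_on (\<lambda>s. \<Sum>m. higher_coeff (- n) \<tau> s (Suc m)) {s. 3/2 < Re s}"
      unfolding Re_gt by (rule mat_holomorphic_higher[OF y])
    show "mat_residue (\<lambda>s. conj_by_tau \<tau> (const_coeff (- n) \<tau> s)) 2 = mat_residue (H \<tau>) 2"
      unfolding res mat_simple_at_2_imp(3)[OF mat_simple_at_2_conj_by_tau[OF mat_simple_const_coeff[OF y]]]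
        conj_const_residue[OF y] c' ..
  qed
  have series: "summable (const_series1 (- n) \<tau> s)" "summable (const_series2 (- n) \<tau> s)"
    "m \<ge> 1 \<Longrightarrow> summable (higher_series (- n) \<tau> s m)" "summable (fourier_coeff (- n) \<tau> s)"
    "H \<tau> s = conj_by_tau \<tau> (\<Sum>m. fourier_coeff (- n) \<tau> s m)" if "\<tau> \<in> \<H>" "3/2 < Re s \<and> s \<noteq> 2" for \<tau> s m
  proof -
    have y: "Im \<tau> > 0" and s: "s \<in> Re_gt" using that by (simp_all add: upper_half_plane_def Re_gt_def)
    show "summable (const_series1 (- n) \<tau> s)" "summable (const_series2 (- n) \<tau> s)"
      by (rule const_coeff_eq[OF y s])+
    show "summable (higher_series (- n) \<tau> s m)" if "m \<ge> 1"
      by (rule higher_coeff_eq(1)[OF y s that])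
    show "summable (fourier_coeff (- n) \<tau> s)" "H \<tau> s = conj_by_tau \<tau> (\<Sum>m. fourier_coeff (- n) \<tau> s m)"
      using fourier_coeff_sums(2)[OF y s, of n] by (simp_all add: Hy[OF y] sums_iff)
  qed
  have harmonic: "harmonic_metric incl_rep (\<lambda>\<tau>. mat_residue (H \<tau>) 2)"
    unfolding res by (rule harmonic_scaled_K_metric[OF c])
  have tame: "tame_metric incl_rep (exponent_mat k) (\<lambda>\<tau>. mat_residue (H \<tau>) 2)" if "k \<ge> 0" for k
    unfolding res by (rule tame_scaled_K_metric[OF c that])
  have last: "\<exists>G. mat_continuation (eisenstein_metric incl_rep L (mat 1) \<tau>) {s. 2 < Re s} G {s. 3/2 < Re s} \<and>
          mat_residue G 2 = (3 / (2 * of_real pi)) *m K_metric \<tau>" if L: "choice_of_exponents incl_rep L" and \<tau>: "\<tau> \<in> \<H>" for L \<tau>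
  proof -
    have y: "Im \<tau> > 0" using \<tau> by (simp add: upper_half_plane_def)
    \<comment> \<open>Each admissible L is some \<open>exponent_mat k\<close>, and the residue does
      not involve k.\<close>
    obtain k where k: "L = exponent_mat k" using choice_of_exponents_unique[OF L] .
    show ?thesis
      unfolding k
      by (intro exI conjI) (rule mat_continuation_eisenstein[OF y] mat_simple_at_2_imp(3)[OF mat_simple_eisenstein[OF y]])+
  qed
  show ?thesis
    unfolding c'
    by (intro conjI ballI allI impI exI[of _ H] choice_of_exponents_exponent_mat norm_summable harmonic tame res last[unfolded c'] pointwise series)
       auto
qed

end
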